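(* There exists a universal constant $c>0$ (independent of $n$ and $\mu$) such that the following holds for every $n\ge 2$. Let $\gamma$ be the standard Gaussian measure on $\mathbb{R}^n$. If $\mu$ is a Borel probability measure on $\mathbb{R}^n$ satisfying the moment assumption, then $C_{PK}(\mu)\geq C_{PK}(\gamma)=1$, and $$ d_{Zol,2}(\mu,\gamma) \leq c\, n^2 \sqrt{C_{PK}(\mu)\, (C_{PK}(\mu)- C_{PK}(\gamma))}. $$
   Context: Throughout $n\ge 2$. The standard Gaussian measure is $d\gamma(x) = (2\pi)^{-n/2}e^{-|x|^2/2}dx$ on $\mathbb{R}^n$. Moment assumption. A Borel probability measure $\mu$ on $\mathbb{R}^n$ satisfies the moment assumption if, for all $1\le i,j,k\le n$, the following integrals exist and $$\int x_i\, d\mu = 0,\qquad \int x_i x_j\, d\mu = \delta_{ij},\qquad \int x_i x_j x_k\, d\mu = 0,$$ and, whenever $i\ne j$, $\int (x_i^2+x_j^2)x_j^2\, d\mu = 4$. (These are the values of the same integrals under $\gamma$.) Poincaré–Korn constant. Let $\mu$ be a centered Borel probability measure on $\mathbb{R}^n$ (i.e. $\int x\,d\mu=0$). Let $\mathcal{A} := \{x\mapsto Ax : A\in M_{n\times n}(\mathbb{R}),\ A=-A^T\}$. For differentiable $u=(u_1,\dots,u_n):\mathbb{R}^n\to\mathbb{R}^n$, let $\nabla_s u := \frac12\big((\nabla u)+(\nabla u)^T\big)$ be the symmetrized gradient, i.e. $[\nabla_s u]_{k\ell}=\frac12(\partial_k u_\ell+\partial_\ell u_k)$. For vector-valued $u$,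 $\|u\|_{L^2(\mu)}^2:=\int |u|^2d\mu$ with $|\cdot|$ the Euclidean norm; for matrix-valued $U$, $\|U\|_{L^2(\mu)}^2:=\int\sum_{i,j}[U]_{ij}^2\,d\mu$. Let $$\mathcal{C}:=\{u:\mathbb{R}^n\to\mathbb{R}^n : u \text{ differentiable},\ \textstyle\int u\,d\mu=0,\ \|\nabla_s u\|_{L^2(\mu)}^2<\infty\}.$$ The Poincaré–Korn constant $C_{PK}(\mu)$ is the smallest constant $C$ such that $$\inf_{a\in\mathcal{A}}\|u-a\|_{L^2(\mu)}^2\le 2C\,\|\nabla_s u\|_{L^2(\mu)}^2\quad\text{for all } u\in\mathcal{C},$$ with $C_{PK}(\mu)=+\infty$ if there is no such finite constant. The factor 2 is a normalization chosen so that $C_{PK}(\gamma)=1$, a fact known from earlier work (Carrapatoso et al.). Zolotarev distance of order 2. For Borel probability measures $\mu,\nu$ on $\mathbb{R}^n$, $$d_{Zol,2}(\mu,\nu):=\sup_f \left(\int f\,d\mu-\int f\,d\nu\right),$$ where the supremum is over all $f:\mathbb{R}^n\to\mathbb{R}$ of class $C^2$ with $\sup_{x\in\mathbb{R}^n}\|\nabla^2 f(x)\|_2\le 1$, and $\|\cdot\|_2$ is the Euclidean (Hilbert–Schmidt) norm on matrices. *)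

theory Defs
  imports "HOL-Probability.Probability"
begin

text \<open>
  The constant in the theorem must not depend on the dimension, so the dimension \<open>n\<close> is a natural
  number rather than a type. Points of $\mathbb{R}^n$ are the extensional functions on
  \<open>{..<n}\<close>, with coordinates \<open>x 0, \<dots>, x (n - 1)\<close>. The topology that the type \<open>nat \<Rightarrow> real\<close> (product
  topology) induces on this set is the Euclidean one, and its Borel sets are those of the product
  measure space \<open>borel_rn\<close>. Functions on $\mathbb{R}^n$ are total functions on
  \<open>nat \<Rightarrow> real\<close> of which only the values on \<open>rn n\<close> are ever used.
\<close>

abbreviation rn :: "nat \<Rightarrow> (nat \<Rightarrow> real) set" where
  "rn n \<equiv> {..<n} \<rightarrow>\<^sub>E UNIV"

abbreviation borel_rn :: "nat \<Rightarrow> (nat \<Rightarrow> real) measure" where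
  "borel_rn n \<equiv> Pi\<^sub>M {..<n} (\<lambda>_. borel)"

definition std_gaussian :: "nat \<Rightarrow> (nat \<Rightarrow> real) measure" where
  "std_gaussian n = density (Pi\<^sub>M {..<n} (\<lambda>_. lborel))
     (\<lambda>x. ennreal ((2 * pi) powr (- real n / 2) * exp (- (\<Sum>i<n. (x i)\<^sup>2) / 2)))"

definition borel_prob :: "nat \<Rightarrow> (nat \<Rightarrow> real) measure \<Rightarrow> bool" where
  "borel_prob n \<mu> \<longleftrightarrow> prob_space \<mu> \<and> sets \<mu> = sets (borel_rn n)"

definition moment_assumption :: "nat \<Rightarrow> (nat \<Rightarrow> real) measure \<Rightarrow> bool" where
  "moment_assumption n \<mu> \<longleftrightarrow>
     (\<forall>i<n. has_bochner_integral \<mu> (\<lambda>x. x i) 0) \<and>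
     (\<forall>i<n. \<forall>j<n. has_bochner_integral \<mu> (\<lambda>x. x i * x j) (if i = j then 1 else 0)) \<and>
     (\<forall>i<n. \<forall>j<n. \<forall>k<n. has_bochner_integral \<mu> (\<lambda>x. x i * x j * x k) 0) \<and>
     (\<forall>i<n. \<forall>j<n. i \<noteq> j \<longrightarrow>
        has_bochner_integral \<mu> (\<lambda>x. ((x i)\<^sup>2 + (x j)\<^sup>2) * (x j)\<^sup>2) 4)"


section \<open>Differential calculus on \<open>rn n\<close>\<close>

text \<open>
  The type \<open>nat \<Rightarrow> real\<close> is not a normed space, so Frechet differentiability is written out, with
  the derivative at \<open>x\<close> given by its gradient vector \<open>g\<close>.
\<close>

definition has_gradient ::
    "nat \<Rightarrow> ((nat \<Rightarrow> real) \<Rightarrow> real) \<Rightarrow> (nat \<Rightarrow> real) \<Rightarrow> (nat \<Rightarrow> real) \<Rightarrow> bool" where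
  "has_gradient n f g x \<longleftrightarrow>
     ((\<lambda>y. (f y - f x - (\<Sum>i<n. g i * (y i - x i))) / L2_set (\<lambda>i. y i - x i) {..<n}) \<longlongrightarrow> 0)
       (at x within rn n)"

definition differentiable_rn :: "nat \<Rightarrow> ((nat \<Rightarrow> real) \<Rightarrow> real) \<Rightarrow> bool" where
  "differentiable_rn n f \<longleftrightarrow> (\<forall>x\<in>rn n. \<exists>g. has_gradient n f g x)"

definition pd :: "nat \<Rightarrow> ((nat \<Rightarrow> real) \<Rightarrow> real) \<Rightarrow> (nat \<Rightarrow> real) \<Rightarrow> real" where
  "pd k f x = deriv (\<lambda>t. f (x(k := t))) (x k)"

fun class_C :: "nat \<Rightarrow> nat \<Rightarrow> ((nat \<Rightarrow> real) \<Rightarrow> real) \<Rightarrow> bool" where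
  "class_C n 0 f \<longleftrightarrow> continuous_on (rn n) f"
| "class_C n (Suc m) f \<longleftrightarrow> differentiable_rn n f \<and> (\<forall>k<n. class_C n m (pd k f))"

text \<open>Vector fields are given by \<open>u x i\<close> (component \<open>i\<close> at the point \<open>x\<close>).\<close>

definition sym_grad ::
    "((nat \<Rightarrow> real) \<Rightarrow> nat \<Rightarrow> real) \<Rightarrow> (nat \<Rightarrow> real) \<Rightarrow> nat \<Rightarrow> nat \<Rightarrow> real" where
  "sym_grad u x k l = (pd k (\<lambda>y. u y l) x + pd l (\<lambda>y. u y k) x) / 2"

definition hess :: "((nat \<Rightarrow> real) \<Rightarrow> real) \<Rightarrow> (nat \<Rightarrow> real) \<Rightarrow> nat \<Rightarrow> nat \<Rightarrow> real" where
  "hess f x i j = pd i (pd j f) x"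


section \<open>The Poincare-Korn constant\<close>

text \<open>Squared $L^2(\mu)$ norms; the value may be infinite.\<close>

definition L2sq_vec ::
    "nat \<Rightarrow> (nat \<Rightarrow> real) measure \<Rightarrow> ((nat \<Rightarrow> real) \<Rightarrow> nat \<Rightarrow> real) \<Rightarrow> ennreal" where
  "L2sq_vec n \<mu> u = (\<integral>\<^sup>+x. ennreal (\<Sum>i<n. (u x i)\<^sup>2) \<partial>\<mu>)"

definition L2sq_mat ::
    "nat \<Rightarrow> (nat \<Rightarrow> real) measure \<Rightarrow> ((nat \<Rightarrow> real) \<Rightarrow> nat \<Rightarrow> nat \<Rightarrow> real) \<Rightarrow> ennreal" where
  "L2sq_mat n \<mu> U = (\<integral>\<^sup>+x. ennreal (\<Sum>i<n. \<Sum>j<n. (U x i j)\<^sup>2) \<partial>\<mu>)"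

definition skew_maps :: "nat \<Rightarrow> ((nat \<Rightarrow> real) \<Rightarrow> nat \<Rightarrow> real) set" where
  "skew_maps n = {(\<lambda>x. \<lambda>i\<in>{..<n}. \<Sum>j<n. A i j * x j) | A. \<forall>i<n. \<forall>j<n. A i j = - A j i}"

definition korn_class ::
    "nat \<Rightarrow> (nat \<Rightarrow> real) measure \<Rightarrow> ((nat \<Rightarrow> real) \<Rightarrow> nat \<Rightarrow> real) set" where
  "korn_class n \<mu> = {u. u \<in> rn n \<rightarrow> rn n \<and>
     (\<forall>i<n. differentiable_rn n (\<lambda>x. u x i)) \<and>
     (\<forall>i<n. has_bochner_integral \<mu> (\<lambda>x. u x i) 0) \<and>
     L2sq_mat n \<mu> (sym_grad u) < \<infinity>}"

text \<open>
  The restriction \<open>0 \<le> C\<close> loses nothing: for a centered \<open>\<mu>\<close> and \<open>n \<ge> 1\<close>, the identity map excludes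
  negative constants. It is there because \<open>ennreal\<close> truncates negative numbers to \<open>0\<close>.
  The infimum of the empty set is \<open>\<infinity>\<close>.
\<close>

definition C_PK :: "nat \<Rightarrow> (nat \<Rightarrow> real) measure \<Rightarrow> ereal" where
  "C_PK n \<mu> = Inf {ereal C | C. 0 \<le> C \<and>
     (\<forall>u\<in>korn_class n \<mu>.
        (INF a\<in>skew_maps n. L2sq_vec n \<mu> (\<lambda>x i. u x i - a x i))
          \<le> ennreal (2 * C) * L2sq_mat n \<mu> (sym_grad u))}"


section \<open>The Zolotarev distance of order 2\<close>

text \<open>
  If \<open>\<mu>\<close> and \<open>\<nu>\<close> have finite second moments, every admissible \<open>f\<close> is integrable, since a bounded
  Hessian forces at most quadratic growth.
\<close>

definition d_Zol2 ::
    "nat \<Rightarrow> (nat \<Rightarrow> real) measure \<Rightarrow> (nat \<Rightarrow> real) measure \<Rightarrow> ereal" where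
  "d_Zol2 n \<mu> \<nu> =
     (SUP f\<in>{f. class_C n 2 f \<and> (\<forall>x\<in>rn n. sqrt (\<Sum>i<n. \<Sum>j<n. (hess f x i j)\<^sup>2) \<le> 1)}.
        ereal ((\<integral>x. f x \<partial>\<mu>) - (\<integral>x. f x \<partial>\<nu>)))"

text \<open>Square root on the extended reals, used only on nonnegative arguments.\<close>

definition ereal_sqrt :: "ereal \<Rightarrow> ereal" where
  "ereal_sqrt x = (if x = \<infinity> then \<infinity> else ereal (sqrt (real_of_ereal x)))"

end

theory Submission
  imports Defs
begin

text \<open>
  Upper bound for the Gaussian constant. Let \<open>P\<^sub>r\<close> be the Mehler (Ornstein-Uhlenbeck) semigroup. Integrating by parts
  against a square root of its kernel gives a differential inequality for \<open>\<langle>u, P\<^sub>r u\<rangle> / r\<close> with right-hand side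
  \<open>2 \<langle>e, P\<^sub>r e\<rangle> / r\<close>, where \<open>e\<close> is the symmetrized gradient. After subtracting the linear part of \<open>u\<close>, the spectral
  gap of \<open>P\<^sub>r\<close> yields \<open>\<langle>u, P\<^sub>r u\<rangle> \<le> 2 r\<^sup>2 \<parallel>e\<parallel>\<^sup>2\<close>, and \<open>r \<rightarrow> 1\<close> gives the sharp inequality.

  Lower bound and stability. The field \<open>w = (x\<^sub>j\<^sup>2 - 1) e\<^sub>i - x\<^sub>i x\<^sub>j e\<^sub>j\<close> is extremal for \<open>\<gamma>\<close>, and the moment assumption makes
  its Korn quotient under \<open>\<mu>\<close> the same; hence the constant \<open>C\<close> of \<open>\<mu>\<close> is at least 1. If \<open>C\<close> is close to 1, then \<open>w\<close>
  is almost extremal for \<open>\<mu>\<close>, so the first variation at \<open>w\<close> is small: testing with \<open>w + t v\<close>, where \<open>v\<close> is a scalar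
  \<open>g\<close> times a basis vector, bounds the Stein discrepancies
  \<open>\<integral>(x\<^sub>i x\<^sub>j g - \<delta>\<^sub>i\<^sub>j g - x\<^sub>j \<partial>\<^sub>i g) d\<mu>\<close> by a multiple of \<open>\<surd>(C (C - 1)) sup |\<nabla>g|\<close>.

  For a test function \<open>f\<close>, interpolate with \<open>F \<theta> = E f (cos \<theta> X + sin \<theta> Y)\<close>, \<open>X \<sim> \<mu>\<close>, \<open>Y \<sim> \<gamma>\<close>. Gaussian integration by parts
  in \<open>Y\<close> expresses \<open>F' \<theta>\<close> through Stein discrepancies of Gaussian averages of the second derivatives of \<open>f\<close>. These
  averages have gradient at most \<open>1 / sin \<theta>\<close>, which cancels against the factor \<open>sin \<theta>\<close> coming from the rotation.
\<close>

text \<open>The obstacle is that a field of \<open>korn_class\<close> has a square integrable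
  symmetrized gradient e, while neither the field nor its single partial derivatives are known to be
  square integrable. Integration by parts is therefore applied only to v.u along the same direction
  v, where v.e v appears, and polarized afterwards. The field itself is handled by weighted
  integrability (\<open>good\<close>): Mehler kernels with |r| < 1 grow in each variable at a
  Gaussian rate below 1/4, so the forms of u are finite before its norm is known to be, and square
  integrability is an output of the limit r -> 1. What separates e from the full gradient are mixed
  terms; the nonnegativity of a smoothed divergence bounds them at the cost of exactly the form
  divided by r, and this is why the form over r is the monotone quantity. In the stability part the
  infimum over skew maps is never computed: w is orthogonal to all of them, so they disappear from a
  linear lower bound. The final constant is 5 * (pi / 2): 5 from two discriminants, pi / 2 from the
  length of the rotation; n^2 counts pairs of coordinates.\<close>

definition lin :: "nat \<Rightarrow> real \<Rightarrow> (nat \<Rightarrow> real) \<Rightarrow> real \<Rightarrow> (nat \<Rightarrow> real) \<Rightarrow> nat \<Rightarrow> real" where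
  "lin n s x t y = (\<lambda>i\<in>{..<n}. s * x i + t * y i)"

definition dot :: "nat \<Rightarrow> (nat \<Rightarrow> real) \<Rightarrow> (nat \<Rightarrow> real) \<Rightarrow> real" where
  "dot n x y = (\<Sum>i<n. x i * y i)"

abbreviation sqn :: "nat \<Rightarrow> (nat \<Rightarrow> real) \<Rightarrow> real" where
  "sqn n x \<equiv> dot n x x"

abbreviation leb :: "nat \<Rightarrow> (nat \<Rightarrow> real) measure" where
  "leb n \<equiv> Pi\<^sub>M {..<n} (\<lambda>_. lborel)"

abbreviation gauss1 :: "real measure" where
  "gauss1 \<equiv> density lborel (\<lambda>x. ennreal (std_normal_density x))"

lemma lin_apply [simp]: "i < n \<Longrightarrow> lin n s x t y i = s * x i + t * y i"
  by (simp add: lin_def)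

text \<open>Holds for arbitrary \<open>x\<close> and \<open>y\<close>: the restriction inside
  \<open>lin\<close> restores extensionality, so directions such as \<open>basis k\<close> can be
  plain functions on the naturals.\<close>

lemma lin_in_rn [simp]: "lin n s x t y \<in> rn n"
  by (simp add: lin_def)

lemma lin_eqI: "(\<And>i. i < n \<Longrightarrow> s * x i + t * y i = z i) \<Longrightarrow> z \<in> rn n \<Longrightarrow> lin n s x t y = z"
  by (rule extensionalityI[of _ "{..<n}"]) (auto simp: PiE_def lin_def)

lemma lin_1_0 [simp]: "x \<in> rn n \<Longrightarrow> lin n 1 x 0 y = x"
  by (rule lin_eqI) auto

lemma dot_commute: "dot n x y = dot n y x"
  by (simp add: dot_def mult.commute)

lemma sqn_eq: "sqn n x = (\<Sum>i<n. (x i)\<^sup>2)"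
  by (simp add: dot_def power2_eq_square)

lemma sqn_nonneg [simp]: "0 \<le> sqn n x"
  by (simp add: sqn_eq sum_nonneg)

lemma dot_lin_left: "dot n (lin n s x t y) z = s * dot n x z + t * dot n y z"
  by (simp add: dot_def algebra_simps sum.distrib sum_distrib_left)

lemma dot_lin_right: "dot n z (lin n s x t y) = s * dot n z x + t * dot n z y"
  by (metis dot_commute dot_lin_left)

lemma dot_le_sqn: "\<bar>dot n x y\<bar> \<le> (sqn n x + sqn n y) / 2"
proof -
  have "\<bar>dot n x y\<bar> \<le> (\<Sum>i<n. \<bar>x i * y i\<bar>)"
    unfolding dot_def by (rule sum_abs)
  also have "\<dots> \<le> (\<Sum>i<n. ((x i)\<^sup>2 + (y i)\<^sup>2) / 2)"
  proof (rule sum_mono)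
    fix i
    have "0 \<le> (\<bar>x i\<bar> - \<bar>y i\<bar>)\<^sup>2" by simp
    then show "\<bar>x i * y i\<bar> \<le> ((x i)\<^sup>2 + (y i)\<^sup>2) / 2"
      by (simp add: power2_diff abs_mult)
  qed
  finally show ?thesis by (simp add: sqn_eq sum.distrib sum_divide_distrib[symmetric])
qed

lemma coord_sq_le_sqn: "i < n \<Longrightarrow> (x i)\<^sup>2 \<le> sqn n x"
  unfolding sqn_eq by (rule member_le_sum) auto

lemma sets_leb [measurable_cong]: "sets (leb n) = sets (borel_rn n)"
  by (rule sets_PiM_cong) auto

lemma space_leb [simp]: "space (leb n) = rn n"
  by (simp add: space_PiM)

lemma space_borel_rn [simp]: "space (borel_rn n) = rn n"
  by (simp add: space_PiM)

lemma sets_std_gaussian [measurable_cong, simp]: "sets (std_gaussian n) = sets (borel_rn n)"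
  unfolding std_gaussian_def by (simp add: sets_leb)

lemma space_std_gaussian [simp]: "space (std_gaussian n) = rn n"
  unfolding std_gaussian_def by simp

lemma measurable_coord:
  "f \<in> measurable M (borel_rn n) \<Longrightarrow> i < n \<Longrightarrow> (\<lambda>x. f x i) \<in> borel_measurable M"
  by (rule measurable_compose[OF _ measurable_component_singleton]) auto

lemma measurable_dot [measurable]:
  assumes "f \<in> measurable M (borel_rn n)" "g \<in> measurable M (borel_rn n)"
  shows "(\<lambda>x. dot n (f x) (g x)) \<in> borel_measurable M"
  unfolding dot_def using measurable_coord[OF assms(1)] measurable_coord[OF assms(2)]
  by (intro borel_measurable_sum borel_measurable_times) auto

lemma measurable_dot_const [measurable]:
  assumes "f \<in> measurable M (borel_rn n)"
  shows "(\<lambda>x. dot n a (f x)) \<in> borel_measurable M"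
  unfolding dot_def using measurable_coord[OF assms(1)]
  by (intro borel_measurable_sum borel_measurable_times) auto

lemma measurable_dot_const' [measurable]:
  assumes "f \<in> measurable M (borel_rn n)"
  shows "(\<lambda>x. dot n (f x) a) \<in> borel_measurable M"
  using measurable_dot_const[OF assms] by (simp add: dot_commute)

lemma measurable_lin [measurable]:
  assumes [measurable]: "s \<in> borel_measurable M" "t \<in> borel_measurable M"
    "f \<in> measurable M (borel_rn n)" "g \<in> measurable M (borel_rn n)"
  shows "(\<lambda>x. lin n (s x) (f x) (t x) (g x)) \<in> measurable M (borel_rn n)"
  unfolding lin_def by measurable

lemma measurable_lin_const [measurable]:
  assumes [measurable]: "s \<in> borel_measurable M" "t \<in> borel_measurable M"
    "f \<in> measurable M (borel_rn n)"
  shows "(\<lambda>x. lin n (s x) (f x) (t x) g) \<in> measurable M (borel_rn n)"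
  unfolding lin_def by measurable

lemma measurable_lin_const' [measurable]:
  assumes [measurable]: "s \<in> borel_measurable M" "t \<in> borel_measurable M"
    "f \<in> measurable M (borel_rn n)"
  shows "(\<lambda>x. lin n (s x) g (t x) (f x)) \<in> measurable M (borel_rn n)"
  unfolding lin_def by measurable

section \<open>Product measures\<close>

text \<open>Both measures agree on boxes, since the preimage of a box under a coordinatewise map is
  the box of preimages. Translations and affine images are thereby reduced to one dimension.\<close>

lemma distr_PiM_map:
  fixes M :: "'i \<Rightarrow> 'a measure" and N :: "'i \<Rightarrow> 'b measure"
  assumes I: "finite I" and M: "product_sigma_finite M" and N: "product_sigma_finite N"
    and f: "\<And>i. i \<in> I \<Longrightarrow> f i \<in> measurable (M i) (N i)"
    and d: "\<And>i. i \<in> I \<Longrightarrow> distr (M i) (N i) (f i) = N i"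
  shows "distr (PiM I M) (PiM I N) (\<lambda>x. \<lambda>i\<in>I. f i (x i)) = PiM I N"
proof (rule product_sigma_finite.PiM_eqI[OF N I])
  have fm: "(\<lambda>x. \<lambda>i\<in>I. f i (x i)) \<in> measurable (PiM I M) (PiM I N)"
    by (rule measurable_restrict) (use f in measurable)
  fix A assume A: "\<And>i. i \<in> I \<Longrightarrow> A i \<in> sets (N i)"
  have eq: "(\<lambda>x. \<lambda>i\<in>I. f i (x i)) -` Pi\<^sub>E I A \<inter> space (PiM I M) = Pi\<^sub>E I (\<lambda>i. f i -` A i \<inter> space (M i))"
    by (auto simp: space_PiM PiE_iff extensional_def)
  have "emeasure (distr (PiM I M) (PiM I N) (\<lambda>x. \<lambda>i\<in>I. f i (x i))) (Pi\<^sub>E I A) =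
      emeasure (PiM I M) (Pi\<^sub>E I (\<lambda>i. f i -` A i \<inter> space (M i)))"
    using A by (subst emeasure_distr[OF fm]) (auto simp: eq intro!: sets_PiM_I_finite I)
  also have "\<dots> = (\<Prod>i\<in>I. emeasure (M i) (f i -` A i \<inter> space (M i)))"
    using A f by (intro product_sigma_finite.emeasure_PiM[OF M I]) (auto intro: measurable_sets)
  also have "\<dots> = (\<Prod>i\<in>I. emeasure (N i) (A i))"
    using A f d by (intro prod.cong refl) (metis emeasure_distr)
  finally show "emeasure (distr (PiM I M) (PiM I N) (\<lambda>x. \<lambda>i\<in>I. f i (x i))) (Pi\<^sub>E I A) =
    (\<Prod>i\<in>I. emeasure (N i) (A i))" .
qed simp

text \<open>The indicator of a box factors over the coordinates, so the integral of the product
  density splits into one-dimensional masses.\<close>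

lemma density_PiM:
  fixes M :: "'i \<Rightarrow> 'a measure" and f :: "'i \<Rightarrow> 'a \<Rightarrow> ennreal"
  assumes I: "finite I" and M: "product_sigma_finite M"
    and N: "product_sigma_finite (\<lambda>i. density (M i) (f i))"
    and f[measurable]: "\<And>i. i \<in> I \<Longrightarrow> f i \<in> borel_measurable (M i)"
  shows "PiM I (\<lambda>i. density (M i) (f i)) = density (PiM I M) (\<lambda>x. \<Prod>i\<in>I. f i (x i))"
proof (rule product_sigma_finite.PiM_eqI[OF N I, symmetric])
  show "sets (density (PiM I M) (\<lambda>x. \<Prod>i\<in>I. f i (x i))) = sets (PiM I (\<lambda>i. density (M i) (f i)))"
    by (auto intro!: sets_PiM_cong)
  fix A assume "\<And>i. i \<in> I \<Longrightarrow> A i \<in> sets (density (M i) (f i))"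
  then have A[measurable]: "\<And>i. i \<in> I \<Longrightarrow> A i \<in> sets (M i)" by simp
  have "emeasure (density (PiM I M) (\<lambda>x. \<Prod>i\<in>I. f i (x i))) (Pi\<^sub>E I A) =
     (\<integral>\<^sup>+x. (\<Prod>i\<in>I. f i (x i)) * indicator (Pi\<^sub>E I A) x \<partial>PiM I M)"
    using A by (intro emeasure_density) (auto intro!: sets_PiM_I_finite I borel_measurable_prod_ennreal)
  also have "\<dots> = (\<integral>\<^sup>+x. (\<Prod>i\<in>I. f i (x i) * indicator (A i) (x i)) \<partial>PiM I M)"
  proof (rule nn_integral_cong)
    fix x assume "x \<in> space (PiM I M)"
    then have "indicator (Pi\<^sub>E I A) x = (\<Prod>i\<in>I. indicator (A i) (x i) :: ennreal)"
      using I by (auto simp: indicator_def space_PiM PiE_iff prod_zero_iff split: if_splits)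
    then show "(\<Prod>i\<in>I. f i (x i)) * indicator (Pi\<^sub>E I A) x = (\<Prod>i\<in>I. f i (x i) * indicator (A i) (x i))"
      by (simp add: prod.distrib)
  qed
  also have "\<dots> = (\<Prod>i\<in>I. (\<integral>\<^sup>+x. f i x * indicator (A i) x \<partial>M i))"
    by (intro product_sigma_finite.product_nn_integral_prod[OF M I]) measurable
  also have "\<dots> = (\<Prod>i\<in>I. emeasure (density (M i) (f i)) (A i))"
    by (intro prod.cong refl) (simp add: emeasure_density)
  finally show "emeasure (density (PiM I M) (\<lambda>x. \<Prod>i\<in>I. f i (x i))) (Pi\<^sub>E I A) =
    (\<Prod>i\<in>I. emeasure (density (M i) (f i)) (A i))" .
qed

lemma psf_lborel: "product_sigma_finite (\<lambda>_. lborel :: real measure)"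
  by standard

lemma prob_space_gauss1: "prob_space gauss1"
  by (rule prob_space_normal_density) simp

lemma psf_gauss1: "product_sigma_finite (\<lambda>_. gauss1)"
  using prob_space_gauss1 by (simp add: product_sigma_finite_def prob_space_imp_sigma_finite)

lemma leb_translation:
  "distr (leb n) (leb n) (\<lambda>x. lin n 1 x 1 v) = leb n"
proof -
  have "distr (leb n) (leb n) (\<lambda>x. \<lambda>i\<in>{..<n}. (\<lambda>t. v i + t) (x i)) = leb n"
  proof (rule distr_PiM_map[OF _ psf_lborel psf_lborel])
    fix i
    have "distr lborel lborel ((+) (v i)) = distr lborel borel ((+) (v i))"
      by (rule distr_cong) auto
    then show "distr lborel lborel ((+) (v i)) = lborel"
      using lborel_distr_plus[of "v i"] by simp
  qed auto
  then show ?thesis by (simp add: lin_def add.commute)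
qed

section \<open>Gaussian density, affine changes of variable and exponential integrals\<close>

definition gdens :: "nat \<Rightarrow> (nat \<Rightarrow> real) \<Rightarrow> real" where
  "gdens n x = (2 * pi) powr (- real n / 2) * exp (- (sqn n x) / 2)"

lemma gdens_pos: "0 < gdens n x"
  by (simp add: gdens_def)

lemma measurable_gdens [measurable]: "gdens n \<in> borel_measurable (borel_rn n)"
  unfolding gdens_def[abs_def] by measurable

lemma std_gaussian_leb: "std_gaussian n = density (leb n) (\<lambda>x. ennreal (gdens n x))"
  unfolding std_gaussian_def gdens_def by (simp add: sqn_eq)

lemma gdens_prod: "gdens n x = (\<Prod>i<n. std_normal_density (x i))"
proof -
  have "(\<Prod>i<n. std_normal_density (x i)) = (1 / sqrt (2 * pi)) ^ n * exp (- sqn n x / 2)"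
    by (simp add: std_normal_density_def prod.distrib prod_dividef exp_sum[symmetric] sqn_eq sum_negf
        sum_divide_distrib power_divide power_one_over)
  also have "(1 / sqrt (2 * pi)) ^ n = (2 * pi) powr (- real n / 2)"
  proof -
    have "1 / sqrt (2 * pi) = (2 * pi) powr - (1 / 2)"
      by (simp only: powr_minus powr_half_sqrt pi_ge_zero mult_nonneg_nonneg zero_le_numeral inverse_eq_divide)
    then have "(1 / sqrt (2 * pi)) ^ n = ((2 * pi) powr - (1 / 2)) powr real n"
      by (subst powr_realpow) auto
    also have "\<dots> = (2 * pi) powr (- real n / 2)"
      by (simp only: powr_powr) (rule arg_cong, simp)
    finally show ?thesis .
  qed
  finally show ?thesis by (simp add: gdens_def)
qed

lemma std_gaussian_PiM: "std_gaussian n = PiM {..<n} (\<lambda>_. gauss1)"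
  unfolding std_gaussian_leb
  by (subst density_PiM[OF _ psf_lborel psf_gauss1])
     (auto simp: gdens_prod prod_ennreal intro!: density_cong)

lemma prob_space_std_gaussian: "prob_space (std_gaussian n)"
  unfolding std_gaussian_PiM by (rule prob_space_PiM) (rule prob_space_gauss1)

text \<open>The density of the law of a + s Y with respect to the law of Y, for Y standard normal: a
  ratio of two Gaussian densities with |z - a|^2 expanded, so that only \<open>dot\<close>
  occurs.\<close>

definition gweight :: "nat \<Rightarrow> real \<Rightarrow> (nat \<Rightarrow> real) \<Rightarrow> (nat \<Rightarrow> real) \<Rightarrow> real" where
  "gweight n s a z = (1 / s) ^ n * exp (sqn n z / 2 - (sqn n z - 2 * dot n a z + sqn n a) / (2 * s\<^sup>2))"

lemma measurable_gweight [measurable]: "gweight n s a \<in> borel_measurable (borel_rn n)"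
  unfolding gweight_def[abs_def] by measurable

lemma gweight_pos: "s > 0 \<Longrightarrow> 0 < gweight n s a z"
  by (simp add: gweight_def)

text \<open>Substitution z = a + s y. The target of \<open>distr\<close> is the density measure
  itself, which is the shape that \<open>distr_PiM_map\<close> asks for.\<close>

lemma gauss1_affine:
  fixes a s :: real
  assumes s: "s > 0"
  defines "w \<equiv> \<lambda>z. 1 / s * exp (z\<^sup>2 / 2 - (z - a)\<^sup>2 / (2 * s\<^sup>2))"
  shows "distr gauss1 (density gauss1 w) (\<lambda>y. a + s * y) = density gauss1 w"
proof (rule measure_eqI)
  fix A assume "A \<in> sets (distr gauss1 (density gauss1 w) (\<lambda>y. a + s * y))"
  then have A[measurable]: "A \<in> sets borel" by simp
  have w[measurable]: "w \<in> borel_measurable borel" unfolding w_def by measurable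
  have m[measurable]: "(\<lambda>y. a + s * y) \<in> measurable gauss1 (density gauss1 w)" by simp
  have "emeasure (distr gauss1 (density gauss1 w) (\<lambda>y. a + s * y)) A =
     (\<integral>\<^sup>+y. indicator A (a + s * y) \<partial>gauss1)"
    by (subst nn_integral_indicator[symmetric], simp, subst nn_integral_distr) auto
  also have "\<dots> = (\<integral>\<^sup>+y. ennreal (std_normal_density y) * indicator A (a + s * y) \<partial>lborel)"
    by (subst nn_integral_density) auto
  also have "\<dots> = (\<integral>\<^sup>+y. ennreal \<bar>s\<bar> * (ennreal (std_normal_density (a + s * y) * w (a + s * y)) * indicator A (a + s * y)) \<partial>lborel)"
  proof (rule nn_integral_cong)
    fix y
    have "std_normal_density y = s * (std_normal_density (a + s * y) * w (a + s * y))"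
      using s by (simp add: std_normal_density_def w_def exp_add[symmetric] power_mult_distrib field_simps)
    then show "ennreal (std_normal_density y) * indicator A (a + s * y) =
      ennreal \<bar>s\<bar> * (ennreal (std_normal_density (a + s * y) * w (a + s * y)) * indicator A (a + s * y))"
      using s by (simp add: ennreal_mult'[symmetric] mult.assoc[symmetric])
  qed
  also have "\<dots> = (\<integral>\<^sup>+z. ennreal (std_normal_density z * w z) * indicator A z \<partial>lborel)"
    using s by (subst nn_integral_real_affine[where c = s and t = a]) (auto simp: nn_integral_cmult)
  also have "\<dots> = emeasure (density gauss1 w) A"
  proof -
    have "w z \<ge> 0" for z using s by (simp add: w_def)
    then show ?thesis
      by (simp add: emeasure_density nn_integral_density ennreal_mult' mult.assoc)
  qed
  finally show "emeasure (distr gauss1 (density gauss1 w) (\<lambda>y. a + s * y)) A = emeasure (density gauss1 w) A" .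
qed simp

lemma gaussian_affine:
  assumes s: "s > 0"
  shows "distr (std_gaussian n) (borel_rn n) (\<lambda>y. lin n 1 a s y) =
    density (std_gaussian n) (\<lambda>z. ennreal (gweight n s a z))"
proof -
  let ?w = "\<lambda>i z. 1 / s * exp (z\<^sup>2 / 2 - (z - a i)\<^sup>2 / (2 * s\<^sup>2))"
  let ?N = "\<lambda>i. density gauss1 (\<lambda>z. ennreal (?w i z))"
  have ps: "prob_space (?N i)" for i
  proof -
    have "prob_space (distr gauss1 (?N i) (\<lambda>y. a i + s * y))"
      by (rule prob_space.prob_space_distr[OF prob_space_gauss1]) simp
    then show ?thesis by (simp only: gauss1_affine[OF s])
  qed
  have psfN: "product_sigma_finite ?N"
    using ps by (simp add: product_sigma_finite_def prob_space_imp_sigma_finite)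
  have "distr (PiM {..<n} (\<lambda>_. gauss1)) (PiM {..<n} ?N) (\<lambda>y. \<lambda>i\<in>{..<n}. (\<lambda>t. a i + s * t) (y i)) = PiM {..<n} ?N"
  proof (rule distr_PiM_map[OF _ psf_gauss1 psfN])
    show "distr gauss1 (?N i) (\<lambda>t. a i + s * t) = ?N i" for i by (rule gauss1_affine[OF s])
  qed auto
  also have "PiM {..<n} ?N = density (std_gaussian n) (\<lambda>x. \<Prod>i<n. ennreal (?w i (x i)))"
    unfolding std_gaussian_PiM by (rule density_PiM[OF _ psf_gauss1 psfN]) auto
  also have "(\<lambda>x. \<Prod>i<n. ennreal (?w i (x i))) = (\<lambda>z. ennreal (gweight n s a z))"
  proof
    fix x
    have "(\<Prod>i<n. ?w i (x i)) = gweight n s a x"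
    proof -
      have "(\<Prod>i<n. ?w i (x i)) = (1 / s) ^ n * exp (\<Sum>i<n. (x i)\<^sup>2 / 2 - (x i - a i)\<^sup>2 / (2 * s\<^sup>2))"
        by (simp add: prod.distrib exp_sum prod_dividef power_divide)
      also have "(\<Sum>i<n. (x i)\<^sup>2 / 2 - (x i - a i)\<^sup>2 / (2 * s\<^sup>2)) =
        sqn n x / 2 - (\<Sum>i<n. (x i - a i)\<^sup>2) / (2 * s\<^sup>2)"
        by (simp add: sqn_eq sum_subtractf sum_divide_distrib)
      also have "(\<Sum>i<n. (x i - a i)\<^sup>2) = sqn n x - 2 * dot n a x + sqn n a"
        by (simp add: sqn_eq power2_diff sum.distrib sum_subtractf sum_distrib_left dot_def mult_ac)
      finally show ?thesis by (simp add: gweight_def)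
    qed
    then show "(\<Prod>i<n. ennreal (?w i (x i))) = ennreal (gweight n s a x)"
      using s by (subst prod_ennreal) auto
  qed
  finally have "distr (std_gaussian n) (PiM {..<n} ?N) (\<lambda>y. \<lambda>i\<in>{..<n}. (\<lambda>t. a i + s * t) (y i))
    = density (std_gaussian n) (\<lambda>z. ennreal (gweight n s a z))"
    by (simp only: std_gaussian_PiM)
  moreover have "distr (std_gaussian n) (PiM {..<n} ?N) (\<lambda>y. \<lambda>i\<in>{..<n}. (\<lambda>t. a i + s * t) (y i))
    = distr (std_gaussian n) (borel_rn n) (\<lambda>y. lin n 1 a s y)"
    by (rule distr_cong) (auto simp: lin_def intro!: sets_PiM_cong)
  ultimately show ?thesis by simp
qed

lemma nn_integral_gaussian_affine:
  assumes s: "s > 0" and [measurable]: "f \<in> borel_measurable (borel_rn n)"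
  shows "(\<integral>\<^sup>+y. f (lin n 1 a s y) \<partial>std_gaussian n) = (\<integral>\<^sup>+z. ennreal (gweight n s a z) * f z \<partial>std_gaussian n)"
proof -
  have "(\<integral>\<^sup>+y. f (lin n 1 a s y) \<partial>std_gaussian n) =
     (\<integral>\<^sup>+z. f z \<partial>distr (std_gaussian n) (borel_rn n) (\<lambda>y. lin n 1 a s y))"
    by (subst nn_integral_distr) auto
  then show ?thesis
    unfolding gaussian_affine[OF s] by (simp add: nn_integral_density)
qed

lemma gaussian_affine_integral:
  assumes s: "s > 0" and [measurable]: "f \<in> borel_measurable (borel_rn n)"
  shows "integrable (std_gaussian n) (\<lambda>y. f (lin n 1 a s y)) \<longleftrightarrow>
      integrable (std_gaussian n) (\<lambda>z. gweight n s a z * f z :: real)" (is ?A)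
    and "(\<integral>y. f (lin n 1 a s y) \<partial>std_gaussian n) = (\<integral>z. gweight n s a z * f z \<partial>std_gaussian n)" (is ?B)
proof -
  note w = gweight_pos[OF s, THEN less_imp_le]
  have "integrable (std_gaussian n) (\<lambda>y. f (lin n 1 a s y)) \<longleftrightarrow>
    integrable (distr (std_gaussian n) (borel_rn n) (\<lambda>y. lin n 1 a s y)) f"
    by (subst integrable_distr_eq) auto
  then show ?A
    unfolding gaussian_affine[OF s] by (subst (asm) integrable_density) (auto intro: w)
  have "(\<integral>y. f (lin n 1 a s y) \<partial>std_gaussian n) =
    integral\<^sup>L (distr (std_gaussian n) (borel_rn n) (\<lambda>y. lin n 1 a s y)) f"
    by (subst integral_distr) auto
  then show ?B
    unfolding gaussian_affine[OF s] by (subst (asm) integral_density) (auto intro: w)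
qed

text \<open>Completing the square makes the integrand a constant multiple of a
  \<open>gweight\<close>, whose total mass is 1; the inverse of that constant in
  \<open>gweight\<close> is the value.\<close>

lemma gaussian_exp_nn:
  assumes b: "1 + b > 0"
  shows "(\<integral>\<^sup>+x. ennreal (exp (dot n a x - b * sqn n x / 2)) \<partial>std_gaussian n) =
     ennreal ((1 / sqrt (1 + b)) ^ n * exp (sqn n a / (2 * (1 + b))))"
proof -
  \<comment> \<open>A Gaussian of precision 1 + b: standard deviation 1 / sqrt (1 + b) and centre a
    / (1 + b). With second coefficient 0, \<open>lin\<close> is a mere scaling of a.\<close>
  let ?s = "1 / sqrt (1 + b)" and ?c = "lin n (1 / (1 + b)) a 0 a"
  have s: "?s > 0" using b by simp
  have "gweight n ?s ?c z = (1 / ?s) ^ n * exp (- sqn n a / (2 * (1 + b))) * exp (dot n a z - b * sqn n z / 2)" for z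
  proof -
    have s2: "?s\<^sup>2 = 1 / (1 + b)" using b by (simp add: power_divide)
    have "sqn n z / 2 - (sqn n z - 2 * dot n ?c z + sqn n ?c) / (2 * ?s\<^sup>2) =
      - sqn n a / (2 * (1 + b)) + (dot n a z - b * sqn n z / 2)"
    proof -
      have "Z / 2 - (Z - 2 * (D / p) + S / p / p) / (2 * (1 / p)) = - S / (2 * p) + (D - (p - 1) * Z / 2)"
        if "p > 0" for p Z D S :: real
        using that by (simp add: field_simps)
      from this[OF b, of "sqn n z" "dot n a z" "sqn n a"] show ?thesis
        unfolding s2 dot_lin_left dot_lin_right by simp
    qed
    then show ?thesis by (simp only: gweight_def exp_add mult.assoc)
  qed
  note W = this
  have "1 = (\<integral>\<^sup>+y. 1 \<partial>std_gaussian n)"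
    using prob_space.emeasure_space_1[OF prob_space_std_gaussian, of n] by simp
  also have "\<dots> = (\<integral>\<^sup>+z. ennreal (gweight n ?s ?c z) * 1 \<partial>std_gaussian n)"
    by (rule nn_integral_gaussian_affine[OF s, where f = "\<lambda>_. 1"]) simp
  also have "\<dots> = ennreal ((1 / ?s) ^ n * exp (- sqn n a / (2 * (1 + b)))) *
      (\<integral>\<^sup>+z. ennreal (exp (dot n a z - b * sqn n z / 2)) \<partial>std_gaussian n)"
    using b unfolding W by (subst nn_integral_cmult[symmetric]) (auto simp: ennreal_mult'[symmetric])
  finally have eq: "1 = ennreal ((1 / ?s) ^ n * exp (- sqn n a / (2 * (1 + b)))) *
      (\<integral>\<^sup>+z. ennreal (exp (dot n a z - b * sqn n z / 2)) \<partial>std_gaussian n)" (is "_ = ennreal ?p * ?I") .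
  have p: "?p > 0" using b by simp
  have inv: "X = ennreal (1 / p)" if eq: "1 = ennreal p * X" and p: "p > 0" for p X
  proof -
    have "X = ennreal (1 / p * p) * X" using p by simp
    also have "\<dots> = ennreal (1 / p) * (ennreal p * X)"
      using p by (subst ennreal_mult') (auto simp: mult.assoc)
    finally show ?thesis by (simp add: eq[symmetric])
  qed
  show ?thesis unfolding inv[OF eq p] using b by (simp add: exp_minus field_simps power_divide)
qed

lemma gaussian_exp:
  assumes b: "1 + b > 0"
  shows "has_bochner_integral (std_gaussian n) (\<lambda>x. exp (dot n a x - b * sqn n x / 2))
     ((1 / sqrt (1 + b)) ^ n * exp (sqn n a / (2 * (1 + b))))"
  by (rule has_bochner_integral_nn_integral) (use b in \<open>auto simp: gaussian_exp_nn\<close>)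

lemma integrable_exp_sqn:
  assumes c: "c < 1 / 2"
  shows "integrable (std_gaussian n) (\<lambda>x. exp (c * sqn n x))"
proof -
  have "integrable (std_gaussian n) (\<lambda>x. exp (dot n (\<lambda>_. 0) x - (- 2 * c) * sqn n x / 2))"
    using c by (intro integrable.intros[OF gaussian_exp]) simp
  then show ?thesis by (simp add: dot_def)
qed

section \<open>Differential calculus on extensional functions\<close>

lemma tendsto_coord: "((\<lambda>y. y i) \<longlongrightarrow> x i) (at x within S)" for x :: "nat \<Rightarrow> real"
proof -
  have "continuous_on UNIV (\<lambda>y :: nat \<Rightarrow> real. y i)" by (rule continuous_on_product_coordinates)
  then have "isCont (\<lambda>y. y i) x" using continuous_on_eq_continuous_at[OF open_UNIV] by blast
  then show ?thesis using continuous_at_imp_continuous_at_within continuous_within by blast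
qed

lemma tendsto_L2_diff: "((\<lambda>y. L2_set (\<lambda>i. y i - x i) {..<n}) \<longlongrightarrow> 0) (at x within S)" for x :: "nat \<Rightarrow> real"
proof -
  have "((\<lambda>y. sqrt (\<Sum>i<n. (y i - x i)\<^sup>2)) \<longlongrightarrow> sqrt (\<Sum>i<n. (x i - x i)\<^sup>2)) (at x within S)"
    by (intro tendsto_intros tendsto_coord)
  then show ?thesis by (simp add: L2_set_def)
qed

lemma L2_diff_eq_0: "x \<in> rn n \<Longrightarrow> y \<in> rn n \<Longrightarrow> L2_set (\<lambda>i. y i - x i) {..<n} = 0 \<longleftrightarrow> y = x"
  by (auto simp: L2_set_eq_0_iff intro!: extensionalityI[of _ "{..<n}"] simp: PiE_def)

text \<open>Coordinates from n on are constantly \<open>undefined\<close> on \<open>rn n\<close>, so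
  the first n coordinates decide convergence in the product topology.\<close>

lemma tendsto_extensional:
  assumes "\<And>s. c s \<in> rn n" and "l \<in> rn n" and "\<And>i. i < n \<Longrightarrow> ((\<lambda>s. c s i) \<longlongrightarrow> l i) F"
  shows "(c \<longlongrightarrow> l) F"
proof -
  have *: "((\<lambda>s. c s i) \<longlongrightarrow> l i) F" for i
  proof (cases "i < n")
    case False
    then have "c s i = undefined" "l i = undefined" for s using assms(1)[of s] assms(2) by (auto simp: PiE_def extensional_def)
    then show ?thesis by simp
  qed (rule assms)
  have "limitin (product_topology (\<lambda>_. euclidean) UNIV) c l F"
    unfolding limitin_componentwise using * by simp
  then show ?thesis by (simp add: euclidean_product_topology)
qed

lemma has_gradient_chain:
  assumes g: "has_gradient n f g (c t)" and c: "\<And>s. c s \<in> rn n"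
    and d: "\<And>i. i < n \<Longrightarrow> ((\<lambda>s. c s i) has_real_derivative d i) (at t)"
  shows "((\<lambda>s. f (c s)) has_real_derivative (\<Sum>i<n. g i * d i)) (at t)"
proof -
  define L where "L y = L2_set (\<lambda>i. y i - c t i) {..<n}" for y
  define rem where "rem y = (f y - f (c t) - (\<Sum>i<n. g i * (y i - c t i))) / L y" for y
  \<comment> \<open>The numerator vanishes at \<open>c t\<close> and 0 / 0 = 0, so
    \<open>rem (c t) = 0\<close>. The limit that excludes the base point thus becomes continuity
    there, and the curve may return to \<open>c t\<close>.\<close>
  have "(rem \<longlongrightarrow> rem (c t)) (at (c t) within rn n)"
    using g unfolding has_gradient_def by (simp add: rem_def[abs_def] L_def)
  then have cont: "continuous (at (c t) within rn n) rem" by (simp add: continuous_within)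
  have "(c \<longlongrightarrow> c t) (at t)"
  proof (rule tendsto_extensional[OF c c])
    fix i assume "i < n"
    from DERIV_isCont[OF d[OF this]] show "((\<lambda>s. c s i) \<longlongrightarrow> c t i) (at t)" by (simp add: isCont_def)
  qed
  then have "((\<lambda>s. rem (c s)) \<longlongrightarrow> rem (c t)) (at t)"
    by (intro continuous_within_tendsto_compose[OF cont]) (use c in auto)
  then have rem0: "((\<lambda>s. rem (c s)) \<longlongrightarrow> 0) (at t)" by (simp add: rem_def)
  have q: "((\<lambda>s. (c s i - c t i) / (s - t)) \<longlongrightarrow> d i) (at t)" if "i < n" for i
    using d[OF that] by (simp add: has_field_derivative_iff)
  have "((\<lambda>s. \<bar>rem (c s)\<bar> * (\<Sum>i<n. \<bar>(c s i - c t i) / (s - t)\<bar>)) \<longlongrightarrow> 0 * (\<Sum>i<n. \<bar>d i\<bar>)) (at t)"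
    by (intro tendsto_intros tendsto_rabs_zero rem0 q) auto
  then have "((\<lambda>s. rem (c s) * (L (c s) / (s - t))) \<longlongrightarrow> 0) (at t)"
  proof (subst (asm) mult_zero_left, elim Lim_null_comparison[rotated])
    show "\<forall>\<^sub>F s in at t. norm (rem (c s) * (L (c s) / (s - t))) \<le> \<bar>rem (c s)\<bar> * (\<Sum>i<n. \<bar>(c s i - c t i) / (s - t)\<bar>)"
    proof (rule always_eventually, rule allI)
      fix s
      have "\<bar>L (c s)\<bar> \<le> (\<Sum>i<n. \<bar>c s i - c t i\<bar>)"
        unfolding L_def by (simp add: L2_set_le_sum_abs)
      then have "\<bar>L (c s)\<bar> / \<bar>s - t\<bar> \<le> (\<Sum>i<n. \<bar>c s i - c t i\<bar>) / \<bar>s - t\<bar>"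
        by (rule divide_right_mono) simp
      then have "\<bar>L (c s) / (s - t)\<bar> \<le> (\<Sum>i<n. \<bar>(c s i - c t i) / (s - t)\<bar>)"
        by (simp add: sum_divide_distrib)
      then show "norm (rem (c s) * (L (c s) / (s - t))) \<le> \<bar>rem (c s)\<bar> * (\<Sum>i<n. \<bar>(c s i - c t i) / (s - t)\<bar>)"
        unfolding real_norm_def abs_mult by (rule mult_left_mono) simp
    qed
  qed
  moreover have "((\<lambda>s. \<Sum>i<n. g i * ((c s i - c t i) / (s - t))) \<longlongrightarrow> (\<Sum>i<n. g i * d i)) (at t)"
    by (intro tendsto_intros q) auto
  ultimately have "((\<lambda>s. (\<Sum>i<n. g i * ((c s i - c t i) / (s - t))) + rem (c s) * (L (c s) / (s - t)))
     \<longlongrightarrow> (\<Sum>i<n. g i * d i) + 0) (at t)" by (intro tendsto_add)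
  moreover have "(\<Sum>i<n. g i * ((c s i - c t i) / (s - t))) + rem (c s) * (L (c s) / (s - t)) =
     (f (c s) - f (c t)) / (s - t)" for s
  proof -
    have "rem (c s) * L (c s) = f (c s) - f (c t) - (\<Sum>i<n. g i * (c s i - c t i))"
    proof (cases "L (c s) = 0")
      case True
      then have "c s = c t" using L2_diff_eq_0[OF c c] unfolding L_def by blast
      then show ?thesis by (simp add: rem_def)
    qed (simp add: rem_def)
    moreover have "(\<Sum>i<n. g i * ((c s i - c t i) / (s - t))) = (\<Sum>i<n. g i * (c s i - c t i)) / (s - t)"
      by (simp add: sum_divide_distrib)
    ultimately show ?thesis by (simp add: add_divide_distrib[symmetric])
  qed
  ultimately show ?thesis by (simp add: has_field_derivative_iff)
qed

lemma upd_in_rn: "x \<in> rn n \<Longrightarrow> k < n \<Longrightarrow> x(k := t) \<in> rn n"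
  by (auto simp: PiE_def extensional_def)

lemma has_gradient_partial:
  assumes g: "has_gradient n f g x" and x: "x \<in> rn n" and k: "k < n"
  shows "((\<lambda>t. f (x(k := t))) has_real_derivative g k) (at (x k))"
proof -
  have "((\<lambda>t. f (x(k := t))) has_real_derivative (\<Sum>i<n. g i * (if i = k then 1 else 0))) (at (x k))"
    by (rule has_gradient_chain[where c = "\<lambda>t. x(k := t)"])
       (use g x k in \<open>auto simp: upd_in_rn intro!: derivative_eq_intros\<close>)
  moreover have "(\<Sum>i<n. g i * (if i = k then 1 else 0)) = g k"
    using k by (simp add: sum.delta if_distrib cong: if_cong)
  ultimately show ?thesis by simp
qed

lemma pd_eq: "has_gradient n f g x \<Longrightarrow> x \<in> rn n \<Longrightarrow> k < n \<Longrightarrow> pd k f x = g k"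
  unfolding pd_def by (rule DERIV_imp_deriv) (rule has_gradient_partial)

lemma has_gradient_cong:
  "(\<And>i. i < n \<Longrightarrow> g i = g' i) \<Longrightarrow> has_gradient n f g x \<longleftrightarrow> has_gradient n f g' x"
  by (simp add: has_gradient_def)

lemma has_gradient_pd:
  assumes "differentiable_rn n f" "x \<in> rn n"
  shows "has_gradient n f (\<lambda>k. pd k f x) x"
proof -
  obtain g where g: "has_gradient n f g x" using assms unfolding differentiable_rn_def by blast
  have "pd k f x = g k" if "k < n" for k using pd_eq[OF g assms(2) that] .
  then show ?thesis using g has_gradient_cong[of n "\<lambda>k. pd k f x" g f x] by simp
qed

lemma differentiable_chain:
  assumes "differentiable_rn n f" "\<And>s. c s \<in> rn n"
    and "\<And>i. i < n \<Longrightarrow> ((\<lambda>s. c s i) has_real_derivative d i) (at t)"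
  shows "((\<lambda>s. f (c s)) has_real_derivative (\<Sum>i<n. pd i f (c t) * d i)) (at t)"
  using has_gradient_chain[OF has_gradient_pd[OF assms(1,2)] assms(2,3)] .

lemma differentiable_partial:
  assumes "differentiable_rn n f" "x \<in> rn n" "k < n"
  shows "((\<lambda>t. f (x(k := t))) has_real_derivative pd k f x) (at (x k))"
  using has_gradient_partial[OF has_gradient_pd[OF assms(1,2)] assms(2,3)] .

lemma differentiable_imp_continuous:
  assumes f: "differentiable_rn n f"
  shows "continuous_on (rn n) f"
  unfolding continuous_on_def
proof
  fix x assume x: "x \<in> rn n"
  let ?L = "\<lambda>y. L2_set (\<lambda>i. y i - x i) {..<n}" and ?g = "\<lambda>k. pd k f x"
  let ?r = "\<lambda>y. (f y - f x - (\<Sum>i<n. ?g i * (y i - x i))) / ?L y"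
  have "((\<lambda>y. f x + (\<Sum>i<n. ?g i * (y i - x i)) + ?r y * ?L y) \<longlongrightarrow> f x + (\<Sum>i<n. ?g i * (x i - x i)) + 0 * 0) (at x within rn n)"
    using has_gradient_pd[OF f x] unfolding has_gradient_def
    by (intro tendsto_intros tendsto_coord tendsto_L2_diff)
  moreover have "\<forall>\<^sub>F y in at x within rn n. f x + (\<Sum>i<n. ?g i * (y i - x i)) + ?r y * ?L y = f y"
    unfolding eventually_at_topological
    by (rule exI[of _ UNIV]) (auto simp: L2_diff_eq_0[OF x])
  ultimately show "(f \<longlongrightarrow> f x) (at x within rn n)"
    by (simp add: tendsto_cong)
qed

text \<open>Connects two structures: continuity on \<open>rn n\<close> refers to the topology of the
  full function space, whereas the measures live on \<open>borel_rn n\<close>. The remaining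
  coordinates are constant, hence measurable.\<close>

lemma measurable_id_rn: "(\<lambda>x. x) \<in> measurable (borel_rn n) (restrict_space borel (rn n))"
proof (rule measurable_restrict_space2)
  have "(\<lambda>x. x) \<in> measurable (borel_rn n) (Pi\<^sub>M UNIV (\<lambda>_. borel :: real measure))"
  proof (rule measurable_PiM_single')
    fix i
    show "(\<lambda>x. x i) \<in> borel_measurable (borel_rn n)"
    proof (cases "i < n")
      case False
      then have "x i = undefined" if "x \<in> space (borel_rn n)" for x :: "nat \<Rightarrow> real"
        using that by (auto simp: space_PiM PiE_def extensional_def)
      then show ?thesis by (subst measurable_cong[of _ _ "\<lambda>_. undefined"]) auto
    qed simp
  qed (auto simp: space_PiM)
  then show "(\<lambda>x. x) \<in> measurable (borel_rn n) borel"
    using sets_PiM_equal_borel measurable_cong_sets by blast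
qed (auto simp: space_PiM)

lemma continuous_imp_measurable:
  fixes f :: "(nat \<Rightarrow> real) \<Rightarrow> real"
  assumes "continuous_on (rn n) f"
  shows "f \<in> borel_measurable (borel_rn n)"
  using measurable_compose[OF measurable_id_rn borel_measurable_continuous_on_restrict[OF assms]] .

lemma differentiable_measurable: "differentiable_rn n f \<Longrightarrow> f \<in> borel_measurable (borel_rn n)"
  by (rule continuous_imp_measurable) (rule differentiable_imp_continuous)

lemma measurable_upd [measurable]:
  "k < n \<Longrightarrow> g \<in> borel_measurable (borel_rn n) \<Longrightarrow> (\<lambda>x. x(k := g x)) \<in> measurable (borel_rn n) (borel_rn n)"
proof (rule measurable_PiM_single')
  fix i assume g[measurable]: "g \<in> borel_measurable (borel_rn n)" and i: "i \<in> {..<n}"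
  show "(\<lambda>x. (x(k := g x)) i) \<in> borel_measurable (borel_rn n)"
    using i by (cases "i = k") auto
qed (auto simp: space_PiM PiE_def extensional_def)

lemma pd_measurable:
  assumes f: "differentiable_rn n f" and k: "k < n"
  shows "pd k f \<in> borel_measurable (borel_rn n)"
proof (rule borel_measurable_LIMSEQ_real)
  have [measurable]: "f \<in> borel_measurable (borel_rn n)" using f by (rule differentiable_measurable)
  fix j :: nat
  show "(\<lambda>x. (f (x(k := x k + inverse (real (Suc j)))) - f x) / inverse (real (Suc j))) \<in> borel_measurable (borel_rn n)"
    using k by (auto intro!: borel_measurable_divide borel_measurable_diff
      measurable_compose[OF measurable_upd differentiable_measurable[OF f]] differentiable_measurable[OF f])
next
  fix x assume "x \<in> space (borel_rn n)"
  then have x: "x \<in> rn n" by simp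
  have "((\<lambda>h. (f (x(k := x k + h)) - f (x(k := x k))) / h) \<longlongrightarrow> pd k f x) (at 0)"
    using differentiable_partial[OF f x k] by (simp add: DERIV_def)
  moreover have "filterlim (\<lambda>j. inverse (real (Suc j))) (at 0) sequentially"
    unfolding filterlim_at using LIMSEQ_inverse_real_of_nat by auto
  ultimately show "(\<lambda>j. (f (x(k := x k + inverse (real (Suc j)))) - f x) / inverse (real (Suc j))) \<longlonglongrightarrow> pd k f x"
    using filterlim_compose by (fastforce simp: fun_upd_idem)
qed

text \<open>A second order remainder beats the norm in the denominator, and only the unit ball
  around x matters. Products of coordinates and Gaussian averages are shown differentiable in this
  way.\<close>

lemma has_gradient_quadratic:
  assumes x: "x \<in> rn n"
    and bd: "\<And>y. y \<in> rn n \<Longrightarrow> (\<Sum>i<n. (y i - x i)\<^sup>2) \<le> 1 \<Longrightarrow>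
      \<bar>f y - f x - (\<Sum>i<n. g i * (y i - x i))\<bar> \<le> K * (\<Sum>i<n. (y i - x i)\<^sup>2)"
  shows "has_gradient n f g x"
  unfolding has_gradient_def
proof (rule Lim_null_comparison)
  let ?L = "\<lambda>y. L2_set (\<lambda>i. y i - x i) {..<n}"
  show "((\<lambda>y. K * ?L y) \<longlongrightarrow> 0) (at x within rn n)"
    using tendsto_mult_right_zero[OF tendsto_L2_diff] by simp
  have "\<forall>\<^sub>F y in at x within rn n. ?L y < 1"
    using tendsto_L2_diff by (rule order_tendstoD) simp
  moreover have "\<forall>\<^sub>F y in at x within rn n. y \<in> rn n"
    unfolding eventually_at_topological by auto
  ultimately show "\<forall>\<^sub>F y in at x within rn n. norm ((f y - f x - (\<Sum>i<n. g i * (y i - x i))) / ?L y) \<le> K * ?L y"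
  proof eventually_elim
    case (elim y)
    have sq: "(\<Sum>i<n. (y i - x i)\<^sup>2) = (?L y)\<^sup>2" by (simp add: L2_set_def sum_nonneg)
    have L0: "?L y \<ge> 0" by simp
    have "\<bar>f y - f x - (\<Sum>i<n. g i * (y i - x i))\<bar> \<le> K * (?L y)\<^sup>2"
      using bd[OF elim(2)] elim(1) L0 unfolding sq by (simp add: power_le_one)
    then have "\<bar>f y - f x - (\<Sum>i<n. g i * (y i - x i))\<bar> / ?L y \<le> K * (?L y)\<^sup>2 / ?L y"
      by (rule divide_right_mono) simp
    then show ?case by (cases "?L y = 0") (auto simp: power2_eq_square)
  qed
qed

lemma has_gradient_const: "has_gradient n (\<lambda>_. c) (\<lambda>_. 0) x"
  by (simp add: has_gradient_def)

lemma has_gradient_add: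
  assumes "has_gradient n f g x" "has_gradient n f' g' x"
  shows "has_gradient n (\<lambda>y. f y + f' y) (\<lambda>i. g i + g' i) x"
proof -
  have "(f y - f x - (\<Sum>i<n. g i * (y i - x i))) / L2_set (\<lambda>i. y i - x i) {..<n} +
     (f' y - f' x - (\<Sum>i<n. g' i * (y i - x i))) / L2_set (\<lambda>i. y i - x i) {..<n} =
     (f y + f' y - (f x + f' x) - (\<Sum>i<n. (g i + g' i) * (y i - x i))) / L2_set (\<lambda>i. y i - x i) {..<n}" for y
    by (simp add: add_divide_distrib[symmetric] distrib_right sum.distrib)
  then show ?thesis
    using tendsto_add[OF assms[unfolded has_gradient_def]] by (simp add: has_gradient_def)
qed

lemma has_gradient_cmult:
  assumes "has_gradient n f g x"
  shows "has_gradient n (\<lambda>y. c * f y) (\<lambda>i. c * g i) x"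
  using tendsto_mult_left[OF assms[unfolded has_gradient_def], of c]
  by (simp add: has_gradient_def algebra_simps sum_distrib_left)

lemma has_gradient_sum:
  assumes "\<And>j. j \<in> J \<Longrightarrow> has_gradient n (f j) (g j) x"
  shows "has_gradient n (\<lambda>y. \<Sum>j\<in>J. f j y) (\<lambda>i. \<Sum>j\<in>J. g j i) x"
  using assms
proof (induction J rule: infinite_finite_induct)
  case (insert j J)
  then show ?case using has_gradient_add[of n "f j" "g j" x] by simp
qed (auto simp: has_gradient_const)

lemma has_gradient_coord:
  assumes "j < n"
  shows "has_gradient n (\<lambda>y. y j) (\<lambda>i. if i = j then 1 else 0) x"
proof -
  have "(\<Sum>i<n. (if i = j then 1 else 0) * (y i - x i)) = y j - x j" for y
    using assms by (simp add: sum.delta if_distrib[of "\<lambda>c. c * _"] cong: if_cong)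
  then show ?thesis by (simp add: has_gradient_def)
qed

section \<open>Integration tools\<close>

text \<open>Fields of \<open>korn_class\<close> are merely differentiable, so derivatives may be
  discontinuous. The gauge integral recovers a function from any everywhere derivative;
  integrability then identifies it with the Lebesgue integral.\<close>

lemma FTC_lebesgue_01:
  fixes F F' :: "real \<Rightarrow> real"
  assumes d: "\<And>t. t \<in> {0..1} \<Longrightarrow> (F has_real_derivative F' t) (at t)"
    and i: "set_integrable lborel {0..1} F'"
  shows "(LINT t:{0..1}|lborel. F' t) = F 1 - F 0"
proof -
  have "(F' has_integral (F 1 - F 0)) {0..1}"
    by (rule fundamental_theorem_of_calculus)
       (auto intro!: has_vector_derivative_at_within d[unfolded has_real_derivative_iff_has_vector_derivative])
  then show ?thesis using set_borel_integral_eq_integral(2)[OF i] by (simp add: integral_unique)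
qed

text \<open>By the mean value theorem \<open>g\<close> dominates all difference quotients, so
  dominated convergence applies along every sequence tending to t.\<close>

lemma has_real_derivative_integral:
  fixes f f' :: "real \<Rightarrow> 'a \<Rightarrow> real"
  assumes t: "t \<in> {a<..<b}"
    and d: "\<And>s x. s \<in> {a<..<b} \<Longrightarrow> x \<in> space M \<Longrightarrow> ((\<lambda>s. f s x) has_real_derivative f' s x) (at s)"
    and i: "\<And>s. s \<in> {a<..<b} \<Longrightarrow> integrable M (f s)"
    and bd: "\<And>s x. s \<in> {a<..<b} \<Longrightarrow> x \<in> space M \<Longrightarrow> \<bar>f' s x\<bar> \<le> g x"
    and g: "integrable M g"
  shows "((\<lambda>s. \<integral>x. f s x \<partial>M) has_real_derivative (\<integral>x. f' t x \<partial>M)) (at t)"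
    and "integrable M (f' t)"
proof -
  have lim: "(\<lambda>k. (f (S k) x - f t x) / (S k - t)) \<longlonglongrightarrow> f' t x"
    if "\<forall>k. S k \<noteq> t" "S \<longlonglongrightarrow> t" "x \<in> space M" for S x
  proof -
    have "((\<lambda>s. (f s x - f t x) / (s - t)) \<longlongrightarrow> f' t x) (at t)"
      using d[OF t that(3)] by (simp add: has_field_derivative_iff)
    moreover have "filterlim S (at t) sequentially" using that by (simp add: filterlim_at)
    ultimately show ?thesis by (rule filterlim_compose)
  qed
  have quot: "\<bar>(f s x - f t x) / (s - t)\<bar> \<le> g x" if s: "s \<in> {a<..<b}" "s \<noteq> t" and x: "x \<in> space M" for s x
  proof -
    have sub: "u \<in> {a<..<b}" if "min s t \<le> u" "u \<le> max s t" for u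
      using that s t by (auto simp: min_def max_def split: if_splits)
    have "min s t < max s t" using s(2) by auto
    then obtain u where u: "min s t < u" "u < max s t"
      and eq: "f (max s t) x - f (min s t) x = (max s t - min s t) * f' u x"
      using MVT2[of "min s t" "max s t" "\<lambda>s. f s x" "\<lambda>s. f' s x"] d[OF sub x] by auto
    have "(f s x - f t x) / (s - t) = f' u x"
      using eq s(2) by (cases "s < t") (auto simp: min_def max_def field_simps)
    then show ?thesis using bd[OF sub x, of u] u by simp
  qed
  \<comment> \<open>One admissible sequence suffices to see that \<open>f' t\<close> is measurable,
    as a pointwise limit of difference quotients.\<close>
  have "\<exists>S. (\<forall>k. S k \<in> {a<..<b} - {t}) \<and> S \<longlonglongrightarrow> t"
  proof -
    have "t islimpt {a<..<b}" using t by (simp add: islimpt_greaterThanLessThan1 interior_limit_point)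
    then show ?thesis unfolding islimpt_sequential by blast
  qed
  then obtain S0 where S0: "\<forall>k. S0 k \<in> {a<..<b} - {t}" "S0 \<longlonglongrightarrow> t" by blast
  have m[measurable]: "f s \<in> borel_measurable M" if "s \<in> {a<..<b}" for s
    using i[OF that] by simp
  have m'[measurable]: "f' t \<in> borel_measurable M"
  proof (rule borel_measurable_LIMSEQ_real)
    show "(\<lambda>x. (f (S0 k) x - f t x) / (S0 k - t)) \<in> borel_measurable M" for k
      using S0 t by (auto intro!: borel_measurable_divide borel_measurable_diff m)
    show "(\<lambda>k. (f (S0 k) x - f t x) / (S0 k - t)) \<longlonglongrightarrow> f' t x" if "x \<in> space M" for x
      using S0 that by (intro lim) auto
  qed
  show "integrable M (f' t)"
    by (rule Bochner_Integration.integrable_bound[OF g m']) (use bd t in fastforce)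
  have key: "(\<lambda>k. ((\<integral>x. f (S k) x \<partial>M) - (\<integral>x. f t x \<partial>M)) / (S k - t)) \<longlonglongrightarrow> (\<integral>x. f' t x \<partial>M)"
    if S: "\<forall>k. S k \<in> {a<..<b} - {t}" "S \<longlonglongrightarrow> t" for S
  proof -
    have "(\<lambda>k. \<integral>x. (f (S k) x - f t x) / (S k - t) \<partial>M) \<longlonglongrightarrow> (\<integral>x. f' t x \<partial>M)"
    proof (rule integral_dominated_convergence[OF m' _ g])
      show "(\<lambda>x. (f (S k) x - f t x) / (S k - t)) \<in> borel_measurable M" for k
        using S t by (auto intro!: borel_measurable_divide borel_measurable_diff m)
    qed (use S quot lim in auto)
    moreover have "(\<integral>x. (f (S k) x - f t x) / (S k - t) \<partial>M) = ((\<integral>x. f (S k) x \<partial>M) - (\<integral>x. f t x \<partial>M)) / (S k - t)" for k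
      using S t i by (simp add: Bochner_Integration.integral_diff)
    ultimately show ?thesis by (simp only:)
  qed
  show "((\<lambda>s. \<integral>x. f s x \<partial>M) has_real_derivative (\<integral>x. f' t x \<partial>M)) (at t)"
  proof -
    have "((\<lambda>s. ((\<integral>x. f s x \<partial>M) - (\<integral>x. f t x \<partial>M)) / (s - t)) \<longlongrightarrow> (\<integral>x. f' t x \<partial>M)) (at t within {a<..<b})"
      unfolding tendsto_at_iff_sequentially using key by (auto simp: comp_def)
    then show ?thesis
      using t by (simp add: has_field_derivative_iff at_within_open[of t "{a<..<b}"])
  qed
qed

section \<open>Integration by parts\<close>

text \<open>F (x + v) - F x is the integral of F' along the segment. Integrating over x, translation
  invariance kills the left side, and Fubini with the same invariance turns the right side into the
  integral of F'. Integrability of F replaces decay at infinity.\<close>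

lemma integral_line_derivative_zero:
  fixes F F' :: "(nat \<Rightarrow> real) \<Rightarrow> real"
  assumes [measurable]: "F \<in> borel_measurable (borel_rn n)" "F' \<in> borel_measurable (borel_rn n)"
    and d: "\<And>x t. x \<in> rn n \<Longrightarrow> ((\<lambda>t. F (lin n 1 x t v)) has_real_derivative F' (lin n 1 x t v)) (at t)"
    and iF: "integrable (leb n) F" and iF': "integrable (leb n) F'"
  shows "(\<integral>x. F' x \<partial>leb n) = 0"
proof -
  interpret L: finite_product_sigma_finite "\<lambda>_. lborel :: real measure" "{..<n}" by standard simp
  interpret P: pair_sigma_finite "leb n" "lborel :: real measure" ..
  have tr: "distr (leb n) (leb n) (\<lambda>x. lin n 1 x t v) = leb n" for t
  proof -
    have "lin n 1 x t v = lin n 1 x 1 (\<lambda>i. t * v i)" for x by (simp add: lin_def)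
    then show ?thesis using leb_translation[of n "\<lambda>i. t * v i"] by simp
  qed
  have T[measurable]: "(\<lambda>x. lin n 1 x t v) \<in> measurable (leb n) (leb n)" for t by measurable
  have tr_int: "(\<integral>x. G (lin n 1 x t v) \<partial>leb n) = (\<integral>x. G x \<partial>leb n)"
    and tr_ible: "integrable (leb n) G \<Longrightarrow> integrable (leb n) (\<lambda>x. G (lin n 1 x t v))"
    if [measurable]: "G \<in> borel_measurable (borel_rn n)" for t and G :: "(nat \<Rightarrow> real) \<Rightarrow> real"
  proof -
    show "(\<integral>x. G (lin n 1 x t v) \<partial>leb n) = (\<integral>x. G x \<partial>leb n)"
      by (subst (2) tr[of t, symmetric], subst integral_distr) auto
    assume "integrable (leb n) G"
    then have "integrable (distr (leb n) (leb n) (\<lambda>x. lin n 1 x t v)) G" by (simp only: tr)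
    then show "integrable (leb n) (\<lambda>x. G (lin n 1 x t v))" by (subst (asm) integrable_distr_eq) auto
  qed
  define h where "h x t = indicat_real {0..1} t * F' (lin n 1 x t v)" for x t
  have [measurable]: "case_prod h \<in> borel_measurable (leb n \<Otimes>\<^sub>M lborel)"
    unfolding h_def by measurable
  have ih: "integrable (leb n \<Otimes>\<^sub>M lborel) (case_prod h)"
  proof (rule integrableI_bounded)
    have "(\<integral>\<^sup>+ p. ennreal (norm (case_prod h p)) \<partial>(leb n \<Otimes>\<^sub>M lborel)) =
        (\<integral>\<^sup>+ t. \<integral>\<^sup>+ x. ennreal (norm (h x t)) \<partial>leb n \<partial>lborel)"
      by (subst P.nn_integral_snd[symmetric]) auto
    also have "\<dots> = (\<integral>\<^sup>+ t. indicator {0..1} t * (\<integral>\<^sup>+ x. ennreal (norm (F' x)) \<partial>leb n) \<partial>(lborel :: real measure))"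
    proof (rule nn_integral_cong)
      fix t :: real
      have "(\<integral>\<^sup>+ x. ennreal (norm (h x t)) \<partial>leb n) = (\<integral>\<^sup>+ x. indicator {0..1} t * ennreal (norm (F' (lin n 1 x t v))) \<partial>leb n)"
        by (rule nn_integral_cong) (auto simp: h_def indicator_def)
      also have "\<dots> = indicator {0..1} t * (\<integral>\<^sup>+ x. ennreal (norm (F' (lin n 1 x t v))) \<partial>leb n)"
        by (rule nn_integral_cmult) measurable
      also have "(\<integral>\<^sup>+ x. ennreal (norm (F' (lin n 1 x t v))) \<partial>leb n) = (\<integral>\<^sup>+ x. ennreal (norm (F' x)) \<partial>leb n)"
        by (subst (2) tr[of t, symmetric], subst nn_integral_distr) auto
      finally show "(\<integral>\<^sup>+ x. ennreal (norm (h x t)) \<partial>leb n) = indicator {0..1} t * (\<integral>\<^sup>+ x. ennreal (norm (F' x)) \<partial>leb n)" .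
    qed
    also have "\<dots> = (\<integral>\<^sup>+ x. ennreal (norm (F' x)) \<partial>leb n)"
      by (simp add: nn_integral_multc)
    also have "\<dots> < \<infinity>" using iF' by (simp add: integrable_iff_bounded)
    finally show "(\<integral>\<^sup>+ p. ennreal (norm (case_prod h p)) \<partial>(leb n \<Otimes>\<^sub>M lborel)) < \<infinity>" .
  qed simp
  have "(\<integral>x. F' x \<partial>leb n) = (\<integral>t. indicat_real {0..1} (t :: real) * (\<integral>x. F' x \<partial>leb n) \<partial>lborel)"
    by simp
  also have "\<dots> = (\<integral>t. \<integral>x. h x t \<partial>leb n \<partial>lborel)"
    unfolding h_def by (simp add: tr_int)
  also have "\<dots> = (\<integral>x. \<integral>t. h x t \<partial>lborel \<partial>leb n)"
    by (rule P.Fubini_integral[OF ih])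
  also have "\<dots> = (\<integral>x. F (lin n 1 x 1 v) - F x \<partial>leb n)"
  proof (rule integral_cong_AE)
    show "AE x in leb n. (\<integral>t. h x t \<partial>lborel) = F (lin n 1 x 1 v) - F x"
      using P.AE_integrable_fst'[OF ih] AE_space
    proof eventually_elim
      case (elim x)
      then have x: "x \<in> rn n" by simp
      have "set_integrable lborel {0..1} (\<lambda>t. F' (lin n 1 x t v))"
        using elim by (simp add: set_integrable_def h_def)
      from FTC_lebesgue_01[OF d[OF x] this]
      show ?case using x by (simp add: set_lebesgue_integral_def h_def)
    qed
  qed measurable
  also have "\<dots> = (\<integral>x. F (lin n 1 x 1 v) \<partial>leb n) - (\<integral>x. F x \<partial>leb n)"
    by (rule Bochner_Integration.integral_diff) (auto intro: tr_ible iF)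
  also have "\<dots> = 0" by (simp add: tr_int)
  finally show ?thesis .
qed

lemma integrable_gaussian_leb:
  assumes [measurable]: "f \<in> borel_measurable (borel_rn n)"
  shows "integrable (std_gaussian n) f \<longleftrightarrow> integrable (leb n) (\<lambda>x. gdens n x * f x :: real)"
    and "(\<integral>x. f x \<partial>std_gaussian n) = (\<integral>x. gdens n x * f x \<partial>leb n)"
  unfolding std_gaussian_leb
  by (subst integrable_density integral_density; auto intro: less_imp_le gdens_pos)+

text \<open>The preceding lemma applied to the product of g with the density, whose logarithmic
  derivative along v is - \<open>dot n v x\<close>.\<close>

lemma gaussian_ibp:
  fixes g g' :: "(nat \<Rightarrow> real) \<Rightarrow> real"
  assumes [measurable]: "g \<in> borel_measurable (borel_rn n)" "g' \<in> borel_measurable (borel_rn n)"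
    and d: "\<And>x t. x \<in> rn n \<Longrightarrow> ((\<lambda>t. g (lin n 1 x t v)) has_real_derivative g' (lin n 1 x t v)) (at t)"
    and ig: "integrable (std_gaussian n) g" and ig': "integrable (std_gaussian n) g'"
    and ivg: "integrable (std_gaussian n) (\<lambda>x. dot n v x * g x)"
  shows "(\<integral>x. g' x \<partial>std_gaussian n) = (\<integral>x. dot n v x * g x \<partial>std_gaussian n)"
proof -
  have gd: "((\<lambda>t. gdens n (lin n 1 x t v)) has_real_derivative
      - dot n v (lin n 1 x t v) * gdens n (lin n 1 x t v)) (at t)" for x t
  proof -
    have sq: "sqn n (lin n 1 x t v) = sqn n x + 2 * t * dot n x v + t\<^sup>2 * sqn n v" for t
      by (simp add: dot_lin_left dot_lin_right dot_commute[of n v x] algebra_simps power2_eq_square)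
    have dd: "dot n v (lin n 1 x t v) = dot n x v + t * sqn n v"
      by (simp add: dot_lin_right dot_commute)
    show ?thesis
      unfolding gdens_def sq dd by (auto intro!: derivative_eq_intros simp: field_simps)
  qed
  have "(\<integral>x. gdens n x * (g' x - dot n v x * g x) \<partial>leb n) = 0"
  proof (rule integral_line_derivative_zero[where F = "\<lambda>x. gdens n x * g x" and v = v])
    fix x :: "nat \<Rightarrow> real" and t :: real assume x: "x \<in> rn n"
    show "((\<lambda>t. gdens n (lin n 1 x t v) * g (lin n 1 x t v)) has_real_derivative
        gdens n (lin n 1 x t v) * (g' (lin n 1 x t v) - dot n v (lin n 1 x t v) * g (lin n 1 x t v))) (at t)"
      using DERIV_mult[OF gd d[OF x]] by (rule DERIV_cong) (simp add: algebra_simps)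
  next
    show "integrable (leb n) (\<lambda>x. gdens n x * g x)"
      using ig by (simp add: integrable_gaussian_leb)
    have "integrable (std_gaussian n) (\<lambda>x. g' x - dot n v x * g x)"
      using ig' ivg by simp
    then show "integrable (leb n) (\<lambda>x. gdens n x * (g' x - dot n v x * g x))"
      by (simp add: integrable_gaussian_leb)
  qed measurable
  then have "(\<integral>x. g' x - dot n v x * g x \<partial>std_gaussian n) = 0"
    by (simp add: integrable_gaussian_leb)
  then show ?thesis using ig' ivg by simp
qed

definition basis :: "nat \<Rightarrow> nat \<Rightarrow> real" where
  "basis k = (\<lambda>i. if i = k then 1 else 0)"

lemma sum_basis: "k < n \<Longrightarrow> (\<Sum>i<n. basis k i * f i) = f k" "k < n \<Longrightarrow> (\<Sum>i<n. f i * basis k i) = f k"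
  by (simp_all add: basis_def if_distrib[of "\<lambda>c. c * _"] if_distrib[of "\<lambda>c. _ * c"] cong: if_cong)

lemma dot_basis: "k < n \<Longrightarrow> dot n (basis k) x = x k"
  by (simp add: dot_def sum_basis)

lemma lin_basis: "x \<in> rn n \<Longrightarrow> k < n \<Longrightarrow> lin n 1 x t (basis k) = x(k := x k + t)"
  by (rule lin_eqI) (auto simp: basis_def upd_in_rn)

lemma gaussian_ibp_coord:
  fixes g g' :: "(nat \<Rightarrow> real) \<Rightarrow> real"
  assumes k: "k < n" and [measurable]: "g \<in> borel_measurable (borel_rn n)" "g' \<in> borel_measurable (borel_rn n)"
    and d: "\<And>x. x \<in> rn n \<Longrightarrow> ((\<lambda>t. g (x(k := t))) has_real_derivative g' x) (at (x k))"
    and ig: "integrable (std_gaussian n) g" and ig': "integrable (std_gaussian n) g'"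
    and ivg: "integrable (std_gaussian n) (\<lambda>x. x k * g x)"
  shows "(\<integral>x. g' x \<partial>std_gaussian n) = (\<integral>x. x k * g x \<partial>std_gaussian n)"
proof -
  have "(\<integral>x. g' x \<partial>std_gaussian n) = (\<integral>x. dot n (basis k) x * g x \<partial>std_gaussian n)"
  proof (rule gaussian_ibp)
    fix x :: "nat \<Rightarrow> real" and t :: real assume x: "x \<in> rn n"
    let ?y = "x(k := x k + t)"
    have "((\<lambda>s. g (?y(k := s))) has_real_derivative g' ?y) (at (x k + t))"
      using d[OF upd_in_rn[OF x k]] by fastforce
    then have "((\<lambda>s. g (?y(k := x k + s))) has_real_derivative g' ?y) (at t)"
      by (simp add: DERIV_shift[of _ _ t "x k"] add.commute)
    then show "((\<lambda>t. g (lin n 1 x t (basis k))) has_real_derivative g' (lin n 1 x t (basis k))) (at t)"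
      using x k by (simp add: lin_basis)
  qed (use assms in \<open>auto simp: dot_basis\<close>)
  then show ?thesis using k by (simp add: dot_basis)
qed

section \<open>Functions integrable against the Mehler kernels\<close>

text \<open>The threshold 1/4 fits the Mehler kernels, which for |r| < 1 grow at a rate below 1/4 in
  each variable. It also admits every square integrable function, because exp (2 c |x|^2) has finite
  Gaussian integral for 2 c < 1/2.\<close>

definition good :: "nat \<Rightarrow> ((nat \<Rightarrow> real) \<Rightarrow> real) \<Rightarrow> bool" where
  "good n f \<longleftrightarrow> f \<in> borel_measurable (borel_rn n) \<and>
     (\<forall>c<1/4. integrable (std_gaussian n) (\<lambda>x. exp (c * sqn n x) * f x))"

lemma good_measurable: "good n f \<Longrightarrow> f \<in> borel_measurable (borel_rn n)"
  by (simp add: good_def)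

lemma good_exp: "good n f \<Longrightarrow> c < 1 / 4 \<Longrightarrow> integrable (std_gaussian n) (\<lambda>x. exp (c * sqn n x) * f x)"
  by (simp add: good_def)

lemma good_bound:
  fixes h f :: "(nat \<Rightarrow> real) \<Rightarrow> real"
  assumes f: "good n f" and [measurable]: "h \<in> borel_measurable (borel_rn n)"
    and c: "c < 1 / 4" and h: "\<And>x. \<bar>h x\<bar> \<le> C * exp (c * sqn n x)"
  shows "integrable (std_gaussian n) (\<lambda>x. h x * f x)"
proof (rule Bochner_Integration.integrable_bound)
  note [measurable] = good_measurable[OF f]
  show "(\<lambda>x. h x * f x) \<in> borel_measurable (std_gaussian n)" by measurable
  show "integrable (std_gaussian n) (\<lambda>x. C * (exp (c * sqn n x) * f x))"
    using good_exp[OF f c] by simp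
  show "AE x in std_gaussian n. norm (h x * f x) \<le> norm (C * (exp (c * sqn n x) * f x))"
  proof (rule AE_I2)
    fix x
    have "\<bar>h x\<bar> \<le> \<bar>C * exp (c * sqn n x)\<bar>" using h[of x] by linarith
    then show "norm (h x * f x) \<le> norm (C * (exp (c * sqn n x) * f x))"
      by (simp add: abs_mult mult.assoc[symmetric] mult_right_mono)
  qed
qed

lemma good_integrable: "good n f \<Longrightarrow> integrable (std_gaussian n) f"
  using good_exp[of n f 0] by simp

lemma good_add: "good n f \<Longrightarrow> good n g \<Longrightarrow> good n (\<lambda>x. f x + g x)"
  by (auto simp: good_def distrib_left)

lemma good_cmult: "good n f \<Longrightarrow> good n (\<lambda>x. a * f x)"
  by (auto simp: good_def mult.left_commute[of _ a])

lemma good_const: "good n (\<lambda>x. a)"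
  unfolding good_def using integrable_exp_sqn by (auto intro!: integrable_mult_left)

lemma good_diff: "good n f \<Longrightarrow> good n g \<Longrightarrow> good n (\<lambda>x. f x - g x)"
  using good_add[OF _ good_cmult[of n g "-1"]] by simp

lemma good_sum: "(\<And>i. i \<in> I \<Longrightarrow> good n (f i)) \<Longrightarrow> good n (\<lambda>x. \<Sum>i\<in>I. f i x)"
  by (induction I rule: infinite_finite_induct) (auto intro: good_const good_add)

lemma sq_le_exp:
  fixes t e :: real
  assumes "e > 0"
  shows "t\<^sup>2 \<le> 1 / e * exp (e * t\<^sup>2)"
proof -
  have "e * t\<^sup>2 \<le> exp (e * t\<^sup>2)" using exp_ge_add_one_self[of "e * t\<^sup>2"] by linarith
  then show ?thesis using assms by (simp add: field_simps)
qed

lemma abs_coord_le_exp: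
  assumes "e > 0" "k < n"
  shows "\<bar>x k\<bar> \<le> (1 + 1 / e) * exp (e * sqn n x)"
proof -
  have "0 \<le> (\<bar>x k\<bar> - 1)\<^sup>2" by simp
  then have "\<bar>x k\<bar> \<le> 1 + (x k)\<^sup>2" unfolding power2_diff power2_abs
    by simp
  also have "\<dots> \<le> exp (e * sqn n x) + 1 / e * exp (e * sqn n x)"
  proof (rule add_mono)
    show "1 \<le> exp (e * sqn n x)" using assms by simp
    have "(x k)\<^sup>2 \<le> 1 / e * exp (e * (x k)\<^sup>2)" using sq_le_exp[OF assms(1)] .
    also have "\<dots> \<le> 1 / e * exp (e * sqn n x)"
      using assms coord_sq_le_sqn[OF assms(2), of x] by (intro mult_left_mono) auto
    finally show "(x k)\<^sup>2 \<le> 1 / e * exp (e * sqn n x)" .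
  qed
  finally show ?thesis by (simp add: distrib_right)
qed

text \<open>The condition c < 1/4 is open: half of the gap that remains above c absorbs the linear
  factor.\<close>

lemma good_coord_mult:
  assumes f: "good n f" and k: "k < n"
  shows "good n (\<lambda>x. x k * f x)"
  unfolding good_def
proof (intro conjI allI impI)
  note [measurable] = good_measurable[OF f]
  show "(\<lambda>x. x k * f x) \<in> borel_measurable (borel_rn n)"
    using k by (intro borel_measurable_times measurable_component_singleton) auto
  fix c :: real assume c: "c < 1 / 4"
  define e where "e = (1 / 4 - c) / 2"
  have e: "e > 0" "c + e < 1 / 4" using c by (auto simp: e_def field_simps)
  have "integrable (std_gaussian n) (\<lambda>x. (exp (c * sqn n x) * x k) * f x)"
  proof (rule good_bound[OF f _ e(2)])
    fix x
    have "exp (c * sqn n x) * \<bar>x k\<bar> \<le> exp (c * sqn n x) * ((1 + 1 / e) * exp (e * sqn n x))"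
      using abs_coord_le_exp[OF e(1) k] by (rule mult_left_mono) simp
    then show "\<bar>exp (c * sqn n x) * x k\<bar> \<le> (1 + 1 / e) * exp ((c + e) * sqn n x)"
      by (simp add: abs_mult distrib_right distrib_left exp_add mult_ac)
  qed (use k in \<open>auto intro!: borel_measurable_times\<close>)
  then show "integrable (std_gaussian n) (\<lambda>x. exp (c * sqn n x) * (x k * f x))"
    by (simp add: mult.assoc)
qed

lemma good_coord: "k < n \<Longrightarrow> good n (\<lambda>x. x k)"
  using good_coord_mult[OF good_const[of n 1]] by simp

text \<open>The weight is square integrable as 2 c < 1/2, so the product is dominated by the sum of
  two squares.\<close>

lemma good_L2:
  assumes [measurable]: "f \<in> borel_measurable (borel_rn n)" and i: "integrable (std_gaussian n) (\<lambda>x. (f x)\<^sup>2)"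
  shows "good n f"
  unfolding good_def
proof (intro conjI allI impI)
  fix c :: real assume c: "c < 1 / 4"
  show "integrable (std_gaussian n) (\<lambda>x. exp (c * sqn n x) * f x)"
  proof (rule Bochner_Integration.integrable_bound)
    show "integrable (std_gaussian n) (\<lambda>x. exp ((2 * c) * sqn n x) + (f x)\<^sup>2)"
      using i c by (intro Bochner_Integration.integrable_add integrable_exp_sqn) auto
    show "AE x in std_gaussian n. norm (exp (c * sqn n x) * f x) \<le> norm (exp ((2 * c) * sqn n x) + (f x)\<^sup>2)"
    proof (rule AE_I2)
      fix x
      let ?a = "exp (c * sqn n x)"
      have "0 \<le> (?a - \<bar>f x\<bar>)\<^sup>2" by simp
      then have "2 * (?a * \<bar>f x\<bar>) \<le> ?a\<^sup>2 + (f x)\<^sup>2" by (simp add: power2_diff)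
      moreover have "?a\<^sup>2 = exp ((2 * c) * sqn n x)" by (simp add: power2_eq_square exp_add[symmetric])
      moreover have "0 \<le> ?a * \<bar>f x\<bar>" by simp
      ultimately have "?a * \<bar>f x\<bar> \<le> exp ((2 * c) * sqn n x) + (f x)\<^sup>2" by linarith
      then show "norm (exp (c * sqn n x) * f x) \<le> norm (exp ((2 * c) * sqn n x) + (f x)\<^sup>2)"
        by (simp add: abs_mult)
    qed
  qed measurable
qed fact

lemma dot_le_eps:
  assumes "e > 0"
  shows "dot n a x \<le> e * sqn n x + sqn n a / (4 * e)"
proof -
  have "0 \<le> sqn n (lin n (2 * e) x (-1) a)" by simp
  also have "\<dots> = 4 * e * (e * sqn n x) - 4 * e * dot n a x + sqn n a"
    by (simp add: dot_lin_left dot_lin_right dot_commute[of n x a] algebra_simps)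
  finally have "4 * e * dot n a x \<le> 4 * e * (e * sqn n x) + sqn n a" by simp
  then show ?thesis using assms by (simp add: field_simps)
qed

text \<open>The weights against which fields are integrated by parts. Their logarithmic gradient a -
  b x is affine, so integration by parts only produces affine factors.\<close>

definition expq :: "nat \<Rightarrow> (nat \<Rightarrow> real) \<Rightarrow> real \<Rightarrow> (nat \<Rightarrow> real) \<Rightarrow> real" where
  "expq n a b x = exp (dot n a x - b * sqn n x / 2)"

lemma measurable_expq [measurable]: "expq n a b \<in> borel_measurable (borel_rn n)"
  unfolding expq_def[abs_def] by measurable

lemma expq_bound:
  assumes "b \<ge> 0" "e > 0"
  shows "expq n a b x \<le> exp (sqn n a / (4 * e)) * exp (e * sqn n x)"
proof -
  have "dot n a x - b * sqn n x / 2 \<le> sqn n a / (4 * e) + e * sqn n x"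
  proof -
    have "0 \<le> b * sqn n x / 2" using assms by simp
    then show ?thesis using dot_le_eps[OF assms(2), of n a x] by linarith
  qed
  then show ?thesis by (simp add: expq_def exp_add[symmetric])
qed

lemma good_expq:
  assumes "good n f" "b \<ge> 0"
  shows "integrable (std_gaussian n) (\<lambda>x. expq n a b x * f x)"
proof (rule good_bound[OF assms(1), where c = "1 / 8"])
  fix x
  show "\<bar>expq n a b x\<bar> \<le> exp (sqn n a / (4 * (1 / 8))) * exp (1 / 8 * sqn n x)"
    using expq_bound[OF assms(2), of "1 / 8" n a x] by (simp add: expq_def)
qed auto

section \<open>Integration by parts with the symmetrized gradient\<close>

lemma quadratic_form_polarization:
  fixes m p :: "nat \<Rightarrow> nat \<Rightarrow> real"
  assumes eq: "\<And>v. (\<Sum>i<n. \<Sum>j<n. v i * v j * m i j) = (\<Sum>i<n. \<Sum>j<n. v i * v j * p i j)"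
    and sym: "m k l = m l k" and k: "k < n" and l: "l < n"
  shows "2 * m k l = p k l + p l k"
proof -
  have one: "(\<Sum>i<n. \<Sum>j<n. basis k i * basis k j * q i j) = q k k" if "k < n" for q :: "nat \<Rightarrow> nat \<Rightarrow> real" and k
    using that by (simp add: mult.assoc sum_distrib_left[symmetric] sum_basis)
  have two: "(\<Sum>i<n. \<Sum>j<n. (basis k i + basis l i) * (basis k j + basis l j) * q i j) = q k k + q k l + q l k + q l l"
    for q :: "nat \<Rightarrow> nat \<Rightarrow> real"
  proof -
    have "(\<Sum>j<n. (basis k j + basis l j) * q i j) = q i k + q i l" for i
      using k l by (simp add: distrib_right sum.distrib sum_basis)
    then show ?thesis
      using k l by (simp add: mult.assoc sum_distrib_left[symmetric] distrib_right sum.distrib sum_basis)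
  qed
  show ?thesis
    using eq[of "basis k"] eq[of "basis l"] eq[of "\<lambda>i. basis k i + basis l i"] sym
    unfolding one[OF k] one[OF l] two by simp
qed

lemma integral_double_sum:
  fixes h :: "nat \<Rightarrow> nat \<Rightarrow> 'a \<Rightarrow> real"
  assumes h: "\<And>i j. i < n \<Longrightarrow> j < n \<Longrightarrow> integrable M (h i j)"
  shows "(\<integral>x. (\<Sum>i<n. \<Sum>j<n. c i j * h i j x) \<partial>M) = (\<Sum>i<n. \<Sum>j<n. c i j * (\<integral>x. h i j x \<partial>M))"
proof -
  have "(\<integral>x. (\<Sum>i<n. \<Sum>j<n. c i j * h i j x) \<partial>M) = (\<Sum>i<n. (\<integral>x. (\<Sum>j<n. c i j * h i j x) \<partial>M))"
    by (rule Bochner_Integration.integral_sum) (use h in \<open>auto intro!: Bochner_Integration.integrable_sum integrable_mult_right\<close>)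
  also have "\<dots> = (\<Sum>i<n. \<Sum>j<n. (\<integral>x. c i j * h i j x \<partial>M))"
    by (intro sum.cong refl Bochner_Integration.integral_sum) (use h in \<open>auto intro!: integrable_mult_right\<close>)
  finally show ?thesis by simp
qed

text \<open>The derivative of v.u along v is the quadratic form of the symmetrized gradient at v,
  the only combination of partials known to be integrable. Gaussian integration by parts is done for
  this form, for every v; polarization then extracts the entries.\<close>

lemma korn_ibp:
  assumes u: "\<And>i. i < n \<Longrightarrow> differentiable_rn n (\<lambda>x. u x i)"
    and gu: "\<And>i. i < n \<Longrightarrow> good n (\<lambda>x. u x i)"
    and ge: "\<And>i j. i < n \<Longrightarrow> j < n \<Longrightarrow> good n (\<lambda>x. sym_grad u x i j)"
    and b: "b \<ge> 0" and k: "k < n" and l: "l < n"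
  shows "2 * (\<integral>x. expq n a b x * sym_grad u x k l \<partial>std_gaussian n) =
    (\<integral>x. expq n a b x * (((1 + b) * x k - a k) * u x l) \<partial>std_gaussian n) +
    (\<integral>x. expq n a b x * (((1 + b) * x l - a l) * u x k) \<partial>std_gaussian n)"
proof -
  let ?e = "sym_grad u" and ?\<Psi> = "expq n a b" and ?G = "std_gaussian n"
  have gx: "good n (\<lambda>x. ((1 + b) * x j - a j) * u x i)" if "i < n" "j < n" for i j
    using good_diff[OF good_cmult[OF good_coord_mult[OF gu[OF that(1)] that(2)], of "1 + b"] good_cmult[OF gu[OF that(1)], of "a j"]]
    by (simp add: algebra_simps)
  have "2 * (\<integral>x. ?\<Psi> x * ?e x k l \<partial>?G) =
     (\<integral>x. ?\<Psi> x * (((1 + b) * x k - a k) * u x l) \<partial>?G) + (\<integral>x. ?\<Psi> x * (((1 + b) * x l - a l) * u x k) \<partial>?G)"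
  proof (rule quadratic_form_polarization[OF _ _ k l, where m = "\<lambda>i j. \<integral>x. ?\<Psi> x * ?e x i j \<partial>?G"
        and p = "\<lambda>i j. \<integral>x. ?\<Psi> x * (((1 + b) * x i - a i) * u x j) \<partial>?G"])
    show "(\<integral>x. ?\<Psi> x * ?e x k l \<partial>?G) = (\<integral>x. ?\<Psi> x * ?e x l k \<partial>?G)"
      by (simp add: sym_grad_def add.commute)
    fix v :: "nat \<Rightarrow> real"
    define g where "g x = (\<Sum>i<n. v i * u x i) * ?\<Psi> x" for x
    define g' where "g' x = (\<Sum>i<n. \<Sum>j<n. v i * v j * ?e x i j) * ?\<Psi> x + (\<Sum>i<n. v i * u x i) * (dot n a v - b * dot n v x) * ?\<Psi> x" for x
    note gum[measurable] = good_measurable[OF gu] and gem[measurable] = good_measurable[OF ge]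
    have gsum: "good n (\<lambda>x. \<Sum>i<n. v i * u x i)" by (intro good_sum good_cmult gu) auto
    have gsum': "good n (\<lambda>x. dot n v x * (\<Sum>i<n. v i * u x i))"
      unfolding dot_def sum_distrib_right mult.assoc
      by (intro good_sum good_cmult good_coord_mult gsum) auto
    have gesum: "good n (\<lambda>x. \<Sum>i<n. \<Sum>j<n. v i * v j * ?e x i j)" by (intro good_sum good_cmult ge) auto
    have ig: "integrable ?G g"
      using good_expq[OF gsum b, of a] by (simp add: g_def[abs_def] mult.commute)
    have ivg: "integrable ?G (\<lambda>x. dot n v x * g x)"
      using good_expq[OF gsum' b, of a] by (simp add: g_def[abs_def] mult_ac)
    have ige: "integrable ?G (\<lambda>x. (\<Sum>i<n. \<Sum>j<n. v i * v j * ?e x i j) * ?\<Psi> x)"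
      using good_expq[OF gesum b, of a] by (simp add: mult.commute)
    have "g' = (\<lambda>x. (\<Sum>i<n. \<Sum>j<n. v i * v j * ?e x i j) * ?\<Psi> x + (dot n a v * g x - b * (dot n v x * g x)))"
      by (rule ext) (simp add: g'_def g_def algebra_simps)
    then have ig': "integrable ?G g'"
      using ige ig ivg by simp
    have "(\<integral>x. g' x \<partial>?G) = (\<integral>x. dot n v x * g x \<partial>?G)"
    proof (rule gaussian_ibp[OF _ _ _ ig ig' ivg])
      show "g \<in> borel_measurable (borel_rn n)"
        using borel_measurable_integrable[OF ig] by simp
      show "g' \<in> borel_measurable (borel_rn n)"
        using borel_measurable_integrable[OF ig'] by simp
      fix x :: "nat \<Rightarrow> real" and t :: real assume x: "x \<in> rn n"
      let ?y = "lin n 1 x t v"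
      have du: "((\<lambda>t. u (lin n 1 x t v) i) has_real_derivative (\<Sum>j<n. pd j (\<lambda>y. u y i) ?y * v j)) (at t)"
        if "i < n" for i
        by (rule differentiable_chain[OF u[OF that]]) (auto intro!: derivative_eq_intros)
      have sq: "sqn n (lin n 1 x t v) = sqn n x + 2 * t * dot n x v + t\<^sup>2 * sqn n v" for t
        by (simp add: dot_lin_left dot_lin_right dot_commute[of n v x] algebra_simps power2_eq_square)
      have dd: "dot n v ?y = dot n x v + t * sqn n v"
        by (simp add: dot_lin_right dot_commute)
      have d\<Psi>: "((\<lambda>t. ?\<Psi> (lin n 1 x t v)) has_real_derivative (dot n a v - b * dot n v ?y) * ?\<Psi> ?y) (at t)"
        unfolding expq_def sq dd dot_lin_right[of n a] by (auto intro!: derivative_eq_intros simp: field_simps)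
      have "(\<Sum>i<n. \<Sum>j<n. v i * v j * ?e ?y i j) = (\<Sum>i<n. v i * (\<Sum>j<n. pd j (\<lambda>y. u y i) ?y * v j))"
      proof -
        have "(\<Sum>i<n. \<Sum>j<n. v i * v j * pd i (\<lambda>y. u y j) ?y) = (\<Sum>i<n. \<Sum>j<n. v i * v j * pd j (\<lambda>y. u y i) ?y)"
          by (subst sum.swap) (simp add: mult_ac)
        moreover have "(\<Sum>i<n. \<Sum>j<n. v i * v j * ?e ?y i j) =
          (\<Sum>i<n. \<Sum>j<n. v i * v j * pd i (\<lambda>y. u y j) ?y) / 2 + (\<Sum>i<n. \<Sum>j<n. v i * v j * pd j (\<lambda>y. u y i) ?y) / 2"
          by (simp add: sym_grad_def sum.distrib[symmetric] sum_divide_distrib algebra_simps add_divide_distrib)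
        ultimately show ?thesis by (simp add: sum_distrib_left mult_ac)
      qed
      moreover have "((\<lambda>t. \<Sum>i<n. v i * u (lin n 1 x t v) i) has_real_derivative
          (\<Sum>i<n. v i * (\<Sum>j<n. pd j (\<lambda>y. u y i) ?y * v j))) (at t)"
        by (intro DERIV_sum DERIV_cmult du) auto
      ultimately show "((\<lambda>t. g (lin n 1 x t v)) has_real_derivative g' ?y) (at t)"
        unfolding g_def g'_def using DERIV_mult[OF _ d\<Psi>] by (fastforce intro: DERIV_cong simp: mult_ac)
    qed
    then have "(\<integral>x. (\<Sum>i<n. \<Sum>j<n. v i * v j * ?e x i j) * ?\<Psi> x + (dot n a v * g x - b * (dot n v x * g x)) \<partial>?G) =
      (\<integral>x. dot n v x * g x \<partial>?G)"
      by (simp add: \<open>g' = _\<close>)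
    \<comment> \<open>The factor 1 + b collects two contributions of \<open>dot n v x\<close>: one
      from the Gaussian density and b from the weight; the weight also contributes the term with
      a.\<close>
    then have "(\<integral>x. (\<Sum>i<n. \<Sum>j<n. v i * v j * ?e x i j) * ?\<Psi> x \<partial>?G) =
       (1 + b) * (\<integral>x. dot n v x * g x \<partial>?G) - dot n a v * (\<integral>x. g x \<partial>?G)"
      using ige ig ivg by (simp add: algebra_simps)
    also have "\<dots> = (\<integral>x. (1 + b) * (dot n v x * g x) - dot n a v * g x \<partial>?G)"
      using ig ivg by simp
    also have "\<dots> = (\<integral>x. (\<Sum>i<n. \<Sum>j<n. v i * v j * (?\<Psi> x * (((1 + b) * x i - a i) * u x j))) \<partial>?G)"
    proof (rule Bochner_Integration.integral_cong[OF refl])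
      fix x
      have "(\<Sum>i<n. \<Sum>j<n. v i * v j * (?\<Psi> x * (((1 + b) * x i - a i) * u x j))) =
         (\<Sum>i<n. v i * ((1 + b) * x i - a i)) * (\<Sum>j<n. v j * u x j) * ?\<Psi> x"
        unfolding sum_product unfolding sum_distrib_right by (simp add: mult_ac)
      moreover have "(\<Sum>i<n. v i * ((1 + b) * x i - a i)) = (1 + b) * dot n v x - dot n a v"
        by (simp add: dot_def sum_subtractf sum_distrib_left algebra_simps)
      ultimately have "(\<Sum>i<n. \<Sum>j<n. v i * v j * (?\<Psi> x * (((1 + b) * x i - a i) * u x j))) =
        ((1 + b) * dot n v x - dot n a v) * (\<Sum>j<n. v j * u x j) * ?\<Psi> x"
        by (simp only:)
      moreover have "(1 + b) * (D * (S * P)) - A * (S * P) = ((1 + b) * D - A) * S * P" for D S P A :: real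
        by (simp add: left_diff_distrib)
      ultimately show "(1 + b) * (dot n v x * g x) - dot n a v * g x =
        (\<Sum>i<n. \<Sum>j<n. v i * v j * (?\<Psi> x * (((1 + b) * x i - a i) * u x j)))"
        unfolding g_def by (simp only:)
    qed
    also have "\<dots> = (\<Sum>i<n. \<Sum>j<n. v i * v j * (\<integral>x. ?\<Psi> x * (((1 + b) * x i - a i) * u x j) \<partial>?G))"
      by (rule integral_double_sum) (intro good_expq[OF gx b])
    finally show "(\<Sum>i<n. \<Sum>j<n. v i * v j * (\<integral>x. ?\<Psi> x * ?e x i j \<partial>?G)) =
       (\<Sum>i<n. \<Sum>j<n. v i * v j * (\<integral>x. ?\<Psi> x * (((1 + b) * x i - a i) * u x j) \<partial>?G))"
    proof (rule trans[rotated])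
      have "(\<integral>x. (\<Sum>i<n. \<Sum>j<n. v i * v j * ?e x i j) * ?\<Psi> x \<partial>?G) =
        (\<integral>x. (\<Sum>i<n. \<Sum>j<n. v i * v j * (?\<Psi> x * ?e x i j)) \<partial>?G)"
        by (simp add: sum_distrib_right sum_distrib_left mult_ac)
      also have "\<dots> = (\<Sum>i<n. \<Sum>j<n. v i * v j * (\<integral>x. ?\<Psi> x * ?e x i j \<partial>?G))"
        by (rule integral_double_sum) (intro good_expq[OF ge b])
      finally show "(\<Sum>i<n. \<Sum>j<n. v i * v j * (\<integral>x. ?\<Psi> x * ?e x i j \<partial>?G)) =
         (\<integral>x. (\<Sum>i<n. \<Sum>j<n. v i * v j * ?e x i j) * ?\<Psi> x \<partial>?G)" ..
    qed
  qed
  then show ?thesis .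
qed

section \<open>Weighted integrability of fields whose symmetrized gradient is square
  integrable\<close>

lemma sqn_scale: "sqn n (\<lambda>i. t * z i) = t\<^sup>2 * sqn n z"
  by (simp add: dot_def sum_distrib_left power2_eq_square mult_ac)

lemma dot_scale: "dot n (\<lambda>i. t * z i) y = t * dot n z y"
  by (simp add: dot_def sum_distrib_left mult_ac)

text \<open>For independent standard normal x and y, the point s x + (1 - s) y is centred Gaussian
  with variance q = s^2 + (1 - s)^2 between 1/2 and 1. Its density relative to the standard Gaussian
  is q^(-n/2) times an exponential that is at most 1 because q <= 1.\<close>

lemma gaussian_segment_bound:
  assumes s: "0 < s" "s < 1" and [measurable]: "g \<in> borel_measurable (borel_rn n)"
  shows "(\<integral>\<^sup>+y. \<integral>\<^sup>+x. g (lin n s x (1 - s) y) \<partial>std_gaussian n \<partial>std_gaussian n) \<le>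
    ennreal (sqrt 2 ^ n) * (\<integral>\<^sup>+z. g z \<partial>std_gaussian n)"
proof -
  interpret G: prob_space "std_gaussian n" by (rule prob_space_std_gaussian)
  interpret P: pair_sigma_finite "std_gaussian n" "std_gaussian n" ..
  define t where "t = 1 - s"
  define q where "q = s\<^sup>2 + t\<^sup>2"
  have q: "1 / 2 \<le> q" "q \<le> 1"
  proof -
    have "q = 1 / 2 + 2 * (s - 1 / 2)\<^sup>2" by (simp add: q_def t_def power2_eq_square algebra_simps)
    then show "1 / 2 \<le> q" by simp
    have "q = 1 - 2 * s * t" by (simp add: q_def t_def power2_eq_square algebra_simps)
    then show "q \<le> 1" using s by (simp add: t_def)
  qed
  \<comment> \<open>As a function of y the weight is again the exponential of a quadratic
    polynomial, so after exchanging the integrals the one over y is explicit.\<close>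
  have gw: "gweight n s (\<lambda>i. t * y i) z = (1 / s) ^ n * exp (sqn n z / 2 - sqn n z / (2 * s\<^sup>2)) *
      expq n (\<lambda>i. t / s\<^sup>2 * z i) (t\<^sup>2 / s\<^sup>2) y" for y z
    unfolding gweight_def expq_def sqn_scale dot_scale mult.assoc exp_add[symmetric] dot_commute[of n y z]
    using s by (simp add: diff_divide_distrib add_divide_distrib)
  have [measurable]: "(\<lambda>(z, y). gweight n s (\<lambda>i. t * y i) z) \<in> borel_measurable (borel_rn n \<Otimes>\<^sub>M borel_rn n)"
    unfolding gweight_def sqn_scale dot_scale by measurable
  have "(\<integral>\<^sup>+y. \<integral>\<^sup>+x. g (lin n s x (1 - s) y) \<partial>std_gaussian n \<partial>std_gaussian n) =
     (\<integral>\<^sup>+y. \<integral>\<^sup>+z. ennreal (gweight n s (\<lambda>i. t * y i) z) * g z \<partial>std_gaussian n \<partial>std_gaussian n)"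
  proof (rule nn_integral_cong)
    fix y
    have "lin n s x (1 - s) y = lin n 1 (\<lambda>i. t * y i) s x" for x
      by (simp add: lin_def t_def add.commute)
    then show "(\<integral>\<^sup>+x. g (lin n s x (1 - s) y) \<partial>std_gaussian n) =
      (\<integral>\<^sup>+z. ennreal (gweight n s (\<lambda>i. t * y i) z) * g z \<partial>std_gaussian n)"
      by (simp add: nn_integral_gaussian_affine[OF s(1)])
  qed
  also have "\<dots> = (\<integral>\<^sup>+z. \<integral>\<^sup>+y. ennreal (gweight n s (\<lambda>i. t * y i) z) * g z \<partial>std_gaussian n \<partial>std_gaussian n)"
    by (rule P.Fubini') measurable
  also have "\<dots> \<le> (\<integral>\<^sup>+z. ennreal (sqrt 2 ^ n) * g z \<partial>std_gaussian n)"
  proof (rule nn_integral_mono)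
    fix z
    have b1: "1 + t\<^sup>2 / s\<^sup>2 > 0" by (simp add: add_pos_nonneg)
    have "(\<integral>\<^sup>+y. ennreal (gweight n s (\<lambda>i. t * y i) z) \<partial>std_gaussian n) =
      ennreal ((1 / s) ^ n * exp (sqn n z / 2 - sqn n z / (2 * s\<^sup>2))) *
      (\<integral>\<^sup>+y. ennreal (exp (dot n (\<lambda>i. t / s\<^sup>2 * z i) y - t\<^sup>2 / s\<^sup>2 * sqn n y / 2)) \<partial>std_gaussian n)"
      unfolding gw expq_def using s
      by (subst nn_integral_cmult[symmetric]) (auto simp: ennreal_mult'[symmetric])
    also have "\<dots> = ennreal ((1 / s) ^ n * exp (sqn n z / 2 - sqn n z / (2 * s\<^sup>2)) *
       ((1 / sqrt (1 + t\<^sup>2 / s\<^sup>2)) ^ n * exp (sqn n (\<lambda>i. t / s\<^sup>2 * z i) / (2 * (1 + t\<^sup>2 / s\<^sup>2)))))"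
      unfolding gaussian_exp_nn[OF b1] using s by (simp add: ennreal_mult'[symmetric])
    also have "\<dots> \<le> ennreal (sqrt 2 ^ n)"
    proof (rule ennreal_leI)
      have qs: "1 + t\<^sup>2 / s\<^sup>2 = q / s\<^sup>2" using s by (simp add: q_def field_simps)
      have "(1 / s) ^ n * (1 / sqrt (1 + t\<^sup>2 / s\<^sup>2)) ^ n = (1 / sqrt q) ^ n"
        unfolding qs using s q by (simp add: real_sqrt_divide power_mult_distrib[symmetric])
      moreover have "(1 / sqrt q) ^ n \<le> sqrt 2 ^ n"
      proof (rule power_mono)
        have "1 / sqrt q = sqrt (1 / q)" by (simp add: real_sqrt_divide)
        also have "\<dots> \<le> sqrt 2" using q by (simp add: field_simps)
        finally show "1 / sqrt q \<le> sqrt 2" .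
      qed (use q in simp)
      moreover have "exp (sqn n z / 2 - sqn n z / (2 * s\<^sup>2)) * exp (sqn n (\<lambda>i. t / s\<^sup>2 * z i) / (2 * (1 + t\<^sup>2 / s\<^sup>2))) \<le> 1"
      proof -
        have t2: "t\<^sup>2 = q - s\<^sup>2" by (simp add: q_def)
        have "sqn n (\<lambda>i. t / s\<^sup>2 * z i) / (2 * (1 + t\<^sup>2 / s\<^sup>2)) = sqn n z / (2 * s\<^sup>2) - sqn n z / (2 * q)"
          unfolding qs sqn_scale power_divide t2 using s q by (simp add: field_simps power2_eq_square)
        then have "sqn n z / 2 - sqn n z / (2 * s\<^sup>2) + sqn n (\<lambda>i. t / s\<^sup>2 * z i) / (2 * (1 + t\<^sup>2 / s\<^sup>2)) =
          sqn n z / 2 - sqn n z / (2 * q)" by simp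
        also have "\<dots> \<le> 0"
        proof -
          have "sqn n z * q \<le> sqn n z * 1" using q by (intro mult_left_mono) auto
          then show ?thesis using q by (simp add: field_simps)
        qed
        finally show ?thesis by (simp add: exp_add[symmetric])
      qed
      ultimately have "((1 / s) ^ n * (1 / sqrt (1 + t\<^sup>2 / s\<^sup>2)) ^ n) *
        (exp (sqn n z / 2 - sqn n z / (2 * s\<^sup>2)) * exp (sqn n (\<lambda>i. t / s\<^sup>2 * z i) / (2 * (1 + t\<^sup>2 / s\<^sup>2)))) \<le> sqrt 2 ^ n * 1"
        by (intro mult_mono) auto
      then show "(1 / s) ^ n * exp (sqn n z / 2 - sqn n z / (2 * s\<^sup>2)) *
       ((1 / sqrt (1 + t\<^sup>2 / s\<^sup>2)) ^ n * exp (sqn n (\<lambda>i. t / s\<^sup>2 * z i) / (2 * (1 + t\<^sup>2 / s\<^sup>2)))) \<le> sqrt 2 ^ n"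
        by (simp add: mult_ac)
    qed
    finally have "(\<integral>\<^sup>+y. ennreal (gweight n s (\<lambda>i. t * y i) z) \<partial>std_gaussian n) * g z \<le> ennreal (sqrt 2 ^ n) * g z"
      by (rule mult_right_mono) simp
    moreover have "(\<integral>\<^sup>+y. ennreal (gweight n s (\<lambda>i. t * y i) z) * g z \<partial>std_gaussian n) =
      (\<integral>\<^sup>+y. ennreal (gweight n s (\<lambda>i. t * y i) z) \<partial>std_gaussian n) * g z"
      unfolding gweight_def sqn_scale dot_scale by (rule nn_integral_multc) measurable
    ultimately show "(\<integral>\<^sup>+y. ennreal (gweight n s (\<lambda>i. t * y i) z) * g z \<partial>std_gaussian n) \<le> ennreal (sqrt 2 ^ n) * g z"
      by simp
  qed
  also have "\<dots> = ennreal (sqrt 2 ^ n) * (\<integral>\<^sup>+z. g z \<partial>std_gaussian n)"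
    by (rule nn_integral_cmult) measurable
  finally show ?thesis .
qed

lemma sq_le_exp_linear:
  fixes s e :: real
  assumes "s \<ge> 0" "e > 0"
  shows "s\<^sup>2 \<le> 4 / e\<^sup>2 * exp (e * s)"
proof -
  have "e * s / 2 \<le> exp (e * s / 2)" using exp_ge_add_one_self[of "e * s / 2"] by linarith
  then have "(e * s / 2)\<^sup>2 \<le> (exp (e * s / 2))\<^sup>2" using assms by (intro power_mono) auto
  also have "(exp (e * s / 2))\<^sup>2 = exp (e * s)" by (simp add: power2_eq_square exp_add[symmetric])
  finally show ?thesis using assms by (simp add: field_simps power2_eq_square)
qed

lemma sym_grad_measurable:
  assumes "\<And>i. i < n \<Longrightarrow> differentiable_rn n (\<lambda>x. u x i)" "i < n" "j < n"
  shows "(\<lambda>x. sym_grad u x i j) \<in> borel_measurable (borel_rn n)"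
  unfolding sym_grad_def using assms
  by (intro borel_measurable_divide borel_measurable_add pd_measurable) auto

text \<open>Only the component of \<open>u\<close> along a segment is controlled by the symmetrized gradient; comparing
  the segments from \<open>x\<close> to two endpoints that differ by a basis vector recovers a component of \<open>u x\<close>.\<close>

definition chord :: "nat \<Rightarrow> ((nat \<Rightarrow> real) \<Rightarrow> nat \<Rightarrow> real) \<Rightarrow> (nat \<Rightarrow> real) \<Rightarrow> (nat \<Rightarrow> real) \<Rightarrow> real" where
  "chord n u x y = (\<Sum>i<n. (u x i - u y i) * (x i - y i))"

text \<open>With d = x - y, the derivative of u.d along the segment is the quadratic form of the
  symmetrized gradient at d. The weight K is carried by the factor d_i d_j, so that |a b| <= a^2 +
  b^2 leaves the gradient squared and unweighted.\<close>

lemma chord_le: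
  assumes u: "\<And>i. i < n \<Longrightarrow> differentiable_rn n (\<lambda>x. u x i)"
    and x: "x \<in> rn n" and y: "y \<in> rn n" and K: "K \<ge> 0"
  shows "ennreal (\<bar>chord n u x y\<bar> * K) \<le>
    (\<integral>\<^sup>+t. indicator {0..1} t * ennreal ((\<Sum>i<n. \<Sum>j<n. (sym_grad u (lin n t x (1 - t) y) i j)\<^sup>2)
       + K\<^sup>2 * (sqn n (lin n 1 x (-1) y))\<^sup>2) \<partial>lborel)"
proof -
  let ?z = "\<lambda>t. lin n t x (1 - t) y"
  define d where "d i = x i - y i" for i
  define h where "h t = (\<Sum>i<n. \<Sum>j<n. sym_grad u (?z t) i j * (d i * d j))" for t
  note em[measurable] = sym_grad_measurable[OF u]
  have hm: "h \<in> borel_measurable borel"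
    unfolding h_def by (intro borel_measurable_sum borel_measurable_times measurable_compose[OF _ em]) (auto intro: measurable_lin_const simp: x y)
  have der: "((\<lambda>t. \<Sum>i<n. u (?z t) i * d i) has_real_derivative h t) (at t)" for t
  proof -
    have "((\<lambda>t. u (?z t) i) has_real_derivative (\<Sum>j<n. pd j (\<lambda>y. u y i) (?z t) * d j)) (at t)" if "i < n" for i
      by (rule differentiable_chain[OF u[OF that]]) (auto intro!: derivative_eq_intros simp: d_def)
    then have "((\<lambda>t. \<Sum>i<n. u (?z t) i * d i) has_real_derivative (\<Sum>i<n. (\<Sum>j<n. pd j (\<lambda>y. u y i) (?z t) * d j) * d i)) (at t)"
      by (intro DERIV_sum DERIV_cmult_right) auto
    moreover have "(\<Sum>i<n. (\<Sum>j<n. pd j (\<lambda>y. u y i) (?z t) * d j) * d i) = h t"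
    proof -
      have "(\<Sum>i<n. \<Sum>j<n. pd i (\<lambda>y. u y j) (?z t) * (d i * d j)) = (\<Sum>i<n. \<Sum>j<n. pd j (\<lambda>y. u y i) (?z t) * (d i * d j))"
        by (subst sum.swap) (simp add: mult_ac)
      moreover have "h t = (\<Sum>i<n. \<Sum>j<n. pd i (\<lambda>y. u y j) (?z t) * (d i * d j)) / 2 + (\<Sum>i<n. \<Sum>j<n. pd j (\<lambda>y. u y i) (?z t) * (d i * d j)) / 2"
        by (simp add: h_def sym_grad_def sum.distrib[symmetric] sum_divide_distrib algebra_simps add_divide_distrib)
      moreover have "(\<Sum>i<n. (\<Sum>j<n. pd j (\<lambda>y. u y i) (?z t) * d j) * d i) = (\<Sum>i<n. \<Sum>j<n. pd j (\<lambda>y. u y i) (?z t) * (d i * d j))"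
        unfolding sum_distrib_right by (intro sum.cong refl) (simp only: mult_ac)
      ultimately show ?thesis by simp
    qed
    ultimately show ?thesis by simp
  qed
  have chord: "(\<Sum>i<n. u (?z 1) i * d i) - (\<Sum>i<n. u (?z 0) i * d i) = chord n u x y"
  proof -
    have z: "?z 1 = x" "?z 0 = y" by (rule lin_eqI; simp add: x y)+
    have "chord n u x y = (\<Sum>i<n. u x i * d i - u y i * d i)"
      unfolding chord_def d_def by (simp only: left_diff_distrib)
    then show ?thesis unfolding z by (simp only: sum_subtractf)
  qed
  have "ennreal \<bar>chord n u x y\<bar> \<le> (\<integral>\<^sup>+t. indicator {0..1} t * ennreal \<bar>h t\<bar> \<partial>lborel)" (is "_ \<le> ?I")
  \<comment> \<open>An infinite right-hand side makes the claim trivial; a finite one provides the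
    integrability that the fundamental theorem requires.\<close>
  proof (cases "?I < \<infinity>")
    case True
    have "?I = (\<integral>\<^sup>+t. ennreal (norm (indicat_real {0..1} t *\<^sub>R h t)) \<partial>lborel)"
      by (rule nn_integral_cong) (auto simp: indicator_def)
    then have "set_integrable lborel {0..1} h"
      unfolding set_integrable_def using True hm by (intro integrableI_bounded) auto
    from FTC_lebesgue_01[OF der this] chord
    have "chord n u x y = (\<integral>t. indicat_real {0..1} t *\<^sub>R h t \<partial>lborel)"
      by (simp add: set_lebesgue_integral_def)
    then have "ennreal \<bar>chord n u x y\<bar> = ennreal (norm (\<integral>t. indicat_real {0..1} t *\<^sub>R h t \<partial>lborel))" by simp
    also have "\<dots> \<le> (\<integral>\<^sup>+t. ennreal (norm (indicat_real {0..1} t *\<^sub>R h t)) \<partial>lborel)"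
      by (rule integral_norm_bound_ennreal) (use \<open>set_integrable lborel {0..1} h\<close> in \<open>simp add: set_integrable_def\<close>)
    finally show ?thesis using \<open>?I = _\<close> by simp
  qed (simp add: top.not_eq_extremum[symmetric])
  then have "ennreal K * ennreal \<bar>chord n u x y\<bar> \<le> ennreal K * ?I" by (rule mult_left_mono) simp
  also have "\<dots> = (\<integral>\<^sup>+t. ennreal K * (indicator {0..1} t * ennreal \<bar>h t\<bar>) \<partial>lborel)"
    using hm by (intro nn_integral_cmult[symmetric]) auto
  also have "\<dots> \<le> (\<integral>\<^sup>+t. indicator {0..1} t * ennreal ((\<Sum>i<n. \<Sum>j<n. (sym_grad u (?z t) i j)\<^sup>2)
       + K\<^sup>2 * (sqn n (lin n 1 x (-1) y))\<^sup>2) \<partial>lborel)"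
  proof (rule nn_integral_mono)
    fix t :: real
    have "K * h t = (\<Sum>i<n. \<Sum>j<n. sym_grad u (?z t) i j * (K * (d i * d j)))"
      unfolding h_def sum_distrib_left by (intro sum.cong refl) (simp only: mult_ac)
    then have "K * \<bar>h t\<bar> = \<bar>\<Sum>i<n. \<Sum>j<n. sym_grad u (?z t) i j * (K * (d i * d j))\<bar>"
      using K by (metis abs_mult abs_of_nonneg)
    also have "\<dots> \<le> (\<Sum>i<n. \<bar>\<Sum>j<n. sym_grad u (?z t) i j * (K * (d i * d j))\<bar>)"
      by (rule sum_abs)
    also have "\<dots> \<le> (\<Sum>i<n. \<Sum>j<n. \<bar>sym_grad u (?z t) i j * (K * (d i * d j))\<bar>)"
      by (intro sum_mono sum_abs)
    also have "\<dots> \<le> (\<Sum>i<n. \<Sum>j<n. (sym_grad u (?z t) i j)\<^sup>2 + (K * (d i * d j))\<^sup>2)"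
    proof (intro sum_mono)
      fix i j
      have "\<bar>a * b\<bar> \<le> a\<^sup>2 + b\<^sup>2" for a b :: real
      proof -
        have "0 \<le> (\<bar>a\<bar> - \<bar>b\<bar>)\<^sup>2" by simp
        then have "2 * \<bar>a * b\<bar> \<le> a\<^sup>2 + b\<^sup>2" by (simp add: power2_diff abs_mult)
        then show ?thesis using abs_ge_zero[of "a * b"] by linarith
      qed
      then show "\<bar>sym_grad u (?z t) i j * (K * (d i * d j))\<bar> \<le> (sym_grad u (?z t) i j)\<^sup>2 + (K * (d i * d j))\<^sup>2" .
    qed
    also have "\<dots> = (\<Sum>i<n. \<Sum>j<n. (sym_grad u (?z t) i j)\<^sup>2) + K\<^sup>2 * (\<Sum>i<n. \<Sum>j<n. (d i)\<^sup>2 * (d j)\<^sup>2)"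
      by (simp add: sum.distrib power_mult_distrib sum_distrib_left mult_ac)
    also have "(\<Sum>i<n. \<Sum>j<n. (d i)\<^sup>2 * (d j)\<^sup>2) = (sqn n (lin n 1 x (-1) y))\<^sup>2"
    proof -
      have "sqn n (lin n 1 x (-1) y) = (\<Sum>i<n. (d i)\<^sup>2)" by (simp add: sqn_eq d_def)
      then show ?thesis by (simp add: power2_eq_square sum_product)
    qed
    finally show "ennreal K * (indicator {0..1} t * ennreal \<bar>h t\<bar>) \<le> indicator {0..1} t * ennreal ((\<Sum>i<n. \<Sum>j<n. (sym_grad u (?z t) i j)\<^sup>2)
       + K\<^sup>2 * (sqn n (lin n 1 x (-1) y))\<^sup>2)"
      using K by (auto simp: indicator_def ennreal_mult'[symmetric] intro!: ennreal_leI)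
  qed
  finally show ?thesis using K by (simp add: ennreal_mult' mult.commute)
qed

text \<open>Apply \<open>chord_le\<close> with K = exp (c |x|^2) and integrate over both endpoints.
  The gradient part is bounded uniformly along the segment by \<open>gaussian_segment_bound\<close>;
  the rest is a product of exponentials of rate below 1/2.\<close>

lemma chord_integrable:
  assumes u: "\<And>i. i < n \<Longrightarrow> differentiable_rn n (\<lambda>x. u x i)"
    and fin: "L2sq_mat n (std_gaussian n) (sym_grad u) < \<infinity>" and c: "c < 1 / 4"
  shows "AE y in std_gaussian n. (\<integral>\<^sup>+x. ennreal (\<bar>chord n u x y\<bar> * exp (c * sqn n x)) \<partial>std_gaussian n) < \<infinity>"
proof -
  let ?G = "std_gaussian n"
  interpret G: prob_space ?G by (rule prob_space_std_gaussian)
  interpret P: pair_sigma_finite ?G ?G ..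
  interpret PL: pair_sigma_finite ?G "lborel :: real measure" ..
  have um[measurable]: "(\<lambda>x. u x i) \<in> borel_measurable (borel_rn n)" if "i < n" for i
    by (rule differentiable_measurable[OF u[OF that]])
  note em[measurable] = sym_grad_measurable[OF u]
  define E where "E z = (\<Sum>i<n. \<Sum>j<n. (sym_grad u z i j)\<^sup>2)" for z
  have Em[measurable]: "E \<in> borel_measurable (borel_rn n)"
    unfolding E_def by (intro borel_measurable_sum borel_measurable_power em) auto
  have E0: "E z \<ge> 0" for z unfolding E_def by (intro sum_nonneg) auto
  \<comment> \<open>Small enough for 2 c + 2 e <= c + 1/4 < 1/2, so both exponential factors of R
    stay Gaussian integrable.\<close>
  define e where "e = min (1 / 16) ((1 / 4 - c) / 2)"
  have e: "e > 0" "2 * c + 2 * e < 1 / 2" "2 * e < 1 / 2"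
    using c by (auto simp: e_def min_def field_simps)
  define R where "R x y = 4 / e\<^sup>2 * (exp ((2 * c + 2 * e) * sqn n x) * exp (2 * e * sqn n y))" for x y
  have R: "(exp (c * sqn n x))\<^sup>2 * (sqn n (lin n 1 x (-1) y))\<^sup>2 \<le> R x y" for x y
  proof -
    have "0 \<le> sqn n (lin n 1 x 1 y)" by simp
    then have "sqn n (lin n 1 x (-1) y) \<le> 2 * sqn n x + 2 * sqn n y"
      by (simp add: dot_lin_left dot_lin_right dot_commute)
    then have "e * sqn n (lin n 1 x (-1) y) \<le> e * (2 * sqn n x + 2 * sqn n y)"
      using e by (intro mult_left_mono) auto
    then have "exp (e * sqn n (lin n 1 x (-1) y)) \<le> exp (e * (2 * sqn n x + 2 * sqn n y))" by simp
    then have "4 / e\<^sup>2 * exp (e * sqn n (lin n 1 x (-1) y)) \<le> 4 / e\<^sup>2 * exp (e * (2 * sqn n x + 2 * sqn n y))"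
      by (rule mult_left_mono) simp
    with sq_le_exp_linear[OF sqn_nonneg e(1), of n "lin n 1 x (-1) y"]
    have "(sqn n (lin n 1 x (-1) y))\<^sup>2 \<le> 4 / e\<^sup>2 * exp (e * (2 * sqn n x + 2 * sqn n y))" by linarith
    then have "(exp (c * sqn n x))\<^sup>2 * (sqn n (lin n 1 x (-1) y))\<^sup>2 \<le>
       (exp (c * sqn n x))\<^sup>2 * (4 / e\<^sup>2 * exp (e * (2 * sqn n x + 2 * sqn n y)))"
      by (rule mult_left_mono) simp
    also have "\<dots> = R x y"
      by (simp add: R_def power2_eq_square exp_add[symmetric] algebra_simps)
    finally show ?thesis .
  qed
  have R0: "R x y \<ge> 0" for x y by (simp add: R_def)
  have Rm[measurable]: "(\<lambda>(x, y). R x y) \<in> borel_measurable (borel_rn n \<Otimes>\<^sub>M borel_rn n)"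
    unfolding R_def by measurable
  have "(\<integral>\<^sup>+y. \<integral>\<^sup>+x. ennreal (\<bar>chord n u x y\<bar> * exp (c * sqn n x)) \<partial>?G \<partial>?G) \<le>
     (\<integral>\<^sup>+y. \<integral>\<^sup>+x. (\<integral>\<^sup>+t. indicator {0..1} t * ennreal (E (lin n t x (1 - t) y)) \<partial>lborel) + ennreal (R x y) \<partial>?G \<partial>?G)"
  proof (intro nn_integral_mono)
    fix x y assume "y \<in> space ?G" "x \<in> space ?G"
    then have xy: "x \<in> rn n" "y \<in> rn n" by auto
    have "ennreal (\<bar>chord n u x y\<bar> * exp (c * sqn n x)) \<le>
      (\<integral>\<^sup>+t. indicator {0..1} t * ennreal (E (lin n t x (1 - t) y) + (exp (c * sqn n x))\<^sup>2 * (sqn n (lin n 1 x (-1) y))\<^sup>2) \<partial>lborel)"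
      unfolding E_def by (rule chord_le[OF u xy]) auto
    also have "\<dots> \<le> (\<integral>\<^sup>+t. indicator {0..1} t * ennreal (E (lin n t x (1 - t) y)) + indicator {0..1} t * ennreal (R x y) \<partial>lborel)"
      using R[of x y] E0 R0 by (intro nn_integral_mono) (auto simp: indicator_def ennreal_plus[symmetric] simp del: ennreal_plus intro!: ennreal_leI)
    also have "\<dots> = (\<integral>\<^sup>+t. indicator {0..1} t * ennreal (E (lin n t x (1 - t) y)) \<partial>lborel) + (\<integral>\<^sup>+t. indicator {0..1} (t :: real) * ennreal (R x y) \<partial>lborel)"
    proof (rule nn_integral_add)
      have [measurable]: "(\<lambda>t. lin n t x (1 - t) y) \<in> measurable borel (borel_rn n)"
        unfolding lin_def by measurable
      show "(\<lambda>t. indicator {0..1} t * ennreal (E (lin n t x (1 - t) y))) \<in> borel_measurable lborel"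
        by measurable
    qed measurable
    also have "(\<integral>\<^sup>+t. indicator {0..1} (t :: real) * ennreal (R x y) \<partial>lborel) = ennreal (R x y)"
      by (simp add: nn_integral_multc)
    finally show "ennreal (\<bar>chord n u x y\<bar> * exp (c * sqn n x)) \<le> (\<integral>\<^sup>+t. indicator {0..1} t * ennreal (E (lin n t x (1 - t) y)) \<partial>lborel) + ennreal (R x y)" .
  qed
  also have "\<dots> = (\<integral>\<^sup>+y. \<integral>\<^sup>+x. (\<integral>\<^sup>+t. indicator {0..1} t * ennreal (E (lin n t x (1 - t) y)) \<partial>lborel) \<partial>?G \<partial>?G)
      + (\<integral>\<^sup>+y. \<integral>\<^sup>+x. ennreal (R x y) \<partial>?G \<partial>?G)"
  proof -
    have "(\<integral>\<^sup>+x. (\<integral>\<^sup>+t. indicator {0..1} t * ennreal (E (lin n t x (1 - t) y)) \<partial>lborel) + ennreal (R x y) \<partial>?G) =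
      (\<integral>\<^sup>+x. (\<integral>\<^sup>+t. indicator {0..1} t * ennreal (E (lin n t x (1 - t) y)) \<partial>lborel) \<partial>?G) + (\<integral>\<^sup>+x. ennreal (R x y) \<partial>?G)"
      if [measurable]: "y \<in> space (borel_rn n)" for y
      by (rule nn_integral_add) measurable
    then have "(\<integral>\<^sup>+y. \<integral>\<^sup>+x. (\<integral>\<^sup>+t. indicator {0..1} t * ennreal (E (lin n t x (1 - t) y)) \<partial>lborel) + ennreal (R x y) \<partial>?G \<partial>?G) =
      (\<integral>\<^sup>+y. (\<integral>\<^sup>+x. (\<integral>\<^sup>+t. indicator {0..1} t * ennreal (E (lin n t x (1 - t) y)) \<partial>lborel) \<partial>?G) + (\<integral>\<^sup>+x. ennreal (R x y) \<partial>?G) \<partial>?G)"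
      by (intro nn_integral_cong) simp
    also have "\<dots> = (\<integral>\<^sup>+y. \<integral>\<^sup>+x. (\<integral>\<^sup>+t. indicator {0..1} t * ennreal (E (lin n t x (1 - t) y)) \<partial>lborel) \<partial>?G \<partial>?G)
      + (\<integral>\<^sup>+y. \<integral>\<^sup>+x. ennreal (R x y) \<partial>?G \<partial>?G)"
      by (rule nn_integral_add) measurable
    finally show ?thesis .
  qed
  also have "\<dots> < \<infinity>"
  proof -
    have "(\<integral>\<^sup>+y. \<integral>\<^sup>+x. (\<integral>\<^sup>+t. indicator {0..1} t * ennreal (E (lin n t x (1 - t) y)) \<partial>lborel) \<partial>?G \<partial>?G) =
      (\<integral>\<^sup>+y. \<integral>\<^sup>+t. \<integral>\<^sup>+x. indicator {0..1} t * ennreal (E (lin n t x (1 - t) y)) \<partial>?G \<partial>lborel \<partial>?G)"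
      by (intro nn_integral_cong PL.Fubini'[symmetric]) measurable
    also have "\<dots> = (\<integral>\<^sup>+t. \<integral>\<^sup>+y. \<integral>\<^sup>+x. indicator {0..1} t * ennreal (E (lin n t x (1 - t) y)) \<partial>?G \<partial>?G \<partial>lborel)"
      by (intro PL.Fubini'[symmetric]) measurable
    \<comment> \<open>The endpoints t = 0 and t = 1 form a null set; removing them meets the strict
      bounds in \<open>gaussian_segment_bound\<close>.\<close>
    also have "\<dots> = (\<integral>\<^sup>+t. indicator {0<..<1} t * (\<integral>\<^sup>+y. \<integral>\<^sup>+x. ennreal (E (lin n t x (1 - t) y)) \<partial>?G \<partial>?G) \<partial>lborel)"
    proof (rule nn_integral_cong_AE)
      have "AE t in lborel. t \<noteq> (0::real) \<and> t \<noteq> 1"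
        by (intro AE_conjI AE_lborel_singleton)
      then show "AE t in lborel. (\<integral>\<^sup>+y. \<integral>\<^sup>+x. indicator {0..1} t * ennreal (E (lin n t x (1 - t) y)) \<partial>?G \<partial>?G) =
         indicator {0<..<1} t * (\<integral>\<^sup>+y. \<integral>\<^sup>+x. ennreal (E (lin n t x (1 - t) y)) \<partial>?G \<partial>?G)"
        by eventually_elim (auto simp: indicator_def)
    qed
    also have "\<dots> \<le> (\<integral>\<^sup>+t. indicator {0<..<1} (t :: real) * (ennreal (sqrt 2 ^ n) * (\<integral>\<^sup>+z. ennreal (E z) \<partial>?G)) \<partial>lborel)"
    proof (rule nn_integral_mono)
      fix t :: real
      show "indicator {0<..<1} t * (\<integral>\<^sup>+y. \<integral>\<^sup>+x. ennreal (E (lin n t x (1 - t) y)) \<partial>?G \<partial>?G) \<le>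
        indicator {0<..<1} t * (ennreal (sqrt 2 ^ n) * (\<integral>\<^sup>+z. ennreal (E z) \<partial>?G))"
        using gaussian_segment_bound[of t "\<lambda>z. ennreal (E z)" n] by (auto simp: indicator_def)
    qed
    also have "\<dots> = ennreal (sqrt 2 ^ n) * (\<integral>\<^sup>+z. ennreal (E z) \<partial>?G)"
      by (simp add: nn_integral_multc)
    also have "\<dots> < \<infinity>"
      using fin by (simp add: L2sq_mat_def E_def ennreal_mult_less_top)
    finally have 1: "(\<integral>\<^sup>+y. \<integral>\<^sup>+x. (\<integral>\<^sup>+t. indicator {0..1} t * ennreal (E (lin n t x (1 - t) y)) \<partial>lborel) \<partial>?G \<partial>?G) < \<infinity>" .
    have nn: "(\<integral>\<^sup>+x. ennreal (exp (k * sqn n x)) \<partial>?G) < \<infinity>" if "k < 1 / 2" for k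
      using integrable_exp_sqn[OF that, of n] by (simp add: integrable_iff_bounded)
    have "(\<integral>\<^sup>+y. \<integral>\<^sup>+x. ennreal (R x y) \<partial>?G \<partial>?G) = (\<integral>\<^sup>+y. \<integral>\<^sup>+x. ennreal (4 / e\<^sup>2) * (ennreal (exp ((2 * c + 2 * e) * sqn n x)) * ennreal (exp (2 * e * sqn n y))) \<partial>?G \<partial>?G)"
      unfolding R_def by (subst ennreal_mult', simp, subst ennreal_mult', simp, rule refl)
    also have "\<dots> = ennreal (4 / e\<^sup>2) * ((\<integral>\<^sup>+x. ennreal (exp ((2 * c + 2 * e) * sqn n x)) \<partial>?G) * (\<integral>\<^sup>+y. ennreal (exp (2 * e * sqn n y)) \<partial>?G))"
      by (simp add: nn_integral_cmult nn_integral_multc)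
    also have "\<dots> < \<infinity>"
      using nn[OF e(2)] nn[OF e(3)] by (simp add: ennreal_mult_less_top)
    finally have 2: "(\<integral>\<^sup>+y. \<integral>\<^sup>+x. ennreal (R x y) \<partial>?G \<partial>?G) < \<infinity>" .
    show ?thesis using 1 2 by simp
  qed
  finally have "(\<integral>\<^sup>+y. \<integral>\<^sup>+x. ennreal (\<bar>chord n u x y\<bar> * exp (c * sqn n x)) \<partial>?G \<partial>?G) \<noteq> \<infinity>" by simp
  moreover have "(\<lambda>y. \<integral>\<^sup>+x. ennreal (\<bar>chord n u x y\<bar> * exp (c * sqn n x)) \<partial>?G) \<in> borel_measurable ?G"
  proof -
    have "(\<lambda>(y, x). chord n u x y) \<in> borel_measurable (?G \<Otimes>\<^sub>M ?G)"
      unfolding chord_def by measurable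
    then show ?thesis by measurable
  qed
  ultimately have "AE y in ?G. (\<integral>\<^sup>+x. ennreal (\<bar>chord n u x y\<bar> * exp (c * sqn n x)) \<partial>?G) \<noteq> \<infinity>"
    by (intro nn_integral_PInf_AE)
  then show ?thesis by eventually_elim (simp add: less_top)
qed

text \<open>A translated Gaussian has a density with respect to the original one, so null sets
  remain null.\<close>

lemma AE_gaussian_shift:
  assumes "AE y in std_gaussian n. Q y" and [measurable]: "Measurable.pred (borel_rn n) Q"
  shows "AE y in std_gaussian n. Q (lin n 1 a 1 y)"
proof -
  have "AE y in density (std_gaussian n) (\<lambda>z. ennreal (gweight n 1 a z)). Q y"
    using assms by (subst AE_density) auto
  then have "AE y in distr (std_gaussian n) (borel_rn n) (\<lambda>y. lin n 1 a 1 y). Q y"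
    by (subst gaussian_affine) auto
  then show ?thesis by (subst (asm) AE_distr_iff) auto
qed

text \<open>Almost every y, and also its shift by the i-th basis vector, is an endpoint with
  integrable chord; fix one such y. The two chords differ by u x i up to a function that is affine
  in x.\<close>

lemma korn_field_good:
  assumes u: "\<And>i. i < n \<Longrightarrow> differentiable_rn n (\<lambda>x. u x i)"
    and fin: "L2sq_mat n (std_gaussian n) (sym_grad u) < \<infinity>" and i: "i < n"
  shows "good n (\<lambda>x. u x i)"
  unfolding good_def
proof (intro conjI allI impI)
  let ?G = "std_gaussian n"
  interpret G: prob_space ?G by (rule prob_space_std_gaussian)
  have um[measurable]: "(\<lambda>x. u x i) \<in> borel_measurable (borel_rn n)" if "i < n" for i
    by (rule differentiable_measurable[OF u[OF that]])
  show "(\<lambda>x. u x i) \<in> borel_measurable (borel_rn n)" using i by measurable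
  fix c :: real assume c: "c < 1 / 4"
  let ?Q = "\<lambda>y. (\<integral>\<^sup>+x. ennreal (\<bar>chord n u x y\<bar> * exp (c * sqn n x)) \<partial>?G) < \<infinity>"
  have [measurable]: "(\<lambda>(y, x). chord n u x y) \<in> borel_measurable (borel_rn n \<Otimes>\<^sub>M borel_rn n)"
    unfolding chord_def by measurable
  have Q: "AE y in ?G. ?Q y" by (rule chord_integrable[OF u fin c])
  have "AE y in ?G. ?Q (lin n 1 (basis i) 1 y)"
    by (rule AE_gaussian_shift[OF Q]) measurable
  with Q AE_space have "AE y in ?G. ?Q y \<and> ?Q (lin n 1 (basis i) 1 y) \<and> y \<in> rn n"
    by eventually_elim auto
  then obtain y where y: "?Q y" "?Q (lin n 1 (basis i) 1 y)" "y \<in> rn n"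
    using eventually_happens'[OF G.ae_filter_bot] by blast
  let ?y = "lin n 1 (basis i) 1 y"
  have int: "integrable ?G (\<lambda>x. exp (c * sqn n x) * chord n u x z)" if "?Q z" "z \<in> rn n" for z
  proof (rule integrableI_bounded)
    show "(\<lambda>x. exp (c * sqn n x) * chord n u x z) \<in> borel_measurable ?G"
      unfolding chord_def by measurable
    show "(\<integral>\<^sup>+x. ennreal (norm (exp (c * sqn n x) * chord n u x z)) \<partial>?G) < \<infinity>"
      using that by (simp add: abs_mult mult.commute)
  qed
  have lin: "integrable ?G (\<lambda>x. exp (c * sqn n x) * (\<Sum>j<n. b j * (x j - z j)))" for b z :: "nat \<Rightarrow> real"
  proof -
    have "good n (\<lambda>x. \<Sum>j<n. b j * (x j - z j))"
      by (intro good_sum good_cmult good_diff good_coord good_const) auto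
    then show ?thesis using good_exp c by blast
  qed
  have ui: "u x i = chord n u x y - chord n u x ?y + (\<Sum>j<n. u y j * (x j - y j)) - (\<Sum>j<n. u ?y j * (x j - ?y j))" for x
  proof -
    have "(\<Sum>j<n. u x j * (?y j - y j)) = (\<Sum>j<n. u x j * basis i j)" by (intro sum.cong) auto
    also have "\<dots> = u x i" using i by (rule sum_basis)
    finally have "u x i = (\<Sum>j<n. u x j * (?y j - y j))" ..
    then show ?thesis
      unfolding chord_def sum_subtractf[symmetric] sum.distrib[symmetric] by (simp add: algebra_simps)
  qed
  have eq: "(\<lambda>x. exp (c * sqn n x) * u x i) = (\<lambda>x. exp (c * sqn n x) * chord n u x y - exp (c * sqn n x) * chord n u x ?y
    + exp (c * sqn n x) * (\<Sum>j<n. u y j * (x j - y j)) - exp (c * sqn n x) * (\<Sum>j<n. u ?y j * (x j - ?y j)))"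
    by (rule ext, subst (1) ui) (simp only: distrib_left right_diff_distrib)
  show "integrable ?G (\<lambda>x. exp (c * sqn n x) * u x i)"
    unfolding eq using y by (intro Bochner_Integration.integrable_add Bochner_Integration.integrable_diff int lin) auto
qed

lemma sym_grad_sq_integrable:
  assumes u: "\<And>i. i < n \<Longrightarrow> differentiable_rn n (\<lambda>x. u x i)"
    and mu: "sets \<mu> = sets (borel_rn n)"
    and fin: "L2sq_mat n \<mu> (sym_grad u) < \<infinity>" and i: "i < n" and j: "j < n"
  shows "integrable \<mu> (\<lambda>x. (sym_grad u x i j)\<^sup>2)"
proof (rule integrableI_bounded)
  have "(\<lambda>x. sym_grad u x i j) \<in> borel_measurable \<mu>"
    using sym_grad_measurable[OF u i j] by (simp only: measurable_cong_sets[OF mu refl])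
  then show "(\<lambda>x. (sym_grad u x i j)\<^sup>2) \<in> borel_measurable \<mu>" by measurable
  have "(\<integral>\<^sup>+x. ennreal (norm ((sym_grad u x i j)\<^sup>2)) \<partial>\<mu>) \<le> L2sq_mat n \<mu> (sym_grad u)"
    unfolding L2sq_mat_def
  proof (intro nn_integral_mono ennreal_leI)
    fix x
    have "(sym_grad u x i j)\<^sup>2 \<le> (\<Sum>j<n. (sym_grad u x i j)\<^sup>2)" using j by (intro member_le_sum) auto
    also have "\<dots> \<le> (\<Sum>i<n. \<Sum>j<n. (sym_grad u x i j)\<^sup>2)"
      using i by (intro member_le_sum[where f = "\<lambda>i. \<Sum>j<n. (sym_grad u x i j)\<^sup>2"]) (auto intro: sum_nonneg)
    finally show "norm ((sym_grad u x i j)\<^sup>2) \<le> (\<Sum>i<n. \<Sum>j<n. (sym_grad u x i j)\<^sup>2)" by simp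
  qed
  then show "(\<integral>\<^sup>+x. ennreal (norm ((sym_grad u x i j)\<^sup>2)) \<partial>\<mu>) < \<infinity>"
    using fin by (rule le_less_trans)
qed

section \<open>Kernels in two variables and Gram identities\<close>

abbreviation GG :: "nat \<Rightarrow> ((nat \<Rightarrow> real) \<times> (nat \<Rightarrow> real)) measure" where
  "GG n \<equiv> std_gaussian n \<Otimes>\<^sub>M std_gaussian n"

lemma psf_gaussian: "pair_sigma_finite (std_gaussian n) (std_gaussian n)"
  using prob_space_std_gaussian[of n] by (simp add: pair_sigma_finite_def prob_space_imp_sigma_finite)

lemma integral_pair_prod:
  fixes a :: "'a \<Rightarrow> real" and b :: "'b \<Rightarrow> real"
  assumes P: "pair_sigma_finite M N" and a: "integrable M a" and b: "integrable N b"
  shows "integrable (M \<Otimes>\<^sub>M N) (\<lambda>(x, z). a x * b z)" (is ?A)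
    and "(\<integral>(x, z). a x * b z \<partial>(M \<Otimes>\<^sub>M N)) = (\<integral>x. a x \<partial>M) * (\<integral>z. b z \<partial>N)" (is ?B)
proof -
  interpret P: pair_sigma_finite M N by (rule P)
  have [measurable]: "a \<in> borel_measurable M" "b \<in> borel_measurable N" using a b by auto
  show A: ?A
    by (rule P.Fubini_integrable) (use a b in \<open>auto simp: abs_mult\<close>)
  show ?B using P.integral_fst[OF A] by simp
qed

text \<open>Rates below 1/4 in both variables serve two purposes: a kernel can be paired with
  \<open>good\<close> functions, and a product of two kernels, of total rate below 1/2, can be
  integrated over a common variable.\<close>

definition kern :: "nat \<Rightarrow> ((nat \<Rightarrow> real) \<Rightarrow> (nat \<Rightarrow> real) \<Rightarrow> real) \<Rightarrow> bool" where
  "kern n P \<longleftrightarrow> (\<lambda>(x, y). P x y) \<in> borel_measurable (borel_rn n \<Otimes>\<^sub>M borel_rn n) \<and>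
     (\<exists>C c l. 0 \<le> C \<and> c < 1 / 4 \<and> l < 1 / 4 \<and> (\<forall>x y. \<bar>P x y\<bar> \<le> C * exp (c * sqn n x) * exp (l * sqn n y)))"

lemma kernI:
  "(\<lambda>(x, y). P x y) \<in> borel_measurable (borel_rn n \<Otimes>\<^sub>M borel_rn n) \<Longrightarrow> 0 \<le> C \<Longrightarrow> c < 1 / 4 \<Longrightarrow> l < 1 / 4 \<Longrightarrow>
   (\<And>x y. \<bar>P x y\<bar> \<le> C * exp (c * sqn n x) * exp (l * sqn n y)) \<Longrightarrow> kern n P"
  unfolding kern_def by blast

lemma kern_measurable: "kern n P \<Longrightarrow> (\<lambda>(x, y). P x y) \<in> borel_measurable (borel_rn n \<Otimes>\<^sub>M borel_rn n)"
  by (simp add: kern_def)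

lemma kern_cmult: "kern n P \<Longrightarrow> kern n (\<lambda>x y. a * P x y)"
proof -
  assume P: "kern n P"
  note [measurable] = kern_measurable[OF P]
  obtain C c l where *: "0 \<le> C" "c < 1 / 4" "l < 1 / 4" "\<And>x y. \<bar>P x y\<bar> \<le> C * exp (c * sqn n x) * exp (l * sqn n y)"
    using P unfolding kern_def by blast
  show ?thesis
  proof (rule kernI[where C = "\<bar>a\<bar> * C", OF _ _ *(2,3)])
    show "\<bar>a * P x y\<bar> \<le> \<bar>a\<bar> * C * exp (c * sqn n x) * exp (l * sqn n y)" for x y
      using mult_left_mono[OF *(4)[of x y], of "\<bar>a\<bar>"] by (simp add: abs_mult mult.assoc)
  qed (use * in auto)
qed

lemma kern_add: "kern n P \<Longrightarrow> kern n Q \<Longrightarrow> kern n (\<lambda>x y. P x y + Q x y)"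
proof -
  assume P: "kern n P" and Q: "kern n Q"
  note [measurable] = kern_measurable[OF P] kern_measurable[OF Q]
  obtain C c l where *: "0 \<le> C" "c < 1 / 4" "l < 1 / 4" "\<And>x y. \<bar>P x y\<bar> \<le> C * exp (c * sqn n x) * exp (l * sqn n y)"
    using P unfolding kern_def by blast
  obtain C' c' l' where **: "0 \<le> C'" "c' < 1 / 4" "l' < 1 / 4" "\<And>x y. \<bar>Q x y\<bar> \<le> C' * exp (c' * sqn n x) * exp (l' * sqn n y)"
    using Q unfolding kern_def by blast
  show ?thesis
  proof (rule kernI[where C = "C + C'" and c = "max c c'" and l = "max l l'"])
    fix x y
    have le: "D * exp (d * sqn n x) * exp (m * sqn n y) \<le> D * exp (max c c' * sqn n x) * exp (max l l' * sqn n y)"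
      if "0 \<le> D" "d \<le> max c c'" "m \<le> max l l'" for D d m
      using that by (intro mult_mono) (auto intro!: mult_right_mono)
    have "\<bar>P x y + Q x y\<bar> \<le> \<bar>P x y\<bar> + \<bar>Q x y\<bar>" by simp
    also have "\<dots> \<le> C * exp (max c c' * sqn n x) * exp (max l l' * sqn n y) + C' * exp (max c c' * sqn n x) * exp (max l l' * sqn n y)"
      by (intro add_mono order_trans[OF *(4) le] order_trans[OF **(4) le]) (use * ** in auto)
    finally show "\<bar>P x y + Q x y\<bar> \<le> (C + C') * exp (max c c' * sqn n x) * exp (max l l' * sqn n y)"
      by (simp add: distrib_right)
  qed (use * ** in auto)
qed

lemma kern_diff: "kern n P \<Longrightarrow> kern n Q \<Longrightarrow> kern n (\<lambda>x y. P x y - Q x y)"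
  using kern_add[OF _ kern_cmult[of n Q "-1"]] by simp

lemma kern_coord:
  assumes P: "kern n P" and k: "k < n"
  shows kern_coord_fst: "kern n (\<lambda>x y. x k * P x y)"
    and kern_coord_snd: "kern n (\<lambda>x y. y k * P x y)"
proof -
  note [measurable] = kern_measurable[OF P]
  obtain C c l where *: "0 \<le> C" "c < 1 / 4" "l < 1 / 4" "\<And>x y. \<bar>P x y\<bar> \<le> C * exp (c * sqn n x) * exp (l * sqn n y)"
    using P unfolding kern_def by blast
  define e where "e = min (1 / 4 - c) (1 / 4 - l) / 2"
  have e: "e > 0" "c + e < 1 / 4" "l + e < 1 / 4" using * by (auto simp: e_def min_def field_simps)
  have k': "k \<in> {..<n}" using k by simp
  have [measurable]: "(\<lambda>x. fst x k) \<in> borel_measurable (borel_rn n \<Otimes>\<^sub>M borel_rn n)"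
    "(\<lambda>x. snd x k) \<in> borel_measurable (borel_rn n \<Otimes>\<^sub>M borel_rn n)"
    by (auto intro!: measurable_coord simp: k)
  show "kern n (\<lambda>x y. x k * P x y)"
  proof (rule kernI[where C = "(1 + 1 / e) * C", OF _ _ e(2) *(3)])
    fix x y
    have "\<bar>x k * P x y\<bar> \<le> ((1 + 1 / e) * exp (e * sqn n x)) * (C * exp (c * sqn n x) * exp (l * sqn n y))"
      unfolding abs_mult by (intro mult_mono abs_coord_le_exp *(4)) (use e k * in auto)
    then show "\<bar>x k * P x y\<bar> \<le> (1 + 1 / e) * C * exp ((c + e) * sqn n x) * exp (l * sqn n y)"
      by (simp only: distrib_right[of c] exp_add mult_ac)
    show "(\<lambda>(x, y). x k * P x y) \<in> borel_measurable (borel_rn n \<Otimes>\<^sub>M borel_rn n)"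
      by (simp add: case_prod_beta')
  qed (use * e in auto)
  show "kern n (\<lambda>x y. y k * P x y)"
  proof (rule kernI[where C = "(1 + 1 / e) * C", OF _ _ *(2) e(3)])
    fix x y
    have "\<bar>y k * P x y\<bar> \<le> ((1 + 1 / e) * exp (e * sqn n y)) * (C * exp (c * sqn n x) * exp (l * sqn n y))"
      unfolding abs_mult by (intro mult_mono abs_coord_le_exp *(4)) (use e k * in auto)
    then show "\<bar>y k * P x y\<bar> \<le> (1 + 1 / e) * C * exp (c * sqn n x) * exp ((l + e) * sqn n y)"
      by (simp only: distrib_right[of l] exp_add mult_ac)
    show "(\<lambda>(x, y). y k * P x y) \<in> borel_measurable (borel_rn n \<Otimes>\<^sub>M borel_rn n)"
      by (simp add: case_prod_beta')
  qed (use * e in auto)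
qed

lemma good_kern_integrable:
  assumes f: "good n f" and P: "kern n P" and y: "y \<in> rn n"
  shows "integrable (std_gaussian n) (\<lambda>x. f x * P x y)"
proof -
  obtain C c l where *: "0 \<le> C" "c < 1 / 4" "l < 1 / 4" "\<And>x y. \<bar>P x y\<bar> \<le> C * exp (c * sqn n x) * exp (l * sqn n y)"
    using P unfolding kern_def by blast
  have y': "y \<in> space (borel_rn n)" using y by simp
  have [measurable]: "(\<lambda>x. P x y) \<in> borel_measurable (borel_rn n)"
    using measurable_compose[OF measurable_Pair2'[OF y'] kern_measurable[OF P]] by simp
  have "integrable (std_gaussian n) (\<lambda>x. P x y * f x)"
  proof (rule good_bound[OF f _ *(2), where C = "C * exp (l * sqn n y)"])
    show "\<bar>P x y\<bar> \<le> C * exp (l * sqn n y) * exp (c * sqn n x)" for x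
      using *(4)[of x y] by (simp add: mult_ac)
  qed measurable
  then show ?thesis by (simp add: mult.commute)
qed

lemma good_pair_integrable:
  assumes f: "good n f" and g: "good n g" and P: "kern n P"
  shows "integrable (GG n) (\<lambda>(x, z). f x * g z * P x z)"
proof -
  note [measurable] = kern_measurable[OF P] good_measurable[OF f] good_measurable[OF g]
  obtain C c l where *: "0 \<le> C" "c < 1 / 4" "l < 1 / 4" "\<And>x y. \<bar>P x y\<bar> \<le> C * exp (c * sqn n x) * exp (l * sqn n y)"
    using P unfolding kern_def by blast
  show ?thesis
  proof (rule Bochner_Integration.integrable_bound)
    show "integrable (GG n) (\<lambda>(x, z). (C * (exp (c * sqn n x) * f x)) * (exp (l * sqn n z) * g z))"
      by (rule integral_pair_prod(1)[OF psf_gaussian]) (use good_exp[OF f *(2)] good_exp[OF g *(3)] in auto)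
    show "AE w in GG n. norm (case w of (x, z) \<Rightarrow> f x * g z * P x z) \<le>
      norm (case w of (x, z) \<Rightarrow> (C * (exp (c * sqn n x) * f x)) * (exp (l * sqn n z) * g z))"
    proof (rule AE_I2, clarsimp simp: abs_mult)
      fix x z
      have "\<bar>f x\<bar> * \<bar>g z\<bar> * \<bar>P x z\<bar> \<le> \<bar>f x\<bar> * \<bar>g z\<bar> * (C * exp (c * sqn n x) * exp (l * sqn n z))"
        by (rule mult_left_mono[OF *(4)]) simp
      then show "\<bar>f x\<bar> * \<bar>g z\<bar> * \<bar>P x z\<bar> \<le> \<bar>C\<bar> * (exp (c * sqn n x) * \<bar>f x\<bar>) * (exp (l * sqn n z) * \<bar>g z\<bar>)"
        using *(1) by (simp add: mult_ac)
    qed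
  qed measurable
qed

text \<open>Fubini over the three variables. The majorant is a product of weighted
  \<open>good\<close> functions in x and z and an exponential in y of rate l + l' < 1/2.\<close>

lemma gram:
  assumes f: "good n f" and g: "good n g" and P: "kern n P" and Q: "kern n Q"
  shows gram_integrable: "integrable (std_gaussian n) (\<lambda>y. (\<integral>x. f x * P x y \<partial>std_gaussian n) * (\<integral>z. g z * Q z y \<partial>std_gaussian n))" (is ?A)
    and gram_eq: "(\<integral>y. (\<integral>x. f x * P x y \<partial>std_gaussian n) * (\<integral>z. g z * Q z y \<partial>std_gaussian n) \<partial>std_gaussian n) =
      (\<integral>(x, z). f x * g z * (\<integral>y. P x y * Q z y \<partial>std_gaussian n) \<partial>GG n)" (is ?B)
proof -
  let ?G = "std_gaussian n"
  interpret G: prob_space ?G by (rule prob_space_std_gaussian)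
  interpret P2: pair_sigma_finite ?G ?G ..
  interpret P3: pair_sigma_finite "GG n" ?G ..
  note [measurable] = kern_measurable[OF P] kern_measurable[OF Q] good_measurable[OF f] good_measurable[OF g]
  obtain C c l where *: "0 \<le> C" "c < 1 / 4" "l < 1 / 4" "\<And>x y. \<bar>P x y\<bar> \<le> C * exp (c * sqn n x) * exp (l * sqn n y)"
    using P unfolding kern_def by blast
  obtain C' c' l' where **: "0 \<le> C'" "c' < 1 / 4" "l' < 1 / 4" "\<And>x y. \<bar>Q x y\<bar> \<le> C' * exp (c' * sqn n x) * exp (l' * sqn n y)"
    using Q unfolding kern_def by blast
  define h where "h w y = (f (fst w) * P (fst w) y) * (g (snd w) * Q (snd w) y)" for w y
  have ih: "integrable (GG n \<Otimes>\<^sub>M ?G) (case_prod h)"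
  proof (rule Bochner_Integration.integrable_bound)
    show "integrable (GG n \<Otimes>\<^sub>M ?G) (\<lambda>(w, y). (case w of (x, z) \<Rightarrow> (C * (exp (c * sqn n x) * f x)) * (C' * (exp (c' * sqn n z) * g z))) * exp ((l + l') * sqn n y))"
      by (rule integral_pair_prod(1)[OF P3.pair_sigma_finite_axioms integral_pair_prod(1)[OF psf_gaussian]])
         (use good_exp[OF f *(2)] good_exp[OF g **(2)] *(3) **(3) in \<open>auto intro: integrable_exp_sqn\<close>)
    show "case_prod h \<in> borel_measurable (GG n \<Otimes>\<^sub>M ?G)"
      unfolding h_def by measurable
    show "AE p in GG n \<Otimes>\<^sub>M ?G. norm (case_prod h p) \<le>
      norm (case p of (w, y) \<Rightarrow> (case w of (x, z) \<Rightarrow> (C * (exp (c * sqn n x) * f x)) * (C' * (exp (c' * sqn n z) * g z))) * exp ((l + l') * sqn n y))"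
    proof (rule AE_I2, clarify)
      fix x z y
      have "\<bar>f x\<bar> * \<bar>P x y\<bar> \<le> \<bar>f x\<bar> * (C * exp (c * sqn n x) * exp (l * sqn n y))"
        by (rule mult_left_mono[OF *(4)]) simp
      moreover have "\<bar>g z\<bar> * \<bar>Q z y\<bar> \<le> \<bar>g z\<bar> * (C' * exp (c' * sqn n z) * exp (l' * sqn n y))"
        by (rule mult_left_mono[OF **(4)]) simp
      ultimately have "(\<bar>f x\<bar> * \<bar>P x y\<bar>) * (\<bar>g z\<bar> * \<bar>Q z y\<bar>) \<le>
        (\<bar>f x\<bar> * (C * exp (c * sqn n x) * exp (l * sqn n y))) * (\<bar>g z\<bar> * (C' * exp (c' * sqn n z) * exp (l' * sqn n y)))"
        by (rule mult_mono) (use * in auto)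
      also have "\<dots> = ((C * (exp (c * sqn n x) * \<bar>f x\<bar>)) * (C' * (exp (c' * sqn n z) * \<bar>g z\<bar>))) * exp ((l + l') * sqn n y)"
        by (simp only: distrib_right exp_add mult_ac)
      finally show "norm (h (x, z) y) \<le> norm ((C * (exp (c * sqn n x) * f x)) * (C' * (exp (c' * sqn n z) * g z)) * exp ((l + l') * sqn n y))"
        using *(1) **(1) by (simp add: h_def abs_mult)
    qed
  qed
  have prod: "(\<integral>w. h w y \<partial>GG n) = (\<integral>x. f x * P x y \<partial>?G) * (\<integral>z. g z * Q z y \<partial>?G)" if "y \<in> rn n" for y
    using integral_pair_prod(2)[OF psf_gaussian good_kern_integrable[OF f P that] good_kern_integrable[OF g Q that]]
    by (simp add: h_def case_prod_beta')
  show ?A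
  proof -
    have "integrable ?G (\<lambda>y. \<integral>w. h w y \<partial>GG n)" by (rule P3.integrable_snd[OF ih])
    then show ?thesis by (subst (asm) Bochner_Integration.integrable_cong[OF refl prod]) auto
  qed
  have "(\<integral>y. (\<integral>x. f x * P x y \<partial>?G) * (\<integral>z. g z * Q z y \<partial>?G) \<partial>?G) = (\<integral>y. \<integral>w. h w y \<partial>GG n \<partial>?G)"
    by (intro Bochner_Integration.integral_cong refl prod[symmetric]) simp
  also have "\<dots> = (\<integral>w. \<integral>y. h w y \<partial>?G \<partial>GG n)"
    by (rule P3.Fubini_integral[OF ih])
  also have "\<dots> = (\<integral>(x, z). f x * g z * (\<integral>y. P x y * Q z y \<partial>?G) \<partial>GG n)"
  proof (rule Bochner_Integration.integral_cong[OF refl])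
    fix w
    have "(\<lambda>y. h w y) = (\<lambda>y. (f (fst w) * g (snd w)) * (P (fst w) y * Q (snd w) y))"
      by (simp add: h_def mult_ac)
    then show "(\<integral>y. h w y \<partial>?G) = (case w of (x, z) \<Rightarrow> f x * g z * (\<integral>y. P x y * Q z y \<partial>?G))"
      by (simp add: case_prod_beta')
  qed
  finally show ?B .
qed

section \<open>The Mehler kernel\<close>

text \<open>The density of the law of r x + sqrt (1 - r^2) Y with respect to the Gaussian. The
  factor (1 - r^2)^(-n/2) is kept inside the exponential, which eases differentiation in r.\<close>

definition mehler :: "nat \<Rightarrow> real \<Rightarrow> (nat \<Rightarrow> real) \<Rightarrow> (nat \<Rightarrow> real) \<Rightarrow> real" where
  "mehler n r x z = exp ((2 * r * dot n x z - r\<^sup>2 * (sqn n x + sqn n z)) / (2 * (1 - r\<^sup>2)) - real n / 2 * ln (1 - r\<^sup>2))"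

lemma mehler_pos: "0 < mehler n r x z"
  by (simp add: mehler_def)

lemma mehler_commute: "mehler n r x z = mehler n r z x"
  by (simp add: mehler_def dot_commute add.commute)

lemma mehler_measurable [measurable]: "(\<lambda>(x, y). mehler n r x y) \<in> borel_measurable (borel_rn n \<Otimes>\<^sub>M borel_rn n)"
  unfolding mehler_def by measurable

lemma one_minus_sq_pos: "\<bar>r\<bar> < 1 \<Longrightarrow> 0 < 1 - r\<^sup>2" for r :: real
  using abs_square_less_1[of r] by simp

text \<open>2 r x.z <= |r| (|x|^2 + |z|^2) leaves the rate |r| / (2 (1 + |r|)), which increases with
  |r|. Uniformity in |r| <= R is what differentiation in r will use.\<close>

lemma mehler_bound:
  assumes r: "\<bar>r\<bar> \<le> R" and R: "R < 1"
  shows "mehler n r x z \<le> exp (- (real n / 2 * ln (1 - R\<^sup>2))) * exp (R / (2 * (1 + R)) * sqn n x) * exp (R / (2 * (1 + R)) * sqn n z)"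
proof -
  have R0: "0 \<le> R" using r by simp
  have d: "0 < 1 - r\<^sup>2" using r R by (intro one_minus_sq_pos) simp
  let ?S = "sqn n x + sqn n z"
  have S: "?S \<ge> 0" by simp
  have "r * dot n x z \<le> \<bar>r\<bar> * \<bar>dot n x z\<bar>" by (metis abs_ge_self abs_mult)
  also have "\<dots> \<le> \<bar>r\<bar> * (?S / 2)" by (intro mult_left_mono dot_le_sqn) simp
  finally have "2 * r * dot n x z - r\<^sup>2 * ?S \<le> \<bar>r\<bar> * (1 - \<bar>r\<bar>) * ?S"
    by (simp add: algebra_simps power2_eq_square)
  then have "(2 * r * dot n x z - r\<^sup>2 * ?S) / (2 * (1 - r\<^sup>2)) \<le> \<bar>r\<bar> * (1 - \<bar>r\<bar>) * ?S / (2 * (1 - r\<^sup>2))"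
    using d by (intro divide_right_mono) auto
  also have "\<bar>r\<bar> * (1 - \<bar>r\<bar>) * ?S / (2 * (1 - r\<^sup>2)) = \<bar>r\<bar> / (2 * (1 + \<bar>r\<bar>)) * ?S"
  proof -
    have fac: "1 - r\<^sup>2 = (1 - \<bar>r\<bar>) * (1 + \<bar>r\<bar>)" by (simp add: algebra_simps power2_eq_square)
    show ?thesis unfolding fac using r R by (simp add: divide_simps)
  qed
  also have "\<dots> \<le> R / (2 * (1 + R)) * ?S"
    using r R0 by (intro mult_right_mono S) (auto simp: field_simps)
  finally have 1: "(2 * r * dot n x z - r\<^sup>2 * ?S) / (2 * (1 - r\<^sup>2)) \<le> R / (2 * (1 + R)) * ?S" .
  have "ln (1 - R\<^sup>2) \<le> ln (1 - r\<^sup>2)"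
  proof (subst ln_le_cancel_iff)
    show "0 < 1 - R\<^sup>2" using R R0 by (intro one_minus_sq_pos) simp
    show "1 - R\<^sup>2 \<le> 1 - r\<^sup>2" using r R0 by (metis abs_le_square_iff abs_of_nonneg diff_left_mono)
  qed (use d in simp)
  then have "real n / 2 * ln (1 - R\<^sup>2) \<le> real n / 2 * ln (1 - r\<^sup>2)" by (intro mult_left_mono) auto
  with 1 show ?thesis
    unfolding mehler_def exp_add[symmetric] exp_le_cancel_iff distrib_left by linarith
qed

lemma mehler_rate: "0 \<le> R \<Longrightarrow> R < 1 \<Longrightarrow> R / (2 * (1 + R)) < 1 / 4" for R :: real
  by (simp add: field_simps)

lemma kern_mehler: "\<bar>r\<bar> < 1 \<Longrightarrow> kern n (mehler n r)"
  using mehler_bound[of r "\<bar>r\<bar>" n]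
  by (intro kernI[where C = "exp (- (real n / 2 * ln (1 - \<bar>r\<bar>\<^sup>2)))", OF _ _ mehler_rate mehler_rate])
     (auto simp: less_imp_le[OF mehler_pos])

definition dmehler :: "nat \<Rightarrow> real \<Rightarrow> (nat \<Rightarrow> real) \<Rightarrow> (nat \<Rightarrow> real) \<Rightarrow> real" where
  "dmehler n r x z = (((1 + r\<^sup>2) * dot n x z - r * (sqn n x + sqn n z)) / (1 - r\<^sup>2)\<^sup>2 + real n * r / (1 - r\<^sup>2)) * mehler n r x z"

lemma mehler_deriv:
  assumes r: "\<bar>r\<bar> < 1"
  shows "((\<lambda>r. mehler n r x z) has_real_derivative dmehler n r x z) (at r)"
proof -
  let ?D = "dot n x z" and ?S = "sqn n x + sqn n z"
  have d: "1 - r\<^sup>2 > 0" using one_minus_sq_pos[OF r] .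
  have "((\<lambda>r. (2 * r * ?D - r\<^sup>2 * ?S) / (2 * (1 - r\<^sup>2))) has_real_derivative
     ((2 * ?D - 2 * r * ?S) * (2 * (1 - r\<^sup>2)) - (2 * r * ?D - r\<^sup>2 * ?S) * (- 4 * r)) / (2 * (1 - r\<^sup>2))\<^sup>2) (at r)"
    using d by (auto intro!: derivative_eq_intros simp: power2_eq_square)
  moreover have "((2 * ?D - 2 * r * ?S) * (2 * (1 - r\<^sup>2)) - (2 * r * ?D - r\<^sup>2 * ?S) * (- 4 * r)) / (2 * (1 - r\<^sup>2))\<^sup>2 =
     ((1 + r\<^sup>2) * ?D - r * ?S) / (1 - r\<^sup>2)\<^sup>2"
  proof -
    have "(2 * ?D - 2 * r * ?S) * (2 * (1 - r\<^sup>2)) - (2 * r * ?D - r\<^sup>2 * ?S) * (- 4 * r) = 4 * ((1 + r\<^sup>2) * ?D - r * ?S)"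
      by (simp add: power2_eq_square algebra_simps)
    moreover have "4 * a / (2 * b)\<^sup>2 = a / b\<^sup>2" for a b :: real by (simp add: power_mult_distrib)
    ultimately show ?thesis by (simp only:)
  qed
  moreover have "((\<lambda>r. real n / 2 * ln (1 - r\<^sup>2)) has_real_derivative - (real n * r / (1 - r\<^sup>2))) (at r)"
    using d by (auto intro!: derivative_eq_intros simp: field_simps)
  ultimately have "((\<lambda>r. (2 * r * ?D - r\<^sup>2 * ?S) / (2 * (1 - r\<^sup>2)) - real n / 2 * ln (1 - r\<^sup>2)) has_real_derivative
     ((1 + r\<^sup>2) * ?D - r * ?S) / (1 - r\<^sup>2)\<^sup>2 - - (real n * r / (1 - r\<^sup>2))) (at r)"
    by (intro DERIV_diff) simp_all
  from DERIV_fun_exp[OF this] show ?thesis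
    unfolding mehler_def dmehler_def by (simp add: mult.commute)
qed

text \<open>The polynomial factor is absorbed by raising the rate slightly, still below 1/4. The
  bound is uniform in |r| <= R and dominates the derivative of the Mehler form.\<close>

lemma dmehler_bound:
  assumes R: "0 \<le> R" "R < 1"
  obtains C c where "0 \<le> C" "c < 1 / 4" "\<And>r x z. \<bar>r\<bar> \<le> R \<Longrightarrow> \<bar>dmehler n r x z\<bar> \<le> C * exp (c * sqn n x) * exp (c * sqn n z)"
proof -
  define c0 where "c0 = R / (2 * (1 + R))"
  have c0: "c0 < 1 / 4" unfolding c0_def by (rule mehler_rate[OF R])
  define e where "e = (1 / 4 - c0) / 2"
  have e: "e > 0" "c0 + e < 1 / 4" using c0 by (auto simp: e_def field_simps)
  define C0 where "C0 = exp (- (real n / 2 * ln (1 - R\<^sup>2)))"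
  define \<delta> where "\<delta> = 1 - R\<^sup>2"
  have \<delta>: "\<delta> > 0" unfolding \<delta>_def using R by (intro one_minus_sq_pos) simp
  define C1 where "C1 = 2 / \<delta>\<^sup>2 * (1 / e) + real n / \<delta>"
  have C1: "C1 \<ge> 0" using \<delta> e by (simp add: C1_def)
  show ?thesis
  proof
    show "0 \<le> C1 * C0" using C1 by (simp add: C0_def)
    show "c0 + e < 1 / 4" by (rule e)
    fix r x z assume r: "\<bar>r\<bar> \<le> R"
    let ?S = "sqn n x + sqn n z" and ?D = "dot n x z"
    have S: "?S \<ge> 0" by simp
    have r1: "\<bar>r\<bar> \<le> 1" using r R by simp
    have r2: "r\<^sup>2 \<le> 1" "r\<^sup>2 \<le> R\<^sup>2" using r r1 R by (auto simp: abs_square_le_1 abs_le_square_iff[symmetric])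
    have \<delta>r: "\<delta> \<le> 1 - r\<^sup>2" using r2 by (simp add: \<delta>_def)
    have "\<bar>(1 + r\<^sup>2) * ?D - r * ?S\<bar> \<le> (1 + r\<^sup>2) * \<bar>?D\<bar> + \<bar>r\<bar> * ?S"
      using abs_triangle_ineq4[of "(1 + r\<^sup>2) * ?D" "r * ?S"] by (simp add: abs_mult)
    also have "\<dots> \<le> 2 * (?S / 2) + 1 * ?S"
      using r1 r2 by (intro add_mono mult_mono dot_le_sqn) auto
    finally have n1: "\<bar>(1 + r\<^sup>2) * ?D - r * ?S\<bar> \<le> 2 * ?S" by linarith
    have "\<bar>(1 + r\<^sup>2) * ?D - r * ?S\<bar> / (1 - r\<^sup>2)\<^sup>2 \<le> 2 * ?S / \<delta>\<^sup>2"
      using n1 \<delta> \<delta>r by (intro frac_le power_mono) auto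
    also have "\<dots> = 2 / \<delta>\<^sup>2 * ?S" by simp
    also have "\<dots> \<le> 2 / \<delta>\<^sup>2 * (1 / e * exp (e * ?S))"
    proof (rule mult_left_mono)
      have "e * ?S \<le> exp (e * ?S)" using exp_ge_add_one_self[of "e * ?S"] by linarith
      then show "?S \<le> 1 / e * exp (e * ?S)" using e by (simp add: field_simps)
    qed simp
    finally have a1: "\<bar>((1 + r\<^sup>2) * ?D - r * ?S) / (1 - r\<^sup>2)\<^sup>2\<bar> \<le> 2 / \<delta>\<^sup>2 * (1 / e) * exp (e * ?S)"
      by simp
    have "\<bar>real n * r / (1 - r\<^sup>2)\<bar> = real n * \<bar>r\<bar> / (1 - r\<^sup>2)"
      using \<delta> \<delta>r by (simp add: abs_mult)
    also have "\<dots> \<le> real n * 1 / \<delta>"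
      using r1 \<delta> \<delta>r by (intro frac_le mult_left_mono) auto
    also have "\<dots> \<le> real n / \<delta> * exp (e * ?S)"
      using \<delta> e S by (simp add: mult_le_cancel_left1 divide_simps)
    finally have a2: "\<bar>real n * r / (1 - r\<^sup>2)\<bar> \<le> real n / \<delta> * exp (e * ?S)" .
    have "\<bar>((1 + r\<^sup>2) * ?D - r * ?S) / (1 - r\<^sup>2)\<^sup>2 + real n * r / (1 - r\<^sup>2)\<bar> \<le> C1 * exp (e * ?S)"
      using order_trans[OF abs_triangle_ineq add_mono[OF a1 a2]] by (simp only: C1_def distrib_right)
    then have "\<bar>dmehler n r x z\<bar> \<le> (C1 * exp (e * ?S)) * (C0 * exp (c0 * sqn n x) * exp (c0 * sqn n z))"
      unfolding dmehler_def abs_mult abs_of_pos[OF mehler_pos] C0_def c0_def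
      by (intro mult_mono mehler_bound r R less_imp_le[OF mehler_pos] mult_nonneg_nonneg C1) auto
    also have "\<dots> = C1 * C0 * exp ((c0 + e) * sqn n x) * exp ((c0 + e) * sqn n z)"
      by (simp only: distrib_left distrib_right exp_add mult_ac)
    finally show "\<bar>dmehler n r x z\<bar> \<le> C1 * C0 * exp ((c0 + e) * sqn n x) * exp ((c0 + e) * sqn n z)" .
  qed
qed

lemma dmehler_measurable [measurable]: "(\<lambda>(x, y). dmehler n r x y) \<in> borel_measurable (borel_rn n \<Otimes>\<^sub>M borel_rn n)"
  unfolding dmehler_def mehler_def by measurable

text \<open>The pairing of f with P_r g, written as a double integral so that it makes sense for
  \<open>good\<close> arguments.\<close>

definition mform :: "nat \<Rightarrow> real \<Rightarrow> ((nat \<Rightarrow> real) \<Rightarrow> real) \<Rightarrow> ((nat \<Rightarrow> real) \<Rightarrow> real) \<Rightarrow> real" where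
  "mform n r f g = (\<integral>(x, z). f x * g z * mehler n r x z \<partial>GG n)"

lemma mform_integrable:
  "good n f \<Longrightarrow> good n g \<Longrightarrow> \<bar>r\<bar> < 1 \<Longrightarrow> integrable (GG n) (\<lambda>(x, z). f x * g z * mehler n r x z)"
  by (rule good_pair_integrable[OF _ _ kern_mehler])

lemma mform_deriv:
  assumes f: "good n f" and g: "good n g" and r: "\<bar>r\<bar> < 1"
  shows "((\<lambda>r. mform n r f g) has_real_derivative (\<integral>(x, z). f x * g z * dmehler n r x z \<partial>GG n)) (at r)"
    and "integrable (GG n) (\<lambda>(x, z). f x * g z * dmehler n r x z)"
proof -
  define R where "R = (1 + \<bar>r\<bar>) / 2"
  have R: "0 \<le> R" "R < 1" "\<bar>r\<bar> < R" using r by (auto simp: R_def)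
  obtain C c where C: "0 \<le> C" "c < 1 / 4" "\<And>r x z. \<bar>r\<bar> \<le> R \<Longrightarrow> \<bar>dmehler n r x z\<bar> \<le> C * exp (c * sqn n x) * exp (c * sqn n z)"
    using dmehler_bound[OF R(1,2)] by blast
  have [measurable]: "f \<in> borel_measurable (borel_rn n)" "g \<in> borel_measurable (borel_rn n)"
    using f g by (auto simp: good_def)
  have kern: "kern n (\<lambda>x z. C * exp (c * sqn n x) * exp (c * sqn n z))"
    by (rule kernI[OF _ C(1) C(2) C(2)]) (use C in auto)
  have dom: "integrable (GG n) (\<lambda>w. \<bar>case w of (x, z) \<Rightarrow> f x * g z * (C * exp (c * sqn n x) * exp (c * sqn n z))\<bar>)"
    using good_pair_integrable[OF f g kern] by simp
  have rin: "r \<in> {- R<..<R}" using R by auto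
  note D = has_real_derivative_integral[OF rin, where M = "GG n" and f = "\<lambda>r w. case w of (x, z) \<Rightarrow> f x * g z * mehler n r x z"
      and f' = "\<lambda>r w. case w of (x, z) \<Rightarrow> f x * g z * dmehler n r x z", OF _ _ _ dom]
  have d1: "((\<lambda>s. case w of (x, z) \<Rightarrow> f x * g z * mehler n s x z) has_real_derivative
      (case w of (x, z) \<Rightarrow> f x * g z * dmehler n s x z)) (at s)" if "s \<in> {- R<..<R}" for s w
    using that R by (cases w) (auto intro!: DERIV_cmult mehler_deriv)
  have d2: "integrable (GG n) (\<lambda>w. case w of (x, z) \<Rightarrow> f x * g z * mehler n s x z)" if "s \<in> {- R<..<R}" for s
    using that R by (intro mform_integrable f g) auto
  have d3: "\<bar>case w of (x, z) \<Rightarrow> f x * g z * dmehler n s x z\<bar> \<le> \<bar>case w of (x, z) \<Rightarrow> f x * g z * (C * exp (c * sqn n x) * exp (c * sqn n z))\<bar>"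
    if "s \<in> {- R<..<R}" for s w
  proof (cases w)
    case (Pair x z)
    have "\<bar>f x * g z\<bar> * \<bar>dmehler n s x z\<bar> \<le> \<bar>f x * g z\<bar> * \<bar>C * exp (c * sqn n x) * exp (c * sqn n z)\<bar>"
      using C(3)[of s x z] that C(1) by (intro mult_left_mono) auto
    then show ?thesis by (simp add: Pair abs_mult)
  qed
  show "((\<lambda>r. mform n r f g) has_real_derivative (\<integral>(x, z). f x * g z * dmehler n r x z \<partial>GG n)) (at r)"
    unfolding mform_def by (rule D(1)[OF d1 d2 d3])
  show "integrable (GG n) (\<lambda>(x, z). f x * g z * dmehler n r x z)"
    by (rule D(2)[OF d1 d2 d3])
qed

text \<open>The semigroup law P_r P_r = P_(r^2). In y the product of kernels is the exponential of a
  quadratic with linear term r (x + z) / (1 - r^2) and b = 2 r^2 / (1 - r^2), so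
  \<open>gaussian_exp\<close> evaluates the integral.\<close>

lemma mehler_comp:
  assumes r: "\<bar>r\<bar> < 1"
  shows "(\<integral>y. mehler n r x y * mehler n r z y \<partial>std_gaussian n) = mehler n (r\<^sup>2) x z"
proof -
  define d where "d = 1 - r\<^sup>2"
  have d: "d > 0" unfolding d_def by (rule one_minus_sq_pos[OF r])
  have r2: "r\<^sup>2 = 1 - d" by (simp add: d_def)
  define e where "e = 1 + r\<^sup>2"
  have e: "e > 0" "e = 2 - d" by (auto simp: e_def d_def add_pos_nonneg)
  define w where "w i = r / d * (x i + z i)" for i
  define b where "b = 2 * r\<^sup>2 / d"
  have b: "1 + b = e / d" using d by (simp add: b_def e_def d_def field_simps)
  have b1: "1 + b > 0" unfolding b using d e by simp
  have wd: "dot n w y = r / d * (dot n x y + dot n z y)" for y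
    by (simp add: w_def dot_def sum_distrib_left sum.distrib[symmetric] algebra_simps)
  have ws: "sqn n w = (r / d)\<^sup>2 * (sqn n x + 2 * dot n x z + sqn n z)"
  proof -
    have "sqn n w = r / d * (dot n x w + dot n z w)" by (rule wd)
    also have "\<dots> = r / d * (r / d * (sqn n x + dot n z x) + r / d * (dot n x z + sqn n z))"
      by (simp add: dot_commute[of n _ w] wd)
    finally show ?thesis by (simp add: dot_commute[of n z x] power2_eq_square algebra_simps)
  qed
  define L where "L = - (r\<^sup>2 * (sqn n x + sqn n z)) / (2 * d) - real n * ln d"
  have "mehler n r x y * mehler n r z y = exp L * exp (dot n w y - b * sqn n y / 2)" for y
    unfolding mehler_def exp_add[symmetric] L_def wd b_def d_def[symmetric] using d
    by (simp add: field_simps)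
  then have "(\<integral>y. mehler n r x y * mehler n r z y \<partial>std_gaussian n) = exp L * ((1 / sqrt (1 + b)) ^ n * exp (sqn n w / (2 * (1 + b))))"
    using has_bochner_integral_integral_eq[OF gaussian_exp[OF b1, of n w]] by simp
  also have "(1 / sqrt (1 + b)) ^ n = exp (- (real n / 2 * ln (1 + b)))"
  proof -
    have "1 / sqrt (1 + b) = exp (- (1 / 2 * ln (1 + b)))"
      using b1 by (simp add: exp_minus ln_sqrt[symmetric] inverse_eq_divide)
    then show ?thesis by (simp add: exp_of_nat_mult[symmetric])
  qed
  also have "exp L * (exp (- (real n / 2 * ln (1 + b))) * exp (sqn n w / (2 * (1 + b)))) = mehler n (r\<^sup>2) x z"
  proof -
    have de: "1 - (r\<^sup>2)\<^sup>2 = d * e" by (simp add: d_def e_def power2_eq_square algebra_simps)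
    have ln1: "ln (1 + b) = ln e - ln d" unfolding b using d e by (simp add: ln_div)
    have ln2: "ln (1 - (r\<^sup>2)\<^sup>2) = ln d + ln e" unfolding de using d e by (simp add: ln_mult)
    have "sqn n w / (2 * (1 + b)) = r\<^sup>2 * (sqn n x + 2 * dot n x z + sqn n z) / (2 * (d * e))"
      unfolding ws b power_divide using d e by (simp add: field_simps power2_eq_square)
    moreover have "- (r\<^sup>2 * (sqn n x + sqn n z)) / (2 * d) + r\<^sup>2 * (sqn n x + 2 * dot n x z + sqn n z) / (2 * (d * e)) =
      (2 * r\<^sup>2 * dot n x z - (r\<^sup>2)\<^sup>2 * (sqn n x + sqn n z)) / (2 * (1 - (r\<^sup>2)\<^sup>2))"
    proof -
      have eq: "- (r\<^sup>2 * (sqn n x + sqn n z)) / (2 * d) = - (r\<^sup>2 * (sqn n x + sqn n z)) * e / (2 * (d * e))"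
        using d e by simp
      show ?thesis unfolding de eq add_divide_distrib[symmetric]
        by (intro arg_cong2[where f = "(/)"] refl) (simp add: e_def algebra_simps power2_eq_square)
    qed
    moreover have "- (real n * ln d) - real n / 2 * (ln e - ln d) = - (real n / 2 * (ln d + ln e))"
      by (simp add: field_simps)
    ultimately have "L - real n / 2 * ln (1 + b) + sqn n w / (2 * (1 + b)) =
      (2 * r\<^sup>2 * dot n x z - (r\<^sup>2)\<^sup>2 * (sqn n x + sqn n z)) / (2 * (1 - (r\<^sup>2)\<^sup>2)) - real n / 2 * ln (1 - (r\<^sup>2)\<^sup>2)"
      unfolding L_def ln1 ln2 by linarith
    then show ?thesis unfolding mehler_def exp_add[symmetric] by (simp add: algebra_simps)
  qed
  finally show ?thesis .
qed

text \<open>The kernel is \<open>gweight\<close> with centre r x and scale sqrt (1 - r^2); this is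
  Mehler's formula.\<close>

lemma mehler_shift:
  assumes r: "\<bar>r\<bar> < 1" and [measurable]: "f \<in> borel_measurable (borel_rn n)"
  shows "(\<integral>z. f z * mehler n r x z \<partial>std_gaussian n) = (\<integral>y. f (lin n r x (sqrt (1 - r\<^sup>2)) y) \<partial>std_gaussian n)"
proof -
  define s where "s = sqrt (1 - r\<^sup>2)"
  have d: "1 - r\<^sup>2 > 0" by (rule one_minus_sq_pos[OF r])
  then have s: "s > 0" "s\<^sup>2 = 1 - r\<^sup>2" by (auto simp: s_def)
  have "gweight n s (\<lambda>i. r * x i) z = mehler n r x z" for z
  proof -
    have 1: "(1 / s) ^ n = exp (- (real n / 2 * ln (1 - r\<^sup>2)))"
    proof -
      have "1 / s = exp (- (1 / 2 * ln (1 - r\<^sup>2)))"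
        using d by (simp add: s_def exp_minus ln_sqrt[symmetric] inverse_eq_divide)
      then show ?thesis by (simp add: exp_of_nat_mult[symmetric])
    qed
    have 2: "sqn n z / 2 - (sqn n z - 2 * dot n (\<lambda>i. r * x i) z + sqn n (\<lambda>i. r * x i)) / (2 * s\<^sup>2) =
      (2 * r * dot n x z - r\<^sup>2 * (sqn n x + sqn n z)) / (2 * (1 - r\<^sup>2))"
      unfolding s sqn_scale dot_scale using d by (simp add: field_simps)
    show ?thesis unfolding gweight_def mehler_def 1 2 exp_add[symmetric] by (simp only: add.commute diff_conv_add_uminus)
  qed
  moreover have "lin n 1 (\<lambda>i. r * x i) s y = lin n r x s y" for y by (simp add: lin_def)
  ultimately show ?thesis
    using gaussian_affine_integral(2)[OF s(1) assms(2), of "\<lambda>i. r * x i"] by (simp add: s_def[symmetric] mult.commute)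
qed

section \<open>Gaussian moment generating functions\<close>

lemma dot_upd:
  assumes "k < n"
  shows "dot n w (x(k := t)) = dot n w x + w k * (t - x k)"
proof -
  have "dot n w (x(k := t)) = w k * t + (\<Sum>i\<in>{..<n} - {k}. w i * x i)"
    unfolding dot_def using assms by (subst sum.remove[of _ k]) (auto intro!: sum.cong)
  moreover have "dot n w x = w k * x k + (\<Sum>i\<in>{..<n} - {k}. w i * x i)"
    unfolding dot_def using assms by (subst sum.remove[of _ k]) auto
  ultimately show ?thesis by (simp add: algebra_simps)
qed

lemma gauss_mgf: "(\<integral>y. expq n w 0 y \<partial>std_gaussian n) = exp (sqn n w / 2)"
  using has_bochner_integral_integral_eq[OF gaussian_exp[of 0 n w]] by (simp add: expq_def)

lemma good_poly_expq:
  assumes "good n f"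
  shows "integrable (std_gaussian n) (\<lambda>y. f y * expq n w 0 y)"
  using good_expq[OF assms order_refl, of w] by (simp add: mult.commute)

lemma gauss_mgf1:
  assumes k: "k < n"
  shows "(\<integral>y. y k * expq n w 0 y \<partial>std_gaussian n) = w k * exp (sqn n w / 2)"
proof -
  have "(\<integral>y. w k * expq n w 0 y \<partial>std_gaussian n) = (\<integral>y. y k * expq n w 0 y \<partial>std_gaussian n)"
  proof (rule gaussian_ibp_coord[OF k])
    fix x :: "nat \<Rightarrow> real"
    show "((\<lambda>t. expq n w 0 (x(k := t))) has_real_derivative w k * expq n w 0 x) (at (x k))"
      unfolding expq_def dot_upd[OF k] by (auto intro!: derivative_eq_intros)
  qed (use good_poly_expq[OF good_const, of n 1 w] good_poly_expq[OF good_coord[OF k]] in auto)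
  then show ?thesis by (simp add: gauss_mgf)
qed

lemma gauss_mgf2:
  assumes k: "k < n" and l: "l < n"
  shows "(\<integral>y. y k * (y l * expq n w 0 y) \<partial>std_gaussian n) = ((if k = l then 1 else 0) + w k * w l) * exp (sqn n w / 2)"
proof -
  let ?\<delta> = "if k = l then 1 else 0 :: real"
  have i1: "integrable (std_gaussian n) (\<lambda>y. expq n w 0 y)" using good_poly_expq[OF good_const, of n 1 w] by simp
  have i2: "integrable (std_gaussian n) (\<lambda>y. y l * expq n w 0 y)" by (rule good_poly_expq[OF good_coord[OF l]])
  have "(\<integral>y. ?\<delta> * expq n w 0 y + w k * (y l * expq n w 0 y) \<partial>std_gaussian n) =
     (\<integral>y. y k * (y l * expq n w 0 y) \<partial>std_gaussian n)"
  proof (rule gaussian_ibp_coord[OF k _ _ _ i2])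
    fix x :: "nat \<Rightarrow> real"
    have "((\<lambda>t. (x(k := t)) l) has_real_derivative ?\<delta>) (at (x k))" by (auto intro!: derivative_eq_intros)
    moreover have "((\<lambda>t. expq n w 0 (x(k := t))) has_real_derivative w k * expq n w 0 x) (at (x k))"
      unfolding expq_def dot_upd[OF k] by (auto intro!: derivative_eq_intros)
    ultimately have "((\<lambda>t. (x(k := t)) l * expq n w 0 (x(k := t))) has_real_derivative
      ?\<delta> * expq n w 0 (x(k := x k)) + w k * expq n w 0 x * (x(k := x k)) l) (at (x k))"
      by (rule DERIV_mult)
    then show "((\<lambda>t. (x(k := t)) l * expq n w 0 (x(k := t))) has_real_derivative
      ?\<delta> * expq n w 0 x + w k * (x l * expq n w 0 x)) (at (x k))"
      by (simp only: fun_upd_triv mult_ac)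
  next
    have "integrable (std_gaussian n) (\<lambda>y. (y k * y l) * expq n w 0 y)"
      by (intro good_poly_expq good_coord_mult good_coord k l)
    then show "integrable (std_gaussian n) (\<lambda>y. y k * (y l * expq n w 0 y))" by (simp add: mult.assoc)
    show "(\<lambda>y. y l * expq n w 0 y) \<in> borel_measurable (borel_rn n)"
      using borel_measurable_integrable[OF i2] by simp
    show "(\<lambda>y. ?\<delta> * expq n w 0 y + w k * (y l * expq n w 0 y)) \<in> borel_measurable (borel_rn n)"
      using borel_measurable_integrable[OF i2] by simp
  qed (use i1 i2 in auto)
  then show ?thesis
    using i1 i2 by (simp add: gauss_mgf gauss_mgf1[OF l] distrib_right)
qed

lemma gauss_second_moment:
  assumes "k < n" "l < n"
  shows "(\<integral>y. y k * y l \<partial>std_gaussian n) = (if k = l then 1 else 0)"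
  using gauss_mgf2[OF assms, of "\<lambda>_. 0"] by (simp add: expq_def dot_def)

lemma gauss_first_moment:
  assumes "k < n"
  shows "(\<integral>y. y k \<partial>std_gaussian n) = 0"
  using gauss_mgf1[OF assms, of "\<lambda>_. 0"] by (simp add: expq_def dot_def)

section \<open>A square root of the Mehler kernel\<close>

text \<open>The coefficient of x.z in the exponent of the Mehler kernel.\<close>

definition mrate :: "real \<Rightarrow> real" where "mrate r = r / (1 - r\<^sup>2)"

text \<open>\<open>gker\<close> factors the Mehler kernel as \<open>M\<^sub>r x z = \<integral>y. gker x y * gker z y\<close>, so that quadratic forms with kernel
  built from \<open>M\<^sub>r\<close> become integrals of squares.\<close>

definition gker :: "nat \<Rightarrow> real \<Rightarrow> (nat \<Rightarrow> real) \<Rightarrow> (nat \<Rightarrow> real) \<Rightarrow> real" where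
  "gker n r x y = exp (- (real n / 4 * ln (1 - r\<^sup>2))) * expq n (\<lambda>i. sqrt (mrate r) * y i) (r / (1 - r)) x"

text \<open>Young's inequality splits the cross term into l |y|^2 and mrate |x|^2 / (4 l), and the
  quadratic decay in x compensates the latter. Some l < 1/4 leaves a rate below 1/4 in x exactly
  when 4 mrate < 1 + 2 b, which amounts to 4 r < (1 + r)^2.\<close>

lemma kern_gker:
  assumes r: "0 < r" "r < 1"
  shows "kern n (gker n r)"
proof -
  define b where "b = r / (1 - r)"
  define K where "K = mrate r"
  have d: "1 - r\<^sup>2 > 0" using r by (intro one_minus_sq_pos) simp
  have K0: "K > 0" using r d by (simp add: K_def mrate_def)
  have b0: "b > 0" using r by (simp add: b_def)
  have Kb: "4 * K < 1 + 2 * b"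
  proof -
    have "(1 + 2 * b) * (1 - r\<^sup>2) = (1 + r)\<^sup>2"
      using r by (simp add: b_def field_simps power2_eq_square)
    moreover have "4 * K * (1 - r\<^sup>2) = 4 * r" using d by (simp add: K_def mrate_def)
    moreover have "4 * r < (1 + r)\<^sup>2"
    proof -
      have "0 < (1 - r)\<^sup>2" using r by simp
      then show ?thesis by (simp add: power2_eq_square algebra_simps)
    qed
    ultimately have "4 * K * (1 - r\<^sup>2) < (1 + 2 * b) * (1 - r\<^sup>2)" by simp
    then show ?thesis using d by (simp only: mult_less_cancel_right_pos)
  qed
  \<comment> \<open>The midpoint between the smallest rate that works in x and the threshold
    1/4.\<close>
  define l where "l = (K / (1 + 2 * b) + 1 / 4) / 2"
  have q: "K / (1 + 2 * b) < 1 / 4" using Kb b0 by (simp add: field_simps)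
  have l: "l < 1 / 4" "K / (1 + 2 * b) < l" 
  proof -
    have "(p + 1 / 4) / 2 < 1 / 4 \<and> p < (p + 1 / 4) / 2" if "p < 1 / 4" for p :: real
      using that by simp
    from this[OF q] show "l < 1 / 4" "K / (1 + 2 * b) < l" unfolding l_def by blast+
  qed
  have l0: "l > 0" using l(2) K0 b0 by (smt (verit) divide_pos_pos)
  define c where "c = K / (4 * l) - b / 2"
  have c: "c < 1 / 4"
  proof -
    have "K < l * (1 + 2 * b)" using l(2) b0 by (simp add: divide_less_eq)
    then have "K / (4 * l) < (1 + 2 * b) / 4" using l0 by (simp add: field_simps)
    moreover have "X < (1 + 2 * b) / 4 \<Longrightarrow> X - b / 2 < 1 / 4" for X by (simp add: field_simps)
    ultimately show ?thesis unfolding c_def by blast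
  qed
  show ?thesis
  proof (rule kernI[where C = "exp (- (real n / 4 * ln (1 - r\<^sup>2)))", OF _ _ c l(1)])
    show "(\<lambda>(x, y). gker n r x y) \<in> borel_measurable (borel_rn n \<Otimes>\<^sub>M borel_rn n)"
      unfolding gker_def expq_def dot_scale by measurable
    fix x y
    have "dot n (\<lambda>i. sqrt K * x i) y \<le> l * sqn n y + sqn n (\<lambda>i. sqrt K * x i) / (4 * l)"
      by (rule dot_le_eps[OF l0])
    then have "dot n (\<lambda>i. sqrt K * y i) x - b * sqn n x / 2 \<le> c * sqn n x + l * sqn n y"
      unfolding sqn_scale dot_scale using K0 by (simp add: c_def dot_commute[of n y x] algebra_simps)
    then show "\<bar>gker n r x y\<bar> \<le> exp (- (real n / 4 * ln (1 - r\<^sup>2))) * exp (c * sqn n x) * exp (l * sqn n y)"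
      unfolding gker_def expq_def K_def[symmetric] b_def[symmetric] by (simp add: abs_mult mult.assoc exp_add[symmetric])
  qed simp
qed

definition gpair :: "nat \<Rightarrow> real \<Rightarrow> (nat \<Rightarrow> real) \<Rightarrow> (nat \<Rightarrow> real) \<Rightarrow> real" where
  "gpair n r x z = exp (- (real n / 2 * ln (1 - r\<^sup>2)) - r / (1 - r) * (sqn n x + sqn n z) / 2)"

lemma gker_prod:
  "gker n r x y * gker n r z y = gpair n r x z * expq n (\<lambda>i. sqrt (mrate r) * (x i + z i)) 0 y"
proof -
  have "dot n (\<lambda>i. x i + z i) y = dot n y x + dot n y z"
    by (simp add: dot_def sum.distrib[symmetric] algebra_simps)
  then show ?thesis
    unfolding gker_def gpair_def expq_def dot_scale by (simp add: exp_add[symmetric] algebra_simps add_divide_distrib)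
qed

lemma gpair_mehler:
  assumes r: "0 < r" "r < 1"
  shows "gpair n r x z * exp (sqn n (\<lambda>i. sqrt (mrate r) * (x i + z i)) / 2) = mehler n r x z"
proof -
  have d: "1 - r\<^sup>2 > 0" using r by (intro one_minus_sq_pos) simp
  have K0: "mrate r > 0" using r d by (simp add: mrate_def)
  have "sqn n (\<lambda>i. x i + z i) = sqn n x + 2 * dot n x z + sqn n z"
    by (simp add: dot_def sum.distrib sum_distrib_left algebra_simps)
  then have s: "sqn n (\<lambda>i. sqrt (mrate r) * (x i + z i)) = mrate r * (sqn n x + 2 * dot n x z + sqn n z)"
    using K0 by (simp add: sqn_scale)
  have "r / (1 - r) = mrate r * (1 + r)"
  proof -
    have "1 - r\<^sup>2 = (1 - r) * (1 + r)" by (simp add: power2_eq_square algebra_simps)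
    then show ?thesis using r by (simp add: mrate_def)
  qed
  then have "- (r / (1 - r) * (sqn n x + sqn n z) / 2) + sqn n (\<lambda>i. sqrt (mrate r) * (x i + z i)) / 2 =
      mrate r * (2 * dot n x z - r * (sqn n x + sqn n z)) / 2"
    unfolding s by (simp add: algebra_simps add_divide_distrib)
  also have "\<dots> = (2 * r * dot n x z - r\<^sup>2 * (sqn n x + sqn n z)) / (2 * (1 - r\<^sup>2))"
  proof -
    have "r / d * (A - r * B) / 2 = (r * A - r\<^sup>2 * B) / (2 * d)" for A B d :: real
      by (cases "d = 0") (simp_all add: field_simps power2_eq_square)
    from this[of "1 - r\<^sup>2" "2 * dot n x z" "sqn n x + sqn n z"] show ?thesis
      by (simp only: mrate_def mult.left_commute mult.assoc)
  qed
  finally show ?thesis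
    unfolding gpair_def mehler_def exp_add[symmetric] by (intro arg_cong[where f = exp]) linarith
qed

lemma gker_integral:
  assumes r: "0 < r" "r < 1"
  shows "(\<integral>y. gker n r x y * gker n r z y \<partial>std_gaussian n) = mehler n r x z"
  unfolding gker_prod by (simp add: gauss_mgf gpair_mehler[OF r])

text \<open>Two values of a matter. For a = r / (1 - r) this is minus the derivative of
  \<open>gker\<close> in x_k; for a = 1 / (1 - r) it is x_k - d/dx_k, the Gaussian adjoint of the
  derivative, applied to \<open>gker\<close>. The latter is the factor that \<open>korn_ibp\<close>
  produces.\<close>

definition gk :: "nat \<Rightarrow> real \<Rightarrow> real \<Rightarrow> nat \<Rightarrow> (nat \<Rightarrow> real) \<Rightarrow> (nat \<Rightarrow> real) \<Rightarrow> real" where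
  "gk n r a k x y = (a * x k - sqrt (mrate r) * y k) * gker n r x y"

lemma kern_gk:
  assumes r: "0 < r" "r < 1" and k: "k < n"
  shows "kern n (gk n r a k)"
proof -
  have "gk n r a k = (\<lambda>x y. a * (x k * gker n r x y) - sqrt (mrate r) * (y k * gker n r x y))"
    by (simp add: gk_def fun_eq_iff algebra_simps)
  then show ?thesis
    using kern_diff[OF kern_cmult[OF kern_coord_fst[OF kern_gker[OF r] k]] kern_cmult[OF kern_coord_snd[OF kern_gker[OF r] k]]]
    by simp
qed

text \<open>By \<open>gker_prod\<close> the two kernels multiply to an exponential tilt in y. Under
  the normalized tilt y has mean w and identity covariance; the covariance is the source of the term
  with k = l.\<close>

lemma gk_integral:
  assumes r: "0 < r" "r < 1" and k: "k < n" and l: "l < n"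
  shows "(\<integral>y. gk n r a k x y * gk n r a l z y \<partial>std_gaussian n) =
    ((a * x k - mrate r * (x k + z k)) * (a * z l - mrate r * (x l + z l)) + mrate r * (if k = l then 1 else 0)) * mehler n r x z"
proof -
  define s where "s = sqrt (mrate r)"
  have d: "1 - r\<^sup>2 > 0" using r by (intro one_minus_sq_pos) simp
  have s2: "s * s = mrate r" using r d by (simp add: s_def mrate_def)
  define w where "w i = s * (x i + z i)" for i
  define D where "D = gpair n r x z"
  have i: "integrable (std_gaussian n) (\<lambda>y. expq n w 0 y)" "integrable (std_gaussian n) (\<lambda>y. y k * expq n w 0 y)"
    "integrable (std_gaussian n) (\<lambda>y. y l * expq n w 0 y)" "integrable (std_gaussian n) (\<lambda>y. y k * (y l * expq n w 0 y))"
    using good_poly_expq[OF good_const, of n 1 w] good_poly_expq[OF good_coord[OF k], of w] good_poly_expq[OF good_coord[OF l], of w]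
      good_poly_expq[OF good_coord_mult[OF good_coord[OF l] k], of w] by (simp_all add: mult.assoc)
  have "gk n r a k x y * gk n r a l z y = D * (a * x k * (a * z l)) * expq n w 0 y - D * (a * x k * s) * (y l * expq n w 0 y)
     - D * (a * z l * s) * (y k * expq n w 0 y) + D * (s * s) * (y k * (y l * expq n w 0 y))" for y
  proof -
    have "gk n r a k x y * gk n r a l z y = (a * x k - s * y k) * (a * z l - s * y l) * (gker n r x y * gker n r z y)"
      by (simp add: gk_def s_def)
    also have "gker n r x y * gker n r z y = D * expq n w 0 y"
      unfolding gker_prod D_def w_def[abs_def] s_def ..
    finally show ?thesis by (simp add: algebra_simps)
  qed
  then have "(\<integral>y. gk n r a k x y * gk n r a l z y \<partial>std_gaussian n) =
     D * (a * x k * (a * z l)) * exp (sqn n w / 2) - D * (a * x k * s) * (w l * exp (sqn n w / 2))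
     - D * (a * z l * s) * (w k * exp (sqn n w / 2)) + D * (s * s) * (((if k = l then 1 else 0) + w k * w l) * exp (sqn n w / 2))"
    using i by (simp add: gauss_mgf gauss_mgf1[OF k] gauss_mgf1[OF l] gauss_mgf2[OF k l])
  also have "\<dots> = ((a * x k - s * w k) * (a * z l - s * w l) + (s * s) * (if k = l then 1 else 0)) * (D * exp (sqn n w / 2))"
    by (simp add: algebra_simps)
  also have "D * exp (sqn n w / 2) = mehler n r x z"
    using gpair_mehler[OF r, of n x z] unfolding D_def w_def[abs_def] s_def .
  also have "s * w k = mrate r * (x k + z k)" by (simp add: w_def s2[symmetric])
  also have "s * w l = mrate r * (x l + z l)" by (simp add: w_def s2[symmetric])
  finally show ?thesis by (simp add: s2)
qed

lemma mform_gram: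
  assumes "good n f" "good n g" and r: "0 < r" "r < 1"
  shows "mform n r f g = (\<integral>y. (\<integral>x. f x * gker n r x y \<partial>std_gaussian n) * (\<integral>z. g z * gker n r z y \<partial>std_gaussian n) \<partial>std_gaussian n)"
  unfolding mform_def gram_eq[OF assms(1,2) kern_gker[OF r] kern_gker[OF r]] gker_integral[OF r] ..

lemma mform_nonneg:
  assumes "good n f" "0 < r" "r < 1"
  shows "0 \<le> mform n r f f"
  unfolding mform_gram[OF assms(1,1,2,3)] by (rule Bochner_Integration.integral_nonneg) simp

section \<open>Contraction and spectral gap of the Mehler forms\<close>

lemma quad_discriminant:
  fixes a b c :: real
  assumes q: "\<And>t. 0 \<le> a + 2 * t * b + t\<^sup>2 * c" and c: "0 \<le> c"
  shows "b\<^sup>2 \<le> a * c"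
proof (cases "c = 0")
  case True
  have "b = 0"
  proof (rule ccontr)
    assume "b \<noteq> 0"
    then have "2 * (- (a + 1) / (2 * b)) * b = - (a + 1)" by simp
    then show False using q[of "- (a + 1) / (2 * b)"] True by simp
  qed
  then show ?thesis using True by simp
next
  case False
  then have "c > 0" using c by simp
  have "a + 2 * (- b / c) * b + (- b / c)\<^sup>2 * c = a - b\<^sup>2 / c"
    using False by (simp add: power2_eq_square field_simps)
  then have "b\<^sup>2 / c \<le> a" using q[of "- b / c"] by simp
  then show ?thesis using \<open>c > 0\<close> by (simp add: field_simps)
qed

text \<open>If q r exceeded r^j, iterating the squaring step k times would give (q r / r^j)^(2^k) <=
  C, although the ratio is above 1. The points r^(2^k) eventually fall below \<delta>, where the
  crude bound holds.\<close>

lemma sq_iterate_bound: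
  fixes q :: "real \<Rightarrow> real" and C \<delta> :: real
  assumes nonneg: "\<And>r. 0 < r \<Longrightarrow> r < 1 \<Longrightarrow> 0 \<le> q r"
    and step: "\<And>r. 0 < r \<Longrightarrow> r < 1 \<Longrightarrow> (q r)\<^sup>2 \<le> q (r\<^sup>2)"
    and small: "\<delta> > 0" "\<And>r. 0 < r \<Longrightarrow> r < \<delta> \<Longrightarrow> q r \<le> C * r ^ j"
    and r: "0 < r" "r < 1"
  shows "q r \<le> r ^ j"
proof (rule ccontr)
  assume "\<not> q r \<le> r ^ j"
  then have gt: "r ^ j < q r" by simp
  define t where "t = q r / r ^ j"
  have t: "t > 1" using gt r by (simp add: t_def field_simps)
  have it: "(q r) ^ (2 ^ k) \<le> q (r ^ (2 ^ k))" for k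
  proof (induction k)
    case (Suc k)
    have p: "0 < r ^ (2 ^ k)" "r ^ (2 ^ k) < 1" using r by (auto simp: power_less_one_iff)
    have "(q r) ^ (2 ^ Suc k) = ((q r) ^ (2 ^ k))\<^sup>2" by (simp add: power_mult[symmetric] mult.commute)
    also have "\<dots> \<le> (q (r ^ (2 ^ k)))\<^sup>2"
      using Suc nonneg[OF r] by (intro power_mono) auto
    also have "\<dots> \<le> q ((r ^ (2 ^ k))\<^sup>2)" by (rule step[OF p])
    also have "(r ^ (2 ^ k))\<^sup>2 = r ^ (2 ^ Suc k)" by (simp add: power_mult[symmetric] mult.commute)
    finally show ?case .
  qed simp
  obtain m1 where m1: "C < t ^ m1" using real_arch_pow[OF t] by blast
  obtain m2 where m2: "r ^ m2 < \<delta>" using real_arch_pow_inv[OF small(1) r(2)] by blast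
  define k where "k = max m1 m2"
  have k: "m1 \<le> 2 ^ k" "m2 \<le> 2 ^ k"
    using less_exp[of k] unfolding k_def by (metis le_trans less_imp_le max.cobounded1 max.cobounded2)+
  have "r ^ (2 ^ k) \<le> r ^ m2" using k r by (intro power_decreasing) auto
  then have "r ^ (2 ^ k) < \<delta>" using m2 by linarith
  then have "q (r ^ (2 ^ k)) \<le> C * (r ^ (2 ^ k)) ^ j" using r by (intro small(2)) auto
  with it[of k] have "(q r) ^ (2 ^ k) \<le> C * (r ^ j) ^ (2 ^ k)"
    by (simp add: power_mult[symmetric] mult.commute)
  then have "t ^ (2 ^ k) \<le> C" using r by (simp add: t_def power_divide field_simps)
  moreover have "t ^ m1 \<le> t ^ (2 ^ k)" using k t by (intro power_increasing) auto
  ultimately show False using m1 by simp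
qed

lemma mehler_0 [simp]: "mehler n 0 x z = 1"
  by (simp add: mehler_def)

lemma mform_0:
  assumes "good n f" "good n g"
  shows "mform n 0 f g = (\<integral>x. f x \<partial>std_gaussian n) * (\<integral>x. g x \<partial>std_gaussian n)"
  unfolding mform_def using integral_pair_prod(2)[OF psf_gaussian good_integrable[OF assms(1)] good_integrable[OF assms(2)]] by simp

lemma mform_fst:
  assumes f: "good n f" and g: "good n g" and r: "\<bar>r\<bar> < 1"
  shows "mform n r f g = (\<integral>x. f x * (\<integral>z. g z * mehler n r x z \<partial>std_gaussian n) \<partial>std_gaussian n)"
    and "integrable (std_gaussian n) (\<lambda>x. f x * (\<integral>z. g z * mehler n r x z \<partial>std_gaussian n))"
proof -
  interpret P: pair_sigma_finite "std_gaussian n" "std_gaussian n" by (rule psf_gaussian)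
  note i = mform_integrable[OF f g r]
  show "mform n r f g = (\<integral>x. f x * (\<integral>z. g z * mehler n r x z \<partial>std_gaussian n) \<partial>std_gaussian n)"
    unfolding mform_def P.integral_fst[OF i, symmetric] by (simp add: mult.assoc)
  show "integrable (std_gaussian n) (\<lambda>x. f x * (\<integral>z. g z * mehler n r x z \<partial>std_gaussian n))"
    using P.integrable_fst[OF i] by (simp add: mult.assoc)
qed

text \<open>With p = P_r f the semigroup law gives that the squared norm of p is the form at r^2.
  Expanding the nonnegative squared norm of f + t p in t yields Cauchy-Schwarz through the
  discriminant.\<close>

lemma mform_sq_le:
  assumes m[measurable]: "f \<in> borel_measurable (borel_rn n)" and i2: "integrable (std_gaussian n) (\<lambda>x. (f x)\<^sup>2)"
    and r: "\<bar>r\<bar> < 1"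
  shows "(mform n r f f)\<^sup>2 \<le> (\<integral>x. (f x)\<^sup>2 \<partial>std_gaussian n) * mform n (r\<^sup>2) f f" "0 \<le> mform n (r\<^sup>2) f f"
proof -
  let ?G = "std_gaussian n"
  have f: "good n f" by (rule good_L2[OF m i2])
  define p where "p x = (\<integral>z. f z * mehler n r z x \<partial>?G)" for x
  have ip: "integrable ?G (\<lambda>x. p x * p x)"
    unfolding p_def by (rule gram_integrable[OF f f kern_mehler[OF r] kern_mehler[OF r]])
  have pp: "(\<integral>x. p x * p x \<partial>?G) = mform n (r\<^sup>2) f f"
    unfolding p_def gram_eq[OF f f kern_mehler[OF r] kern_mehler[OF r]] mehler_comp[OF r] mform_def ..
  have fp: "mform n r f f = (\<integral>x. f x * p x \<partial>?G)" "integrable ?G (\<lambda>x. f x * p x)"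
    using mform_fst[OF f f r] unfolding p_def by (simp_all add: mehler_commute[of n r _ _])
  show "0 \<le> mform n (r\<^sup>2) f f" unfolding pp[symmetric] by (rule Bochner_Integration.integral_nonneg) simp
  then show "(mform n r f f)\<^sup>2 \<le> (\<integral>x. (f x)\<^sup>2 \<partial>?G) * mform n (r\<^sup>2) f f"
  proof (rule quad_discriminant[rotated])
    fix t
    have "0 \<le> (\<integral>x. (f x + t * p x)\<^sup>2 \<partial>?G)" by (rule Bochner_Integration.integral_nonneg) simp
    also have "\<dots> = (\<integral>x. (f x)\<^sup>2 + 2 * t * (f x * p x) + t\<^sup>2 * (p x * p x) \<partial>?G)"
      by (intro Bochner_Integration.integral_cong refl) (simp add: power2_eq_square algebra_simps)
    also have "\<dots> = (\<integral>x. (f x)\<^sup>2 \<partial>?G) + 2 * t * mform n r f f + t\<^sup>2 * mform n (r\<^sup>2) f f"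
      using i2 ip fp by (simp add: pp)
    finally show "0 \<le> (\<integral>x. (f x)\<^sup>2 \<partial>?G) + 2 * t * mform n r f f + t\<^sup>2 * mform n (r\<^sup>2) f f" .
  qed
qed

text \<open>Contraction and spectral gap of the Ornstein-Uhlenbeck semigroup. Self-adjointness gives
  \<open>\<langle>f, P\<^sub>r f\<rangle>\<^sup>2 \<le> \<parallel>f\<parallel>\<^sup>2 \<langle>f, P\<^sub>s f\<rangle>\<close> with \<open>s = r\<^sup>2\<close>; iterating this reduces the sharp bounds to crude bounds
  for small \<open>r\<close>.\<close>

lemma mform_le_power:
  assumes m: "f \<in> borel_measurable (borel_rn n)" and i2: "integrable (std_gaussian n) (\<lambda>x. (f x)\<^sup>2)"
    and small: "\<delta> > 0" "\<And>r. 0 < r \<Longrightarrow> r < \<delta> \<Longrightarrow> mform n r f f \<le> C * r ^ j"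
    and r: "0 < r" "r < 1"
  shows "mform n r f f \<le> r ^ j * (\<integral>x. (f x)\<^sup>2 \<partial>std_gaussian n)"
proof -
  define N where "N = (\<integral>x. (f x)\<^sup>2 \<partial>std_gaussian n)"
  have N0: "N \<ge> 0" unfolding N_def by (rule Bochner_Integration.integral_nonneg) simp
  have f: "good n f" by (rule good_L2[OF m i2])
  show ?thesis
  proof (cases "N = 0")
    case True
    then have "(mform n r f f)\<^sup>2 \<le> 0" using mform_sq_le(1)[OF m i2, of r] r by (simp add: N_def)
    then show ?thesis using True by (simp add: N_def)
  next
    case False
    then have N: "N > 0" using N0 by simp
    have "mform n r f f / N \<le> r ^ j"
    proof (rule sq_iterate_bound[where q = "\<lambda>r. mform n r f f / N", OF _ _ small(1) _ r])
      fix r :: real assume r: "0 < r" "r < 1"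
      show "0 \<le> mform n r f f / N" using mform_nonneg[OF f r] N by simp
      have "(mform n r f f)\<^sup>2 \<le> N * mform n (r\<^sup>2) f f"
        using mform_sq_le(1)[OF m i2, of r] r by (simp add: N_def)
      then have "(mform n r f f)\<^sup>2 / N\<^sup>2 \<le> N * mform n (r\<^sup>2) f f / N\<^sup>2"
        by (rule divide_right_mono) simp
      then show "(mform n r f f / N)\<^sup>2 \<le> mform n (r\<^sup>2) f f / N"
        using N by (simp add: power_divide power2_eq_square[of N])
    next
      fix r :: real assume r: "0 < r" "r < \<delta>"
      show "mform n r f f / N \<le> C / N * r ^ j" using small(2)[OF r] N by (simp add: field_simps)
    qed
    then show ?thesis using N by (simp add: N_def[symmetric] field_simps)
  qed
qed

text \<open>The crude bounds come from r = 0: continuity there gives exponent 0. A zero mean makes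
  the form vanish at 0, and differentiability then gives exponent 1.\<close>

lemma mform_contraction:
  assumes m: "f \<in> borel_measurable (borel_rn n)" and i2: "integrable (std_gaussian n) (\<lambda>x. (f x)\<^sup>2)"
    and r: "0 < r" "r < 1"
  shows "mform n r f f \<le> (\<integral>x. (f x)\<^sup>2 \<partial>std_gaussian n)"
    and "(\<integral>x. f x \<partial>std_gaussian n) = 0 \<Longrightarrow> mform n r f f \<le> r * (\<integral>x. (f x)\<^sup>2 \<partial>std_gaussian n)"
proof -
  have f: "good n f" by (rule good_L2[OF m i2])
  obtain D where D: "((\<lambda>r. mform n r f f) has_real_derivative D) (at 0)"
    using mform_deriv(1)[OF f f, of 0] by auto
  have "isCont (\<lambda>r. mform n r f f) 0" using DERIV_isCont[OF D] .
  then have "\<forall>\<^sub>F r in at 0. mform n r f f < mform n 0 f f + 1"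
    unfolding isCont_def by (rule order_tendstoD) simp
  then obtain \<delta> where \<delta>: "\<delta> > 0" "\<And>r. r \<noteq> 0 \<Longrightarrow> \<bar>r\<bar> < \<delta> \<Longrightarrow> mform n r f f < mform n 0 f f + 1"
    unfolding eventually_at by (auto simp: dist_real_def)
  have "mform n r f f \<le> r ^ 0 * (\<integral>x. (f x)\<^sup>2 \<partial>std_gaussian n)"
  proof (rule mform_le_power[OF m i2 \<delta>(1) _ r])
    fix r :: real assume "0 < r" "r < \<delta>"
    then show "mform n r f f \<le> (mform n 0 f f + 1) * r ^ 0" using \<delta>(2)[of r] by simp
  qed
  then show "mform n r f f \<le> (\<integral>x. (f x)\<^sup>2 \<partial>std_gaussian n)" by simp
  assume "(\<integral>x. f x \<partial>std_gaussian n) = 0"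
  then have 0: "mform n 0 f f = 0" by (simp add: mform_0[OF f f])
  have "((\<lambda>h. mform n h f f / h) \<longlongrightarrow> D) (at 0)" using D by (simp add: DERIV_def 0)
  then have "\<forall>\<^sub>F r in at 0. mform n r f f / r < D + 1" by (rule order_tendstoD) simp
  then obtain \<delta> where \<delta>: "\<delta> > 0" "\<And>r. r \<noteq> 0 \<Longrightarrow> \<bar>r\<bar> < \<delta> \<Longrightarrow> mform n r f f / r < D + 1"
    unfolding eventually_at by (auto simp: dist_real_def)
  have "mform n r f f \<le> r ^ 1 * (\<integral>x. (f x)\<^sup>2 \<partial>std_gaussian n)"
  proof (rule mform_le_power[OF m i2 \<delta>(1) _ r])
    fix r :: real assume "0 < r" "r < \<delta>"
    then show "mform n r f f \<le> (D + 1) * r ^ 1" using \<delta>(2)[of r] by (simp add: field_simps)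
  qed
  then show "mform n r f f \<le> r * (\<integral>x. (f x)\<^sup>2 \<partial>std_gaussian n)" by simp
qed

section \<open>The Korn inequality along the Mehler flow\<close>

text \<open>Since x_k - d/dx_k applied to M_r multiplies it by (x_k - r z_k) / (1 - r^2), the kernel
  is M_r under x_k - d/dx_k and z_l - d/dz_l, without the extra term that arises for k = l.\<close>

definition jform :: "nat \<Rightarrow> real \<Rightarrow> nat \<Rightarrow> nat \<Rightarrow> ((nat \<Rightarrow> real) \<Rightarrow> real) \<Rightarrow> ((nat \<Rightarrow> real) \<Rightarrow> real) \<Rightarrow> real" where
  "jform n r k l f g = (\<integral>(x, z). f x * g z * ((x k - r * z k) * (z l - r * x l) / (1 - r\<^sup>2)\<^sup>2 * mehler n r x z) \<partial>GG n)"

lemma kern_jform: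
  assumes r: "\<bar>r\<bar> < 1" and k: "k < n" and l: "l < n"
  shows "kern n (\<lambda>x z. (x k - r * z k) * (z l - r * x l) / (1 - r\<^sup>2)\<^sup>2 * mehler n r x z)"
proof -
  define q where "q = 1 / (1 - r\<^sup>2)\<^sup>2"
  have eq: "(\<lambda>x z. (x k - r * z k) * (z l - r * x l) / (1 - r\<^sup>2)\<^sup>2 * mehler n r x z) =
    (\<lambda>x z. q * (x k * (z l * mehler n r x z) - r * (x k * (x l * mehler n r x z))
      - (r * (z k * (z l * mehler n r x z)) - r * r * (z k * (x l * mehler n r x z)))))"
  proof (intro ext)
    fix x z
    have "a / (1 - r\<^sup>2)\<^sup>2 * M = q * (a * M)" for a M by (simp add: q_def)
    then have "(x k - r * z k) * (z l - r * x l) / (1 - r\<^sup>2)\<^sup>2 * mehler n r x z =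
      q * ((x k - r * z k) * (z l - r * x l) * mehler n r x z)" .
    then show "(x k - r * z k) * (z l - r * x l) / (1 - r\<^sup>2)\<^sup>2 * mehler n r x z =
      q * (x k * (z l * mehler n r x z) - r * (x k * (x l * mehler n r x z))
      - (r * (z k * (z l * mehler n r x z)) - r * r * (z k * (x l * mehler n r x z))))"
      by (simp only: left_diff_distrib right_diff_distrib mult_ac)
  qed
  note K = kern_mehler[OF r, of n]
  show ?thesis unfolding eq
    by (rule kern_cmult[OF kern_diff[OF
          kern_diff[OF kern_coord_fst[OF kern_coord_snd[OF K l] k] kern_cmult[OF kern_coord_fst[OF kern_coord_fst[OF K l] k]]]
          kern_diff[OF kern_cmult[OF kern_coord_snd[OF kern_coord_snd[OF K l] k]] kern_cmult[OF kern_coord_snd[OF kern_coord_fst[OF K l] k]]]]])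
qed

text \<open>The adjoint derivatives and the plain derivatives of M_r lead to the same
  \<open>jform\<close>, with k and l exchanged and up to the factor r^2. Exchanging the indices is
  what later turns a mixed term into a square.\<close>

lemma gk_gram:
  assumes f: "good n f" and g: "good n g" and r: "0 < r" "r < 1" and k: "k < n" and l: "l < n"
  shows "(\<integral>y. (\<integral>x. f x * gk n r (1 / (1 - r)) k x y \<partial>std_gaussian n) * (\<integral>z. g z * gk n r (1 / (1 - r)) l z y \<partial>std_gaussian n) \<partial>std_gaussian n) =
      jform n r k l f g + mrate r * (if k = l then mform n r f g else 0)" (is ?A)
    and "(\<integral>y. (\<integral>x. f x * gk n r (r / (1 - r)) k x y \<partial>std_gaussian n) * (\<integral>z. g z * gk n r (r / (1 - r)) l z y \<partial>std_gaussian n) \<partial>std_gaussian n) =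
      r\<^sup>2 * jform n r l k f g + mrate r * (if k = l then mform n r f g else 0)" (is ?B)
proof -
  have r': "\<bar>r\<bar> < 1" using r by simp
  have d: "1 - r\<^sup>2 > 0" using one_minus_sq_pos[OF r'] .
  have fac: "1 - r\<^sup>2 = (1 - r) * (1 + r)" by (simp add: algebra_simps power2_eq_square)
  let ?\<delta> = "if k = l then 1 else 0 :: real"
  have e1: "1 / (1 - r) * a - mrate r * (a + b) = (a - r * b) / (1 - r\<^sup>2)" for a b
  proof -
    have "1 / (1 - r) = (1 + r) / (1 - r\<^sup>2)" using r unfolding fac by simp
    then show ?thesis by (simp add: mrate_def diff_divide_distrib[symmetric] algebra_simps)
  qed
  have e1': "1 / (1 - r) * a - mrate r * (b + a) = (a - r * b) / (1 - r\<^sup>2)" for a b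
    using e1[of a b] by (simp only: add.commute)
  have e2: "r / (1 - r) * a - mrate r * (a + b) = - r * ((b - r * a) / (1 - r\<^sup>2))" for a b
  proof -
    have "r / (1 - r) = r * (1 + r) / (1 - r\<^sup>2)" using r unfolding fac by simp
    then show ?thesis by (simp add: mrate_def diff_divide_distrib[symmetric] algebra_simps)
  qed
  note j = good_pair_integrable[OF f g kern_jform[OF r' k l]] good_pair_integrable[OF f g kern_jform[OF r' l k]]
  note M = mform_integrable[OF f g r']
  have split: "(\<integral>(x, z). f x * g z * ((c * J x z + mrate r * ?\<delta>) * mehler n r x z) \<partial>GG n) =
      c * (\<integral>(x, z). f x * g z * (J x z * mehler n r x z) \<partial>GG n) + mrate r * (if k = l then mform n r f g else 0)"
    if "integrable (GG n) (\<lambda>(x, z). f x * g z * (J x z * mehler n r x z))" for c J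
  proof -
    have "(\<integral>(x, z). f x * g z * ((c * J x z + mrate r * ?\<delta>) * mehler n r x z) \<partial>GG n) =
      (\<integral>w. c * (case w of (x, z) \<Rightarrow> f x * g z * (J x z * mehler n r x z)) + mrate r * ?\<delta> * (case w of (x, z) \<Rightarrow> f x * g z * mehler n r x z) \<partial>GG n)"
      by (intro Bochner_Integration.integral_cong refl) (auto simp: algebra_simps)
    then show ?thesis using that M by (simp add: mform_def)
  qed
  have e2': "r / (1 - r) * a - mrate r * (b + a) = - r * ((b - r * a) / (1 - r\<^sup>2))" for a b
    using e2[of a b] by (simp only: add.commute)
  have e3: "(A / d) * (B / d) = A * B / d\<^sup>2" for A B d :: real
    by (simp add: power2_eq_square)
  have e4: "(- r * (A / d)) * (- r * (B / d)) = r\<^sup>2 * (B * A / d\<^sup>2)" for A B d :: real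
    by (simp add: power2_eq_square)
  show ?A
    unfolding gram_eq[OF f g kern_gk[OF r k] kern_gk[OF r l]] gk_integral[OF r k l] e1 e1' e3
    using split[OF j(1), of 1] unfolding jform_def mult_1 .
  show ?B
    unfolding gram_eq[OF f g kern_gk[OF r k] kern_gk[OF r l]] gk_integral[OF r k l] e2 e2' e4
    using split[OF j(2), of "r\<^sup>2"] unfolding jform_def .
qed

text \<open>Expanding the squares of (P k l + P l k) / 2 splits the energy into S1, the sum of all
  squares, and S2, the sum of the mixed products. S1 is the r-derivative of the Mehler form. S2 has
  no sign by itself, but it is bounded below by the nonnegative square of a smoothed
  divergence.\<close>

lemma korn_mehler_ineq:
  assumes u: "\<And>i. i < n \<Longrightarrow> differentiable_rn n (\<lambda>x. u x i)"
    and gu: "\<And>i. i < n \<Longrightarrow> good n (\<lambda>x. u x i)"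
    and ge: "\<And>i j. i < n \<Longrightarrow> j < n \<Longrightarrow> good n (\<lambda>x. sym_grad u x i j)"
    and r: "0 < r" "r < 1"
  shows "(\<Sum>l<n. \<integral>(x, z). u x l * u z l * dmehler n r x z \<partial>GG n) - (\<Sum>l<n. mform n r (\<lambda>x. u x l) (\<lambda>x. u x l)) / r
     \<le> 2 * (\<Sum>k<n. \<Sum>l<n. mform n r (\<lambda>x. sym_grad u x k l) (\<lambda>x. sym_grad u x k l))"
proof -
  let ?G = "std_gaussian n"
  have r': "\<bar>r\<bar> < 1" using r by simp
  have d: "1 - r\<^sup>2 > 0" using one_minus_sq_pos[OF r'] .
  define U where "U l = (\<lambda>x. u x l)" for l
  define E where "E k l = (\<lambda>x. sym_grad u x k l)" for k l
  define P where "P k l y = (\<integral>x. U l x * gk n r (1 / (1 - r)) k x y \<partial>?G)" for k l y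
  define m where "m l = mform n r (U l) (U l)" for l
  have U: "good n (U l)" if "l < n" for l using gu[OF that] by (simp add: U_def)
  have E: "good n (E k l)" if "k < n" "l < n" for k l using ge[OF that] by (simp add: E_def)
  have iP: "integrable ?G (\<lambda>y. P k l y * P k' l' y)" if "k < n" "l < n" "k' < n" "l' < n" for k l k' l'
    unfolding P_def by (intro gram_integrable U kern_gk r that)
  have PP: "(\<integral>y. P k l y * P k' l' y \<partial>?G) = jform n r k k' (U l) (U l') + mrate r * (if k = k' then mform n r (U l) (U l') else 0)"
    if "k < n" "l < n" "k' < n" "l' < n" for k l k' l'
    unfolding P_def by (intro gk_gram(1) U r that)
  \<comment> \<open>\<open>korn_ibp\<close> with b = r / (1 - r): its factor (1 + b) x_k - a_k is
    that of \<open>gk\<close> for 1 / (1 - r), because 1 + b = 1 / (1 - r).\<close>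
  have TE: "(\<integral>x. E k l x * gker n r x y \<partial>?G) = (P k l y + P l k y) / 2" if k: "k < n" and l: "l < n" for k l y
  proof -
    define c0 where "c0 = exp (- (real n / 4 * ln (1 - r\<^sup>2)))"
    define a where "a i = sqrt (mrate r) * y i" for i
    define b where "b = r / (1 - r)"
    have b: "b \<ge> 0" "1 + b = 1 / (1 - r)" using r by (auto simp: b_def field_simps)
    have gkr: "gker n r x y = c0 * expq n a b x" for x
      by (simp add: gker_def c0_def a_def[abs_def] b_def)
    have Pk: "P k l y = c0 * (\<integral>x. expq n a b x * (((1 + b) * x k - a k) * u x l) \<partial>?G)" for k l
    proof -
      have "U l x * gk n r (1 / (1 - r)) k x y = c0 * (expq n a b x * (((1 + b) * x k - a k) * u x l))" for x
        unfolding gk_def gkr b(2) by (simp add: U_def a_def)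
      then show ?thesis unfolding P_def by simp
    qed
    have "(\<integral>x. E k l x * gker n r x y \<partial>?G) = c0 * (\<integral>x. expq n a b x * sym_grad u x k l \<partial>?G)"
      unfolding gkr E_def by (subst integral_mult_right_zero[symmetric]) (simp add: mult_ac)
    then show ?thesis
      using korn_ibp[OF u gu ge b(1) k l, of a] unfolding Pk by (simp add: field_simps)
  qed
  have mE: "4 * mform n r (E k l) (E k l) = (\<integral>y. P k l y * P k l y \<partial>?G) + 2 * (\<integral>y. P k l y * P l k y \<partial>?G) + (\<integral>y. P l k y * P l k y \<partial>?G)"
    if "k < n" "l < n" for k l
  proof -
    have "4 * mform n r (E k l) (E k l) = (\<integral>y. 4 * ((P k l y + P l k y) / 2 * ((P k l y + P l k y) / 2)) \<partial>?G)"
      unfolding mform_gram[OF E[OF that] E[OF that] r] TE[OF that] by simp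
    also have "\<dots> = (\<integral>y. P k l y * P k l y + 2 * (P k l y * P l k y) + P l k y * P l k y \<partial>?G)"
      by (intro Bochner_Integration.integral_cong refl) (simp add: algebra_simps)
    also have "\<dots> = (\<integral>y. P k l y * P k l y \<partial>?G) + 2 * (\<integral>y. P k l y * P l k y \<partial>?G) + (\<integral>y. P l k y * P l k y \<partial>?G)"
      using iP[OF that that] iP[OF that that(2) that(1)] iP[OF that(2) that(1) that(2) that(1)] by simp
    finally show ?thesis .
  qed
  define S1 where "S1 = (\<Sum>k<n. \<Sum>l<n. \<integral>y. P k l y * P k l y \<partial>?G)"
  define S2 where "S2 = (\<Sum>k<n. \<Sum>l<n. \<integral>y. P k l y * P l k y \<partial>?G)"
  define \<phi> where "\<phi> = (\<Sum>l<n. m l)"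
  have sum: "2 * (\<Sum>k<n. \<Sum>l<n. mform n r (E k l) (E k l)) = S1 + S2"
  proof -
    have "(\<Sum>k<n. \<Sum>l<n. 4 * mform n r (E k l) (E k l)) =
      (\<Sum>k<n. \<Sum>l<n. (\<integral>y. P k l y * P k l y \<partial>?G) + 2 * (\<integral>y. P k l y * P l k y \<partial>?G) + (\<integral>y. P l k y * P l k y \<partial>?G))"
      by (intro sum.cong refl) (auto simp: mE)
    also have "\<dots> = S1 + 2 * S2 + (\<Sum>k<n. \<Sum>l<n. \<integral>y. P l k y * P l k y \<partial>?G)"
      by (simp add: sum.distrib S1_def S2_def sum_distrib_left)
    also have "(\<Sum>k<n. \<Sum>l<n. \<integral>y. P l k y * P l k y \<partial>?G) = S1"
      unfolding S1_def by (rule sum.swap)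
    finally have "4 * (\<Sum>k<n. \<Sum>l<n. mform n r (E k l) (E k l)) = 2 * (S1 + S2)"
      by (simp add: sum_distrib_left)
    then show ?thesis by simp
  qed
  \<comment> \<open>Summed over k, the diagonal kernels of \<open>jform\<close> give the polynomial
    part of \<open>dmehler\<close>; the n diagonal terms with \<open>mrate\<close> give the
    derivative of the normalizing factor.\<close>
  have S1: "S1 = (\<Sum>l<n. \<integral>(x, z). U l x * U l z * dmehler n r x z \<partial>GG n)"
  proof -
    have "(\<Sum>k<n. \<integral>y. P k l y * P k l y \<partial>?G) = (\<integral>(x, z). U l x * U l z * dmehler n r x z \<partial>GG n)" if l: "l < n" for l
    proof -
      let ?J = "\<lambda>k w. case w of (x, z) \<Rightarrow> U l x * U l z * ((x k - r * z k) * (z k - r * x k) / (1 - r\<^sup>2)\<^sup>2 * mehler n r x z)"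
      have iJ: "integrable (GG n) (?J k)" if "k < n" for k
        by (intro good_pair_integrable U l kern_jform r' that)
      have iM: "integrable (GG n) (\<lambda>w. case w of (x, z) \<Rightarrow> U l x * U l z * mehler n r x z)"
        by (intro mform_integrable U l r')
      have "(\<Sum>k<n. \<integral>y. P k l y * P k l y \<partial>?G) = (\<Sum>k<n. jform n r k k (U l) (U l)) + real n * (mrate r * m l)"
        using l by (simp add: PP sum.distrib m_def)
      also have "\<dots> = (\<integral>w. (\<Sum>k<n. ?J k w) + real n * mrate r * (case w of (x, z) \<Rightarrow> U l x * U l z * mehler n r x z) \<partial>GG n)"
      proof -
        have iS: "integrable (GG n) (\<lambda>w. \<Sum>k<n. ?J k w)" by (intro Bochner_Integration.integrable_sum iJ) simp
        have 1: "(\<integral>w. (\<Sum>k<n. ?J k w) + real n * mrate r * (case w of (x, z) \<Rightarrow> U l x * U l z * mehler n r x z) \<partial>GG n) =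
          (\<integral>w. (\<Sum>k<n. ?J k w) \<partial>GG n) + (\<integral>w. real n * mrate r * (case w of (x, z) \<Rightarrow> U l x * U l z * mehler n r x z) \<partial>GG n)"
          by (rule Bochner_Integration.integral_add[OF iS integrable_mult_right]) (rule iM)
        have 2: "(\<integral>w. (\<Sum>k<n. ?J k w) \<partial>GG n) = (\<Sum>k<n. \<integral>w. ?J k w \<partial>GG n)"
          by (intro Bochner_Integration.integral_sum iJ) simp
        show ?thesis unfolding 1 2 jform_def m_def mform_def by simp
      qed
      also have "\<dots> = (\<integral>(x, z). U l x * U l z * dmehler n r x z \<partial>GG n)"
      proof (intro Bochner_Integration.integral_cong refl, clarify)
        fix x z :: "nat \<Rightarrow> real"
        have a: "(\<Sum>k<n. (x k - r * z k) * (z k - r * x k)) = (1 + r\<^sup>2) * dot n x z - r * (sqn n x + sqn n z)"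
          by (simp add: dot_def sum_distrib_left sum.distrib[symmetric] sum_subtractf[symmetric] algebra_simps power2_eq_square)
        have b: "(\<Sum>k<n. U l x * U l z * ((x k - r * z k) * (z k - r * x k) / (1 - r\<^sup>2)\<^sup>2 * mehler n r x z)) =
          U l x * U l z * ((\<Sum>k<n. (x k - r * z k) * (z k - r * x k)) / (1 - r\<^sup>2)\<^sup>2 * mehler n r x z)"
          by (simp add: sum_distrib_left sum_distrib_right sum_divide_distrib)
        have c: "W * (p * M) + N * (q / D) * (W * M) = W * ((p + N * q / D) * M)" for W p M N q D :: real
          by (simp add: distrib_left distrib_right)
        show "(\<Sum>k<n. U l x * U l z * ((x k - r * z k) * (z k - r * x k) / (1 - r\<^sup>2)\<^sup>2 * mehler n r x z)) +
           real n * mrate r * (U l x * U l z * mehler n r x z) = U l x * U l z * dmehler n r x z"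
          unfolding dmehler_def mrate_def b a by (rule c)
      qed
      finally show ?thesis .
    qed
    then show ?thesis unfolding S1_def by (subst sum.swap) simp
  qed
  define X where "X = (\<Sum>k<n. \<Sum>l<n. jform n r k l (U l) (U k))"
  have delta: "(\<Sum>k<n. \<Sum>l<n. mrate r * (if k = l then mform n r (U l) (U k) else 0)) = mrate r * \<phi>"
    by (simp add: \<phi>_def m_def sum_distrib_left[symmetric] if_distrib cong: if_cong)
  have S2: "S2 = X + mrate r * \<phi>"
  proof -
    have "S2 = (\<Sum>k<n. \<Sum>l<n. jform n r k l (U l) (U k) + mrate r * (if k = l then mform n r (U l) (U k) else 0))"
      unfolding S2_def by (intro sum.cong refl) (auto simp: PP)
    then show ?thesis by (simp only: sum.distrib delta X_def)
  qed
  \<comment> \<open>The sum of the Q l is formally minus the Gaussian divergence of u smoothed by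
    \<open>gker\<close>. Its squared norm contains X with exchanged indices, which bounds X from
    below.\<close>
  have "0 \<le> r\<^sup>2 * X + mrate r * \<phi>"
  proof -
    define Q where "Q l y = (\<integral>x. U l x * gk n r (r / (1 - r)) l x y \<partial>?G)" for l y
    have iQ: "integrable ?G (\<lambda>y. Q l y * Q k y)" if "k < n" "l < n" for k l
      unfolding Q_def by (intro gram_integrable U kern_gk r that)
    have QQ: "(\<integral>y. Q l y * Q k y \<partial>?G) = r\<^sup>2 * jform n r k l (U l) (U k) + mrate r * (if k = l then mform n r (U l) (U k) else 0)"
      if "k < n" "l < n" for k l
      using gk_gram(2)[OF U[OF that(2)] U[OF that(1)] r that(2) that(1)] unfolding Q_def by (simp add: eq_commute[of k l])
    have "0 \<le> (\<integral>y. (\<Sum>l<n. Q l y) * (\<Sum>k<n. Q k y) \<partial>?G)" by (rule Bochner_Integration.integral_nonneg) simp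
    also have "\<dots> = (\<integral>y. (\<Sum>k<n. \<Sum>l<n. 1 * (Q l y * Q k y)) \<partial>?G)"
      unfolding sum_product by (subst sum.swap) simp
    also have "\<dots> = (\<Sum>k<n. \<Sum>l<n. 1 * (\<integral>y. Q l y * Q k y \<partial>?G))"
      by (rule integral_double_sum) (rule iQ)
    also have "\<dots> = (\<Sum>k<n. \<Sum>l<n. r\<^sup>2 * jform n r k l (U l) (U k) + mrate r * (if k = l then mform n r (U l) (U k) else 0))"
      by (intro sum.cong refl) (auto simp: QQ)
    also have "\<dots> = r\<^sup>2 * X + mrate r * \<phi>"
      by (simp only: sum.distrib delta X_def sum_distrib_left)
    finally show ?thesis .
  qed
  then have "0 \<le> (r\<^sup>2 * X + mrate r * \<phi>) / r\<^sup>2" by simp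
  also have "\<dots> = X + mrate r * \<phi> / r\<^sup>2" using r by (simp add: add_divide_distrib)
  finally have "X \<ge> - (mrate r * \<phi> / r\<^sup>2)" by simp
  \<comment> \<open>Since mrate r = r / (1 - r^2), the two \<open>mrate\<close> terms combine to
    exactly -1 / r; this produces the quotient of the form by r in the differential
    inequality.\<close>
  moreover have "mrate r * \<phi> - mrate r * \<phi> / r\<^sup>2 = - (\<phi> / r)"
  proof -
    have "mrate r * (1 - r\<^sup>2) = r" using d by (simp add: mrate_def)
    then have "mrate r * r\<^sup>2 - mrate r = - r" by (simp add: right_diff_distrib)
    moreover have "(K - K / r\<^sup>2) * r\<^sup>2 = K * r\<^sup>2 - K" for K using r by (simp add: left_diff_distrib)
    moreover have "- (1 / r) * r\<^sup>2 = - r" using r by (simp add: power2_eq_square)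
    ultimately have "(mrate r - mrate r / r\<^sup>2) * r\<^sup>2 = - (1 / r) * r\<^sup>2" by simp
    then have "mrate r - mrate r / r\<^sup>2 = - (1 / r)" using r by (metis mult_right_cancel less_irrefl power_not_zero)
    then have "(mrate r - mrate r / r\<^sup>2) * \<phi> = - (1 / r) * \<phi>" by (simp only:)
    then show ?thesis by (simp add: left_diff_distrib)
  qed
  ultimately have "S2 \<ge> - (\<phi> / r)" unfolding S2 by linarith
  then have "S1 - \<phi> / r \<le> 2 * (\<Sum>k<n. \<Sum>l<n. mform n r (E k l) (E k l))" unfolding sum by linarith
  then show ?thesis unfolding S1 \<phi>_def m_def U_def E_def .
qed

lemma mform_am:
  assumes f: "good n f" and g: "good n g" and r: "0 < r" "r < 1"
  shows "2 * mform n r f g \<le> mform n r f f + mform n r g g"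
proof -
  let ?G = "std_gaussian n"
  define F where "F y = (\<integral>x. f x * gker n r x y \<partial>?G)" for y
  define H where "H y = (\<integral>x. g x * gker n r x y \<partial>?G)" for y
  note K = kern_gker[OF r]
  have i: "integrable ?G (\<lambda>y. F y * F y)" "integrable ?G (\<lambda>y. F y * H y)" "integrable ?G (\<lambda>y. H y * H y)"
    unfolding F_def H_def by (intro gram_integrable f g K)+
  have "0 \<le> (\<integral>y. (F y - H y)\<^sup>2 \<partial>?G)" by (rule Bochner_Integration.integral_nonneg) simp
  also have "\<dots> = (\<integral>y. F y * F y - 2 * (F y * H y) + H y * H y \<partial>?G)"
    by (intro Bochner_Integration.integral_cong refl) (simp add: power2_eq_square algebra_simps)
  also have "\<dots> = mform n r f f - 2 * mform n r f g + mform n r g g"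
    using i unfolding mform_gram[OF f f r] mform_gram[OF f g r] mform_gram[OF g g r] F_def[symmetric] H_def[symmetric] by simp
  finally show ?thesis by simp
qed

text \<open>The kernel is moved onto the bounded continuous factor: by Mehler's formula P_r g tends
  to g pointwise with the uniform bound N, so an integrable f is enough for dominated
  convergence.\<close>

lemma mform_limit:
  assumes f: "good n f" and g: "continuous_on (rn n) g" and N: "\<And>x. \<bar>g x\<bar> \<le> N"
    and r: "\<And>k. \<bar>r k\<bar> < 1" and r1: "r \<longlonglongrightarrow> 1"
  shows "(\<lambda>k. mform n (r k) f g) \<longlonglongrightarrow> (\<integral>x. f x * g x \<partial>std_gaussian n)"
proof -
  let ?G = "std_gaussian n"
  interpret G: prob_space ?G by (rule prob_space_std_gaussian)
  have gm[measurable]: "g \<in> borel_measurable (borel_rn n)" by (rule continuous_imp_measurable[OF g])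
  note fm[measurable] = good_measurable[OF f]
  have N0: "N \<ge> 0" using N[of undefined] by linarith
  have ig: "integrable ?G (\<lambda>x. (g x)\<^sup>2)"
  proof (rule Bochner_Integration.integrable_bound[of _ "\<lambda>_. N\<^sup>2"])
    show "AE x in ?G. norm ((g x)\<^sup>2) \<le> norm (N\<^sup>2)"
    proof (rule AE_I2)
      fix x
      have "\<bar>g x\<bar>\<^sup>2 \<le> N\<^sup>2" using N[of x] by (intro power_mono) auto
      then show "norm ((g x)\<^sup>2) \<le> norm (N\<^sup>2)" by simp
    qed
  qed auto
  have gg: "good n g" by (rule good_L2[OF gm ig])
  define s where "s k = sqrt (1 - (r k)\<^sup>2)" for k
  have s0: "s \<longlonglongrightarrow> 0"
  proof -
    have "(\<lambda>k. sqrt (1 - (r k)\<^sup>2)) \<longlonglongrightarrow> sqrt (1 - 1\<^sup>2)" by (intro tendsto_intros r1)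
    then show ?thesis by (simp add: s_def[abs_def])
  qed
  have meas: "(\<lambda>y. g (lin n a x b y)) \<in> borel_measurable ?G" if "x \<in> rn n" for a b x
    using that by measurable
  have inner: "(\<lambda>k. \<integral>y. g (lin n (r k) x (s k) y) \<partial>?G) \<longlonglongrightarrow> g x" if x: "x \<in> rn n" for x
  proof -
    have "(\<lambda>k. \<integral>y. g (lin n (r k) x (s k) y) \<partial>?G) \<longlonglongrightarrow> (\<integral>y. g x \<partial>?G)"
    proof (rule integral_dominated_convergence[where w = "\<lambda>_. N"])
      show "AE y in ?G. (\<lambda>k. g (lin n (r k) x (s k) y)) \<longlonglongrightarrow> g x"
      proof (rule AE_I2)
        fix y
        have "(\<lambda>k. lin n (r k) x (s k) y) \<longlonglongrightarrow> x"
        proof (rule tendsto_extensional[OF _ x])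
          fix i assume i: "i < n"
          have "(\<lambda>k. r k * x i + s k * y i) \<longlonglongrightarrow> 1 * x i + 0 * y i" by (intro tendsto_intros r1 s0)
          then show "(\<lambda>k. lin n (r k) x (s k) y i) \<longlonglongrightarrow> x i" using i by simp
        qed simp
        then show "(\<lambda>k. g (lin n (r k) x (s k) y)) \<longlonglongrightarrow> g x"
          by (intro continuous_on_tendsto_compose[OF g]) (use x in auto)
      qed
      show "AE y in ?G. norm (g (lin n (r k) x (s k) y)) \<le> N" for k using N by auto
      show "(\<lambda>y. g (lin n (r k) x (s k) y)) \<in> borel_measurable ?G" for k by (rule meas[OF x])
    qed auto
    then show ?thesis using G.prob_space by simp
  qed
  have mf: "mform n (r k) f g = (\<integral>x. f x * (\<integral>y. g (lin n (r k) x (s k) y) \<partial>?G) \<partial>?G)" for k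
    unfolding mform_fst(1)[OF f gg r] mehler_shift[OF r gm] s_def ..
  have mi: "integrable ?G (\<lambda>x. f x * (\<integral>y. g (lin n (r k) x (s k) y) \<partial>?G))" for k
    using mform_fst(2)[OF f gg r[of k]] unfolding mehler_shift[OF r gm] s_def .
  show ?thesis unfolding mf
  proof (rule integral_dominated_convergence[where w = "\<lambda>x. N * \<bar>f x\<bar>"])
    show "integrable ?G (\<lambda>x. N * \<bar>f x\<bar>)" using good_integrable[OF f] by simp
    show "AE x in ?G. (\<lambda>k. f x * (\<integral>y. g (lin n (r k) x (s k) y) \<partial>?G)) \<longlonglongrightarrow> f x * g x"
      by (rule AE_I2) (auto intro!: tendsto_mult_left inner)
    show "AE x in ?G. norm (f x * (\<integral>y. g (lin n (r k) x (s k) y) \<partial>?G)) \<le> N * \<bar>f x\<bar>" for k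
    proof (rule AE_I2)
      fix x assume "x \<in> space ?G"
      then have x: "x \<in> rn n" by simp
      have ign: "integrable ?G (\<lambda>y. g (lin n (r k) x (s k) y))"
        by (rule G.integrable_const_bound[where B = N]) (use N meas[OF x] in auto)
      have "\<bar>\<integral>y. g (lin n (r k) x (s k) y) \<partial>?G\<bar> \<le> (\<integral>y. \<bar>g (lin n (r k) x (s k) y)\<bar> \<partial>?G)"
        by (rule integral_abs_bound)
      also have "\<dots> \<le> (\<integral>y. N \<partial>?G)" using ign N by (intro integral_mono) auto
      also have "\<dots> = N" using G.prob_space by simp
      finally have "\<bar>\<integral>y. g (lin n (r k) x (s k) y) \<partial>?G\<bar> \<le> N" .
      then have "\<bar>f x\<bar> * \<bar>\<integral>y. g (lin n (r k) x (s k) y) \<partial>?G\<bar> \<le> \<bar>f x\<bar> * N" by (rule mult_left_mono) simp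
      then show "norm (f x * (\<integral>y. g (lin n (r k) x (s k) y) \<partial>?G)) \<le> N * \<bar>f x\<bar>" by (simp add: abs_mult mult.commute)
    qed
    show "(\<lambda>x. f x * (\<integral>y. g (lin n (r k) x (s k) y) \<partial>?G)) \<in> borel_measurable ?G" for k
      using mi[of k] by simp
  qed (measurable)
qed

text \<open>By \<open>korn_ibp\<close> with constant weight, vanishing first moments of u give e
  mean zero, so the spectral gap contributes a factor r on the right-hand side. They also make the
  form vanish to first order at r = 0, so its quotient by r starts from 0.\<close>

lemma gaussian_korn_flow:
  assumes u: "\<And>i. i < n \<Longrightarrow> differentiable_rn n (\<lambda>x. u x i)"
    and gu: "\<And>i. i < n \<Longrightarrow> good n (\<lambda>x. u x i)"
    and ie2: "\<And>i j. i < n \<Longrightarrow> j < n \<Longrightarrow> integrable (std_gaussian n) (\<lambda>x. (sym_grad u x i j)\<^sup>2)"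
    and m0: "\<And>i. i < n \<Longrightarrow> (\<integral>x. u x i \<partial>std_gaussian n) = 0"
    and m1: "\<And>i k. i < n \<Longrightarrow> k < n \<Longrightarrow> (\<integral>x. x k * u x i \<partial>std_gaussian n) = 0"
    and r: "0 < r" "r < 1"
  shows "(\<Sum>l<n. mform n r (\<lambda>x. u x l) (\<lambda>x. u x l)) \<le>
    2 * (\<Sum>k<n. \<Sum>l<n. \<integral>x. (sym_grad u x k l)\<^sup>2 \<partial>std_gaussian n)"
proof -
  let ?G = "std_gaussian n"
  note em[measurable] = sym_grad_measurable[OF u]
  have ge: "good n (\<lambda>x. sym_grad u x i j)" if "i < n" "j < n" for i j
    by (rule good_L2[OF em[OF _ that] ie2[OF that]])
  define E where "E = (\<Sum>k<n. \<Sum>l<n. \<integral>x. (sym_grad u x k l)\<^sup>2 \<partial>?G)"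
  have E0: "E \<ge> 0" unfolding E_def by (intro sum_nonneg Bochner_Integration.integral_nonneg) simp
  have e0: "(\<integral>x. sym_grad u x k l \<partial>?G) = 0" if "k < n" "l < n" for k l
  proof -
    have "expq n (\<lambda>_. 0) 0 x = 1" for x by (simp add: expq_def dot_def)
    then show ?thesis using korn_ibp[OF u gu ge order_refl that, of "\<lambda>_. 0"] m1 that by simp
  qed
  define \<phi> where "\<phi> s = (\<Sum>l<n. mform n s (\<lambda>x. u x l) (\<lambda>x. u x l))" for s
  define D where "D s = (\<Sum>l<n. \<integral>(x, z). u x l * u z l * dmehler n s x z \<partial>GG n)" for s
  have d\<phi>: "(\<phi> has_real_derivative D s) (at s)" if "\<bar>s\<bar> < 1" for s
    unfolding \<phi>_def[abs_def] D_def using that by (intro DERIV_sum mform_deriv(1) gu) auto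
  have \<phi>0: "\<phi> 0 = 0" unfolding \<phi>_def using gu m0 by (intro sum.neutral) (simp add: mform_0)
  have D0: "D 0 = 0"
    unfolding D_def
  proof (rule sum.neutral, rule ballI)
    fix l assume "l \<in> {..<n}"
    then have l: "l < n" by simp
    have ii: "integrable (GG n) (\<lambda>(x, z). (x k * u x l) * (z k * u z l))"
      and eq: "(\<integral>(x, z). (x k * u x l) * (z k * u z l) \<partial>GG n) = 0" if k: "k < n" for k
      using integral_pair_prod[OF psf_gaussian good_integrable[OF good_coord_mult[OF gu[OF l] k]] good_integrable[OF good_coord_mult[OF gu[OF l] k]]]
        m1[OF l k] by auto
    have "(\<integral>(x, z). u x l * u z l * dmehler n 0 x z \<partial>GG n) = (\<integral>w. (\<Sum>k<n. case w of (x, z) \<Rightarrow> (x k * u x l) * (z k * u z l)) \<partial>GG n)"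
    proof (intro Bochner_Integration.integral_cong refl, clarify)
      fix x z
      have "u x l * u z l * dmehler n 0 x z = u x l * u z l * dot n x z" by (simp add: dmehler_def)
      also have "\<dots> = (\<Sum>k<n. (x k * u x l) * (z k * u z l))"
        unfolding dot_def sum_distrib_left by (intro sum.cong refl) (simp only: mult_ac)
      finally show "u x l * u z l * dmehler n 0 x z = (\<Sum>k<n. (x k * u x l) * (z k * u z l))" .
    qed
    also have "\<dots> = (\<Sum>k<n. \<integral>(x, z). (x k * u x l) * (z k * u z l) \<partial>GG n)"
      by (rule Bochner_Integration.integral_sum) (use ii in auto)
    also have "\<dots> = 0" using eq by (intro sum.neutral) auto
    finally show "(\<integral>(x, z). u x l * u z l * dmehler n 0 x z \<partial>GG n) = 0" .
  qed
  have ineq: "D s - \<phi> s / s \<le> 2 * (s * E)" if s: "0 < s" "s < 1" for s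
  proof -
    have "D s - \<phi> s / s \<le> 2 * (\<Sum>k<n. \<Sum>l<n. mform n s (\<lambda>x. sym_grad u x k l) (\<lambda>x. sym_grad u x k l))"
      unfolding D_def \<phi>_def by (rule korn_mehler_ineq[OF u gu ge s])
    also have "\<dots> \<le> 2 * (\<Sum>k<n. \<Sum>l<n. s * (\<integral>x. (sym_grad u x k l)\<^sup>2 \<partial>?G))"
      by (intro mult_left_mono sum_mono mform_contraction(2) s em u ie2 e0) auto
    also have "\<dots> = 2 * (s * E)" by (simp add: E_def sum_distrib_left)
    finally show ?thesis .
  qed
  \<comment> \<open>Subtracting 2 E s integrates the right-hand side: by \<open>ineq\<close> the
    derivative of the quotient of \<phi> by s is at most 2 E.\<close>
  define \<psi> where "\<psi> s = \<phi> s / s - 2 * E * s" for s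
  have d\<psi>: "(\<psi> has_real_derivative ((D s - \<phi> s / s) / s - 2 * E)) (at s)" if s: "0 < s" "s < 1" for s
    unfolding \<psi>_def[abs_def] using s by (auto intro!: derivative_eq_intros d\<phi> simp: field_simps)
  have mono: "\<psi> r \<le> \<psi> e" if e: "0 < e" "e < r" for e
  proof (rule DERIV_nonpos_imp_nonincreasing[where f = \<psi> and a = e and b = r])
    fix x assume x: "e \<le> x" "x \<le> r"
    then have x1: "0 < x" "x < 1" using e r by auto
    have "(D x - \<phi> x / x) / x \<le> 2 * E"
      using ineq[OF x1] x1 by (simp add: divide_le_eq mult_ac)
    then show "\<exists>y. DERIV \<psi> x :> y \<and> y \<le> 0" using d\<psi>[OF x1] by (intro exI[of _ "(D x - \<phi> x / x) / x - 2 * E"]) auto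
  qed (use e in simp)
  have "((\<lambda>h. \<phi> h / h) \<longlongrightarrow> 0) (at 0)"
    using d\<phi>[of 0] by (simp add: DERIV_def \<phi>0 D0)
  then have lim: "((\<lambda>h. \<phi> h / h - 2 * E * h) \<longlongrightarrow> 0 - 2 * E * 0) (at_right 0)"
    by (intro tendsto_intros) (auto intro: tendsto_within_subset)
  have "\<psi> r \<le> 0"
  proof (rule tendsto_lowerbound[OF lim[simplified]])
    have "\<forall>\<^sub>F h in at_right 0. 0 < h \<and> h < r"
      using r(1) eventually_at_right_real[of 0 r] by simp
    then show "\<forall>\<^sub>F h in at_right 0. \<psi> r \<le> \<phi> h / h - 2 * E * h"
      by eventually_elim (use mono in \<open>auto simp: \<psi>_def\<close>)
  qed simp
  then have "\<phi> r \<le> 2 * E * r * r" using r by (simp add: \<psi>_def field_simps)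
  also have "\<dots> \<le> 2 * E * 1 * 1" using r E0 by (intro mult_mono) auto
  finally show ?thesis by (simp add: \<phi>_def E_def)
qed

section \<open>Truncation and the Gaussian Korn inequality\<close>

definition clamp_real :: "real \<Rightarrow> real \<Rightarrow> real" where
  "clamp_real N t = max (- N) (min N t)"

lemma clamp_real_bound: "0 \<le> N \<Longrightarrow> \<bar>clamp_real N t\<bar> \<le> N"
  by (auto simp: clamp_real_def)

lemma clamp_real_sq_le: "0 \<le> N \<Longrightarrow> (clamp_real N t)\<^sup>2 \<le> t * clamp_real N t"
proof -
  assume N: "0 \<le> N"
  have "0 \<le> (t - clamp_real N t) * clamp_real N t"
    using N unfolding clamp_real_def by (cases "t \<ge> 0") (auto simp: max_def min_def intro: mult_nonneg_nonneg mult_nonpos_nonpos mult_nonpos_nonneg)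
  then show ?thesis by (simp add: power2_eq_square left_diff_distrib)
qed

lemma clamp_real_abs_mono: "0 \<le> N \<Longrightarrow> N \<le> M \<Longrightarrow> \<bar>clamp_real N t\<bar> \<le> \<bar>clamp_real M t\<bar>"
  by (auto simp: clamp_real_def max_def min_def)

lemma clamp_real_eq: "\<bar>t\<bar> \<le> N \<Longrightarrow> clamp_real N t = t"
  by (auto simp: clamp_real_def)

text \<open>The limit r -> 1 needs a bounded partner, so u is paired with its truncation C: 2 <u,
  P_r C> <= <u, P_r u> + <C, P_r C> <= 2 E + |C|^2. In the limit, with |C|^2 <= <u, C>, one copy of
  |C|^2 cancels, and monotone convergence removes the truncation.\<close>

lemma gaussian_korn_core:
  assumes u: "\<And>i. i < n \<Longrightarrow> differentiable_rn n (\<lambda>x. u x i)"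
    and gu: "\<And>i. i < n \<Longrightarrow> good n (\<lambda>x. u x i)"
    and ie2: "\<And>i j. i < n \<Longrightarrow> j < n \<Longrightarrow> integrable (std_gaussian n) (\<lambda>x. (sym_grad u x i j)\<^sup>2)"
    and m0: "\<And>i. i < n \<Longrightarrow> (\<integral>x. u x i \<partial>std_gaussian n) = 0"
    and m1: "\<And>i k. i < n \<Longrightarrow> k < n \<Longrightarrow> (\<integral>x. x k * u x i \<partial>std_gaussian n) = 0"
  shows "(\<integral>\<^sup>+x. ennreal (\<Sum>l<n. (u x l)\<^sup>2) \<partial>std_gaussian n) \<le>
    ennreal (2 * (\<Sum>k<n. \<Sum>l<n. \<integral>x. (sym_grad u x k l)\<^sup>2 \<partial>std_gaussian n))"
proof -
  let ?G = "std_gaussian n"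
  interpret G: prob_space ?G by (rule prob_space_std_gaussian)
  define E where "E = (\<Sum>k<n. \<Sum>l<n. \<integral>x. (sym_grad u x k l)\<^sup>2 \<partial>?G)"
  have um[measurable]: "(\<lambda>x. u x l) \<in> borel_measurable (borel_rn n)" if "l < n" for l
    using good_measurable[OF gu[OF that]] .
  define C where "C N l x = clamp_real (real N) (u x l)" for N :: nat and l x
  have Cc: "continuous_on (rn n) (C N l)" if "l < n" for N l
    unfolding C_def[abs_def] clamp_real_def using differentiable_imp_continuous[OF u[OF that]]
    by (intro continuous_on_max continuous_on_min continuous_on_const)
  have Cm[measurable]: "C N l \<in> borel_measurable (borel_rn n)" if "l < n" for N l
    by (rule continuous_imp_measurable[OF Cc[OF that]])
  have Cb: "\<bar>C N l x\<bar> \<le> real N" for N l x unfolding C_def by (rule clamp_real_bound) simp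
  have Ci: "integrable ?G (\<lambda>x. (C N l x)\<^sup>2)" if "l < n" for N l
  proof (rule G.integrable_const_bound[where B = "(real N)\<^sup>2"])
    show "AE x in ?G. norm ((C N l x)\<^sup>2) \<le> (real N)\<^sup>2"
    proof (rule AE_I2)
      fix x
      have "\<bar>C N l x\<bar>\<^sup>2 \<le> (real N)\<^sup>2" by (intro power_mono Cb) simp
      then show "norm ((C N l x)\<^sup>2) \<le> (real N)\<^sup>2" by simp
    qed
  qed (use that in measurable)
  have gC: "good n (C N l)" if "l < n" for N l by (rule good_L2[OF Cm[OF that] Ci[OF that]])
  define r where "r k = 1 - 1 / (real k + 2)" for k :: nat
  have r: "0 < r k" "r k < 1" "\<bar>r k\<bar> < 1" for k by (auto simp: r_def field_simps abs_if)
  have r1: "r \<longlonglongrightarrow> 1"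
  proof -
    have "(\<lambda>k. 1 / (real k + 2)) \<longlonglongrightarrow> 0" by real_asymp
    then have "(\<lambda>k. 1 - 1 / (real k + 2)) \<longlonglongrightarrow> 1 - 0" by (intro tendsto_intros)
    then show ?thesis by (simp add: r_def[abs_def])
  qed
  have key: "(\<Sum>l<n. \<integral>x. (C N l x)\<^sup>2 \<partial>?G) \<le> 2 * E" for N
  proof -
    have lim: "(\<lambda>k. \<Sum>l<n. 2 * mform n (r k) (\<lambda>x. u x l) (C N l)) \<longlonglongrightarrow> (\<Sum>l<n. 2 * (\<integral>x. u x l * C N l x \<partial>?G))"
      by (intro tendsto_intros mform_limit[OF gu Cc Cb r(3) r1]) auto
    have le: "(\<Sum>l<n. 2 * mform n (r k) (\<lambda>x. u x l) (C N l)) \<le> 2 * E + (\<Sum>l<n. \<integral>x. (C N l x)\<^sup>2 \<partial>?G)" for k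
    proof -
      have "(\<Sum>l<n. 2 * mform n (r k) (\<lambda>x. u x l) (C N l)) \<le>
        (\<Sum>l<n. mform n (r k) (\<lambda>x. u x l) (\<lambda>x. u x l) + mform n (r k) (C N l) (C N l))"
        by (intro sum_mono mform_am gu gC r) auto
      also have "\<dots> \<le> (\<Sum>l<n. mform n (r k) (\<lambda>x. u x l) (\<lambda>x. u x l)) + (\<Sum>l<n. \<integral>x. (C N l x)\<^sup>2 \<partial>?G)"
        unfolding sum.distrib by (intro add_left_mono sum_mono mform_contraction(1) Cm Ci r) auto
      also have "\<dots> \<le> 2 * E + (\<Sum>l<n. \<integral>x. (C N l x)\<^sup>2 \<partial>?G)"
        unfolding E_def by (intro add_right_mono gaussian_korn_flow[OF u gu ie2 m0 m1 r(1,2)])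
      finally show ?thesis .
    qed
    have "(\<Sum>l<n. 2 * (\<integral>x. u x l * C N l x \<partial>?G)) \<le> 2 * E + (\<Sum>l<n. \<integral>x. (C N l x)\<^sup>2 \<partial>?G)"
      by (rule LIMSEQ_le_const2[OF lim]) (use le in blast)
    moreover have "(\<Sum>l<n. 2 * (\<integral>x. (C N l x)\<^sup>2 \<partial>?G)) \<le> (\<Sum>l<n. 2 * (\<integral>x. u x l * C N l x \<partial>?G))"
    proof (intro sum_mono mult_left_mono integral_mono Ci)
      fix l assume "l \<in> {..<n}"
      then have l: "l < n" by simp
      show "integrable ?G (\<lambda>x. u x l * C N l x)"
      proof (rule Bochner_Integration.integrable_bound)
        show "integrable ?G (\<lambda>x. real N * u x l)" using good_integrable[OF gu[OF l]] by simp
        show "AE x in ?G. norm (u x l * C N l x) \<le> norm (real N * u x l)"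
        proof (rule AE_I2)
          fix x
          show "norm (u x l * C N l x) \<le> norm (real N * u x l)"
            using mult_left_mono[OF Cb[of N l x], of "\<bar>u x l\<bar>"] by (simp add: abs_mult mult.commute)
        qed
      qed (use l in measurable)
      show "(C N l x)\<^sup>2 \<le> u x l * C N l x" for x
        unfolding C_def by (rule clamp_real_sq_le) simp
    qed auto
    ultimately show ?thesis by (simp add: sum_distrib_left[symmetric])
  qed
  have lim: "(\<lambda>N. \<integral>\<^sup>+x. ennreal (\<Sum>l<n. (C N l x)\<^sup>2) \<partial>?G) \<longlonglongrightarrow> (\<integral>\<^sup>+x. ennreal (\<Sum>l<n. (u x l)\<^sup>2) \<partial>?G)"
  proof (rule nn_integral_LIMSEQ)
    show "incseq (\<lambda>N x. ennreal (\<Sum>l<n. (C N l x)\<^sup>2))"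
    proof (intro incseq_SucI le_funI ennreal_leI sum_mono)
      fix N x l
      have "\<bar>C N l x\<bar> \<le> \<bar>C (Suc N) l x\<bar>" unfolding C_def by (rule clamp_real_abs_mono) auto
      then show "(C N l x)\<^sup>2 \<le> (C (Suc N) l x)\<^sup>2" by (simp add: abs_le_square_iff)
    qed
    show "(\<lambda>x. ennreal (\<Sum>l<n. (C N l x)\<^sup>2)) \<in> borel_measurable ?G" for N by measurable
    fix x
    have "(\<lambda>N. C N l x) \<longlonglongrightarrow> u x l" for l
    proof (rule tendsto_eventually)
      obtain N0 :: nat where "\<bar>u x l\<bar> \<le> real N0" using real_arch_simple by blast
      then have "C N l x = u x l" if "N \<ge> N0" for N
        unfolding C_def using that by (intro clamp_real_eq) (meson of_nat_le_iff order_trans)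
      then show "\<forall>\<^sub>F N in sequentially. C N l x = u x l" using eventually_sequentially by blast
    qed
    then show "(\<lambda>N. ennreal (\<Sum>l<n. (C N l x)\<^sup>2)) \<longlonglongrightarrow> ennreal (\<Sum>l<n. (u x l)\<^sup>2)"
      by (intro tendsto_ennrealI tendsto_intros)
  qed
  have le: "(\<integral>\<^sup>+x. ennreal (\<Sum>l<n. (C N l x)\<^sup>2) \<partial>?G) \<le> ennreal (2 * E)" for N
  proof -
    have "(\<integral>\<^sup>+x. ennreal (\<Sum>l<n. (C N l x)\<^sup>2) \<partial>?G) = ennreal (\<integral>x. (\<Sum>l<n. (C N l x)\<^sup>2) \<partial>?G)"
      by (intro nn_integral_eq_integral Bochner_Integration.integrable_sum Ci) (auto intro!: AE_I2 sum_nonneg)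
    also have "(\<integral>x. (\<Sum>l<n. (C N l x)\<^sup>2) \<partial>?G) = (\<Sum>l<n. \<integral>x. (C N l x)\<^sup>2 \<partial>?G)"
      by (intro Bochner_Integration.integral_sum Ci) auto
    also have "ennreal \<dots> \<le> ennreal (2 * E)" by (intro ennreal_leI key)
    finally show ?thesis .
  qed
  show ?thesis unfolding E_def[symmetric] by (rule LIMSEQ_le_const2[OF lim]) (use le in blast)
qed

text \<open>The linear part of u is split into a symmetric part S and a skew part A. Removing all of
  it gives v with zero first moments and energy lowered by |S|^2; u minus the skew map is v + S x,
  an orthogonal sum with squared norms |v|^2 and |S|^2.\<close>

lemma gaussian_korn:
  assumes uK: "u \<in> korn_class n (std_gaussian n)"
  shows "(INF a\<in>skew_maps n. L2sq_vec n (std_gaussian n) (\<lambda>x i. u x i - a x i))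
     \<le> ennreal 2 * L2sq_mat n (std_gaussian n) (sym_grad u)"
proof -
  let ?G = "std_gaussian n"
  have u: "\<And>i. i < n \<Longrightarrow> differentiable_rn n (\<lambda>x. u x i)"
    and u0: "\<And>i. i < n \<Longrightarrow> (\<integral>x. u x i \<partial>?G) = 0"
    and fin: "L2sq_mat n ?G (sym_grad u) < \<infinity>"
    using uK unfolding korn_class_def by (auto dest: has_bochner_integral_integral_eq)
  have gu: "good n (\<lambda>x. u x i)" if "i < n" for i by (rule korn_field_good[OF u fin that])
  have ie2: "integrable ?G (\<lambda>x. (sym_grad u x i j)\<^sup>2)" if "i < n" "j < n" for i j
    by (rule sym_grad_sq_integrable[OF u sets_std_gaussian fin that])
  have ge: "good n (\<lambda>x. sym_grad u x i j)" if "i < n" "j < n" for i j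
    by (rule good_L2[OF sym_grad_measurable[OF u that] ie2[OF that]])
  define L where "L i k = (\<integral>x. x k * u x i \<partial>?G)" for i k
  define S where "S i j = (L i j + L j i) / 2" for i j
  define A where "A i j = (L i j - L j i) / 2" for i j
  define v where "v x i = u x i + (\<Sum>k<n. - L i k * x k)" for x i
  define lin_S where "lin_S x i = (\<Sum>k<n. S i k * x k)" for x i
  have gradv: "has_gradient n (\<lambda>x. v x i) (\<lambda>j. pd j (\<lambda>x. u x i) x - L i j) x" if i: "i < n" and x: "x \<in> rn n" for i x
  proof -
    have "has_gradient n (\<lambda>x. v x i) (\<lambda>j. pd j (\<lambda>x. u x i) x + (\<Sum>k<n. - L i k * (if j = k then 1 else 0))) x"
      unfolding v_def by (intro has_gradient_add has_gradient_pd u i x has_gradient_sum has_gradient_cmult has_gradient_coord) auto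
    moreover have "(\<Sum>k<n. - L i k * (if j = k then 1 else 0)) = - L i j" if "j < n" for j
      using that by (simp add: if_distrib[of "\<lambda>c. _ * c"] cong: if_cong)
    ultimately show ?thesis by (subst has_gradient_cong[of n _ "\<lambda>j. pd j (\<lambda>x. u x i) x + (\<Sum>k<n. - L i k * (if j = k then 1 else 0))"]) auto
  qed
  have v: "differentiable_rn n (\<lambda>x. v x i)" if "i < n" for i
    unfolding differentiable_rn_def using gradv[OF that] by blast
  have ev: "sym_grad v x k l = sym_grad u x k l - S k l" if "x \<in> rn n" "k < n" "l < n" for x k l
  proof -
    have "pd k (\<lambda>y. v y l) x = pd k (\<lambda>y. u y l) x - L l k" "pd l (\<lambda>y. v y k) x = pd l (\<lambda>y. u y k) x - L k l"
      using that by (auto intro!: pd_eq[OF gradv])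
    then show ?thesis unfolding sym_grad_def S_def by (simp add: field_simps)
  qed
  have gv: "good n (\<lambda>x. v x i)" if "i < n" for i
    unfolding v_def by (intro good_add gu good_sum good_cmult good_coord that) auto
  have eS: "(\<integral>x. sym_grad u x k l \<partial>?G) = S k l" if "k < n" "l < n" for k l
  proof -
    have "expq n (\<lambda>_. 0) 0 x = 1" for x by (simp add: expq_def dot_def)
    then show ?thesis using korn_ibp[OF u gu ge order_refl that, of "\<lambda>_. 0"] by (simp add: S_def L_def)
  qed
  have iev: "integrable ?G (\<lambda>x. (sym_grad v x k l)\<^sup>2)"
    and eev: "(\<integral>x. (sym_grad v x k l)\<^sup>2 \<partial>?G) = (\<integral>x. (sym_grad u x k l)\<^sup>2 \<partial>?G) - (S k l)\<^sup>2"
    if kl: "k < n" "l < n" for k l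
  proof -
    interpret G: prob_space ?G by (rule prob_space_std_gaussian)
    have eq: "(sym_grad v x k l)\<^sup>2 = (sym_grad u x k l)\<^sup>2 - 2 * S k l * sym_grad u x k l + (S k l)\<^sup>2" if "x \<in> space ?G" for x
      using ev[OF _ kl, of x] that by (simp add: power2_diff)
    have i: "integrable ?G (\<lambda>x. (sym_grad u x k l)\<^sup>2 - 2 * S k l * sym_grad u x k l + (S k l)\<^sup>2)"
      using ie2[OF kl] good_integrable[OF ge[OF kl]] by simp
    then show "integrable ?G (\<lambda>x. (sym_grad v x k l)\<^sup>2)"
      by (subst Bochner_Integration.integrable_cong[OF refl eq]) auto
    have "(\<integral>x. (sym_grad v x k l)\<^sup>2 \<partial>?G) = (\<integral>x. (sym_grad u x k l)\<^sup>2 - 2 * S k l * sym_grad u x k l + (S k l)\<^sup>2 \<partial>?G)"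
      by (rule Bochner_Integration.integral_cong[OF refl eq])
    also have "\<dots> = (\<integral>x. (sym_grad u x k l)\<^sup>2 \<partial>?G) - 2 * S k l * S k l + (S k l)\<^sup>2"
      using ie2[OF kl] good_integrable[OF ge[OF kl]] eS[OF kl] G.prob_space by simp
    finally show "(\<integral>x. (sym_grad v x k l)\<^sup>2 \<partial>?G) = (\<integral>x. (sym_grad u x k l)\<^sup>2 \<partial>?G) - (S k l)\<^sup>2"
      by (simp add: power2_eq_square)
  qed
  have ix: "integrable ?G (\<lambda>x. x k)" if "k < n" for k using good_integrable[OF good_coord[OF that]] .
  have ixx: "integrable ?G (\<lambda>x. x k * x l)" if "k < n" "l < n" for k l
    using good_integrable[OF good_coord_mult[OF good_coord[OF that(2)] that(1)]] .
  have m0: "(\<integral>x. v x i \<partial>?G) = 0" if "i < n" for i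
  proof -
    have "(\<integral>x. v x i \<partial>?G) = (\<integral>x. u x i \<partial>?G) + (\<integral>x. (\<Sum>k<n. - L i k * x k) \<partial>?G)"
      unfolding v_def using good_integrable[OF gu[OF that]] ix
      by (intro Bochner_Integration.integral_add Bochner_Integration.integrable_sum integrable_mult_right) auto
    also have "(\<integral>x. (\<Sum>k<n. - L i k * x k) \<partial>?G) = (\<Sum>k<n. \<integral>x. - L i k * x k \<partial>?G)"
      by (intro Bochner_Integration.integral_sum integrable_mult_right ix) auto
    finally show ?thesis using that by (simp add: u0 gauss_first_moment)
  qed
  have m1: "(\<integral>x. x k * v x i \<partial>?G) = 0" if "i < n" "k < n" for i k
  proof -
    have "(\<integral>x. x k * v x i \<partial>?G) = (\<integral>x. x k * u x i + (\<Sum>j<n. - L i j * (x k * x j)) \<partial>?G)"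
      unfolding v_def by (intro Bochner_Integration.integral_cong refl) (simp add: distrib_left sum_distrib_left mult_ac)
    also have "\<dots> = (\<integral>x. x k * u x i \<partial>?G) + (\<integral>x. (\<Sum>j<n. - L i j * (x k * x j)) \<partial>?G)"
      using good_integrable[OF good_coord_mult[OF gu[OF that(1)] that(2)]] ixx that
      by (intro Bochner_Integration.integral_add Bochner_Integration.integrable_sum integrable_mult_right) auto
    also have "(\<integral>x. (\<Sum>j<n. - L i j * (x k * x j)) \<partial>?G) = (\<Sum>j<n. \<integral>x. - L i j * (x k * x j) \<partial>?G)"
      using that by (intro Bochner_Integration.integral_sum integrable_mult_right ixx) auto
    also have "\<dots> = (\<Sum>j<n. if k = j then - L i j else 0)"
      using that by (intro sum.cong refl) (auto simp: gauss_second_moment)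
    also have "\<dots> = - L i k" using that by simp
    finally show ?thesis by (simp add: L_def)
  qed
  define EE where "EE = (\<Sum>k<n. \<Sum>l<n. \<integral>x. (sym_grad u x k l)\<^sup>2 \<partial>?G)"
  define SS where "SS = (\<Sum>k<n. \<Sum>l<n. (S k l)\<^sup>2)"
  have SS0: "SS \<ge> 0" unfolding SS_def by (intro sum_nonneg) auto
  have ES: "EE - SS = (\<Sum>k<n. \<Sum>l<n. \<integral>x. (sym_grad v x k l)\<^sup>2 \<partial>?G)"
    unfolding EE_def SS_def sum_subtractf[symmetric] by (intro sum.cong refl) (simp only: eev lessThan_iff)
  have core: "(\<integral>\<^sup>+x. ennreal (\<Sum>l<n. (v x l)\<^sup>2) \<partial>?G) \<le> ennreal (2 * (EE - SS))"
    unfolding ES by (rule gaussian_korn_core[OF v gv iev m0 m1])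
  have ES0: "EE - SS \<ge> 0"
    unfolding ES by (intro sum_nonneg Bochner_Integration.integral_nonneg) simp
  have iv: "integrable ?G (\<lambda>x. (v x i)\<^sup>2)" if i: "i < n" for i
  proof (rule integrableI_bounded)
    have "(\<integral>\<^sup>+x. ennreal (norm ((v x i)\<^sup>2)) \<partial>?G) \<le> (\<integral>\<^sup>+x. ennreal (\<Sum>l<n. (v x l)\<^sup>2) \<partial>?G)"
    proof (intro nn_integral_mono ennreal_leI)
      fix x
      show "norm ((v x i)\<^sup>2) \<le> (\<Sum>l<n. (v x l)\<^sup>2)"
        using i member_le_sum[of i "{..<n}" "\<lambda>l. (v x l)\<^sup>2"] by simp
    qed
    also have "\<dots> < \<infinity>" using core by (rule le_less_trans) simp
    finally show "(\<integral>\<^sup>+x. ennreal (norm ((v x i)\<^sup>2)) \<partial>?G) < \<infinity>" .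
    show "(\<lambda>x. (v x i)\<^sup>2) \<in> borel_measurable ?G" using good_measurable[OF gv[OF i]] by measurable
  qed
  have sv: "(\<Sum>l<n. \<integral>x. (v x l)\<^sup>2 \<partial>?G) \<le> 2 * (EE - SS)"
  proof -
    have "(\<integral>\<^sup>+x. ennreal (\<Sum>l<n. (v x l)\<^sup>2) \<partial>?G) = ennreal (\<integral>x. (\<Sum>l<n. (v x l)\<^sup>2) \<partial>?G)"
      by (intro nn_integral_eq_integral Bochner_Integration.integrable_sum iv) (auto intro!: AE_I2 sum_nonneg)
    also have "(\<integral>x. (\<Sum>l<n. (v x l)\<^sup>2) \<partial>?G) = (\<Sum>l<n. \<integral>x. (v x l)\<^sup>2 \<partial>?G)"
      by (intro Bochner_Integration.integral_sum iv) auto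
    finally show ?thesis using core ES0 by (simp add: ennreal_le_iff)
  qed
  define a where "a x = (\<lambda>i\<in>{..<n}. \<Sum>j<n. A i j * x j)" for x
  have a: "a \<in> skew_maps n"
    unfolding skew_maps_def a_def[abs_def] by (rule CollectI, rule exI[of _ A]) (auto simp: A_def field_simps)
  have ua: "u x i - a x i = v x i + lin_S x i" if "i < n" for x i
  proof -
    have "lin_S x i - (\<Sum>k<n. L i k * x k) + (\<Sum>j<n. A i j * x j) = 0"
      unfolding lin_S_def sum_subtractf[symmetric] sum.distrib[symmetric]
      by (intro sum.neutral) (simp add: S_def A_def field_simps)
    then show ?thesis using that by (simp add: v_def a_def sum_negf)
  qed
  have iS: "integrable ?G (\<lambda>x. (lin_S x i)\<^sup>2)" and eSS: "(\<integral>x. (lin_S x i)\<^sup>2 \<partial>?G) = (\<Sum>k<n. (S i k)\<^sup>2)"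
    and ivS: "integrable ?G (\<lambda>x. v x i * lin_S x i)" and evS: "(\<integral>x. v x i * lin_S x i \<partial>?G) = 0"
    if i: "i < n" for i
  proof -
    have e1: "(lin_S x i)\<^sup>2 = (\<Sum>k<n. \<Sum>l<n. (S i k * S i l) * (x k * x l))" for x
      unfolding lin_S_def power2_eq_square sum_product by (intro sum.cong refl) (simp only: mult_ac)
    show "integrable ?G (\<lambda>x. (lin_S x i)\<^sup>2)"
      unfolding e1 by (intro Bochner_Integration.integrable_sum integrable_mult_right ixx) auto
    have "(\<integral>x. (lin_S x i)\<^sup>2 \<partial>?G) = (\<Sum>k<n. \<Sum>l<n. (S i k * S i l) * (\<integral>x. x k * x l \<partial>?G))"
      unfolding e1 by (rule integral_double_sum) (rule ixx)
    also have "\<dots> = (\<Sum>k<n. \<Sum>l<n. if k = l then S i k * S i l else 0)"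
      by (intro sum.cong refl) (auto simp: gauss_second_moment)
    also have "\<dots> = (\<Sum>k<n. (S i k)\<^sup>2)"
      by (intro sum.cong refl) (auto simp: power2_eq_square)
    finally show "(\<integral>x. (lin_S x i)\<^sup>2 \<partial>?G) = (\<Sum>k<n. (S i k)\<^sup>2)" .
    have e2: "v x i * lin_S x i = (\<Sum>k<n. S i k * (x k * v x i))" for x
      unfolding lin_S_def sum_distrib_left by (intro sum.cong refl) (simp only: mult_ac)
    have ixv: "integrable ?G (\<lambda>x. S i k * (x k * v x i))" if "k < n" for k
      by (intro integrable_mult_right good_integrable good_coord_mult gv i that)
    show "integrable ?G (\<lambda>x. v x i * lin_S x i)"
      unfolding e2 by (intro Bochner_Integration.integrable_sum ixv) auto
    have "(\<integral>x. v x i * lin_S x i \<partial>?G) = (\<Sum>k<n. \<integral>x. S i k * (x k * v x i) \<partial>?G)"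
      unfolding e2 by (intro Bochner_Integration.integral_sum ixv) auto
    then show "(\<integral>x. v x i * lin_S x i \<partial>?G) = 0" using m1[OF i] by simp
  qed
  have "L2sq_vec n ?G (\<lambda>x i. u x i - a x i) = (\<integral>\<^sup>+x. ennreal (\<Sum>i<n. (v x i)\<^sup>2 + 2 * (v x i * lin_S x i) + (lin_S x i)\<^sup>2) \<partial>?G)"
    unfolding L2sq_vec_def
    by (intro nn_integral_cong arg_cong[where f = ennreal] sum.cong refl) (simp add: ua power2_sum mult_ac)
  also have "\<dots> = ennreal (\<integral>x. (\<Sum>i<n. (v x i)\<^sup>2 + 2 * (v x i * lin_S x i) + (lin_S x i)\<^sup>2) \<partial>?G)"
  proof (intro nn_integral_eq_integral Bochner_Integration.integrable_sum Bochner_Integration.integrable_add integrable_mult_right iv ivS iS)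
    show "AE x in ?G. 0 \<le> (\<Sum>i<n. (v x i)\<^sup>2 + 2 * (v x i * lin_S x i) + (lin_S x i)\<^sup>2)"
    proof (intro AE_I2 sum_nonneg)
      fix x i
      have "0 \<le> (v x i + lin_S x i)\<^sup>2" by simp
      then show "0 \<le> (v x i)\<^sup>2 + 2 * (v x i * lin_S x i) + (lin_S x i)\<^sup>2" by (simp add: power2_sum mult_ac)
    qed
  qed auto
  also have "(\<integral>x. (\<Sum>i<n. (v x i)\<^sup>2 + 2 * (v x i * lin_S x i) + (lin_S x i)\<^sup>2) \<partial>?G) =
    (\<Sum>i<n. \<integral>x. (v x i)\<^sup>2 + 2 * (v x i * lin_S x i) + (lin_S x i)\<^sup>2 \<partial>?G)"
    by (intro Bochner_Integration.integral_sum Bochner_Integration.integrable_add integrable_mult_right iv ivS iS) auto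
  also have "\<dots> = (\<Sum>i<n. (\<integral>x. (v x i)\<^sup>2 \<partial>?G) + (\<Sum>k<n. (S i k)\<^sup>2))"
    using iv ivS iS by (intro sum.cong refl) (simp add: evS eSS)
  also have "\<dots> = (\<Sum>i<n. \<integral>x. (v x i)\<^sup>2 \<partial>?G) + SS" by (simp add: sum.distrib SS_def)
  \<comment> \<open>Restoring S costs |S|^2 in the norm but saved 2 |S|^2 in the energy.\<close>
  also have "ennreal \<dots> \<le> ennreal (2 * EE)"
    using sv SS0 by (intro ennreal_leI) simp
  also have "\<dots> = ennreal 2 * L2sq_mat n ?G (sym_grad u)"
  proof -
    have "L2sq_mat n ?G (sym_grad u) = ennreal (\<integral>x. (\<Sum>i<n. \<Sum>j<n. (sym_grad u x i j)\<^sup>2) \<partial>?G)"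
      unfolding L2sq_mat_def by (intro nn_integral_eq_integral Bochner_Integration.integrable_sum ie2) (auto intro!: AE_I2 sum_nonneg)
    also have "(\<integral>x. (\<Sum>i<n. \<Sum>j<n. (sym_grad u x i j)\<^sup>2) \<partial>?G) = EE"
      unfolding EE_def using integral_double_sum[of n ?G "\<lambda>i j x. (sym_grad u x i j)\<^sup>2" "\<lambda>_ _. 1"] ie2 by simp
    finally show ?thesis by (simp add: ennreal_mult')
  qed
  finally have "L2sq_vec n ?G (\<lambda>x i. u x i - a x i) \<le> ennreal 2 * L2sq_mat n ?G (sym_grad u)" .
  then show ?thesis using a by (meson INF_lower2)
qed

lemma C_PK_gaussian_le: "C_PK n (std_gaussian n) \<le> 1"
proof -
  have "C_PK n (std_gaussian n) \<le> ereal 1"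
    unfolding C_PK_def
  proof (rule Inf_lower, rule CollectI, intro exI[of _ 1] conjI ballI)
    fix u assume "u \<in> korn_class n (std_gaussian n)"
    from gaussian_korn[OF this] show "(INF a\<in>skew_maps n. L2sq_vec n (std_gaussian n) (\<lambda>x i. u x i - a x i))
       \<le> ennreal (2 * 1) * L2sq_mat n (std_gaussian n) (sym_grad u)" by simp
  qed auto
  then show ?thesis by (simp add: one_ereal_def)
qed

section \<open>The extremal fields\<close>

lemma has_gradient_coord_prod:
  assumes x: "x \<in> rn n" and i: "i < n" and j: "j < n"
  shows "has_gradient n (\<lambda>y. y i * y j) (\<lambda>k. (if k = i then x j else 0) + (if k = j then x i else 0)) x"
proof (rule has_gradient_quadratic[OF x, where K = 1])
  fix y :: "nat \<Rightarrow> real" assume "y \<in> rn n"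
  have "(\<Sum>k<n. ((if k = i then x j else 0) + (if k = j then x i else 0)) * (y k - x k)) = x j * (y i - x i) + x i * (y j - x j)"
    using i j by (simp add: distrib_right sum.distrib if_distrib[of "\<lambda>c. c * _"] cong: if_cong)
  then have "y i * y j - x i * x j - (\<Sum>k<n. ((if k = i then x j else 0) + (if k = j then x i else 0)) * (y k - x k)) = (y i - x i) * (y j - x j)"
    by (simp add: algebra_simps)
  moreover have "\<bar>(y i - x i) * (y j - x j)\<bar> \<le> (\<Sum>k<n. (y k - x k)\<^sup>2)"
  proof -
    have *: "(y k - x k)\<^sup>2 \<le> (\<Sum>k<n. (y k - x k)\<^sup>2)" if "k < n" for k
      by (rule member_le_sum) (use that in auto)
    have "0 \<le> (\<bar>y i - x i\<bar> - \<bar>y j - x j\<bar>)\<^sup>2" by simp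
    then have "2 * \<bar>(y i - x i) * (y j - x j)\<bar> \<le> (y i - x i)\<^sup>2 + (y j - x j)\<^sup>2"
      by (simp add: power2_diff abs_mult)
    then show ?thesis using *[OF i] *[OF j] by linarith
  qed
  ultimately show "\<bar>y i * y j - x i * x j - (\<Sum>k<n. ((if k = i then x j else 0) + (if k = j then x i else 0)) * (y k - x k))\<bar>
      \<le> 1 * (\<Sum>k<n. (y k - x k)\<^sup>2)" by simp
qed

text \<open>Under the moment assumption \<open>wfield\<close> is orthogonal to the skew maps, with squared norm \<open>3\<close> and squared norm
  \<open>3 / 2\<close> of the symmetrized gradient: equality in the Korn inequality with constant \<open>1\<close>.\<close>

definition wfield :: "nat \<Rightarrow> nat \<Rightarrow> nat \<Rightarrow> (nat \<Rightarrow> real) \<Rightarrow> nat \<Rightarrow> real" where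
  "wfield n i j x = (\<lambda>k\<in>{..<n}. if k = i then x j * x j - 1 else if k = j then - (x i * x j) else 0)"

definition wgrad :: "nat \<Rightarrow> nat \<Rightarrow> (nat \<Rightarrow> real) \<Rightarrow> nat \<Rightarrow> nat \<Rightarrow> real" where
  "wgrad i j x k l = (if l = i \<and> k = j then 2 * x j else 0) - (if l = j \<and> k = i then x j else 0) - (if l = j \<and> k = j then x i else 0)"

lemma wfield_gradient:
  assumes x: "x \<in> rn n" and i: "i < n" and j: "j < n" and ij: "i \<noteq> j" and l: "l < n"
  shows "has_gradient n (\<lambda>y. wfield n i j y l) (\<lambda>k. wgrad i j x k l) x"
proof -
  consider "l = i" | "l = j" | "l \<noteq> i" "l \<noteq> j" by blast
  then show ?thesis
  proof cases
    case 1
    have "has_gradient n (\<lambda>y. y j * y j + (- 1)) (\<lambda>k. (if k = j then x j else 0) + (if k = j then x j else 0) + 0) x"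
      by (intro has_gradient_add has_gradient_coord_prod has_gradient_const x j)
    then have "has_gradient n (\<lambda>y. y j * y j + (- 1)) (\<lambda>k. wgrad i j x k l) x"
      by (subst has_gradient_cong[of n _ "\<lambda>k. (if k = j then x j else 0) + (if k = j then x j else 0) + 0"]) (auto simp: wgrad_def 1 ij)
    moreover have "(\<lambda>y. wfield n i j y l) = (\<lambda>y. y j * y j + (- 1))" using l by (simp add: wfield_def 1 fun_eq_iff)
    ultimately show ?thesis by simp
  next
    case 2
    have "has_gradient n (\<lambda>y. (- 1) * (y i * y j)) (\<lambda>k. (- 1) * ((if k = i then x j else 0) + (if k = j then x i else 0))) x"
      by (intro has_gradient_cmult has_gradient_coord_prod x i j)
    then have "has_gradient n (\<lambda>y. (- 1) * (y i * y j)) (\<lambda>k. wgrad i j x k l) x"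
      by (subst has_gradient_cong[of n _ "\<lambda>k. (- 1) * ((if k = i then x j else 0) + (if k = j then x i else 0))"]) (use ij in \<open>auto simp: wgrad_def 2\<close>)
    moreover have "(\<lambda>y. wfield n i j y l) = (\<lambda>y. (- 1) * (y i * y j))" using l ij by (auto simp add: wfield_def 2 fun_eq_iff)
    ultimately show ?thesis by simp
  next
    case 3
    have "has_gradient n (\<lambda>y. 0) (\<lambda>k. wgrad i j x k l) x"
      using has_gradient_const[of n 0 x] 3 by (simp add: wgrad_def)
    moreover have "(\<lambda>y. wfield n i j y l) = (\<lambda>y. 0)" using l 3 by (simp add: wfield_def fun_eq_iff)
    ultimately show ?thesis by simp
  qed
qed

text \<open>The symmetrized gradient of \<open>wfield\<close> has the entries x_j / 2 at (i, j) and
  (j, i), and - x_i at (j, j); all others are 0.\<close>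

lemma wfield_sym_grad_sum:
  assumes x: "x \<in> rn n" and i: "i < n" and j: "j < n" and ij: "i \<noteq> j"
    and M: "\<And>k l. M k l = M l k"
  shows "(\<Sum>k<n. \<Sum>l<n. sym_grad (wfield n i j) x k l * M k l) = x j * M i j - x i * M j j"
proof -
  have g: "pd k (\<lambda>y. wfield n i j y l) x = wgrad i j x k l" if "k < n" "l < n" for k l
    by (rule pd_eq[OF wfield_gradient[OF x i j ij that(2)] x that(1)])
  have "(\<Sum>k<n. \<Sum>l<n. sym_grad (wfield n i j) x k l * M k l) =
     (\<Sum>k<n. \<Sum>l<n. wgrad i j x k l * M k l / 2 + wgrad i j x l k * M l k / 2)"
    by (intro sum.cong refl) (simp add: sym_grad_def g M[of _ _] add_divide_distrib distrib_right)
  also have "\<dots> = (\<Sum>k<n. \<Sum>l<n. wgrad i j x k l * M k l / 2) + (\<Sum>k<n. \<Sum>l<n. wgrad i j x l k * M l k / 2)"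
    by (simp add: sum.distrib)
  also have "(\<Sum>k<n. \<Sum>l<n. wgrad i j x l k * M l k / 2) = (\<Sum>k<n. \<Sum>l<n. wgrad i j x k l * M k l / 2)"
    by (rule sum.swap)
  also have "(\<Sum>k<n. \<Sum>l<n. wgrad i j x k l * M k l / 2) + (\<Sum>k<n. \<Sum>l<n. wgrad i j x k l * M k l / 2) = (\<Sum>k<n. \<Sum>l<n. wgrad i j x k l * M k l)"
    by (simp add: sum.distrib[symmetric] mult.commute)
  also have "\<dots> = (\<Sum>k<n. \<Sum>l<n. (if l = i then (if k = j then 2 * x j * M k l else 0) else 0)
      - (if l = j then (if k = i then x j * M k l else 0) else 0) - (if l = j then (if k = j then x i * M k l else 0) else 0))"
    by (intro sum.cong refl) (simp add: wgrad_def left_diff_distrib)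
  also have "\<dots> = 2 * x j * M j i - x j * M i j - x i * M j j"
    using i j by (simp add: sum_subtractf)
  finally show ?thesis using M[of i j] by simp
qed

section \<open>Measures with the prescribed moments, and the first variation at the extremal
  field\<close>

locale moment_measure =
  fixes n :: nat and \<mu> :: "(nat \<Rightarrow> real) measure"
  assumes bp: "borel_prob n \<mu>" and ma: "moment_assumption n \<mu>"
begin

lemma prob_mu: "prob_space \<mu>" using bp by (simp add: borel_prob_def)

lemma sets_mu [measurable_cong, simp]: "sets \<mu> = sets (borel_rn n)" using bp by (simp add: borel_prob_def)

lemma space_mu [simp]: "space \<mu> = rn n" using sets_eq_imp_space_eq[OF sets_mu] by simp

sublocale prob_space \<mu> by (rule prob_mu)

lemma hb1: "i < n \<Longrightarrow> has_bochner_integral \<mu> (\<lambda>x. x i) 0"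
  and hb2: "i < n \<Longrightarrow> j < n \<Longrightarrow> has_bochner_integral \<mu> (\<lambda>x. x i * x j) (if i = j then 1 else 0)"
  and hb3: "i < n \<Longrightarrow> j < n \<Longrightarrow> k < n \<Longrightarrow> has_bochner_integral \<mu> (\<lambda>x. x i * x j * x k) 0"
  and hb4: "i < n \<Longrightarrow> j < n \<Longrightarrow> i \<noteq> j \<Longrightarrow> has_bochner_integral \<mu> (\<lambda>x. ((x i)\<^sup>2 + (x j)\<^sup>2) * (x j)\<^sup>2) 4"
  using ma unfolding moment_assumption_def by blast+

lemma int1: "i < n \<Longrightarrow> integrable \<mu> (\<lambda>x. x i)" and int2: "i < n \<Longrightarrow> j < n \<Longrightarrow> integrable \<mu> (\<lambda>x. x i * x j)"
  using hb1 hb2 by (auto simp: has_bochner_integral_iff)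

lemma ev1: "i < n \<Longrightarrow> (\<integral>x. x i \<partial>\<mu>) = 0" and ev2: "i < n \<Longrightarrow> j < n \<Longrightarrow> (\<integral>x. x i * x j \<partial>\<mu>) = (if i = j then 1 else 0)"
  using hb1 hb2 by (auto simp: has_bochner_integral_iff)

lemma meas_mu: "f \<in> borel_measurable (borel_rn n) \<Longrightarrow> f \<in> borel_measurable \<mu>"
  using measurable_cong_sets[OF sets_mu refl] by (metis (no_types))

lemma int_sqn: "integrable \<mu> (\<lambda>x. sqn n x)"
  unfolding dot_def by (intro Bochner_Integration.integrable_sum int2) auto

text \<open>The prescribed fourth order integrand is a sum of two nonnegative terms and dominates
  each, so both are integrable although only the value of the sum is known.\<close>

lemma int4:
  assumes i: "i < n" and j: "j < n" and ij: "i \<noteq> j"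
  shows "integrable \<mu> (\<lambda>x. (x j)\<^sup>2 * (x j)\<^sup>2)" "integrable \<mu> (\<lambda>x. (x i * x j)\<^sup>2)"
    "(\<integral>x. (x i * x j)\<^sup>2 \<partial>\<mu>) + (\<integral>x. (x j)\<^sup>2 * (x j)\<^sup>2 \<partial>\<mu>) = 4"
proof -
  have m[measurable]: "(\<lambda>x. x i) \<in> borel_measurable \<mu>" "(\<lambda>x. x j) \<in> borel_measurable \<mu>"
    using int1[OF i] int1[OF j] by auto
  have h: "integrable \<mu> (\<lambda>x. ((x i)\<^sup>2 + (x j)\<^sup>2) * (x j)\<^sup>2)" "(\<integral>x. ((x i)\<^sup>2 + (x j)\<^sup>2) * (x j)\<^sup>2 \<partial>\<mu>) = 4"
    using hb4[OF i j ij] by (auto simp: has_bochner_integral_iff)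
  show 1: "integrable \<mu> (\<lambda>x. (x j)\<^sup>2 * (x j)\<^sup>2)"
  proof (rule Bochner_Integration.integrable_bound[OF h(1)])
    show "AE x in \<mu>. norm ((x j)\<^sup>2 * (x j)\<^sup>2) \<le> norm (((x i)\<^sup>2 + (x j)\<^sup>2) * (x j)\<^sup>2)"
      unfolding real_norm_def abs_mult by (intro AE_I2 mult_right_mono) auto
  qed measurable
  show 2: "integrable \<mu> (\<lambda>x. (x i * x j)\<^sup>2)"
  proof (rule Bochner_Integration.integrable_bound[OF h(1)])
    show "AE x in \<mu>. norm ((x i * x j)\<^sup>2) \<le> norm (((x i)\<^sup>2 + (x j)\<^sup>2) * (x j)\<^sup>2)"
      unfolding real_norm_def power_mult_distrib abs_mult by (intro AE_I2 mult_right_mono) auto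
  qed measurable
  have "(\<integral>x. (x i * x j)\<^sup>2 \<partial>\<mu>) + (\<integral>x. (x j)\<^sup>2 * (x j)\<^sup>2 \<partial>\<mu>) = (\<integral>x. (x i * x j)\<^sup>2 + (x j)\<^sup>2 * (x j)\<^sup>2 \<partial>\<mu>)"
    using 1 2 by simp
  also have "\<dots> = 4" unfolding h(2)[symmetric] by (simp add: power_mult_distrib distrib_right)
  finally show "(\<integral>x. (x i * x j)\<^sup>2 \<partial>\<mu>) + (\<integral>x. (x j)\<^sup>2 * (x j)\<^sup>2 \<partial>\<mu>) = 4" .
qed

lemma integrable_mult_L2:
  fixes f g :: "(nat \<Rightarrow> real) \<Rightarrow> real"
  assumes [measurable]: "f \<in> borel_measurable \<mu>" "g \<in> borel_measurable \<mu>"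
    and f: "integrable \<mu> (\<lambda>x. (f x)\<^sup>2)" and g: "integrable \<mu> (\<lambda>x. (g x)\<^sup>2)"
  shows "integrable \<mu> (\<lambda>x. f x * g x)"
proof (rule Bochner_Integration.integrable_bound)
  show "integrable \<mu> (\<lambda>x. (f x)\<^sup>2 + (g x)\<^sup>2)" using f g by simp
  show "AE x in \<mu>. norm (f x * g x) \<le> norm ((f x)\<^sup>2 + (g x)\<^sup>2)"
  proof (rule AE_I2)
    fix x
    have "0 \<le> (\<bar>f x\<bar> - \<bar>g x\<bar>)\<^sup>2" by simp
    then have "2 * \<bar>f x * g x\<bar> \<le> (f x)\<^sup>2 + (g x)\<^sup>2" by (simp add: power2_diff abs_mult)
    then show "norm (f x * g x) \<le> norm ((f x)\<^sup>2 + (g x)\<^sup>2)" using abs_ge_zero[of "f x * g x"] by simp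
  qed
qed measurable

end

text \<open>C is any constant admissible in \<open>C_PK\<close>. The infimum is reached only at the
  very end, as a limit of such constants.\<close>

locale korn_const = moment_measure +
  fixes C :: real
  assumes C0: "0 \<le> C"
    and adm: "\<And>u. u \<in> korn_class n \<mu> \<Longrightarrow>
        (INF a\<in>skew_maps n. L2sq_vec n \<mu> (\<lambda>x i. u x i - a x i)) \<le> ennreal (2 * C) * L2sq_mat n \<mu> (sym_grad u)"
begin

definition wpair :: "nat \<Rightarrow> nat \<Rightarrow> ((nat \<Rightarrow> real) \<Rightarrow> nat \<Rightarrow> real) \<Rightarrow> real" where
  "wpair i j v = (\<integral>x. (x j * x j - 1) * v x i - x i * x j * v x j \<partial>\<mu>)"

text \<open>The inner product of the symmetrized gradients of \<open>wfield\<close> and v,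
  contracted by \<open>wfield_sym_grad_sum\<close>; \<open>wpair\<close> is the inner product of the
  fields themselves.\<close>

definition wsym :: "nat \<Rightarrow> nat \<Rightarrow> ((nat \<Rightarrow> real) \<Rightarrow> nat \<Rightarrow> real) \<Rightarrow> real" where
  "wsym i j v = (\<integral>x. x j * sym_grad v x i j - x i * sym_grad v x j j \<partial>\<mu>)"

text \<open>The test field w + t v has an energy that is an exact quadratic in t. Its distance to a
  skew map a is bounded below by |w + h|^2 >= |w|^2 + 2 w.h with h = t v - a, in which a enters
  linearly and integrates to 0.\<close>

lemma variation:
  assumes i: "i < n" and j: "j < n" and ij: "i \<noteq> j"
    and v: "\<And>l. l < n \<Longrightarrow> differentiable_rn n (\<lambda>x. v x l)"
    and v0: "\<And>l. l < n \<Longrightarrow> has_bochner_integral \<mu> (\<lambda>x. v x l) 0"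
    and v2: "\<And>l. l < n \<Longrightarrow> integrable \<mu> (\<lambda>x. (v x l)\<^sup>2)"
    and e2: "\<And>k l. k < n \<Longrightarrow> l < n \<Longrightarrow> integrable \<mu> (\<lambda>x. (sym_grad v x k l)\<^sup>2)"
  defines "N \<equiv> \<Sum>k<n. \<Sum>l<n. \<integral>x. (sym_grad v x k l)\<^sup>2 \<partial>\<mu>"
  shows "3 + 2 * t * wpair i j v \<le> 2 * C * (3 / 2 + 2 * t * wsym i j v + t\<^sup>2 * N)" (is ?A)
    and "0 \<le> 3 / 2 + 2 * t * wsym i j v + t\<^sup>2 * N" (is ?B)
proof -
  let ?w = "wfield n i j"
  define u where "u x = (\<lambda>l\<in>{..<n}. ?w x l + t * v x l)" for x
  have ul: "(\<lambda>x. u x l) = (\<lambda>x. ?w x l + t * v x l)" if "l < n" for l using that by (simp add: u_def)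
  have gradu: "has_gradient n (\<lambda>x. u x l) (\<lambda>k. wgrad i j x k l + t * pd k (\<lambda>x. v x l) x) x" if "l < n" "x \<in> rn n" for l x
    unfolding ul[OF that(1)] by (intro has_gradient_add has_gradient_cmult wfield_gradient has_gradient_pd v that i j ij)
  have du: "differentiable_rn n (\<lambda>x. u x l)" if "l < n" for l
    unfolding differentiable_rn_def using gradu[OF that] by blast
  have eu: "sym_grad u x k l = sym_grad ?w x k l + t * sym_grad v x k l" if "x \<in> rn n" "k < n" "l < n" for x k l
  proof -
    have "pd k (\<lambda>y. u y l) x = wgrad i j x k l + t * pd k (\<lambda>x. v x l) x" "pd l (\<lambda>y. u y k) x = wgrad i j x l k + t * pd l (\<lambda>x. v x k) x"
      using that by (auto intro!: pd_eq[OF gradu])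
    moreover have "pd k (\<lambda>y. ?w y l) x = wgrad i j x k l" "pd l (\<lambda>y. ?w y k) x = wgrad i j x l k"
      using that i j ij by (auto intro!: pd_eq[OF wfield_gradient])
    ultimately show ?thesis by (simp add: sym_grad_def field_simps)
  qed
  have xm[measurable]: "(\<lambda>x. x k) \<in> borel_measurable \<mu>" if "k < n" for k using int1[OF that] by simp
  have vm[measurable]: "(\<lambda>x. v x k) \<in> borel_measurable \<mu>" if "k < n" for k using v0[OF that] by (auto simp: has_bochner_integral_iff)
  have em[measurable]: "(\<lambda>x. sym_grad v x k l) \<in> borel_measurable \<mu>" if "k < n" "l < n" for k l
    by (rule meas_mu[OF sym_grad_measurable[OF v that]])
  have ix: "integrable \<mu> (\<lambda>x. (x k)\<^sup>2)" "(\<integral>x. (x k)\<^sup>2 \<partial>\<mu>) = 1" if "k < n" for k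
    using int2[OF that that] ev2[OF that that] by (simp_all add: power2_eq_square)
  note I4 = int4[OF i j ij]
  define ee where "ee x = x j * sym_grad v x i j - x i * sym_grad v x j j" for x
  define Nv where "Nv x = (\<Sum>k<n. \<Sum>l<n. (sym_grad v x k l)\<^sup>2)" for x
  have iee: "integrable \<mu> ee" unfolding ee_def[abs_def]
    by (intro Bochner_Integration.integrable_diff integrable_mult_L2 xm em ix e2 i j)
  have iNv: "integrable \<mu> Nv" unfolding Nv_def[abs_def] by (intro Bochner_Integration.integrable_sum e2) auto
  have N: "(\<integral>x. Nv x \<partial>\<mu>) = N"
    unfolding Nv_def N_def using integral_double_sum[of n \<mu> "\<lambda>i j x. (sym_grad v x i j)\<^sup>2" "\<lambda>_ _. 1"] e2 by simp
  have symg: "sym_grad f x k l = sym_grad f x l k" for f x k l by (simp add: sym_grad_def add.commute)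
  have eu2: "(\<Sum>k<n. \<Sum>l<n. (sym_grad u x k l)\<^sup>2) = (x j)\<^sup>2 / 2 + (x i)\<^sup>2 + 2 * t * ee x + t\<^sup>2 * Nv x" if x: "x \<in> rn n" for x
  proof -
    have wij: "sym_grad ?w x i j = x j / 2" "sym_grad ?w x j j = - x i"
    proof -
      have "pd k (\<lambda>y. ?w y l) x = wgrad i j x k l" if "k < n" "l < n" for k l
        using that i j ij x by (auto intro!: pd_eq[OF wfield_gradient])
      then show "sym_grad ?w x i j = x j / 2" "sym_grad ?w x j j = - x i"
        using i j ij by (auto simp: sym_grad_def wgrad_def)
    qed
    have "(\<Sum>k<n. \<Sum>l<n. (sym_grad u x k l)\<^sup>2) =
      (\<Sum>k<n. \<Sum>l<n. sym_grad ?w x k l * sym_grad ?w x k l + 2 * t * (sym_grad ?w x k l * sym_grad v x k l) + t\<^sup>2 * (sym_grad v x k l)\<^sup>2)"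
      by (intro sum.cong refl) (simp add: eu[OF x] power2_eq_square algebra_simps)
    also have "\<dots> = (\<Sum>k<n. \<Sum>l<n. sym_grad ?w x k l * sym_grad ?w x k l) + 2 * t * (\<Sum>k<n. \<Sum>l<n. sym_grad ?w x k l * sym_grad v x k l) + t\<^sup>2 * Nv x"
      by (simp add: sum.distrib sum_distrib_left Nv_def)
    also have "(\<Sum>k<n. \<Sum>l<n. sym_grad ?w x k l * sym_grad ?w x k l) = x j * sym_grad ?w x i j - x i * sym_grad ?w x j j"
      by (rule wfield_sym_grad_sum[OF x i j ij]) (rule symg)
    also have "(\<Sum>k<n. \<Sum>l<n. sym_grad ?w x k l * sym_grad v x k l) = ee x"
      unfolding ee_def by (rule wfield_sym_grad_sum[OF x i j ij]) (rule symg)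
    finally show ?thesis by (simp add: wij power2_eq_square)
  qed
  have iq: "integrable \<mu> (\<lambda>x. (x j)\<^sup>2 / 2 + (x i)\<^sup>2 + 2 * t * ee x + t\<^sup>2 * Nv x)"
    using ix[OF i] ix[OF j] iee iNv by simp
  have eq: "(\<integral>x. (x j)\<^sup>2 / 2 + (x i)\<^sup>2 + 2 * t * ee x + t\<^sup>2 * Nv x \<partial>\<mu>) = 3 / 2 + 2 * t * wsym i j v + t\<^sup>2 * N"
    using ix[OF i] ix[OF j] iee iNv by (simp add: N) (simp add: wsym_def ee_def[abs_def])
  have nn: "0 \<le> (x j)\<^sup>2 / 2 + (x i)\<^sup>2 + 2 * t * ee x + t\<^sup>2 * Nv x" if "x \<in> rn n" for x
    unfolding eu2[OF that, symmetric] by (intro sum_nonneg) auto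
  show B: ?B unfolding eq[symmetric] by (rule Bochner_Integration.integral_nonneg) (use nn in auto)
  have L2m: "L2sq_mat n \<mu> (sym_grad u) = ennreal (3 / 2 + 2 * t * wsym i j v + t\<^sup>2 * N)"
  proof -
    have "L2sq_mat n \<mu> (sym_grad u) = (\<integral>\<^sup>+x. ennreal ((x j)\<^sup>2 / 2 + (x i)\<^sup>2 + 2 * t * ee x + t\<^sup>2 * Nv x) \<partial>\<mu>)"
      unfolding L2sq_mat_def by (rule nn_integral_cong) (use eu2 in auto)
    also have "\<dots> = ennreal (3 / 2 + 2 * t * wsym i j v + t\<^sup>2 * N)"
      unfolding eq[symmetric] by (rule nn_integral_eq_integral[OF iq]) (use nn in \<open>auto intro!: AE_I2\<close>)
    finally show ?thesis .
  qed
  have iw1: "has_bochner_integral \<mu> (\<lambda>x. x j * x j - 1) 0"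
    using int2[OF j j] ev2[OF j j] prob_space by (simp add: has_bochner_integral_iff)
  have iw2: "has_bochner_integral \<mu> (\<lambda>x. - (x i * x j)) 0"
    using int2[OF i j] ev2[OF i j] ij by (simp add: has_bochner_integral_iff)
  have wl: "(\<lambda>x. ?w x l) = (if l = i then (\<lambda>x. x j * x j - 1) else if l = j then (\<lambda>x. - (x i * x j)) else (\<lambda>_. 0))" if "l < n" for l
    using that by (simp add: wfield_def)
  have w0: "has_bochner_integral \<mu> (\<lambda>x. ?w x l) 0" if "l < n" for l
    unfolding wl[OF that] using iw1 iw2 by auto
  have u0: "has_bochner_integral \<mu> (\<lambda>x. u x l) 0" if "l < n" for l
    unfolding ul[OF that] using has_bochner_integral_add[OF w0[OF that] has_bochner_integral_mult_right[of t, OF v0[OF that]]] by simp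
  have uK: "u \<in> korn_class n \<mu>"
    unfolding korn_class_def using du u0 L2m by (auto simp: u_def)
  define wv where "wv x = (x j * x j - 1) * v x i - x i * x j * v x j" for x
  have i1: "integrable \<mu> (\<lambda>x. (x j * x j - 1)\<^sup>2)" "(\<integral>x. (x j * x j - 1)\<^sup>2 \<partial>\<mu>) = (\<integral>x. (x j)\<^sup>2 * (x j)\<^sup>2 \<partial>\<mu>) - 1"
  proof -
    have e: "(x j * x j - 1)\<^sup>2 = (x j)\<^sup>2 * (x j)\<^sup>2 - 2 * (x j)\<^sup>2 + 1" for x :: "nat \<Rightarrow> real" by (simp add: power2_eq_square algebra_simps)
    show "integrable \<mu> (\<lambda>x. (x j * x j - 1)\<^sup>2)" unfolding e using I4(1) ix[OF j] by simp
    show "(\<integral>x. (x j * x j - 1)\<^sup>2 \<partial>\<mu>) = (\<integral>x. (x j)\<^sup>2 * (x j)\<^sup>2 \<partial>\<mu>) - 1"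
      unfolding e using I4(1) ix[OF j] prob_space by simp
  qed
  have iwv: "integrable \<mu> wv" unfolding wv_def[abs_def]
    by (intro Bochner_Integration.integrable_diff integrable_mult_L2 i1 I4 v2 vm i j) (use i j in measurable)
  have "ennreal (3 + 2 * t * wpair i j v) \<le> (INF a\<in>skew_maps n. L2sq_vec n \<mu> (\<lambda>x l. u x l - a x l))"
  proof (rule INF_greatest)
    fix a assume "a \<in> skew_maps n"
    then obtain A where a: "a = (\<lambda>x. \<lambda>l\<in>{..<n}. \<Sum>k<n. A l k * x k)" unfolding skew_maps_def by blast
    define wa where "wa x = (\<Sum>k<n. A i k * ((x j * x j) * x k - x k)) - (\<Sum>k<n. A j k * (x i * x j * x k))" for x :: "nat \<Rightarrow> real"
    \<comment> \<open>Orthogonality of w to every skew map: its inner product with a linear map has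
      only third and first moments, which vanish.\<close>
    have hwa: "has_bochner_integral \<mu> wa 0"
    proof -
      have "has_bochner_integral \<mu> wa ((\<Sum>k<n. A i k * (0 - 0)) - (\<Sum>k<n. A j k * 0))"
        unfolding wa_def[abs_def] using i j
        by (intro has_bochner_integral_diff has_bochner_integral_sum has_bochner_integral_mult_right hb3 hb1) auto
      then show ?thesis by simp
    qed
    define Gf where "Gf x = (x j * x j - 1)\<^sup>2 + (x i * x j)\<^sup>2 + 2 * (t * wv x - wa x)" for x
    have iG: "integrable \<mu> Gf" unfolding Gf_def[abs_def]
      using i1 I4 iwv hwa by (intro Bochner_Integration.integrable_add integrable_mult_right Bochner_Integration.integrable_diff) (auto simp: has_bochner_integral_iff)
    have "(\<integral>x. Gf x \<partial>\<mu>) = ((\<integral>x. (x j)\<^sup>2 * (x j)\<^sup>2 \<partial>\<mu>) - 1) + (\<integral>x. (x i * x j)\<^sup>2 \<partial>\<mu>) + 2 * (t * (\<integral>x. wv x \<partial>\<mu>) - 0)"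
      unfolding Gf_def[abs_def] using i1 I4 iwv hwa by (simp add: has_bochner_integral_iff)
    \<comment> \<open>3 = 4 - 1: the fourth order assumption gives 4, and centring x_j^2 costs
      1.\<close>
    then have eG: "(\<integral>x. Gf x \<partial>\<mu>) = 3 + 2 * t * wpair i j v"
      using I4(3) by (simp add: wpair_def wv_def[abs_def])
    have GL: "Gf x \<le> (\<Sum>l<n. (u x l - a x l)\<^sup>2)" for x
    proof -
      have "(\<Sum>l<n. ?w x l * f l) = (x j * x j - 1) * f i - x i * x j * f j" for f
      proof -
        have "(\<Sum>l<n. ?w x l * f l) = (\<Sum>l<n. (if l = i then (x j * x j - 1) * f l else 0) - (if l = j then x i * x j * f l else 0))"
          by (intro sum.cong refl) (use ij in \<open>auto simp: wfield_def\<close>)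
        then show ?thesis using i j by (simp add: sum_subtractf)
      qed
      note ws = this
      have "(\<Sum>l<n. ?w x l * ?w x l) = (x j * x j - 1)\<^sup>2 + (x i * x j)\<^sup>2"
        unfolding ws using i j ij by (simp add: wfield_def power2_eq_square)
      moreover have "(\<Sum>l<n. ?w x l * (t * v x l - a x l)) = t * wv x - wa x"
      proof -
        have "a x i = (\<Sum>k<n. A i k * x k)" "a x j = (\<Sum>k<n. A j k * x k)" using i j by (auto simp: a)
        moreover have "wa x = (x j * x j - 1) * (\<Sum>k<n. A i k * x k) - x i * x j * (\<Sum>k<n. A j k * x k)"
          unfolding wa_def sum_distrib_left by (intro arg_cong2[where f = "(-)"] sum.cong refl) (simp_all add: algebra_simps)
        ultimately show ?thesis unfolding ws by (simp add: wv_def algebra_simps)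
      qed
      ultimately have "Gf x = (\<Sum>l<n. ?w x l * ?w x l + 2 * (?w x l * (t * v x l - a x l)))"
        by (simp add: Gf_def sum.distrib sum_distrib_left[symmetric])
      also have "\<dots> \<le> (\<Sum>l<n. (u x l - a x l)\<^sup>2)"
      proof (rule sum_mono)
        fix l assume "l \<in> {..<n}"
        then have "u x l - a x l = ?w x l + (t * v x l - a x l)" by (simp add: u_def)
        moreover have "(p + q)\<^sup>2 = p * p + 2 * (p * q) + q\<^sup>2" for p q :: real
          by (simp add: power2_eq_square algebra_simps)
        ultimately have "(u x l - a x l)\<^sup>2 = ?w x l * ?w x l + 2 * (?w x l * (t * v x l - a x l)) + (t * v x l - a x l)\<^sup>2"
          by (simp only:)
        then show "?w x l * ?w x l + 2 * (?w x l * (t * v x l - a x l)) \<le> (u x l - a x l)\<^sup>2" by simp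
      qed
      finally show ?thesis .
    qed
    \<comment> \<open>The linear lower bound may be negative while the squared distance is not, so
      it is compared through its positive part.\<close>
    have "ennreal (3 + 2 * t * wpair i j v) \<le> ennreal (\<integral>x. max 0 (Gf x) \<partial>\<mu>)"
      unfolding eG[symmetric] using iG by (intro ennreal_leI integral_mono) auto
    also have "\<dots> = (\<integral>\<^sup>+x. ennreal (max 0 (Gf x)) \<partial>\<mu>)"
      using iG by (intro nn_integral_eq_integral[symmetric]) auto
    also have "\<dots> \<le> L2sq_vec n \<mu> (\<lambda>x l. u x l - a x l)"
      unfolding L2sq_vec_def using GL by (intro nn_integral_mono ennreal_leI) (auto intro: sum_nonneg)
    finally show "ennreal (3 + 2 * t * wpair i j v) \<le> L2sq_vec n \<mu> (\<lambda>x l. u x l - a x l)" .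
  qed
  also have "\<dots> \<le> ennreal (2 * C) * L2sq_mat n \<mu> (sym_grad u)" by (rule adm[OF uK])
  also have "\<dots> = ennreal (2 * C * (3 / 2 + 2 * t * wsym i j v + t\<^sup>2 * N))"
    unfolding L2m using C0 B by (simp add: ennreal_mult)
  finally show ?A using C0 B by (subst (asm) ennreal_le_iff) (auto intro: mult_nonneg_nonneg)
qed

text \<open>The case v = 0 of the variation: 3 <= 2 C * (3 / 2). Two distinct coordinates require n
  >= 2.\<close>

lemma C_ge_1:
  assumes "2 \<le> n"
  shows "1 \<le> C"
proof -
  have i: "0 < n" and j: "1 < n" using assms by auto
  have "differentiable_rn n (\<lambda>x. 0)" unfolding differentiable_rn_def using has_gradient_const by blast
  moreover have "sym_grad (\<lambda>x l. 0) x k l = 0" if "x \<in> rn n" "k < n" "l < n" for x k l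
    using that pd_eq[OF has_gradient_const] by (simp add: sym_grad_def)
  moreover have "integrable \<mu> (\<lambda>x. (sym_grad (\<lambda>x l. 0) x k l)\<^sup>2)" if "k < n" "l < n" for k l
    using calculation(2) that by (subst Bochner_Integration.integrable_cong[where g = "\<lambda>_. 0"]) auto
  moreover have "has_bochner_integral \<mu> (\<lambda>x. 0 :: real) 0" by (rule has_bochner_integral_zero)
  ultimately show ?thesis
    using variation(1)[OF i j, of "\<lambda>x l. 0" 0] by simp
qed

text \<open>With p and s the two pairings, the inequalities of \<open>variation\<close> are
  quadratics in t that stay nonnegative, so their discriminants give (2 C s - p)^2 <= 6 C (C - 1) N
  and s^2 <= (3 / 2) N. Since p - 2 s = - (2 C s - p) + 2 (C - 1) s and C - 1 <= sqrt (C (C - 1)),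
  the rounded roots 5/2 and 5/4 add up to 5/2 + 2 * 5/4 = 5.\<close>

lemma variation_bound:
  assumes n2: "2 \<le> n" and i: "i < n" and j: "j < n" and ij: "i \<noteq> j"
    and v: "\<And>l. l < n \<Longrightarrow> differentiable_rn n (\<lambda>x. v x l)"
    and v0: "\<And>l. l < n \<Longrightarrow> has_bochner_integral \<mu> (\<lambda>x. v x l) 0"
    and v2: "\<And>l. l < n \<Longrightarrow> integrable \<mu> (\<lambda>x. (v x l)\<^sup>2)"
    and e2: "\<And>k l. k < n \<Longrightarrow> l < n \<Longrightarrow> integrable \<mu> (\<lambda>x. (sym_grad v x k l)\<^sup>2)"
    and N: "(\<Sum>k<n. \<Sum>l<n. \<integral>x. (sym_grad v x k l)\<^sup>2 \<partial>\<mu>) \<le> B\<^sup>2" and B: "0 \<le> B"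
  shows "\<bar>wpair i j v - 2 * wsym i j v\<bar> \<le> 5 * sqrt (C * (C - 1)) * B"
proof -
  define N where "N = (\<Sum>k<n. \<Sum>l<n. \<integral>x. (sym_grad v x k l)\<^sup>2 \<partial>\<mu>)"
  define p where "p = wpair i j v"
  define s where "s = wsym i j v"
  have C1: "1 \<le> C" by (rule C_ge_1[OF n2])
  have N0: "0 \<le> N" unfolding N_def by (intro sum_nonneg Bochner_Integration.integral_nonneg) auto
  have NB: "N \<le> B\<^sup>2" using N by (simp add: N_def)
  note V = variation[OF i j ij v v0 v2 e2, folded N_def p_def s_def]
  have "(2 * C * s - p)\<^sup>2 \<le> (3 * (C - 1)) * (2 * C * N)"
  proof (rule quad_discriminant)
    fix t
    show "0 \<le> 3 * (C - 1) + 2 * t * (2 * C * s - p) + t\<^sup>2 * (2 * C * N)"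
      using V(1)[of t] by (simp add: algebra_simps)
  qed (use N0 C0 in simp)
  also have "\<dots> \<le> (3 * (C - 1)) * (2 * C * B\<^sup>2)"
    using C1 NB by (intro mult_left_mono) auto
  also have "\<dots> \<le> (5 / 2 * sqrt (C * (C - 1)) * B)\<^sup>2"
  proof -
    have "0 \<le> C * (C - 1) * B\<^sup>2" using C1 by simp
    moreover have "(5 / 2 * sqrt (C * (C - 1)) * B)\<^sup>2 = 25 / 4 * (C * (C - 1) * B\<^sup>2)"
      using C1 by (simp add: power_mult_distrib power_divide)
    moreover have "3 * (C - 1) * (2 * C * B\<^sup>2) = 6 * (C * (C - 1) * B\<^sup>2)" by simp
    ultimately show ?thesis by linarith
  qed
  finally have "\<bar>2 * C * s - p\<bar> \<le> \<bar>5 / 2 * sqrt (C * (C - 1)) * B\<bar>"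
    by (simp only: abs_le_square_iff)
  moreover have "0 \<le> 5 / 2 * sqrt (C * (C - 1)) * B" using B C1 by simp
  ultimately have 1: "\<bar>2 * C * s - p\<bar> \<le> 5 / 2 * sqrt (C * (C - 1)) * B" by linarith
  have "s\<^sup>2 \<le> 3 / 2 * N" by (rule quad_discriminant[OF V(2) N0])
  also have "\<dots> \<le> 3 / 2 * B\<^sup>2" using NB by simp
  also have "\<dots> \<le> (5 / 4 * B)\<^sup>2" by (simp add: power_mult_distrib power2_eq_square)
  finally have "\<bar>s\<bar> \<le> \<bar>5 / 4 * B\<bar>" by (simp only: abs_le_square_iff)
  then have 2: "\<bar>s\<bar> \<le> 5 / 4 * B" using B by simp
  have 3: "C - 1 \<le> sqrt (C * (C - 1))"
  proof (rule real_le_rsqrt)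
    show "(C - 1)\<^sup>2 \<le> C * (C - 1)" using C1 unfolding power2_eq_square by (intro mult_right_mono) auto
  qed
  have "\<bar>p - 2 * s\<bar> \<le> \<bar>2 * C * s - p\<bar> + 2 * ((C - 1) * \<bar>s\<bar>)"
  proof -
    have "p - 2 * s = - (2 * C * s - p) + 2 * ((C - 1) * s)" by (simp add: algebra_simps)
    then have "\<bar>p - 2 * s\<bar> \<le> \<bar>2 * C * s - p\<bar> + \<bar>2 * ((C - 1) * s)\<bar>" by linarith
    then show ?thesis using C1 by (simp add: abs_mult)
  qed
  also have "\<dots> \<le> 5 / 2 * sqrt (C * (C - 1)) * B + 2 * (sqrt (C * (C - 1)) * (5 / 4 * B))"
    using 1 2 3 C1 B by (intro add_mono mult_left_mono mult_mono) auto
  also have "\<dots> = 5 * sqrt (C * (C - 1)) * B" by simp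
  finally show ?thesis by (simp add: p_def s_def)
qed

end

section \<open>Gaussian smoothing\<close>

text \<open>Mean value theorem on the segment from the origin, which is written
  \<open>lin n 0 x 0 x\<close>, followed by Cauchy-Schwarz.\<close>

lemma gradient_bound_growth:
  assumes g: "differentiable_rn n g" and B: "\<And>x. x \<in> rn n \<Longrightarrow> (\<Sum>k<n. (pd k g x)\<^sup>2) \<le> B\<^sup>2" and x: "x \<in> rn n"
  shows "(g x - g (lin n 0 x 0 x))\<^sup>2 \<le> B\<^sup>2 * sqn n x"
proof -
  let ?c = "\<lambda>t. lin n t x 0 x"
  have d: "((\<lambda>t. g (?c t)) has_real_derivative (\<Sum>k<n. pd k g (?c t) * x k)) (at t)" for t
    by (rule differentiable_chain[OF g]) (auto intro!: derivative_eq_intros)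
  obtain z where z: "g (?c 1) - g (?c 0) = (1 - 0) * (\<Sum>k<n. pd k g (?c z) * x k)"
    using MVT2[of 0 1 "\<lambda>t. g (?c t)" "\<lambda>t. \<Sum>k<n. pd k g (?c t) * x k"] d by auto
  have "?c 1 = x" using x by simp
  then have "(g x - g (?c 0))\<^sup>2 = (\<Sum>k<n. pd k g (?c z) * x k)\<^sup>2" using z by simp
  also have "\<dots> \<le> (\<Sum>k<n. (pd k g (?c z))\<^sup>2) * (\<Sum>k<n. (x k)\<^sup>2)" by (rule Cauchy_Schwarz_ineq_sum)
  also have "\<dots> \<le> B\<^sup>2 * sqn n x" unfolding sqn_eq by (intro mult_right_mono B sum_nonneg) auto
  finally show ?thesis .
qed

lemma gauss_dot_sq:
  shows "integrable (std_gaussian n) (\<lambda>y. (dot n q y)\<^sup>2)" "(\<integral>y. (dot n q y)\<^sup>2 \<partial>std_gaussian n) = sqn n q"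
proof -
  have ixx: "integrable (std_gaussian n) (\<lambda>x. x k * x l)" if "k < n" "l < n" for k l
    using good_integrable[OF good_coord_mult[OF good_coord[OF that(2)] that(1)]] .
  have e: "(dot n q y)\<^sup>2 = (\<Sum>k<n. \<Sum>l<n. (q k * q l) * (y k * y l))" for y
    unfolding dot_def power2_eq_square sum_product by (intro sum.cong refl) (simp only: mult_ac)
  show "integrable (std_gaussian n) (\<lambda>y. (dot n q y)\<^sup>2)"
    unfolding e by (intro Bochner_Integration.integrable_sum integrable_mult_right ixx) auto
  have "(\<integral>y. (dot n q y)\<^sup>2 \<partial>std_gaussian n) = (\<Sum>k<n. \<Sum>l<n. (q k * q l) * (\<integral>y. y k * y l \<partial>std_gaussian n))"
    unfolding e by (rule integral_double_sum) (rule ixx)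
  also have "\<dots> = (\<Sum>k<n. \<Sum>l<n. if k = l then q k * q l else 0)"
    by (intro sum.cong refl) (auto simp: gauss_second_moment)
  also have "\<dots> = sqn n q"
    unfolding dot_def by (intro sum.cong refl) auto
  finally show "(\<integral>y. (dot n q y)\<^sup>2 \<partial>std_gaussian n) = sqn n q" .
qed

lemma gauss_dot_integrable: "integrable (std_gaussian n) (\<lambda>y. dot n q y)"
  unfolding dot_def using good_integrable[OF good_coord] by (intro Bochner_Integration.integrable_sum integrable_mult_right) auto

lemma gauss_dot_abs: "(\<integral>y. \<bar>dot n q y\<bar> \<partial>std_gaussian n) \<le> sqrt (sqn n q)"
proof -
  interpret G: prob_space "std_gaussian n" by (rule prob_space_std_gaussian)
  let ?m = "\<integral>y. \<bar>dot n q y\<bar> \<partial>std_gaussian n"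
  have "?m\<^sup>2 \<le> 1 * sqn n q"
  proof (rule quad_discriminant)
    fix t
    have "0 \<le> (\<integral>y. (1 + t * \<bar>dot n q y\<bar>)\<^sup>2 \<partial>std_gaussian n)" by (rule Bochner_Integration.integral_nonneg) simp
    also have "\<dots> = (\<integral>y. 1 + 2 * t * \<bar>dot n q y\<bar> + t\<^sup>2 * (dot n q y)\<^sup>2 \<partial>std_gaussian n)"
      by (simp add: power2_sum power_mult_distrib mult_ac add_ac)
    also have "\<dots> = 1 + 2 * t * ?m + t\<^sup>2 * sqn n q"
      using gauss_dot_sq[of n q] gauss_dot_integrable[of n q] G.prob_space by simp
    finally show "0 \<le> 1 + 2 * t * ?m + t\<^sup>2 * sqn n q" .
  qed simp
  then show ?thesis by (simp add: real_le_rsqrt)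
qed

text \<open>q is the second order Taylor remainder of the density of a shifted Gaussian. With e =
  |d|^2, its second moment is exp e - 1 - e, at most e^2 for e <= 1, so its mean absolute value is
  at most e; for e > 1 the triangle inequality gives 2 + sqrt e <= 3 e.\<close>

lemma gauss_tilt_remainder:
  fixes h :: "(nat \<Rightarrow> real) \<Rightarrow> real" and d :: "nat \<Rightarrow> real"
  assumes [measurable]: "h \<in> borel_measurable (std_gaussian n)" and h: "\<And>z. z \<in> rn n \<Longrightarrow> \<bar>h z\<bar> \<le> 1"
  defines "q \<equiv> \<lambda>z. exp (dot n d z - sqn n d / 2) - 1 - dot n d z"
  shows "\<bar>\<integral>z. h z * q z \<partial>std_gaussian n\<bar> \<le> 3 * sqn n d"
proof -
  let ?G = "std_gaussian n"
  interpret G: prob_space ?G by (rule prob_space_std_gaussian)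
  define e where "e = sqn n d"
  have e0: "e \<ge> 0" by (simp add: e_def)
  define W where "W z = exp (dot n d z - e / 2)" for z
  have Wx: "W z = exp (- e / 2) * expq n d 0 z" for z
    by (simp add: W_def expq_def exp_add[symmetric])
  have iE: "integrable ?G (\<lambda>z. expq n w 0 z)" for w using good_poly_expq[OF good_const, of n 1 w] by simp
  have iW: "integrable ?G W" unfolding Wx[abs_def] using iE by simp
  have EW: "(\<integral>z. W z \<partial>?G) = 1"
    unfolding Wx[abs_def] by (simp add: gauss_mgf e_def[symmetric] exp_add[symmetric])
  have W2x: "(W z)\<^sup>2 = exp (- e) * expq n (\<lambda>i. 2 * d i) 0 z" for z
    by (simp add: W_def expq_def dot_scale exp_add[symmetric] power2_eq_square)
  have iW2: "integrable ?G (\<lambda>z. (W z)\<^sup>2)" unfolding W2x using iE by simp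
  have EW2: "(\<integral>z. (W z)\<^sup>2 \<partial>?G) = exp e"
    unfolding W2x by (simp add: gauss_mgf sqn_scale e_def[symmetric] exp_add[symmetric])
  have Wdx: "W z * dot n d z = (\<Sum>k<n. exp (- e / 2) * d k * (z k * expq n d 0 z))" for z
    unfolding Wx by (simp add: dot_def sum_distrib_left sum_distrib_right mult_ac)
  have iz: "integrable ?G (\<lambda>z. z k * expq n d 0 z)" if "k < n" for k by (rule good_poly_expq[OF good_coord[OF that]])
  have iWd: "integrable ?G (\<lambda>z. W z * dot n d z)"
    unfolding Wdx by (intro Bochner_Integration.integrable_sum integrable_mult_right iz) auto
  have EWd: "(\<integral>z. W z * dot n d z \<partial>?G) = e"
  proof -
    have "(\<integral>z. W z * dot n d z \<partial>?G) = (\<Sum>k<n. \<integral>z. exp (- e / 2) * d k * (z k * expq n d 0 z) \<partial>?G)"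
      unfolding Wdx by (intro Bochner_Integration.integral_sum integrable_mult_right iz) auto
    also have "\<dots> = (\<Sum>k<n. d k * d k)"
      by (intro sum.cong refl) (simp add: gauss_mgf1 e_def[symmetric] exp_minus)
    finally show ?thesis by (simp add: e_def dot_def)
  qed
  note D = gauss_dot_integrable[of n d] gauss_dot_sq[of n d, folded e_def]
  have ED: "(\<integral>z. dot n d z \<partial>?G) = 0"
  proof -
    have "(\<integral>z. dot n d z \<partial>?G) = (\<Sum>k<n. \<integral>z. d k * z k \<partial>?G)"
      unfolding dot_def by (intro Bochner_Integration.integral_sum integrable_mult_right good_integrable good_coord) auto
    then show ?thesis by (simp add: gauss_first_moment)
  qed
  have q: "q z = W z - 1 - dot n d z" for z by (simp add: q_def W_def e_def)
  have iq: "integrable ?G q" unfolding q[abs_def] using iW D by simp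
  have q2: "(q z)\<^sup>2 = (W z)\<^sup>2 + 1 + (dot n d z)\<^sup>2 - 2 * W z - 2 * (W z * dot n d z) + 2 * dot n d z" for z
    unfolding q by (simp add: power2_eq_square algebra_simps)
  have iq2: "integrable ?G (\<lambda>z. (q z)\<^sup>2)" unfolding q2 using iW2 D iW iWd by simp
  have Eq2: "(\<integral>z. (q z)\<^sup>2 \<partial>?G) = exp e - 1 - e"
    unfolding q2 using iW2 D iW iWd by (simp add: EW2 EW EWd ED G.prob_space[simplified])
  have "\<bar>\<integral>z. h z * q z \<partial>?G\<bar> \<le> (\<integral>z. \<bar>q z\<bar> \<partial>?G)"
  proof -
    have ihq: "integrable ?G (\<lambda>z. h z * q z)"
    proof (rule Bochner_Integration.integrable_bound[OF iq])
      show "AE z in ?G. norm (h z * q z) \<le> norm (q z)"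
        using h by (intro AE_I2) (simp add: abs_mult mult_left_le_one_le)
    qed (use iq in measurable)
    have "\<bar>\<integral>z. h z * q z \<partial>?G\<bar> \<le> (\<integral>z. \<bar>h z * q z\<bar> \<partial>?G)" by (rule integral_abs_bound)
    also have "\<dots> \<le> (\<integral>z. \<bar>q z\<bar> \<partial>?G)"
    proof (rule integral_mono)
      show "integrable ?G (\<lambda>z. \<bar>h z * q z\<bar>)" by (rule integrable_abs[OF ihq])
      show "integrable ?G (\<lambda>z. \<bar>q z\<bar>)" by (rule integrable_abs[OF iq])
      fix z assume "z \<in> space ?G"
      then show "\<bar>h z * q z\<bar> \<le> \<bar>q z\<bar>" using h[of z] by (simp add: abs_mult mult_left_le_one_le)
    qed
    finally show ?thesis .
  qed
  also have "\<dots> \<le> 3 * e"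
  proof (cases "e \<le> 1")
    case True
    show ?thesis
    proof (cases "e = 0")
      case True
      then have "d i = 0" if "i < n" for i
        using coord_sq_le_sqn[OF that, of d] by (simp add: e_def)
      then have "q z = 0" for z by (simp add: q_def dot_def)
      then show ?thesis using e0 by simp
    next
      case False
      then have e: "e > 0" using e0 by simp
      have "exp e \<le> 1 + e + e\<^sup>2" using True e0 by (intro exp_bound) auto
      then have b: "exp e - 1 - e \<le> e\<^sup>2" by simp
      have "(\<integral>z. \<bar>q z\<bar> \<partial>?G) \<le> (\<integral>z. (1 / (2 * e)) * (q z)\<^sup>2 + e / 2 \<partial>?G)"
      proof (rule integral_mono)
        fix z
        have "0 \<le> (\<bar>q z\<bar> - e)\<^sup>2" by simp
        then have "2 * \<bar>q z\<bar> * e \<le> (q z)\<^sup>2 + e\<^sup>2" by (simp add: power2_diff)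
        then have "2 * e * \<bar>q z\<bar> \<le> (q z)\<^sup>2 + e * e" by (simp only: power2_eq_square mult_ac)
        then show "\<bar>q z\<bar> \<le> (1 / (2 * e)) * (q z)\<^sup>2 + e / 2" using e by (simp add: field_simps)
      qed (use iq iq2 in auto)
      also have "\<dots> = (1 / (2 * e)) * (exp e - 1 - e) + e / 2"
        using iq2 by (simp add: Eq2 G.prob_space[simplified])
      also have "\<dots> \<le> (1 / (2 * e)) * e\<^sup>2 + e / 2" using b e by (intro add_right_mono mult_left_mono) auto
      also have "\<dots> = e" using e by (simp add: power2_eq_square)
      finally show ?thesis using e by simp
    qed
  next
    case False
    have "(\<integral>z. \<bar>q z\<bar> \<partial>?G) \<le> (\<integral>z. W z + 1 + \<bar>dot n d z\<bar> \<partial>?G)"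
    proof (rule integral_mono)
      fix z
      have "W z > 0" by (simp add: W_def)
      then show "\<bar>q z\<bar> \<le> W z + 1 + \<bar>dot n d z\<bar>" unfolding q by (simp add: abs_if)
    qed (use iq iW D in auto)
    also have "\<dots> = 2 + (\<integral>z. \<bar>dot n d z\<bar> \<partial>?G)" using iW D by (simp add: EW G.prob_space[simplified])
    also have "\<dots> \<le> 2 + sqrt e" using gauss_dot_abs[of n d] by (simp add: e_def)
    also have "sqrt e \<le> e" using False by (intro real_le_lsqrt) (auto simp: power2_eq_square)
    finally show ?thesis using False by simp
  qed
  finally show ?thesis by (simp add: e_def)
qed

definition unif :: "real measure" where
  "unif = density lborel (\<lambda>t. ennreal (indicat_real {0..1} t))"

lemma sets_unif [measurable_cong, simp]: "sets unif = sets borel" by (simp add: unif_def)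

lemma prob_space_unif: "prob_space unif"
  by (rule prob_spaceI) (simp add: unif_def emeasure_density ennreal_indicator)

lemma AE_unif: "AE t in unif. 0 \<le> t \<and> t \<le> 1"
  unfolding unif_def by (subst AE_density) (auto simp: indicator_def split: if_splits)

lemma integral_unif:
  fixes f :: "real \<Rightarrow> real"
  assumes [measurable]: "f \<in> borel_measurable borel"
  shows "(\<integral>t. f t \<partial>unif) = (LINT t:{0..1}|lborel. f t)"
    and "integrable unif f \<longleftrightarrow> set_integrable lborel {0..1} f"
  unfolding unif_def set_lebesgue_integral_def set_integrable_def
  by (subst integral_density integrable_density; auto)+

lemma psf_gu: "pair_sigma_finite (std_gaussian n) unif"
  using prob_space_std_gaussian prob_space_unif by (simp add: pair_sigma_finite_def prob_space_imp_sigma_finite)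

text \<open>The fundamental theorem of calculus along the segment from \<open>0\<close> to \<open>x\<close> writes a Gaussian average of a function
  \<open>\<partial>\<^sub>i f\<close> as a constant plus \<open>\<Sum>\<^sub>j x\<^sub>j savg (\<partial>\<^sub>j \<partial>\<^sub>i f)\<close>.\<close>

definition savg :: "nat \<Rightarrow> ((nat \<Rightarrow> real) \<Rightarrow> real) \<Rightarrow> real \<Rightarrow> real \<Rightarrow> (nat \<Rightarrow> real) \<Rightarrow> real" where
  "savg n h c s x = (\<integral>t. (\<integral>y. c * h (lin n (c * t) x s y) \<partial>std_gaussian n) \<partial>unif)"

text \<open>Shifting x by d shifts y by c t d / s. The derivative therefore falls on the Gaussian
  density and leaves the factor c t y_k / s, so h itself is not differentiated.\<close>

definition sgrad :: "nat \<Rightarrow> ((nat \<Rightarrow> real) \<Rightarrow> real) \<Rightarrow> real \<Rightarrow> real \<Rightarrow> (nat \<Rightarrow> real) \<Rightarrow> nat \<Rightarrow> real" where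
  "sgrad n h c s x k = (\<integral>t. (\<integral>y. c * (c * t / s) * (h (lin n (c * t) x s y) * y k) \<partial>std_gaussian n) \<partial>unif)"

text \<open>For bounded measurable h differentiability comes from the Gaussian alone: a shift of x
  is a tilt of the Gaussian, whose Taylor remainder is quadratic in the shift. The gradient bound
  follows by testing the gradient against itself.\<close>

lemma smoothing:
  fixes h :: "(nat \<Rightarrow> real) \<Rightarrow> real"
  assumes hm[measurable]: "h \<in> borel_measurable (borel_rn n)" and h: "\<And>z. z \<in> rn n \<Longrightarrow> \<bar>h z\<bar> \<le> 1"
    and s: "0 < s" and c: "0 \<le> c" "c \<le> 1" and x: "x \<in> rn n"
  shows savg_gradient: "has_gradient n (savg n h c s) (sgrad n h c s x) x"
    and sgrad_bound: "(\<Sum>k<n. (sgrad n h c s x k)\<^sup>2) \<le> (1 / s)\<^sup>2"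
proof -
  let ?G = "std_gaussian n"
  interpret G: prob_space ?G by (rule prob_space_std_gaussian)
  interpret T: prob_space unif by (rule prob_space_unif)
  interpret P: pair_sigma_finite ?G unif by (rule psf_gu)
  interpret PP: pair_prob_space ?G unif ..
  define H where "H x t y = h (lin n (c * t) x s y)" for x t y
  have Hm[measurable]: "(\<lambda>(y, t). H x t y) \<in> borel_measurable (?G \<Otimes>\<^sub>M unif)" if "x \<in> rn n" for x
  proof -
    have [measurable]: "(\<lambda>_. x) \<in> measurable (?G \<Otimes>\<^sub>M unif) (borel_rn n)" using that by simp
    show ?thesis unfolding H_def by measurable
  qed
  have Hm1[measurable]: "(\<lambda>y. H x t y) \<in> borel_measurable ?G" if "x \<in> rn n" for x t
  proof -
    have [measurable]: "(\<lambda>_. x) \<in> measurable ?G (borel_rn n)" using that by simp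
    show ?thesis unfolding H_def by measurable
  qed
  have Hb: "\<bar>H x t y\<bar> \<le> 1" for x t y unfolding H_def by (rule h) simp
  have iH: "integrable ?G (\<lambda>y. H x t y)" if "x \<in> rn n" for x t
    by (rule G.integrable_const_bound[where B = 1]) (use Hb Hm1[OF that] in auto)
  have iyk: "integrable ?G (\<lambda>y. y k)" if "k < n" for k using good_integrable[OF good_coord[OF that]] .
  have ym[measurable]: "(\<lambda>y. y k) \<in> borel_measurable ?G" if "k < n" for k using iyk[OF that] by simp
  have iHd: "integrable ?G (\<lambda>y. H x t y * dot n d y)" if "x \<in> rn n" for x t d
  proof (rule Bochner_Integration.integrable_bound[OF gauss_dot_integrable[of n d]])
    show "AE y in ?G. norm (H x t y * dot n d y) \<le> norm (dot n d y)"
      using Hb by (auto simp: abs_mult mult_left_le_one_le)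
  qed (use Hm1[OF that] in measurable)
  have iHy: "integrable ?G (\<lambda>y. H x t y * y k)" if "x \<in> rn n" "k < n" for x t k
    using iHd[OF that(1), of t "basis k"] that by (simp add: dot_basis)
  have iA: "integrable unif (\<lambda>t. \<integral>y. c * H x t y \<partial>?G)" if "x \<in> rn n" for x
  proof -
    have "integrable (?G \<Otimes>\<^sub>M unif) (\<lambda>(y, t). c * H x t y)"
      by (rule PP.P.integrable_const_bound[where B = c]) (use Hm[OF that] Hb c in \<open>auto simp: abs_mult mult_left_le\<close>)
    from P.integrable_snd[OF this] show ?thesis .
  qed
  have iB: "integrable unif (\<lambda>t. \<integral>y. c * (c * t / s) * (H x t y * y k) \<partial>?G)" if "x \<in> rn n" "k < n" for x k
  proof -
    have "integrable (?G \<Otimes>\<^sub>M unif) (\<lambda>(y, t). c * (c * t / s) * (H x t y * y k))"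
    proof (rule Bochner_Integration.integrable_bound)
      have "integrable unif (\<lambda>t. t)"
        by (rule T.integrable_const_bound[where B = 1]) (use AE_unif in \<open>auto intro!: measurable_ident_sets\<close>)
      then show "integrable (?G \<Otimes>\<^sub>M unif) (\<lambda>(y, t). (c * c / s * y k) * t)"
        by (intro integral_pair_prod(1)[OF psf_gu]) (use iyk[OF that(2)] in auto)
      show "(\<lambda>(y, t). c * (c * t / s) * (H x t y * y k)) \<in> borel_measurable (?G \<Otimes>\<^sub>M unif)"
        using Hm[OF that(1)] ym[OF that(2)] by measurable
      show "AE p in ?G \<Otimes>\<^sub>M unif. norm (case p of (y, t) \<Rightarrow> c * (c * t / s) * (H x t y * y k)) \<le> norm (case p of (y, t) \<Rightarrow> (c * c / s * y k) * t)"
      proof (rule AE_I2, clarify)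
        fix y t
        have "\<bar>c * c / s * y k * t\<bar> * \<bar>H x t y\<bar> \<le> \<bar>c * c / s * y k * t\<bar> * 1"
          by (rule mult_left_mono[OF Hb]) simp
        then show "norm (c * (c * t / s) * (H x t y * y k)) \<le> norm (c * c / s * y k * t)"
          by (simp add: abs_mult mult_ac)
      qed
    qed
    from P.integrable_snd[OF this] show ?thesis .
  qed
  define q where "q = sgrad n h c s x"
  have qk: "q k = (\<integral>t. (\<integral>y. c * (c * t / s) * (H x t y * y k) \<partial>?G) \<partial>unif)" for k by (simp add: q_def sgrad_def H_def)
  have qd: "(\<Sum>k<n. q k * d k) = (\<integral>t. c * (c * t / s) * (\<integral>y. H x t y * dot n d y \<partial>?G) \<partial>unif)"
    and iqd: "integrable unif (\<lambda>t. c * (c * t / s) * (\<integral>y. H x t y * dot n d y \<partial>?G))" for d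
  proof -
    have e: "c * (c * t / s) * (\<integral>y. H x t y * dot n d y \<partial>?G) = (\<Sum>k<n. d k * (\<integral>y. c * (c * t / s) * (H x t y * y k) \<partial>?G))" for t
    proof -
      have "(\<integral>y. H x t y * dot n d y \<partial>?G) = (\<integral>y. (\<Sum>k<n. d k * (H x t y * y k)) \<partial>?G)"
        unfolding dot_def sum_distrib_left by (simp add: mult_ac)
      also have "\<dots> = (\<Sum>k<n. \<integral>y. d k * (H x t y * y k) \<partial>?G)"
        by (intro Bochner_Integration.integral_sum integrable_mult_right iHy x) auto
      finally have 1: "(\<integral>y. H x t y * dot n d y \<partial>?G) = (\<Sum>k<n. d k * (\<integral>y. H x t y * y k \<partial>?G))" by simp
      have "(\<integral>y. c * (c * t / s) * (H x t y * y k) \<partial>?G) = c * (c * t / s) * (\<integral>y. H x t y * y k \<partial>?G)" for k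
        by (rule integral_mult_right_zero)
      then show ?thesis unfolding 1 sum_distrib_left by (simp only: mult_ac)
    qed
    show "integrable unif (\<lambda>t. c * (c * t / s) * (\<integral>y. H x t y * dot n d y \<partial>?G))"
      unfolding e by (intro Bochner_Integration.integrable_sum integrable_mult_right iB x) auto
    have "(\<integral>t. c * (c * t / s) * (\<integral>y. H x t y * dot n d y \<partial>?G) \<partial>unif) = (\<Sum>k<n. \<integral>t. d k * (\<integral>y. c * (c * t / s) * (H x t y * y k) \<partial>?G) \<partial>unif)"
      unfolding e by (intro Bochner_Integration.integral_sum integrable_mult_right iB x) auto
    then show "(\<Sum>k<n. q k * d k) = (\<integral>t. c * (c * t / s) * (\<integral>y. H x t y * dot n d y \<partial>?G) \<partial>unif)"
      by (simp add: qk mult.commute)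
  qed
  show "has_gradient n (savg n h c s) (sgrad n h c s x) x"
    unfolding q_def[symmetric]
  proof (rule has_gradient_quadratic[OF x, where K = "3 * (c / s)\<^sup>2"])
    fix x' :: "nat \<Rightarrow> real" assume x': "x' \<in> rn n"
    define d where "d i = x' i - x i" for i
    define S where "S = (\<Sum>i<n. (x' i - x i)\<^sup>2)"
    have S: "sqn n d = S" by (simp add: sqn_eq d_def S_def)
    define rem where "rem t = (\<integral>y. c * H x' t y \<partial>?G) - (\<integral>y. c * H x t y \<partial>?G) - c * (c * t / s) * (\<integral>y. H x t y * dot n d y \<partial>?G)" for t
    have irem: "integrable unif rem" unfolding rem_def[abs_def] using iA[OF x'] iA[OF x] iqd by simp
    have "savg n h c s x' - savg n h c s x - (\<Sum>i<n. q i * (x' i - x i)) = (\<integral>t. rem t \<partial>unif)"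
    proof -
      have "(\<Sum>i<n. q i * (x' i - x i)) = (\<Sum>i<n. q i * d i)" by (simp add: d_def)
      then show ?thesis
        unfolding savg_def H_def[symmetric] rem_def[abs_def] qd using iA[OF x'] iA[OF x] iqd[of d] by simp
    qed
    moreover have "\<bar>\<integral>t. rem t \<partial>unif\<bar> \<le> 3 * (c / s)\<^sup>2 * S"
    proof -
      have b: "\<bar>rem t\<bar> \<le> 3 * (c / s)\<^sup>2 * S" if t: "0 \<le> t \<and> t \<le> 1" for t
      proof -
        define \<delta> where "\<delta> i = c * t / s * d i" for i
        \<comment> \<open>The shift of x is transferred to y, where
          \<open>gaussian_affine_integral\<close> turns it into an exponential weight.\<close>
        have sh: "H x' t y = H x t (lin n 1 \<delta> 1 y)" for y
        proof -
          have "lin n (c * t) x' s y = lin n (c * t) x s (lin n 1 \<delta> 1 y)"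
            using s by (intro lin_eqI) (auto simp: \<delta>_def d_def field_simps)
          then show ?thesis by (simp add: H_def)
        qed
        have Hmb: "(\<lambda>y. H x t y) \<in> borel_measurable (borel_rn n)" using Hm1[OF x, of t] by (simp cong: measurable_cong_sets)
        have gw: "gweight n 1 \<delta> z = exp (dot n \<delta> z - sqn n \<delta> / 2)" for z
          by (simp add: gweight_def diff_divide_distrib add_divide_distrib)
        have iW: "integrable ?G (\<lambda>z. gweight n 1 \<delta> z * H x t z)"
          using gaussian_affine_integral(1)[OF _ Hmb, of 1 \<delta>] iH[OF x', of t] by (simp add: sh)
        have "rem t = c * (\<integral>z. gweight n 1 \<delta> z * H x t z \<partial>?G) - c * (\<integral>y. H x t y \<partial>?G) - c * (\<integral>y. H x t y * dot n \<delta> y \<partial>?G)"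
        proof -
          have "(\<integral>y. H x' t y \<partial>?G) = (\<integral>z. gweight n 1 \<delta> z * H x t z \<partial>?G)"
            unfolding sh by (rule gaussian_affine_integral(2)[OF _ Hmb]) simp
          moreover have "dot n \<delta> y = c * t / s * dot n d y" for y
            unfolding \<delta>_def dot_scale ..
          ultimately show ?thesis by (simp add: rem_def mult_ac)
        qed
        also have "\<dots> = c * (\<integral>z. H x t z * (exp (dot n \<delta> z - sqn n \<delta> / 2) - 1 - dot n \<delta> z) \<partial>?G)"
        proof -
          have "(\<integral>z. H x t z * (exp (dot n \<delta> z - sqn n \<delta> / 2) - 1 - dot n \<delta> z) \<partial>?G) =
             (\<integral>z. gweight n 1 \<delta> z * H x t z - H x t z - H x t z * dot n \<delta> z \<partial>?G)"
            by (simp add: gw algebra_simps)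
          then show ?thesis using iW iH[OF x] iHd[OF x] by (simp add: right_diff_distrib)
        qed
        finally have "\<bar>rem t\<bar> = c * \<bar>\<integral>z. H x t z * (exp (dot n \<delta> z - sqn n \<delta> / 2) - 1 - dot n \<delta> z) \<partial>?G\<bar>"
          using c by (simp add: abs_mult)
        also have "\<dots> \<le> 1 * (3 * sqn n \<delta>)"
          using c Hb by (intro mult_mono gauss_tilt_remainder Hm1[OF x]) auto
        also have "sqn n \<delta> = (c * t / s)\<^sup>2 * S" unfolding \<delta>_def sqn_scale S ..
        also have "1 * (3 * ((c * t / s)\<^sup>2 * S)) \<le> 1 * (3 * ((c / s)\<^sup>2 * S))"
        proof -
          have "(c * t / s)\<^sup>2 \<le> (c / s)\<^sup>2"
            using t c s by (intro power_mono divide_right_mono) (auto simp: mult_left_le)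
          moreover have "S \<ge> 0" unfolding S_def by (intro sum_nonneg) auto
          ultimately show ?thesis by (intro mult_left_mono mult_right_mono) auto
        qed
        finally show ?thesis by simp
      qed
      have "\<bar>\<integral>t. rem t \<partial>unif\<bar> \<le> (\<integral>t. \<bar>rem t\<bar> \<partial>unif)" by (rule integral_abs_bound)
      also have "\<dots> \<le> (\<integral>t. 3 * (c / s)\<^sup>2 * S \<partial>unif)"
        using irem AE_unif b by (intro integral_mono_AE) auto
      finally show ?thesis by (simp add: T.prob_space)
    qed
    ultimately show "\<bar>savg n h c s x' - savg n h c s x - (\<Sum>i<n. q i * (x' i - x i))\<bar> \<le> 3 * (c / s)\<^sup>2 * (\<Sum>i<n. (x' i - x i)\<^sup>2)"
      by (simp add: S_def)
  qed
  define Q where "Q = sqn n q"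
  have Q0: "Q \<ge> 0" by (simp add: Q_def)
  \<comment> \<open>Duality: |q|^2 is at most 1 / s times the mean of |q.y|, hence at most |q| / s,
    using |h| <= 1, c <= 1 and t <= 1. Dividing by |q| gives the bound.\<close>
  have "Q = (\<integral>t. c * (c * t / s) * (\<integral>y. H x t y * dot n q y \<partial>?G) \<partial>unif)"
    using qd[of q] by (simp add: Q_def dot_def)
  also have "\<dots> \<le> (\<integral>t. 1 / s * sqrt Q \<partial>unif)"
  proof (rule integral_mono_AE[OF iqd])
    show "AE t in unif. c * (c * t / s) * (\<integral>y. H x t y * dot n q y \<partial>?G) \<le> 1 / s * sqrt Q"
      using AE_unif
    proof eventually_elim
      case (elim t)
      have "\<bar>\<integral>y. H x t y * dot n q y \<partial>?G\<bar> \<le> (\<integral>y. \<bar>H x t y * dot n q y\<bar> \<partial>?G)" by (rule integral_abs_bound)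
      also have "\<dots> \<le> (\<integral>y. \<bar>dot n q y\<bar> \<partial>?G)"
      proof (rule integral_mono)
        show "integrable ?G (\<lambda>y. \<bar>H x t y * dot n q y\<bar>)" by (rule integrable_abs[OF iHd[OF x]])
        show "integrable ?G (\<lambda>y. \<bar>dot n q y\<bar>)" by (rule integrable_abs[OF gauss_dot_integrable])
        fix y
        show "\<bar>H x t y * dot n q y\<bar> \<le> \<bar>dot n q y\<bar>" using Hb[of x t y] by (simp add: abs_mult mult_left_le_one_le)
      qed
      also have "\<dots> \<le> sqrt Q" unfolding Q_def by (rule gauss_dot_abs)
      finally have 1: "\<bar>\<integral>y. H x t y * dot n q y \<partial>?G\<bar> \<le> sqrt Q" .
      have "c * (c * t) \<le> 1 * (1 * 1)" using c elim by (intro mult_mono) auto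
      then have 2: "0 \<le> c * (c * t / s)" "c * (c * t / s) \<le> 1 / s"
        using s c elim by (auto simp: divide_right_mono)
      have "c * (c * t / s) * (\<integral>y. H x t y * dot n q y \<partial>?G) \<le> c * (c * t / s) * sqrt Q"
        using 1 2 by (intro mult_left_mono) auto
      also have "\<dots> \<le> 1 / s * sqrt Q" using 2 Q0 by (intro mult_right_mono) auto
      finally show ?case .
    qed
  qed simp
  finally have "Q \<le> 1 / s * sqrt Q" by (simp add: T.prob_space)
  then have "sqrt Q * sqrt Q \<le> 1 / s * sqrt Q" using Q0 by simp
  then have "sqrt Q \<le> 1 / s"
  proof (cases "Q = 0")
    case False
    then have "0 < sqrt Q" using Q0 by simp
    then show ?thesis using \<open>sqrt Q * sqrt Q \<le> 1 / s * sqrt Q\<close> by (rule mult_right_le_imp_le[rotated])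
  qed (use s in simp)
  then have "(sqrt Q)\<^sup>2 \<le> (1 / s)\<^sup>2" using Q0 by (intro power_mono) auto
  then show "(\<Sum>k<n. (sgrad n h c s x k)\<^sup>2) \<le> (1 / s)\<^sup>2"
    using Q0 by (simp add: Q_def sqn_eq q_def)
qed

section \<open>Stein discrepancies\<close>

context korn_const
begin

lemma gradient_bounded_integrable:
  assumes g: "differentiable_rn n g" and B: "\<forall>x\<in>rn n. (\<Sum>k<n. (pd k g x)\<^sup>2) \<le> B\<^sup>2"
  shows "integrable \<mu> (\<lambda>x. (g x)\<^sup>2)" "integrable \<mu> g"
proof -
  have gm[measurable]: "g \<in> borel_measurable \<mu>" by (rule meas_mu[OF differentiable_measurable[OF g]])
  obtain z where z: "\<And>x. lin n 0 x 0 x = z" by (simp add: lin_def)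
  have bd: "(g x)\<^sup>2 \<le> 2 * (g z)\<^sup>2 + 2 * B\<^sup>2 * sqn n x" if x: "x \<in> rn n" for x
  proof -
    have "(g x - g z)\<^sup>2 \<le> B\<^sup>2 * sqn n x" using gradient_bound_growth[OF g B[rule_format] x] by (simp add: z)
    moreover have "0 \<le> (g x - 2 * g z)\<^sup>2" by simp
    ultimately show ?thesis by (simp add: power2_eq_square algebra_simps)
  qed
  show i2: "integrable \<mu> (\<lambda>x. (g x)\<^sup>2)"
  proof (rule Bochner_Integration.integrable_bound)
    show "integrable \<mu> (\<lambda>x. 2 * (g z)\<^sup>2 + 2 * B\<^sup>2 * sqn n x)" using int_sqn by simp
    show "AE x in \<mu>. norm ((g x)\<^sup>2) \<le> norm (2 * (g z)\<^sup>2 + 2 * B\<^sup>2 * sqn n x)"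
      using bd by (intro AE_I2) force
  qed measurable
  show "integrable \<mu> g"
    using integrable_mult_L2[OF gm _ i2, of "\<lambda>_. 1"] by simp
qed

lemma pd_bounded_integrable:
  assumes g: "differentiable_rn n g" and B: "\<forall>x\<in>rn n. (\<Sum>k<n. (pd k g x)\<^sup>2) \<le> B\<^sup>2"
    and k: "k < n" and j: "j < n"
  shows "pd k g \<in> borel_measurable \<mu>" "integrable \<mu> (\<lambda>x. (pd k g x)\<^sup>2)" "integrable \<mu> (\<lambda>x. x j * pd k g x)"
proof -
  show m[measurable]: "pd k g \<in> borel_measurable \<mu>" by (rule meas_mu[OF pd_measurable[OF g k]])
  show i2: "integrable \<mu> (\<lambda>x. (pd k g x)\<^sup>2)"
  proof (rule integrable_const_bound[where B = "B\<^sup>2"])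
    show "AE x in \<mu>. norm ((pd k g x)\<^sup>2) \<le> B\<^sup>2"
    proof (rule AE_I2)
      fix x assume x: "x \<in> space \<mu>"
      have "(pd k g x)\<^sup>2 \<le> (\<Sum>k<n. (pd k g x)\<^sup>2)"
        by (rule member_le_sum[of k "{..<n}" "\<lambda>k. (pd k g x)\<^sup>2"]) (use k in auto)
      then show "norm ((pd k g x)\<^sup>2) \<le> B\<^sup>2" using B x by force
    qed
  qed measurable
  have "integrable \<mu> (\<lambda>x. (x j)\<^sup>2)" using int2[OF j j] by (simp add: power2_eq_square)
  then show "integrable \<mu> (\<lambda>x. x j * pd k g x)"
    using integrable_mult_L2[OF _ m _ i2, of "\<lambda>x. x j"] int1[OF j] by auto
qed

lemma stein_integrable:
  assumes g: "differentiable_rn n g" and B: "\<forall>x\<in>rn n. (\<Sum>k<n. (pd k g x)\<^sup>2) \<le> B\<^sup>2"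
    and n2: "2 \<le> n" and i: "i < n" and j: "j < n"
  shows "integrable \<mu> (\<lambda>x. x i * x j * g x)"
proof -
  have [measurable]: "(\<lambda>x. x i) \<in> borel_measurable \<mu>" "(\<lambda>x. x j) \<in> borel_measurable \<mu>"
    using int1[OF i] int1[OF j] by auto
  have "integrable \<mu> (\<lambda>x. (x i * x j)\<^sup>2)"
  proof (cases "i = j")
    case True
    obtain i' where "i' < n" "i' \<noteq> j" using n2 by (cases "j = 0") (auto intro: that[of 0] that[of 1])
    from int4(1)[OF this(1) j this(2)] show ?thesis by (simp add: True power_mult_distrib)
  qed (rule int4(2)[OF i j])
  then show ?thesis
    using gradient_bounded_integrable(1)[OF g B] by (intro integrable_mult_L2 meas_mu[OF differentiable_measurable[OF g]]) auto
qed

text \<open>The mean is subtracted because fields of \<open>korn_class\<close> are centred; the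
  constant does not affect the pairing with w, which is centred too.\<close>

definition sfield :: "nat \<Rightarrow> ((nat \<Rightarrow> real) \<Rightarrow> real) \<Rightarrow> (nat \<Rightarrow> real) \<Rightarrow> nat \<Rightarrow> real" where
  "sfield k g x l = (if l = k then g x - (\<integral>y. g y \<partial>\<mu>) else 0)"

lemma sfield_sym_grad:
  assumes g: "differentiable_rn n g" and x: "x \<in> rn n" and a: "a < n" and b: "b < n"
  shows "sym_grad (sfield k g) x a b = ((if b = k then pd a g x else 0) + (if a = k then pd b g x else 0)) / 2"
proof -
  have "pd a (\<lambda>y. sfield k g y b) x = (if b = k then pd a g x else 0)" if a: "a < n" and b: "b < n" for a b
  proof (cases "b = k")
    case True
    have "has_gradient n (\<lambda>y. g y + (- (\<integral>y. g y \<partial>\<mu>))) (\<lambda>a. pd a g x + 0) x"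
      by (intro has_gradient_add has_gradient_pd[OF g x] has_gradient_const)
    from pd_eq[OF this x a] show ?thesis by (simp add: sfield_def True)
  next
    case False
    then show ?thesis using pd_eq[OF has_gradient_const x a] by (simp add: sfield_def)
  qed
  then show ?thesis using a b by (simp add: sym_grad_def)
qed

text \<open>The convexity bound ((a + b) / 2)^2 <= (a^2 + b^2) / 2 shows that the squared
  symmetrized gradient of a scalar times a basis vector is at most |grad g|^2, hence N <=
  B^2.\<close>

lemma sfield_bound:
  assumes n2: "2 \<le> n" and g: "differentiable_rn n g" and B: "\<forall>x\<in>rn n. (\<Sum>k<n. (pd k g x)\<^sup>2) \<le> B\<^sup>2" and B0: "0 \<le> B"
    and i: "i < n" and j: "j < n" and ij: "i \<noteq> j" and k: "k < n"
  shows "\<bar>wpair i j (sfield k g) - 2 * wsym i j (sfield k g)\<bar> \<le> 5 * sqrt (C * (C - 1)) * B"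
proof -
  let ?m = "\<integral>y. g y \<partial>\<mu>"
  note G = gradient_bounded_integrable[OF g B]
  have e2: "integrable \<mu> (\<lambda>x. (sym_grad (sfield k g) x a b)\<^sup>2)" if "a < n" "b < n" for a b
  proof -
    have "integrable \<mu> (\<lambda>x. (((if b = k then pd a g x else 0) + (if a = k then pd b g x else 0)) / 2)\<^sup>2)"
      using pd_bounded_integrable(2)[OF g B that(1) j] pd_bounded_integrable(2)[OF g B that(2) j]
      by (cases "a = k"; cases "b = k") (simp_all add: power_divide power_mult_distrib mult_2[symmetric])
    then show ?thesis
      by (rule Bochner_Integration.integrable_cong[THEN iffD1, rotated -1]) (auto simp: sfield_sym_grad[OF g _ that])
  qed
  show ?thesis
  proof (rule variation_bound[OF n2 i j ij _ _ _ e2 _ B0])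
    show "differentiable_rn n (\<lambda>x. sfield k g x l)" for l
    proof (cases "l = k")
      case True
      have "has_gradient n (\<lambda>y. g y + (- ?m)) (\<lambda>a. pd a g x + 0) x" if "x \<in> rn n" for x
        by (intro has_gradient_add has_gradient_pd[OF g that] has_gradient_const)
      then show ?thesis unfolding differentiable_rn_def sfield_def True by auto
    next
      case False
      then show ?thesis unfolding differentiable_rn_def sfield_def using has_gradient_const by auto
    qed
    show "has_bochner_integral \<mu> (\<lambda>x. sfield k g x l) 0" for l
      using G(2) by (cases "l = k") (simp_all add: sfield_def has_bochner_integral_iff prob_space[simplified])
    show "integrable \<mu> (\<lambda>x. (sfield k g x l)\<^sup>2)" for l
      using G by (cases "l = k") (simp_all add: sfield_def power2_diff)
    have "(\<Sum>a<n. \<Sum>b<n. \<integral>x. (sym_grad (sfield k g) x a b)\<^sup>2 \<partial>\<mu>) = (\<integral>x. (\<Sum>a<n. \<Sum>b<n. (sym_grad (sfield k g) x a b)\<^sup>2) \<partial>\<mu>)"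
    proof -
      have "(\<integral>x. (\<Sum>a<n. \<Sum>b<n. (sym_grad (sfield k g) x a b)\<^sup>2) \<partial>\<mu>) = (\<Sum>a<n. \<integral>x. (\<Sum>b<n. (sym_grad (sfield k g) x a b)\<^sup>2) \<partial>\<mu>)"
        using e2 by (intro Bochner_Integration.integral_sum Bochner_Integration.integrable_sum) auto
      also have "\<dots> = (\<Sum>a<n. \<Sum>b<n. \<integral>x. (sym_grad (sfield k g) x a b)\<^sup>2 \<partial>\<mu>)"
        using e2 by (intro sum.cong refl Bochner_Integration.integral_sum) auto
      finally show ?thesis ..
    qed
    also have "\<dots> \<le> (\<integral>x. B\<^sup>2 \<partial>\<mu>)"
    proof (rule integral_mono)
      show "integrable \<mu> (\<lambda>x. \<Sum>a<n. \<Sum>b<n. (sym_grad (sfield k g) x a b)\<^sup>2)"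
        using e2 by (intro Bochner_Integration.integrable_sum) auto
      fix x assume "x \<in> space \<mu>"
      then have x: "x \<in> rn n" by simp
      have "(\<Sum>a<n. \<Sum>b<n. (sym_grad (sfield k g) x a b)\<^sup>2) \<le>
        (\<Sum>a<n. \<Sum>b<n. (if b = k then (pd a g x)\<^sup>2 / 2 else 0) + (if a = k then (pd b g x)\<^sup>2 / 2 else 0))"
      proof (intro sum_mono)
        fix a b assume ab: "a \<in> {..<n}" "b \<in> {..<n}"
        have *: "((u + v) / 2)\<^sup>2 \<le> u\<^sup>2 / 2 + v\<^sup>2 / 2" for u v :: real
        proof -
          have "0 \<le> (u - v)\<^sup>2" by simp
          then show ?thesis by (simp add: power2_eq_square field_simps)
        qed
        have "(sym_grad (sfield k g) x a b)\<^sup>2 \<le> (if b = k then pd a g x else 0)\<^sup>2 / 2 + (if a = k then pd b g x else 0)\<^sup>2 / 2"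
          using sfield_sym_grad[OF g x, of a b k] ab by (simp only: * lessThan_iff)
        then show "(sym_grad (sfield k g) x a b)\<^sup>2 \<le> (if b = k then (pd a g x)\<^sup>2 / 2 else 0) + (if a = k then (pd b g x)\<^sup>2 / 2 else 0)"
          by (auto split: if_splits)
      qed
      also have "\<dots> = (\<Sum>a<n. (pd a g x)\<^sup>2 / 2) + (\<Sum>b<n. (pd b g x)\<^sup>2 / 2)"
      proof -
        have "(\<Sum>a<n. \<Sum>b<n. if a = k then (pd b g x)\<^sup>2 / 2 else 0) = (\<Sum>a<n. if a = k then (\<Sum>b<n. (pd b g x)\<^sup>2 / 2) else 0)"
          by (intro sum.cong refl) auto
        then show ?thesis using k by (simp add: sum.distrib)
      qed
      also have "\<dots> = (\<Sum>a<n. (pd a g x)\<^sup>2)" by (simp add: sum_divide_distrib[symmetric])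
      also have "\<dots> \<le> B\<^sup>2" using B x by blast
      finally show "(\<Sum>a<n. \<Sum>b<n. (sym_grad (sfield k g) x a b)\<^sup>2) \<le> B\<^sup>2" .
    qed simp
    finally show "(\<Sum>a<n. \<Sum>b<n. \<integral>x. (sym_grad (sfield k g) x a b)\<^sup>2 \<partial>\<mu>) \<le> B\<^sup>2" by (simp add: prob_space[simplified])
  qed
qed

text \<open>For i = j, the extremal field of (k, j) tested with g in direction k, for some k
  different from j, gives the diagonal discrepancy itself. For distinct i and j, direction j gives
  only the combination T i j - 2 T j i, and exchanging the roles gives a second one.\<close>

lemma stein_bound:
  assumes n2: "2 \<le> n" and g: "differentiable_rn n g" and B: "\<forall>x\<in>rn n. (\<Sum>k<n. (pd k g x)\<^sup>2) \<le> B\<^sup>2" and B0: "0 \<le> B"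
    and i: "i < n" and j: "j < n"
  shows "\<bar>\<integral>x. x i * x j * g x - (if i = j then g x else 0) - x j * pd i g x \<partial>\<mu>\<bar> \<le> 5 * sqrt (C * (C - 1)) * B"
proof -
  let ?m = "\<integral>y. g y \<partial>\<mu>"
  note G = gradient_bounded_integrable[OF g B] and P = pd_bounded_integrable(3)[OF g B] and S = stein_integrable[OF g B n2]
  note SB = sfield_bound[OF n2 g B B0]
  have sg: "(\<integral>x. x a * sym_grad (sfield k g) x c d - x b * sym_grad (sfield k g) x e f \<partial>\<mu>) =
     (\<integral>x. x a * (((if d = k then pd c g x else 0) + (if c = k then pd d g x else 0)) / 2) - x b * (((if f = k then pd e g x else 0) + (if e = k then pd f g x else 0)) / 2) \<partial>\<mu>)"
    if "c < n" "d < n" "e < n" "f < n" for a b c d e f k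
    using that by (intro Bochner_Integration.integral_cong refl) (simp add: sfield_sym_grad[OF g])
  show ?thesis
  proof (cases "i = j")
    case True
    obtain k where k: "k < n" "k \<noteq> j" using n2 by (cases "j = 0") (auto intro: that[of 0] that[of 1])
    have "wpair k j (sfield k g) = (\<integral>x. x j * x j * g x - g x - ?m * (x j * x j - 1) \<partial>\<mu>)"
      unfolding wpair_def sfield_def using k by (simp add: algebra_simps)
    also have "\<dots> = (\<integral>x. x j * x j * g x - g x \<partial>\<mu>)"
      using G S[OF j j] int2[OF j j] ev2[OF j j] by (simp add: prob_space[simplified])
    finally have 1: "wpair k j (sfield k g) = (\<integral>x. x j * x j * g x - g x \<partial>\<mu>)" .
    have 2: "2 * wsym k j (sfield k g) = (\<integral>x. x j * pd j g x \<partial>\<mu>)"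
      unfolding wsym_def sg[OF k(1) j j j] using k by simp
    have "(\<integral>x. x i * x j * g x - (if i = j then g x else 0) - x j * pd i g x \<partial>\<mu>) = wpair k j (sfield k g) - 2 * wsym k j (sfield k g)"
      unfolding 1 2 using True S[OF j j] G P[OF j j] by simp
    then show ?thesis using SB[OF k(1) j k(2) k(1)] by simp
  next
    case False
    define T where "T i j = (\<integral>x. x i * x j * g x - x j * pd i g x \<partial>\<mu>)" for i j
    have key: "wpair i j (sfield j g) - 2 * wsym i j (sfield j g) = T i j - 2 * T j i" if i: "i < n" and j: "j < n" and ij: "i \<noteq> j" for i j
    proof -
      have "wpair i j (sfield j g) = (\<integral>x. ?m * (x i * x j) - x i * x j * g x \<partial>\<mu>)"
        unfolding wpair_def sfield_def using ij by (simp add: algebra_simps)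
      also have "\<dots> = - (\<integral>x. x i * x j * g x \<partial>\<mu>)"
        using S[OF i j] int2[OF i j] ev2[OF i j] ij by simp
      finally have 1: "wpair i j (sfield j g) = - (\<integral>x. x i * x j * g x \<partial>\<mu>)" .
      have "wsym i j (sfield j g) = (\<integral>x. (1 / 2) * (x j * pd i g x) - x i * pd j g x \<partial>\<mu>)"
        unfolding wsym_def sg[OF i j j j] using ij by simp
      also have "\<dots> = (1 / 2) * (\<integral>x. x j * pd i g x \<partial>\<mu>) - (\<integral>x. x i * pd j g x \<partial>\<mu>)"
        using P[OF i j] P[OF j i] by simp
      finally have 2: "2 * wsym i j (sfield j g) = (\<integral>x. x j * pd i g x \<partial>\<mu>) - 2 * (\<integral>x. x i * pd j g x \<partial>\<mu>)" by simp
      have 3: "T i j = (\<integral>x. x i * x j * g x \<partial>\<mu>) - (\<integral>x. x j * pd i g x \<partial>\<mu>)"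
        unfolding T_def using S[OF i j] P[OF i j] by simp
      have 4: "T j i = (\<integral>x. x i * x j * g x \<partial>\<mu>) - (\<integral>x. x i * pd j g x \<partial>\<mu>)"
        unfolding T_def using S[OF j i] P[OF j i] by (simp add: mult.commute[of "_ j" "_ i"])
      show ?thesis unfolding 1 2 3 4 by simp
    qed
    define D where "D = 5 * sqrt (C * (C - 1)) * B"
    \<comment> \<open>The system is inverted without loss: 3 T i j = - (T i j - 2 T j i) - 2 (T j i
      - 2 T i j), so the bound is (D + 2 D) / 3 = D.\<close>
    have "\<bar>T i j - 2 * T j i\<bar> \<le> D" "\<bar>T j i - 2 * T i j\<bar> \<le> D"
      using key[OF i j False] key[OF j i False[symmetric]] SB[OF i j False j] SB[OF j i False[symmetric] i] by (simp_all add: D_def)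
    then have "\<bar>T i j\<bar> \<le> D" by linarith
    then show ?thesis using False by (simp add: T_def D_def)
  qed
qed

end

section \<open>Moments of the Gaussian measure\<close>

lemma gaussian_poly_ibp:
  assumes k: "k < n" and p: "good n p" and p': "good n p'"
    and d: "\<And>x. x \<in> rn n \<Longrightarrow> ((\<lambda>t. p (x(k := t))) has_real_derivative p' x) (at (x k))"
  shows "has_bochner_integral (std_gaussian n) (\<lambda>y. y k * p y) (\<integral>y. p' y \<partial>std_gaussian n)"
proof -
  have "integrable (std_gaussian n) (\<lambda>y. y k * p y)" by (rule good_integrable[OF good_coord_mult[OF p k]])
  moreover have "(\<integral>y. p' y \<partial>std_gaussian n) = (\<integral>y. y k * p y \<partial>std_gaussian n)"
    by (rule gaussian_ibp_coord[OF k good_measurable[OF p] good_measurable[OF p'] d])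
       (auto intro: good_integrable p p' calculation)
  ultimately show ?thesis by (simp add: has_bochner_integral_iff)
qed

text \<open>The fourth order value is E x_i^2 x_j^2 + E x_j^4 = 1 + 3. The lower bound 1 on the Korn
  constant thereby applies to the Gaussian itself.\<close>

lemma moment_measure_std_gaussian: "moment_measure n (std_gaussian n)"
proof
  let ?G = "std_gaussian n"
  interpret G: prob_space ?G by (rule prob_space_std_gaussian)
  show "borel_prob n ?G"
    by (simp add: borel_prob_def prob_space_std_gaussian)
  have ig: "integrable ?G (\<lambda>x. x i)" "integrable ?G (\<lambda>x. x i * x j)" if "i < n" "j < n" for i j
    using that by (auto intro!: good_integrable good_coord good_coord_mult)
  have m3: "has_bochner_integral ?G (\<lambda>x. x i * x j * x k) 0" if i: "i < n" and j: "j < n" and k: "k < n" for i j k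
  proof -
    have "has_bochner_integral ?G (\<lambda>y. y i * (y j * y k)) (\<integral>y. (if j = i then 1 else 0) * y k + (if k = i then 1 else 0) * y j \<partial>?G)"
    proof (rule gaussian_poly_ibp[OF i])
      show "good n (\<lambda>y. y j * y k)" by (rule good_coord_mult[OF good_coord[OF k] j])
      show "good n (\<lambda>y. (if j = i then 1 else 0) * y k + (if k = i then 1 else 0) * y j)"
        by (intro good_add good_cmult good_coord j k)
      show "((\<lambda>t. (x(i := t)) j * (x(i := t)) k) has_real_derivative (if j = i then 1 else 0) * x k + (if k = i then 1 else 0) * x j) (at (x i))" for x :: "nat \<Rightarrow> real"
        by (cases "j = i"; cases "k = i") (auto intro!: derivative_eq_intros)
    qed
    moreover have "(\<integral>y. (if j = i then 1 else 0) * y k + (if k = i then 1 else 0) * y j \<partial>?G) = 0"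
      using ig[OF j j] ig[OF k k] gauss_first_moment[OF j] gauss_first_moment[OF k] by simp
    ultimately show ?thesis by (simp add: mult.assoc)
  qed
  have m4: "has_bochner_integral ?G (\<lambda>x. x j * (x j * (x i * x i))) (if i = j then 3 else 1)" if i: "i < n" and j: "j < n" for i j
  proof -
    have "has_bochner_integral ?G (\<lambda>y. y j * (y j * (y i * y i))) (\<integral>y. 1 * (y i * y i) + (if i = j then 2 else 0) * (y j * y i) \<partial>?G)"
    proof (rule gaussian_poly_ibp[OF j])
      show "good n (\<lambda>y. y j * (y i * y i))" by (intro good_coord_mult good_coord i j)
      show "good n (\<lambda>y. 1 * (y i * y i) + (if i = j then 2 else 0) * (y j * y i))"
        by (intro good_add good_cmult good_coord_mult good_coord i j)
      show "((\<lambda>t. (x(j := t)) j * ((x(j := t)) i * (x(j := t)) i)) has_real_derivative 1 * (x i * x i) + (if i = j then 2 else 0) * (x j * x i)) (at (x j))" for x :: "nat \<Rightarrow> real"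
        by (cases "i = j") (auto intro!: derivative_eq_intros)
    qed
    moreover have "(\<integral>y. 1 * (y i * y i) + (if i = j then 2 else 0) * (y j * y i) \<partial>?G) = (if i = j then 3 else 1)"
      using ig(2)[OF i i] ig(2)[OF j i] gauss_second_moment[OF i i] gauss_second_moment[OF j i] by simp
    ultimately show ?thesis by simp
  qed
  show "moment_assumption n ?G"
    unfolding moment_assumption_def
  proof (intro conjI allI impI)
    fix i j assume i: "i < n" and j: "j < n" and ij: "i \<noteq> j"
    have "has_bochner_integral ?G (\<lambda>x. x j * (x j * (x i * x i)) + x j * (x j * (x j * x j))) (1 + 3)"
      using has_bochner_integral_add[OF m4[OF i j] m4[OF j j]] ij by simp
    moreover have "(\<lambda>x. ((x i)\<^sup>2 + (x j)\<^sup>2) * (x j)\<^sup>2) = (\<lambda>x. x j * (x j * (x i * x i)) + x j * (x j * (x j * x j) :: real))"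
      by (simp add: fun_eq_iff power2_eq_square algebra_simps)
    ultimately show "has_bochner_integral ?G (\<lambda>x. ((x i)\<^sup>2 + (x j)\<^sup>2) * (x j)\<^sup>2) 4" by simp
  qed (use m3 ig gauss_first_moment gauss_second_moment in \<open>auto simp: has_bochner_integral_iff\<close>)
qed

section \<open>Test functions with bounded Hessian\<close>

lemma sqn_lin_le: "sqn n (lin n c x s y) \<le> 2 * c\<^sup>2 * sqn n x + 2 * s\<^sup>2 * sqn n y"
proof -
  have "(c * x i + s * y i)\<^sup>2 \<le> 2 * c\<^sup>2 * (x i)\<^sup>2 + 2 * s\<^sup>2 * (y i)\<^sup>2" for i
  proof -
    have "0 \<le> (c * x i - s * y i)\<^sup>2" by simp
    then show ?thesis by (simp add: power2_eq_square algebra_simps)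
  qed
  then have "(\<Sum>i<n. (c * x i + s * y i)\<^sup>2) \<le> (\<Sum>i<n. 2 * c\<^sup>2 * (x i)\<^sup>2 + 2 * s\<^sup>2 * (y i)\<^sup>2)" by (rule sum_mono)
  then show ?thesis by (simp add: sqn_eq sum.distrib sum_distrib_left)
qed

lemma abs_le_sq_add_1: "\<bar>a\<bar> \<le> a\<^sup>2 + 1" for a :: real
proof -
  have "0 \<le> (\<bar>a\<bar> - 1)\<^sup>2" by simp
  then have "2 * \<bar>a\<bar> \<le> a\<^sup>2 + 1" by (simp add: power2_diff)
  then show ?thesis by linarith
qed

lemma abs_mult_le_sq_add_sq: "\<bar>a * b\<bar> \<le> a\<^sup>2 + b\<^sup>2" for a b :: real
proof -
  have "0 \<le> (\<bar>a\<bar> - \<bar>b\<bar>)\<^sup>2" by simp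
  then have "2 * \<bar>a * b\<bar> \<le> a\<^sup>2 + b\<^sup>2" by (simp add: power2_diff abs_mult)
  moreover have "0 \<le> a\<^sup>2 + b\<^sup>2" by simp
  ultimately show ?thesis by linarith
qed

lemma integrable_gaussian_sqn: "integrable (std_gaussian n) (\<lambda>y. sqn n y)"
  by (rule moment_measure.int_sqn[OF moment_measure_std_gaussian])

locale quad_test =
  fixes n :: nat and f :: "(nat \<Rightarrow> real) \<Rightarrow> real"
  assumes f0: "differentiable_rn n f"
    and f1: "i < n \<Longrightarrow> differentiable_rn n (pd i f)"
    and f2: "i < n \<Longrightarrow> j < n \<Longrightarrow> continuous_on (rn n) (pd j (pd i f))"
    and hess_le: "x \<in> rn n \<Longrightarrow> (\<Sum>i<n. \<Sum>j<n. (pd i (pd j f) x)\<^sup>2) \<le> 1"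
begin

lemma f_meas [measurable]: "f \<in> borel_measurable (borel_rn n)"
  and pd_meas: "i < n \<Longrightarrow> pd i f \<in> borel_measurable (borel_rn n)"
  and pd2_meas: "i < n \<Longrightarrow> j < n \<Longrightarrow> pd j (pd i f) \<in> borel_measurable (borel_rn n)"
  by (auto intro: differentiable_measurable continuous_imp_measurable f0 f1 f2)

lemma row_le:
  assumes i: "i < n" and x: "x \<in> rn n"
  shows "(\<Sum>j<n. (pd j (pd i f) x)\<^sup>2) \<le> 1\<^sup>2"
proof -
  have "(\<Sum>j<n. (pd j (pd i f) x)\<^sup>2) \<le> (\<Sum>i<n. \<Sum>j<n. (pd j (pd i f) x)\<^sup>2)"
    by (rule member_le_sum[of i "{..<n}" "\<lambda>i. \<Sum>j<n. (pd j (pd i f) x)\<^sup>2"]) (use i in \<open>auto intro: sum_nonneg\<close>)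
  also have "\<dots> = (\<Sum>i<n. \<Sum>j<n. (pd i (pd j f) x)\<^sup>2)" by (rule sum.swap)
  finally show ?thesis using hess_le[OF x] by simp
qed

lemma pd2_le:
  assumes i: "i < n" and j: "j < n" and x: "x \<in> rn n"
  shows "\<bar>pd j (pd i f) x\<bar> \<le> 1"
proof -
  have "(pd j (pd i f) x)\<^sup>2 \<le> (\<Sum>j<n. (pd j (pd i f) x)\<^sup>2)"
    by (rule member_le_sum[of j "{..<n}" "\<lambda>j. (pd j (pd i f) x)\<^sup>2"]) (use j in auto)
  then have "(pd j (pd i f) x)\<^sup>2 \<le> 1" using row_le[OF i x] by simp
  then show ?thesis by (simp add: abs_square_le_1)
qed

definition orig :: "nat \<Rightarrow> real" where "orig = (\<lambda>i\<in>{..<n}. 0)"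

lemma lin_orig: "lin n 0 x 0 y = orig" by (simp add: lin_def orig_def)

definition A :: real where "A = (\<Sum>i<n. (pd i f orig)\<^sup>2)"

lemma A_nonneg: "0 \<le> A" unfolding A_def by (intro sum_nonneg) auto

lemma pd_growth:
  assumes i: "i < n" and x: "x \<in> rn n"
  shows "(pd i f x)\<^sup>2 \<le> 2 * A + 2 * sqn n x"
proof -
  have "(pd i f x - pd i f orig)\<^sup>2 \<le> 1\<^sup>2 * sqn n x"
    using gradient_bound_growth[OF f1[OF i] row_le[OF i] x] by (simp add: lin_orig)
  moreover have "(pd i f orig)\<^sup>2 \<le> A"
    unfolding A_def by (rule member_le_sum[of i "{..<n}" "\<lambda>i. (pd i f orig)\<^sup>2"]) (use i in auto)
  moreover have "0 \<le> (pd i f x - 2 * pd i f orig)\<^sup>2" by simp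
  ultimately show ?thesis by (simp add: power2_eq_square algebra_simps)
qed

text \<open>Bounded second derivatives give a gradient of linear growth, hence quadratic growth of
  f; second moments then dominate everything along the interpolation.\<close>

lemma f_growth:
  assumes x: "x \<in> rn n"
  shows "\<bar>f x\<bar> \<le> \<bar>f orig\<bar> + real n * (2 * A + 3 * sqn n x)"
proof -
  let ?c = "\<lambda>t. lin n t x 0 x"
  have d: "((\<lambda>t. f (?c t)) has_real_derivative (\<Sum>k<n. pd k f (?c t) * x k)) (at t)" for t
    by (rule differentiable_chain[OF f0]) (auto intro!: derivative_eq_intros)
  obtain z where z: "0 < z" "z < 1" "f (?c 1) - f (?c 0) = (1 - 0) * (\<Sum>k<n. pd k f (?c z) * x k)"
    using MVT2[of 0 1 "\<lambda>t. f (?c t)" "\<lambda>t. \<Sum>k<n. pd k f (?c t) * x k"] d by auto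
  have "?c 1 = x" using x by simp
  then have "f x - f orig = (\<Sum>k<n. pd k f (?c z) * x k)" using z by (simp add: lin_orig)
  also have "\<bar>\<dots>\<bar> \<le> (\<Sum>k<n. 2 * A + 3 * sqn n x)"
  proof (rule order_trans[OF sum_abs sum_mono])
    fix k assume k: "k \<in> {..<n}"
    have "sqn n (?c z) = z\<^sup>2 * sqn n x"
      by (simp add: dot_lin_left dot_lin_right power2_eq_square)
    also have "\<dots> \<le> 1 * sqn n x" using z by (intro mult_right_mono) (auto simp: power_le_one)
    finally have "(pd k f (?c z))\<^sup>2 \<le> 2 * A + 2 * sqn n x" using pd_growth[of k "?c z"] k by simp
    then show "\<bar>pd k f (?c z) * x k\<bar> \<le> 2 * A + 3 * sqn n x"
      using abs_mult_le_sq_add_sq[of "pd k f (?c z)" "x k"] coord_sq_le_sqn[of k n x] k by simp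
  qed
  finally show ?thesis by simp
qed

lemma lin_meas1 [measurable]: "x \<in> rn n \<Longrightarrow> (\<lambda>y. lin n c x s y) \<in> measurable (std_gaussian n) (borel_rn n)"
proof -
  assume "x \<in> rn n"
  then have [measurable]: "(\<lambda>_. x) \<in> measurable (std_gaussian n) (borel_rn n)" by simp
  show ?thesis by measurable
qed

lemma pd_lin_integrable:
  assumes i: "i < n" and x: "x \<in> rn n"
  shows "integrable (std_gaussian n) (\<lambda>y. pd i f (lin n c x s y))"
    and "k < n \<Longrightarrow> integrable (std_gaussian n) (\<lambda>y. y k * pd i f (lin n c x s y))"
proof -
  interpret G: prob_space "std_gaussian n" by (rule prob_space_std_gaussian)
  note [measurable] = pd_meas[OF i] lin_meas1[OF x]
  have b: "(pd i f (lin n c x s y))\<^sup>2 \<le> 2 * A + 2 * (2 * c\<^sup>2 * sqn n x + 2 * s\<^sup>2 * sqn n y)" for y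
    using pd_growth[OF i, of "lin n c x s y"] sqn_lin_le[of n c x s y] by simp
  show "integrable (std_gaussian n) (\<lambda>y. pd i f (lin n c x s y))"
  proof (rule Bochner_Integration.integrable_bound)
    show "integrable (std_gaussian n) (\<lambda>y. 2 * A + 2 * (2 * c\<^sup>2 * sqn n x + 2 * s\<^sup>2 * sqn n y) + 1)"
      using integrable_gaussian_sqn by simp
    show "AE y in std_gaussian n. norm (pd i f (lin n c x s y)) \<le> norm (2 * A + 2 * (2 * c\<^sup>2 * sqn n x + 2 * s\<^sup>2 * sqn n y) + 1)"
    proof (rule AE_I2)
      fix y show "norm (pd i f (lin n c x s y)) \<le> norm (2 * A + 2 * (2 * c\<^sup>2 * sqn n x + 2 * s\<^sup>2 * sqn n y) + 1)"
        using b[of y] abs_le_sq_add_1[of "pd i f (lin n c x s y)"] by simp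
    qed
  qed measurable
  assume k: "k < n"
  note [measurable] = good_measurable[OF good_coord[OF k]]
  show "integrable (std_gaussian n) (\<lambda>y. y k * pd i f (lin n c x s y))"
  proof (rule Bochner_Integration.integrable_bound)
    show "integrable (std_gaussian n) (\<lambda>y. 2 * A + 2 * (2 * c\<^sup>2 * sqn n x + 2 * s\<^sup>2 * sqn n y) + sqn n y)"
      using integrable_gaussian_sqn by simp
    show "AE y in std_gaussian n. norm (y k * pd i f (lin n c x s y)) \<le> norm (2 * A + 2 * (2 * c\<^sup>2 * sqn n x + 2 * s\<^sup>2 * sqn n y) + sqn n y)"
    proof (rule AE_I2)
      fix y show "norm (y k * pd i f (lin n c x s y)) \<le> norm (2 * A + 2 * (2 * c\<^sup>2 * sqn n x + 2 * s\<^sup>2 * sqn n y) + sqn n y)"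
        using b[of y] abs_mult_le_sq_add_sq[of "y k" "pd i f (lin n c x s y)"] coord_sq_le_sqn[OF k, of y] by simp
    qed
  qed measurable
qed

lemma pd2_lin_integrable:
  assumes i: "i < n" and j: "j < n" and x: "x \<in> rn n"
  shows "integrable (std_gaussian n) (\<lambda>y. pd j (pd i f) (lin n c x s y))"
proof -
  interpret G: prob_space "std_gaussian n" by (rule prob_space_std_gaussian)
  note [measurable] = pd2_meas[OF i j] lin_meas1[OF x]
  show ?thesis
    by (rule G.integrable_const_bound[where B = 1]) (use pd2_le[OF i j] in auto)
qed

text \<open>With c = cos t and s = sin t these are the conditional expectations, given X = x, of the
  i-th first and pure second derivative of f at the interpolated point.\<close>

definition phi :: "nat \<Rightarrow> real \<Rightarrow> real \<Rightarrow> (nat \<Rightarrow> real) \<Rightarrow> real" where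
  "phi i c s x = (\<integral>y. pd i f (lin n c x s y) \<partial>std_gaussian n)"

definition psi :: "nat \<Rightarrow> real \<Rightarrow> real \<Rightarrow> (nat \<Rightarrow> real) \<Rightarrow> real" where
  "psi i c s x = (\<integral>y. pd i (pd i f) (lin n c x s y) \<partial>std_gaussian n)"

lemma phi_ibp:
  assumes i: "i < n" and x: "x \<in> rn n"
  shows "(\<integral>y. y i * pd i f (lin n c x s y) \<partial>std_gaussian n) = s * psi i c s x"
proof -
  have "(\<integral>y. pd i (pd i f) (lin n c x s y) * s \<partial>std_gaussian n) = (\<integral>y. y i * pd i f (lin n c x s y) \<partial>std_gaussian n)"
  proof (rule gaussian_ibp_coord[OF i])
    note [measurable] = pd_meas[OF i] pd2_meas[OF i i] lin_meas1[OF x]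
    have "(\<lambda>y. pd i f (lin n c x s y)) \<in> borel_measurable (std_gaussian n)"
      "(\<lambda>y. pd i (pd i f) (lin n c x s y) * s) \<in> borel_measurable (std_gaussian n)" by measurable
    then show "(\<lambda>y. pd i f (lin n c x s y)) \<in> borel_measurable (borel_rn n)"
      "(\<lambda>y. pd i (pd i f) (lin n c x s y) * s) \<in> borel_measurable (borel_rn n)" by (simp_all cong: measurable_cong_sets)
    fix y :: "nat \<Rightarrow> real" assume y: "y \<in> rn n"
    have "((\<lambda>t. pd i f (lin n c x s (y(i := t)))) has_real_derivative (\<Sum>k<n. pd k (pd i f) (lin n c x s (y(i := y i))) * (if k = i then s else 0))) (at (y i))"
      by (rule differentiable_chain[OF f1[OF i]]) (auto intro!: derivative_eq_intros)
    then show "((\<lambda>t. pd i f (lin n c x s (y(i := t)))) has_real_derivative pd i (pd i f) (lin n c x s y) * s) (at (y i))"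
      using i by (simp add: if_distrib cong: if_cong)
  qed (use pd_lin_integrable[OF i x] pd2_lin_integrable[OF i i x] i in auto)
  then show ?thesis by (simp add: psi_def mult.commute)
qed

lemma phi_partial:
  assumes i: "i < n" and x: "x \<in> rn n"
  shows "((\<lambda>t. phi i c s (x(i := t))) has_real_derivative c * psi i c s x) (at (x i))"
proof -
  interpret G: prob_space "std_gaussian n" by (rule prob_space_std_gaussian)
  have "((\<lambda>t. \<integral>y. pd i f (lin n c (x(i := t)) s y) \<partial>std_gaussian n) has_real_derivative
      (\<integral>y. pd i (pd i f) (lin n c (x(i := x i)) s y) * c \<partial>std_gaussian n)) (at (x i))"
  proof (rule has_real_derivative_integral(1)[where a = "x i - 1" and b = "x i + 1" and g = "\<lambda>_. \<bar>c\<bar>"])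
    fix t :: real and y :: "nat \<Rightarrow> real"
    have "((\<lambda>t. pd i f (lin n c (x(i := t)) s y)) has_real_derivative (\<Sum>k<n. pd k (pd i f) (lin n c (x(i := t)) s y) * (if k = i then c else 0))) (at t)"
      by (rule differentiable_chain[OF f1[OF i]]) (auto intro!: derivative_eq_intros)
    then show "((\<lambda>t. pd i f (lin n c (x(i := t)) s y)) has_real_derivative pd i (pd i f) (lin n c (x(i := t)) s y) * c) (at t)"
      using i by (simp add: if_distrib cong: if_cong)
    show "\<bar>pd i (pd i f) (lin n c (x(i := t)) s y) * c\<bar> \<le> \<bar>c\<bar>"
      using pd2_le[OF i i, of "lin n c (x(i := t)) s y"] by (simp add: abs_mult mult_left_le_one_le)
    show "integrable (std_gaussian n) (\<lambda>y. pd i f (lin n c (x(i := t)) s y))"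
      by (rule pd_lin_integrable(1)[OF i upd_in_rn[OF x i]])
  qed auto
  then show ?thesis by (simp add: phi_def psi_def mult.commute)
qed

text \<open>The fundamental theorem is applied for each fixed y and then averaged over y by Fubini.
  The chain rule factor c is built into \<open>savg\<close>, and the constant is the value with x
  replaced by the origin.\<close>

lemma phi_expand:
  assumes i: "i < n" and x: "x \<in> rn n" and s: "0 < s" and c: "0 \<le> c" "c \<le> 1"
  shows "phi i c s x = phi i 0 s orig + (\<Sum>j<n. x j * savg n (pd j (pd i f)) c s x)"
proof -
  let ?G = "std_gaussian n"
  interpret G: prob_space ?G by (rule prob_space_std_gaussian)
  interpret T: prob_space unif by (rule prob_space_unif)
  interpret P: pair_sigma_finite ?G unif by (rule psf_gu)
  interpret PP: pair_prob_space ?G unif ..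
  define H where "H j t y = c * pd j (pd i f) (lin n (c * t) x s y)" for j t y
  have xm[measurable]: "(\<lambda>_. x) \<in> measurable M (borel_rn n)" for M :: "'z measure" using x by simp
  have Hm: "(\<lambda>(y, t). H j t y) \<in> borel_measurable (?G \<Otimes>\<^sub>M unif)" if j: "j < n" for j
  proof -
    note [measurable] = pd2_meas[OF i j]
    show ?thesis unfolding H_def by measurable
  qed
  have Hb: "\<bar>H j t y\<bar> \<le> 1" if j: "j < n" for j t y
    using pd2_le[OF i j, of "lin n (c * t) x s y"] c mult_mono[of c 1 "\<bar>pd j (pd i f) (lin n (c * t) x s y)\<bar>" 1] by (simp add: H_def abs_mult)
  have iH: "integrable (?G \<Otimes>\<^sub>M unif) (\<lambda>(y, t). H j t y)" if j: "j < n" for j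
    by (rule PP.P.integrable_const_bound[where B = 1]) (use Hm[OF j] Hb[OF j] in auto)
  have iHt: "integrable unif (\<lambda>t. H j t y)" if j: "j < n" and y: "y \<in> rn n" for j y
  proof (rule T.integrable_const_bound[where B = 1])
    have "(\<lambda>t. (y, t)) \<in> measurable unif (?G \<Otimes>\<^sub>M unif)" using y by simp
    from measurable_compose[OF this Hm[OF j]] show "(\<lambda>t. H j t y) \<in> borel_measurable unif" by simp
  qed (use Hb[OF j] in auto)
  have ftc: "pd i f (lin n c x s y) - pd i f (lin n 0 orig s y) = (\<Sum>j<n. x j * (\<integral>t. H j t y \<partial>unif))" if y: "y \<in> rn n" for y
  proof -
    have d: "((\<lambda>t. pd i f (lin n (c * t) x s y)) has_real_derivative (\<Sum>j<n. pd j (pd i f) (lin n (c * t) x s y) * (c * x j))) (at t)" for t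
      by (rule differentiable_chain[OF f1[OF i]]) (auto intro!: derivative_eq_intros)
    have e: "(\<Sum>j<n. pd j (pd i f) (lin n (c * t) x s y) * (c * x j)) = (\<Sum>j<n. x j * H j t y)" for t
      by (intro sum.cong refl) (simp add: H_def)
    have iS: "integrable unif (\<lambda>t. \<Sum>j<n. x j * H j t y)"
      using iHt[OF _ y] by (intro Bochner_Integration.integrable_sum integrable_mult_right) auto
    have m: "(\<lambda>t. \<Sum>j<n. x j * H j t y) \<in> borel_measurable borel"
      using borel_measurable_integrable[OF iS] unfolding measurable_cong_sets[OF sets_unif refl] .
    have "(LINT t:{0..1}|lborel. (\<Sum>j<n. x j * H j t y)) = pd i f (lin n (c * 1) x s y) - pd i f (lin n (c * 0) x s y)"
      by (rule FTC_lebesgue_01) (use d[unfolded e] iS[unfolded integral_unif(2)[OF m]] in auto)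
    moreover have "lin n 0 x s y = lin n 0 orig s y" by (simp add: lin_def)
    ultimately have "pd i f (lin n c x s y) - pd i f (lin n 0 orig s y) = (\<integral>t. (\<Sum>j<n. x j * H j t y) \<partial>unif)"
      by (simp add: integral_unif(1)[OF m])
    also have "\<dots> = (\<Sum>j<n. \<integral>t. x j * H j t y \<partial>unif)"
      using iHt[OF _ y] by (intro Bochner_Integration.integral_sum integrable_mult_right) auto
    finally show ?thesis by simp
  qed
  have orig: "orig \<in> rn n" by (simp add: orig_def)
  have iI: "integrable ?G (\<lambda>y. \<integral>t. H j t y \<partial>unif)" if "j < n" for j
    using P.integrable_fst'[OF iH[OF that]] by simp
  have sw: "(\<integral>y. (\<integral>t. H j t y \<partial>unif) \<partial>?G) = savg n (pd j (pd i f)) c s x" if "j < n" for j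
    using P.Fubini_integral[OF iH[OF that]] by (simp only: savg_def H_def)
  have "phi i c s x - phi i 0 s orig = (\<integral>y. pd i f (lin n c x s y) - pd i f (lin n 0 orig s y) \<partial>?G)"
    unfolding phi_def using pd_lin_integrable(1)[OF i x] pd_lin_integrable(1)[OF i orig] by simp
  also have "\<dots> = (\<integral>y. (\<Sum>j<n. x j * (\<integral>t. H j t y \<partial>unif)) \<partial>?G)"
    by (intro Bochner_Integration.integral_cong refl ftc) simp
  also have "\<dots> = (\<Sum>j<n. \<integral>y. x j * (\<integral>t. H j t y \<partial>unif) \<partial>?G)"
    using iI by (intro Bochner_Integration.integral_sum integrable_mult_right) auto
  also have "\<dots> = (\<Sum>j<n. x j * savg n (pd j (pd i f)) c s x)"
    by (intro sum.cong refl) (simp add: sw)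
  finally show ?thesis by simp
qed

lemma savg_smooth:
  assumes i: "i < n" and j: "j < n" and s: "0 < s" and c: "0 \<le> c" "c \<le> 1"
  shows "differentiable_rn n (savg n (pd j (pd i f)) c s)"
    and "\<forall>x\<in>rn n. (\<Sum>k<n. (pd k (savg n (pd j (pd i f)) c s) x)\<^sup>2) \<le> (1 / s)\<^sup>2"
proof -
  note S = smoothing[OF pd2_meas[OF i j] pd2_le[OF i j] s c]
  show "differentiable_rn n (savg n (pd j (pd i f)) c s)"
    unfolding differentiable_rn_def using S(1) by blast
  show "\<forall>x\<in>rn n. (\<Sum>k<n. (pd k (savg n (pd j (pd i f)) c s) x)\<^sup>2) \<le> (1 / s)\<^sup>2"
  proof
    fix x :: "nat \<Rightarrow> real" assume x: "x \<in> rn n"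
    show "(\<Sum>k<n. (pd k (savg n (pd j (pd i f)) c s) x)\<^sup>2) \<le> (1 / s)\<^sup>2"
      using S(2)[OF _ x] pd_eq[OF S(1)[OF _ x] x] by simp
  qed
qed

text \<open>The x_i-derivative of \<open>phi\<close> computed in two ways: under the integral, and
  by the product rule on \<open>phi_expand\<close>. No third derivative of f enters, because the
  averages themselves are differentiable.\<close>

lemma psi_expand:
  assumes i: "i < n" and x: "x \<in> rn n" and s: "0 < s" and c: "0 \<le> c" "c \<le> 1"
  shows "c * psi i c s x = (\<Sum>j<n. (if i = j then savg n (pd j (pd i f)) c s x else 0) + x j * pd i (savg n (pd j (pd i f)) c s) x)"
proof (rule DERIV_unique[OF phi_partial[OF i x]])
  let ?g = "\<lambda>j. savg n (pd j (pd i f)) c s"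
  have "((\<lambda>t. phi i 0 s orig + (\<Sum>j<n. (x(i := t)) j * ?g j (x(i := t)))) has_real_derivative
     0 + (\<Sum>j<n. (if i = j then 1 else 0) * ?g j (x(i := x i)) + pd i (?g j) x * (x(i := x i)) j)) (at (x i))"
  proof (intro DERIV_add DERIV_const DERIV_sum DERIV_mult)
    fix j
    show "((\<lambda>t. (x(i := t)) j) has_real_derivative (if i = j then 1 else 0)) (at (x i))"
      by (cases "i = j") auto
    assume "j \<in> {..<n}"
    then show "((\<lambda>t. ?g j (x(i := t))) has_real_derivative pd i (?g j) x) (at (x i))"
      using differentiable_partial[OF savg_smooth(1)[OF i _ s c] x i, of j] by simp
  qed
  then show "((\<lambda>t. phi i c s (x(i := t))) has_real_derivative
     (\<Sum>j<n. (if i = j then ?g j x else 0) + x j * pd i (?g j) x)) (at (x i))"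
    by (simp add: phi_expand[OF i upd_in_rn[OF x i] s c] if_distrib[of "\<lambda>u. u * _"] mult.commute cong: if_cong)
qed

end

section \<open>Interpolation by rotation\<close>

locale zolotarev = korn_const + quad_test +
  assumes n2: "2 \<le> n"
begin

text \<open>Inserting both expansions writes the integrand as a sum over j of Stein discrepancies of
  the averages, plus a constant times x_i, which has mean zero. Each average has gradient at most 1
  / s.\<close>

lemma stein_phi:
  assumes i: "i < n" and s: "0 < s" and c: "0 \<le> c" "c \<le> 1"
  shows "\<bar>\<integral>x. x i * phi i c s x - c * psi i c s x \<partial>\<mu>\<bar> \<le> real n * (5 * sqrt (C * (C - 1)) * (1 / s))"
proof -
  let ?g = "\<lambda>j. savg n (pd j (pd i f)) c s"
  let ?S = "\<lambda>j x. x i * x j * ?g j x - (if i = j then ?g j x else 0) - x j * pd i (?g j) x"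
  have s': "0 \<le> 1 / s" using s by simp
  have iS: "integrable \<mu> (?S j)" if j: "j < n" for j
    using stein_integrable[OF savg_smooth[OF i j s c] n2 i j] gradient_bounded_integrable(2)[OF savg_smooth[OF i j s c]]
      pd_bounded_integrable(3)[OF savg_smooth[OF i j s c] i j]
    by (cases "i = j") simp_all
  have "(\<integral>x. x i * phi i c s x - c * psi i c s x \<partial>\<mu>) = (\<integral>x. phi i 0 s orig * x i + (\<Sum>j<n. ?S j x) \<partial>\<mu>)"
  proof (intro Bochner_Integration.integral_cong refl)
    fix x assume "x \<in> space \<mu>"
    then have x: "x \<in> rn n" by simp
    show "x i * phi i c s x - c * psi i c s x = phi i 0 s orig * x i + (\<Sum>j<n. ?S j x)"
      unfolding phi_expand[OF i x s c] psi_expand[OF i x s c]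
      by (simp add: sum_subtractf sum.distrib distrib_left sum_distrib_left mult_ac)
  qed
  also have "\<dots> = (\<Sum>j<n. \<integral>x. ?S j x \<partial>\<mu>)"
  proof -
    have "integrable \<mu> (\<lambda>x. \<Sum>j<n. ?S j x)" using iS by (intro Bochner_Integration.integrable_sum) auto
    moreover have "(\<integral>x. (\<Sum>j<n. ?S j x) \<partial>\<mu>) = (\<Sum>j<n. \<integral>x. ?S j x \<partial>\<mu>)"
      using iS by (intro Bochner_Integration.integral_sum) auto
    ultimately show ?thesis using int1[OF i] ev1[OF i] by simp
  qed
  finally have eq: "(\<integral>x. x i * phi i c s x - c * psi i c s x \<partial>\<mu>) = (\<Sum>j<n. \<integral>x. ?S j x \<partial>\<mu>)" .
  have "\<bar>\<Sum>j<n. \<integral>x. ?S j x \<partial>\<mu>\<bar> \<le> (\<Sum>j<n. 5 * sqrt (C * (C - 1)) * (1 / s))"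
  proof (rule order_trans[OF sum_abs sum_mono])
    fix j assume "j \<in> {..<n}"
    then have j: "j < n" by simp
    show "\<bar>\<integral>x. ?S j x \<partial>\<mu>\<bar> \<le> 5 * sqrt (C * (C - 1)) * (1 / s)"
      by (rule stein_bound[OF n2 savg_smooth[OF i j s c] s' i j])
  qed
  then show ?thesis unfolding eq by (simp only: sum_constant card_lessThan)
qed

abbreviation MG :: "((nat \<Rightarrow> real) \<times> (nat \<Rightarrow> real)) measure" where
  "MG \<equiv> \<mu> \<Otimes>\<^sub>M std_gaussian n"

lemma psf_MG: "pair_sigma_finite \<mu> (std_gaussian n)"
  using prob_mu prob_space_std_gaussian by (simp add: pair_sigma_finite_def prob_space_imp_sigma_finite)

text \<open>Dominates, uniformly in the angle, both f along the rotation and its derivative in the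
  angle.\<close>

definition majorant :: "(nat \<Rightarrow> real) \<times> (nat \<Rightarrow> real) \<Rightarrow> real" where
  "majorant p = (\<bar>f orig\<bar> + 2 * real n * A) + 6 * real n * sqn n (fst p) + 6 * real n * sqn n (snd p)"

lemma majorant_integrable: "integrable MG majorant"
proof -
  interpret G: prob_space "std_gaussian n" by (rule prob_space_std_gaussian)
  have "integrable MG (\<lambda>(x, y). sqn n x * 1)" "integrable MG (\<lambda>(x, y). 1 * sqn n y)" "integrable MG (\<lambda>(x, y). 1 * (1 :: real))"
    by (rule integral_pair_prod(1)[OF psf_MG]; simp add: int_sqn integrable_gaussian_sqn)+
  then have "integrable MG (\<lambda>p. (\<bar>f orig\<bar> + 2 * real n * A) * 1 + 6 * real n * sqn n (fst p) + 6 * real n * sqn n (snd p))"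
    unfolding case_prod_beta by (intro Bochner_Integration.integrable_add integrable_mult_right) simp_all
  then show ?thesis unfolding majorant_def[abs_def] by simp
qed

definition rot :: "real \<Rightarrow> (nat \<Rightarrow> real) \<times> (nat \<Rightarrow> real) \<Rightarrow> nat \<Rightarrow> real" where
  "rot t p = lin n (cos t) (fst p) (sin t) (snd p)"

lemma rot_in_rn [simp]: "rot t p \<in> rn n" by (simp add: rot_def)

lemma sqn_rot: "sqn n (rot t p) \<le> 2 * sqn n (fst p) + 2 * sqn n (snd p)"
proof -
  have "sqn n (rot t p) \<le> 2 * (cos t)\<^sup>2 * sqn n (fst p) + 2 * (sin t)\<^sup>2 * sqn n (snd p)"
    unfolding rot_def by (rule sqn_lin_le)
  also have "\<dots> \<le> 2 * 1 * sqn n (fst p) + 2 * 1 * sqn n (snd p)"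
    by (intro add_mono mult_mono) (auto simp: abs_square_le_1)
  finally show ?thesis by simp
qed

lemma f_rot_le: "\<bar>f (rot t p)\<bar> \<le> majorant p"
proof -
  have "\<bar>f (rot t p)\<bar> \<le> \<bar>f orig\<bar> + real n * (2 * A + 3 * sqn n (rot t p))" by (rule f_growth) simp
  also have "\<dots> \<le> \<bar>f orig\<bar> + real n * (2 * A + 3 * (2 * sqn n (fst p) + 2 * sqn n (snd p)))"
    using sqn_rot[of t p] by (intro add_left_mono mult_left_mono) auto
  finally show ?thesis by (simp add: majorant_def algebra_simps)
qed

definition drot :: "nat \<Rightarrow> real \<Rightarrow> (nat \<Rightarrow> real) \<times> (nat \<Rightarrow> real) \<Rightarrow> real" where
  "drot i t p = pd i f (rot t p) * (- sin t * fst p i + cos t * snd p i)"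

lemma rot_deriv: "((\<lambda>t. f (rot t p)) has_real_derivative (\<Sum>i<n. drot i t p)) (at t)"
  unfolding drot_def rot_def by (rule differentiable_chain[OF f0]) (auto intro!: derivative_eq_intros)

lemma drot_le:
  assumes i: "i < n"
  shows "\<bar>drot i t p\<bar> \<le> 2 * A + 6 * sqn n (fst p) + 6 * sqn n (snd p)"
proof -
  have "(- sin t * fst p i + cos t * snd p i)\<^sup>2 \<le> sqn n (lin n (- sin t) (fst p) (cos t) (snd p))"
    using coord_sq_le_sqn[OF i, of "lin n (- sin t) (fst p) (cos t) (snd p)"] i by simp
  also have "\<dots> \<le> 2 * (- sin t)\<^sup>2 * sqn n (fst p) + 2 * (cos t)\<^sup>2 * sqn n (snd p)" by (rule sqn_lin_le)
  also have "\<dots> \<le> 2 * 1 * sqn n (fst p) + 2 * 1 * sqn n (snd p)"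
    by (intro add_mono mult_mono) (auto simp: abs_square_le_1)
  finally have 1: "(- sin t * fst p i + cos t * snd p i)\<^sup>2 \<le> 2 * sqn n (fst p) + 2 * sqn n (snd p)" by simp
  have 2: "(pd i f (rot t p))\<^sup>2 \<le> 2 * A + 2 * sqn n (rot t p)" by (rule pd_growth[OF i]) simp
  show ?thesis unfolding drot_def
    using abs_mult_le_sq_add_sq[of "pd i f (rot t p)" "- sin t * fst p i + cos t * snd p i"] 1 2 sqn_rot[of t p] by linarith
qed

lemma sum_drot_le: "\<bar>\<Sum>i<n. drot i t p\<bar> \<le> majorant p"
proof -
  have "\<bar>\<Sum>i<n. drot i t p\<bar> \<le> (\<Sum>i<n. 2 * A + 6 * sqn n (fst p) + 6 * sqn n (snd p))"
    by (rule order_trans[OF sum_abs sum_mono]) (use drot_le in auto)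
  also have "\<dots> \<le> majorant p" by (simp add: majorant_def algebra_simps)
  finally show ?thesis .
qed

lemma rot_meas [measurable]: "rot t \<in> measurable MG (borel_rn n)"
proof -
  have [measurable]: "fst \<in> measurable MG (borel_rn n)" "snd \<in> measurable MG (borel_rn n)"
    using measurable_fst[of \<mu> "std_gaussian n"] measurable_snd[of \<mu> "std_gaussian n"] by (simp_all cong: measurable_cong_sets)
  show ?thesis unfolding rot_def[abs_def] by measurable
qed

lemma f_rot_integrable: "integrable MG (\<lambda>p. f (rot t p))"
proof (rule Bochner_Integration.integrable_bound[OF majorant_integrable])
  show "AE p in MG. norm (f (rot t p)) \<le> norm (majorant p)"
  proof (rule AE_I2)
    fix p show "norm (f (rot t p)) \<le> norm (majorant p)" using f_rot_le[of t p] by simp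
  qed
qed measurable

definition F :: "real \<Rightarrow> real" where "F t = (\<integral>p. f (rot t p) \<partial>MG)"

lemma F_deriv: "(F has_real_derivative (\<integral>p. (\<Sum>i<n. drot i t p) \<partial>MG)) (at t)"
  unfolding F_def[abs_def]
  by (rule has_real_derivative_integral(1)[where a = "t - 1" and b = "t + 1" and g = majorant])
     (use rot_deriv f_rot_integrable sum_drot_le majorant_integrable in auto)

lemma F_0: "F 0 = (\<integral>x. f x \<partial>\<mu>)"
proof -
  interpret P: pair_sigma_finite \<mu> "std_gaussian n" by (rule psf_MG)
  interpret G: prob_space "std_gaussian n" by (rule prob_space_std_gaussian)
  have "F 0 = (\<integral>x. (\<integral>y. f (rot 0 (x, y)) \<partial>std_gaussian n) \<partial>\<mu>)"
    unfolding F_def by (rule P.integral_fst'[symmetric]) (rule f_rot_integrable)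
  also have "\<dots> = (\<integral>x. f x \<partial>\<mu>)"
    by (intro Bochner_Integration.integral_cong refl) (simp add: rot_def G.prob_space[simplified])
  finally show ?thesis .
qed

lemma F_pi2: "F (pi / 2) = (\<integral>x. f x \<partial>std_gaussian n)"
proof -
  interpret P: pair_sigma_finite \<mu> "std_gaussian n" by (rule psf_MG)
  have "F (pi / 2) = (\<integral>x. (\<integral>y. f (rot (pi / 2) (x, y)) \<partial>std_gaussian n) \<partial>\<mu>)"
    unfolding F_def by (rule P.integral_fst'[symmetric]) (rule f_rot_integrable)
  also have "\<dots> = (\<integral>x. (\<integral>y. f y \<partial>std_gaussian n) \<partial>\<mu>)"
  proof (intro Bochner_Integration.integral_cong refl)
    fix x y assume "y \<in> space (std_gaussian n)"
    then have "rot (pi / 2) (x, y) = y" unfolding rot_def by (intro lin_eqI) auto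
    then show "f (rot (pi / 2) (x, y)) = f y" by simp
  qed
  finally show ?thesis by (simp add: prob_space[simplified])
qed

text \<open>Integration by parts in y turns cos t * y_i times a first derivative into cos t * sin t
  times a second one, so the whole expression carries the factor sin t.\<close>

lemma drot_integral:
  assumes i: "i < n" and t: "0 < sin t" "0 \<le> cos t"
  shows "integrable MG (drot i t)"
    and "(\<integral>p. drot i t p \<partial>MG) = - sin t * (\<integral>x. x i * phi i (cos t) (sin t) x - cos t * psi i (cos t) (sin t) x \<partial>\<mu>)"
proof -
  interpret P: pair_sigma_finite \<mu> "std_gaussian n" by (rule psf_MG)
  note [measurable] = pd_meas[OF i]
  have "fst \<in> measurable MG (borel_rn n)" "snd \<in> measurable MG (borel_rn n)"
    using measurable_fst[of \<mu> "std_gaussian n"] measurable_snd[of \<mu> "std_gaussian n"] by (simp_all cong: measurable_cong_sets)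
  note [measurable] = this[THEN measurable_coord, OF i]
  show int: "integrable MG (drot i t)"
  proof (rule Bochner_Integration.integrable_bound[OF majorant_integrable])
    show "drot i t \<in> borel_measurable MG" unfolding drot_def[abs_def] by measurable
    show "AE p in MG. norm (drot i t p) \<le> norm (majorant p)"
    proof (rule AE_I2)
      fix p
      have "1 * (2 * A + 6 * sqn n (fst p) + 6 * sqn n (snd p)) \<le> real n * (2 * A + 6 * sqn n (fst p) + 6 * sqn n (snd p))"
        using n2 A_nonneg by (intro mult_right_mono) auto
      then show "norm (drot i t p) \<le> norm (majorant p)" using drot_le[OF i, of t p] by (simp add: majorant_def algebra_simps)
    qed
  qed
  have "(\<integral>p. drot i t p \<partial>MG) = (\<integral>x. (\<integral>y. drot i t (x, y) \<partial>std_gaussian n) \<partial>\<mu>)"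
    by (rule P.integral_fst'[symmetric]) (rule int)
  also have "\<dots> = (\<integral>x. - sin t * (x i * phi i (cos t) (sin t) x - cos t * psi i (cos t) (sin t) x) \<partial>\<mu>)"
  proof (intro Bochner_Integration.integral_cong refl)
    fix x assume "x \<in> space \<mu>"
    then have x: "x \<in> rn n" by simp
    have "(\<integral>y. drot i t (x, y) \<partial>std_gaussian n) = (\<integral>y. - sin t * x i * pd i f (lin n (cos t) x (sin t) y) + cos t * (y i * pd i f (lin n (cos t) x (sin t) y)) \<partial>std_gaussian n)"
      by (simp add: drot_def rot_def algebra_simps)
    also have "\<dots> = - sin t * x i * phi i (cos t) (sin t) x + cos t * (sin t * psi i (cos t) (sin t) x)"
      using pd_lin_integrable[OF i x] i by (simp add: phi_ibp[OF i x] phi_def)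
    finally show "(\<integral>y. drot i t (x, y) \<partial>std_gaussian n) = - sin t * (x i * phi i (cos t) (sin t) x - cos t * psi i (cos t) (sin t) x)"
      by (simp add: algebra_simps)
  qed
  finally show "(\<integral>p. drot i t p \<partial>MG) = - sin t * (\<integral>x. x i * phi i (cos t) (sin t) x - cos t * psi i (cos t) (sin t) x \<partial>\<mu>)"
    by simp
qed

text \<open>The sum over i of n bounds, each already a sum over n indices j, is the origin of n^2;
  sin t cancels the gradient bound 1 / sin t.\<close>

lemma F_deriv_le:
  assumes t: "0 < sin t" "0 \<le> cos t"
  shows "\<bar>\<integral>p. (\<Sum>i<n. drot i t p) \<partial>MG\<bar> \<le> 5 * (real n)\<^sup>2 * sqrt (C * (C - 1))"
proof -
  have "(\<integral>p. (\<Sum>i<n. drot i t p) \<partial>MG) = (\<Sum>i<n. \<integral>p. drot i t p \<partial>MG)"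
    using drot_integral(1)[OF _ t] by (intro Bochner_Integration.integral_sum) auto
  also have "\<bar>\<dots>\<bar> \<le> (\<Sum>i<n. real n * (5 * sqrt (C * (C - 1))))"
  proof (rule order_trans[OF sum_abs sum_mono])
    fix i assume "i \<in> {..<n}"
    then have i: "i < n" by simp
    have "\<bar>\<integral>p. drot i t p \<partial>MG\<bar> = sin t * \<bar>\<integral>x. x i * phi i (cos t) (sin t) x - cos t * psi i (cos t) (sin t) x \<partial>\<mu>\<bar>"
      using t by (simp add: drot_integral(2)[OF i t] abs_mult)
    also have "\<dots> \<le> sin t * (real n * (5 * sqrt (C * (C - 1)) * (1 / sin t)))"
      using t by (intro mult_left_mono stein_phi[OF i]) auto
    also have "\<dots> = real n * (5 * sqrt (C * (C - 1)))" using t by simp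
    finally show "\<bar>\<integral>p. drot i t p \<partial>MG\<bar> \<le> real n * (5 * sqrt (C * (C - 1)))" .
  qed
  also have "\<dots> = 5 * (real n)\<^sup>2 * sqrt (C * (C - 1))" by (simp add: power2_eq_square)
  finally show ?thesis .
qed

text \<open>The difference is F 0 - F (pi / 2). The mean value theorem multiplies a uniform bound on
  |F'| inside the quarter turn by its length pi / 2, which avoids the endpoint sin t = 0.\<close>

lemma test_difference_le:
  "(\<integral>x. f x \<partial>\<mu>) - (\<integral>x. f x \<partial>std_gaussian n) \<le> 5 * pi / 2 * (real n)\<^sup>2 * sqrt (C * (C - 1))"
proof -
  obtain z where z: "0 < z" "z < pi / 2" "F (pi / 2) - F 0 = (pi / 2 - 0) * (\<integral>p. (\<Sum>i<n. drot i z p) \<partial>MG)"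
    using MVT2[of 0 "pi / 2" F "\<lambda>t. \<integral>p. (\<Sum>i<n. drot i t p) \<partial>MG"] F_deriv pi_half_gt_zero by metis
  have "0 < sin z" "0 < cos z" using z by (auto intro: sin_gt_zero cos_gt_zero)
  then have "- (\<integral>p. (\<Sum>i<n. drot i z p) \<partial>MG) \<le> 5 * (real n)\<^sup>2 * sqrt (C * (C - 1))"
    using F_deriv_le[of z] by simp
  then have "pi / 2 * (- (\<integral>p. (\<Sum>i<n. drot i z p) \<partial>MG)) \<le> pi / 2 * (5 * (real n)\<^sup>2 * sqrt (C * (C - 1)))"
    by (rule mult_left_mono) simp
  then show ?thesis using z(3) by (simp add: F_0 F_pi2)
qed

end

section \<open>From admissible constants to the Poincare-Korn constant\<close>

lemma C_PK_ge_1: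
  assumes n2: "2 \<le> n" and m: "moment_measure n \<mu>"
  shows "1 \<le> C_PK n \<mu>"
  unfolding C_PK_def
proof (rule Inf_greatest, clarify)
  fix C :: real
  assume C0: "0 \<le> C" and adm: "\<forall>u\<in>korn_class n \<mu>. (INF a\<in>skew_maps n. L2sq_vec n \<mu> (\<lambda>x i. u x i - a x i))
    \<le> ennreal (2 * C) * L2sq_mat n \<mu> (sym_grad u)"
  interpret M: moment_measure n \<mu> by (rule m)
  interpret korn_const n \<mu> C by unfold_locales (use C0 adm in auto)
  show "1 \<le> ereal C" using C_ge_1[OF n2] unfolding one_ereal_def ereal_less_eq .
qed

lemma zolotarev_le_admissible:
  assumes n2: "2 \<le> n" and k: "korn_const n \<mu> C"
  shows "d_Zol2 n \<mu> (std_gaussian n) \<le> ereal (5 * pi / 2 * (real n)\<^sup>2 * sqrt (C * (C - 1)))"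
  unfolding d_Zol2_def
proof (rule SUP_least, clarify)
  fix f assume c: "class_C n 2 f" and h: "\<forall>x\<in>rn n. sqrt (\<Sum>i<n. \<Sum>j<n. (hess f x i j)\<^sup>2) \<le> 1"
  interpret K: korn_const n \<mu> C by (rule k)
  interpret Z: zolotarev n \<mu> C f
  proof unfold_locales
    show "(\<Sum>i<n. \<Sum>j<n. (pd i (pd j f) x)\<^sup>2) \<le> 1" if "x \<in> rn n" for x
      using h that by (simp add: hess_def)
  qed (use c n2 in \<open>auto simp: numeral_2_eq_2\<close>)
  show "ereal ((\<integral>x. f x \<partial>\<mu>) - (\<integral>x. f x \<partial>std_gaussian n)) \<le> ereal (5 * pi / 2 * (real n)\<^sup>2 * sqrt (C * (C - 1)))"
    using Z.test_difference_le by simp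
qed

text \<open>For a finite infimum K, each K + e lies above some admissible constant, and C (C - 1) is
  increasing for C >= 1. Continuity of the square root lets e tend to 0.\<close>

lemma zolotarev_le:
  assumes n2: "2 \<le> n" and m: "moment_measure n \<mu>"
  shows "d_Zol2 n \<mu> (std_gaussian n) \<le> ereal (5 * pi / 2 * (real n)\<^sup>2) * ereal_sqrt (C_PK n \<mu> * (C_PK n \<mu> - 1))"
proof (cases "C_PK n \<mu>")
  \<comment> \<open>The coefficient is positive because n >= 2, so the right-hand side is
    infinite.\<close>
  case PInf
  then show ?thesis using n2 by (simp add: ereal_sqrt_def)
next
  case MInf
  then show ?thesis using C_PK_ge_1[OF n2 m] by simp
next
  case (real K)
  let ?a = "5 * pi / 2 * (real n)\<^sup>2"
  have K: "1 \<le> K" using C_PK_ge_1[OF n2 m] unfolding real one_ereal_def ereal_less_eq .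
  have adm: "d_Zol2 n \<mu> (std_gaussian n) \<le> ereal (?a * sqrt ((K + e) * (K + e - 1)))" if e: "0 < e" for e
  proof -
    have "C_PK n \<mu> < ereal (K + e)" using e by (simp add: real)
    then obtain C where C0: "0 \<le> C" and adm: "\<forall>u\<in>korn_class n \<mu>. (INF a\<in>skew_maps n. L2sq_vec n \<mu> (\<lambda>x i. u x i - a x i))
        \<le> ennreal (2 * C) * L2sq_mat n \<mu> (sym_grad u)" and Ce: "C < K + e"
      unfolding C_PK_def by (auto simp: Inf_less_iff)
    interpret M: moment_measure n \<mu> by (rule m)
    interpret Q: korn_const n \<mu> C by unfold_locales (use C0 adm in auto)
    have "C * (C - 1) \<le> (K + e) * (K + e - 1)"
      using Q.C_ge_1[OF n2] Ce by (intro mult_mono) auto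
    then have "?a * sqrt (C * (C - 1)) \<le> ?a * sqrt ((K + e) * (K + e - 1))"
      by (intro mult_left_mono) auto
    then show ?thesis using zolotarev_le_admissible[OF n2 Q.korn_const_axioms] by (meson ereal_less_eq(3) order_trans)
  qed
  have "((\<lambda>e. ereal (?a * sqrt ((K + e) * (K + e - 1)))) \<longlongrightarrow> ereal (?a * sqrt ((K + 0) * (K + 0 - 1)))) (at_right 0)"
    by (intro tendsto_intros)
  then have "d_Zol2 n \<mu> (std_gaussian n) \<le> ereal (?a * sqrt ((K + 0) * (K + 0 - 1)))"
    by (rule tendsto_lowerbound) (rule eventually_mono[OF eventually_at_right_less adm], assumption, simp)
  then show ?thesis unfolding real one_ereal_def ereal_minus(1) times_ereal.simps(1) by (simp add: ereal_sqrt_def)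
qed

theorem theorem1:
  shows "\<exists>c::real. c > 0 \<and>
    (\<forall>n::nat. n \<ge> 2 \<longrightarrow>
      (\<forall>\<mu> :: (nat \<Rightarrow> real) measure. borel_prob n \<mu> \<and> moment_assumption n \<mu> \<longrightarrow>
         C_PK n \<mu> \<ge> C_PK n (std_gaussian n) \<and> C_PK n (std_gaussian n) = 1 \<and>
         d_Zol2 n \<mu> (std_gaussian n)
           \<le> ereal (c * (real n)\<^sup>2) * ereal_sqrt (C_PK n \<mu> * (C_PK n \<mu> - C_PK n (std_gaussian n)))))"
proof (intro exI[of _ "5 * pi / 2"] conjI allI impI)
  fix n :: nat and \<mu> :: "(nat \<Rightarrow> real) measure"
  assume n2: "2 \<le> n" and \<mu>: "borel_prob n \<mu> \<and> moment_assumption n \<mu>"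
  have m: "moment_measure n \<mu>" using \<mu> by (simp add: moment_measure_def)
  show g: "C_PK n (std_gaussian n) = 1"
    \<comment> \<open>The lower bound holds for every measure with the prescribed moments, in
      particular for the Gaussian, where it meets the Korn inequality.\<close>
    by (intro antisym C_PK_gaussian_le C_PK_ge_1 n2 moment_measure_std_gaussian)
  show "C_PK n (std_gaussian n) \<le> C_PK n \<mu>" unfolding g by (rule C_PK_ge_1[OF n2 m])
  show "d_Zol2 n \<mu> (std_gaussian n)
      \<le> ereal (5 * pi / 2 * (real n)\<^sup>2) * ereal_sqrt (C_PK n \<mu> * (C_PK n \<mu> - C_PK n (std_gaussian n)))"
    unfolding g by (rule zolotarev_le[OF n2 m])
qed simp

end
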